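(* Fix $r\ge2$, and let $p=p(n)$ satisfy $$n^{-2/r}(\log n)^{1/\binom r2}\ll p\ll n^{-2/(r+1)}.$$ Then $$\frac{\chi(G(n,1-p))-\mathbb E\chi(G(n,1-p))}{\sqrt{\mu_{r+1}(n,p)}/r}\xrightarrow{\mathrm d}\mathcal N(0,1),\qquad \operatorname{Var}\bigl(\chi(G(n,1-p))\bigr)\sim\frac{\mu_{r+1}(n,p)}{r^2}.$$
   Context: All asymptotics are as $n\to\infty$; $f\ll g$ means $f/g\to0$ and $f\sim g$ means $f/g\to1$. $G(n,1-p)$ is the binomial random graph on $[n]$ with edge probability $1-p$, and $\chi$ is the chromatic number. $\mu_{r+1}(n,p):=\binom n{r+1}p^{\binom{r+1}2}$. $\xrightarrow{\mathrm d}$ denotes convergence in distribution. *)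

theory Defs
  imports "HOL-Probability.Probability" "HOL-Library.Landau_Symbols"
begin

unbundle asymp_equiv_syntax

text \<open>A graph is a pair of a vertex set and a set of edges, each edge being a two-element
  set of vertices.\<close>

type_synonym 'a graph = "'a set \<times> 'a set set"

definition all_edges :: "'a set \<Rightarrow> 'a set set" where
  "all_edges V = {e. e \<subseteq> V \<and> card e = 2}"

definition proper_colouring :: "'a graph \<Rightarrow> nat \<Rightarrow> ('a \<Rightarrow> nat) \<Rightarrow> bool" where
  "proper_colouring G k c \<longleftrightarrow>
     (\<forall>v\<in>fst G. c v < k) \<and> (\<forall>u\<in>fst G. \<forall>v\<in>fst G. {u, v} \<in> snd G \<longrightarrow> c u \<noteq> c v)"

definition chromatic_number :: "'a graph \<Rightarrow> nat" where
  "chromatic_number G = (LEAST k. \<exists>c. proper_colouring G k c)"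

text \<open>Note that \<^const>\<open>bernoulli_pmf\<close> clips its argument to the unit interval, so
  \<open>binomial_random_graph n q\<close> is meaningful only for \<open>0 \<le> q \<le> 1\<close>.\<close>

definition binomial_random_graph :: "nat \<Rightarrow> real \<Rightarrow> nat graph pmf" where
  "binomial_random_graph n q =
     map_pmf (\<lambda>X. ({1..n}, {e \<in> all_edges {1..n}. X e}))
       (Pi_pmf (all_edges {1..n}) False (\<lambda>_. bernoulli_pmf q))"

definition \<mu> :: "nat \<Rightarrow> nat \<Rightarrow> real \<Rightarrow> real" where
  "\<mu> s n p = real (n choose s) * p ^ (s choose 2)"

end

theory Submission
  imports Defs "HOL-Real_Asymp.Real_Asymp"
begin

text \<open>
  Complementing turns the chromatic number of \<open>G(n,1-p)\<close> into the least number of cliques that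
  cover the vertices of a random graph \<open>g\<close> with edge probability \<open>p\<close>.  In the given window, \<open>g\<close> has
  a bounded number of cliques of size \<open>r+2\<close> on average, a growing number \<open>X\<close> of cliques of size
  \<open>r+1\<close> that are nearly all disjoint, and enough cliques of size \<open>r\<close> to tile almost everything else.
  A best cover therefore takes as many disjoint \<open>(r+1)\<close>-cliques as it can and fills up with
  \<open>r\<close>-cliques, so that \<open>r\<close> times the chromatic number is about \<open>n - X\<close>.  Since \<open>X\<close> behaves like a
  Poisson variable with mean \<open>\<mu>\<close>, it is asymptotically normal with variance \<open>\<sim> \<mu>\<close>, and both claims
  follow.

  To make this precise, let \<open>\<nu>\<close> be the packing number of the \<open>(r+1)\<close>-cliques.  The vertices outside a
  maximum packing, up to fewer than \<open>r\<close> of them, form the core; its deficiency \<open>b\<close> is the least number of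
  blocks that are not cliques in a partition of the core into \<open>r\<close>-sets.  Counting colour classes
  (\<open>chromatic_lower\<close>, \<open>chromatic_upper\<close>) places \<open>r \<chi> + \<nu> - n\<close> between minus the number of
  \<open>(r+2)\<close>-cliques and \<open>r^2 (b + 1)\<close>, and both ends have bounded second moment.  The difference \<open>X - \<nu>\<close>
  reacts to an edge only if two \<open>(r+1)\<close>-cliques meet, so its variance is \<open>o(\<mu>)\<close> by the Efron-Stein
  inequality (\<open>vari_packing_excess\<close>).  Hence \<open>r \<chi> + X\<close> has standard deviation \<open>o(\<surd>\<mu>)\<close>.  The
  characteristic function of \<open>X\<close> is controlled by size biasing: conditioning on one clique adds one to
  \<open>X\<close> and rarely anything else (\<open>size_biased_char\<close>), which makes the normalised characteristic function
  an approximate solution of \<open>f' = - t f\<close> (\<open>gaussian_estimate\<close>).  Levy's continuity theorem concludes.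

  The hard part is \<open>E b^2 = O(1)\<close> (\<open>deficiency_second_moment\<close>).  It is a robust form of the theorem on
  clique factors at the threshold \<open>n^(-2/r) (log n)^(1/(r choose 2))\<close>, on a random vertex set that
  depends on the same graph.  The proof follows the fragment argument for spread measures, written as an
  encoding (locale \<open>encoding\<close>).  Let \<open>S\<close> range over a family of partitions of the core into \<open>r\<close>-sets that
  is spread: any \<open>b\<close> blocks lie together in at most a fraction \<open>(C / n^(r-1))^b\<close> of the members.
  The \<open>r\<close>-cliques are revealed in about \<open>log_2 n\<close> rounds by a random colouring, and each round halves
  the number of missing blocks: if a smallest missing fragment \<open>F \<subseteq> S\<close> has size \<open>b\<close>, planting the edges
  of \<open>F\<close> gives a configuration from which \<open>F\<close> can be recovered among few candidates, while planting
  multiplies probabilities by a factor that the spread more than compensates.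

  Planting must leave the core unchanged, so it may create no \<open>(r+1)\<close>-clique, and it must create few
  \<open>r\<close>-cliques besides the blocks of \<open>F\<close>, as their colours have to be overwritten.  Partitions with these
  properties are called clean.  To find them, each \<open>r\<close>-set that would create a clique on its own is
  discarded; every vertex lies in few of those, and a switching argument shows that the partitions that
  avoid them exist and are spread (\<open>pms_nonempty\<close>, \<open>pms_spread\<close>).  Cliques that use two planted blocks are
  excluded for most partitions (for \<open>r = 4\<close>, \<open>r\<close>-cliques of this kind are only shown to be few at
  every block) by a first moment computation, after high moments have bounded the number of the patterns
  that such a clique leaves in the graph (\<open>clean_factors_empty_prob\<close>).  If \<open>p\<close> is far above the threshold
  there would be too many side cliques, so a second random edge set \<open>h\<close> thins the graph, and only cliques of \<open>g \<inter> h\<close> are used for the tiling.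
\<close>

section \<open>Random subsets of a finite set\<close>

abbreviation expct :: "'a pmf \<Rightarrow> ('a \<Rightarrow> 'b::{banach,second_countable_topology}) \<Rightarrow> 'b" where
  "expct M f \<equiv> measure_pmf.expectation M f"

lemma expct_add: "finite (set_pmf M) \<Longrightarrow> expct M (\<lambda>x. f x + g x) = expct M f + expct M g"
  by (intro Bochner_Integration.integral_add integrable_measure_pmf_finite)

lemma expct_diff: "finite (set_pmf M) \<Longrightarrow> expct M (\<lambda>x. f x - g x) = expct M f - expct M g"
  by (intro Bochner_Integration.integral_diff integrable_measure_pmf_finite)

lemma expct_sum: "finite (set_pmf M) \<Longrightarrow> expct M (\<lambda>x. \<Sum>i\<in>I. f i x) = (\<Sum>i\<in>I. expct M (f i))"
  by (intro Bochner_Integration.integral_sum integrable_measure_pmf_finite)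

lemma expct_cong: "(\<And>x. x \<in> set_pmf M \<Longrightarrow> f x = g x) \<Longrightarrow> expct M f = expct M g"
  by (intro integral_cong_AE) (auto simp: AE_measure_pmf_iff)

lemma expct_mono:
  fixes f g :: "'a \<Rightarrow> real"
  assumes "finite (set_pmf M)" "\<And>x. x \<in> set_pmf M \<Longrightarrow> f x \<le> g x"
  shows "expct M f \<le> expct M g"
  using assms by (intro integral_mono_AE integrable_measure_pmf_finite) (auto simp: AE_measure_pmf_iff)

lemma expct_nonneg:
  fixes f :: "'a \<Rightarrow> real"
  assumes "\<And>x. x \<in> set_pmf M \<Longrightarrow> 0 \<le> f x"
  shows "0 \<le> expct M f"
  using assms by (intro integral_nonneg_AE) (auto simp: AE_measure_pmf_iff)

lemma expct_norm_le:
  assumes "finite (set_pmf M)"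
  shows "norm (expct M f) \<le> expct M (\<lambda>x. norm (f x))"
  using assms by (rule_tac integral_norm_bound)

lemma expct_pair:
  fixes f :: "'a \<times> 'b \<Rightarrow> 'c::{banach,second_countable_topology}"
  assumes "finite (set_pmf A)" "finite (set_pmf B)"
  shows "expct (pair_pmf A B) f = expct A (\<lambda>a. expct B (\<lambda>b. f (a, b)))"
proof -
  have "expct (pair_pmf A B) f
      = expct (A \<bind> (\<lambda>x. map_pmf (Pair x) B)) f"
    by (simp add: pair_pmf_def map_pmf_def)
  also have "\<dots> = (\<Sum>a\<in>set_pmf A. pmf A a *\<^sub>R expct (map_pmf (Pair a) B) f)"
    using assms by (intro pmf_expectation_bind) auto
  also have "\<dots> = (\<Sum>a\<in>set_pmf A. pmf A a *\<^sub>R expct B (\<lambda>b. f (a, b)))"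
    by (simp add: integral_map_pmf)
  also have "\<dots> = expct A (\<lambda>a. expct B (\<lambda>b. f (a, b)))"
    using assms by (subst integral_measure_pmf[where A = "set_pmf A"]) auto
  finally show ?thesis .
qed

lemma expct_swap:
  fixes f :: "'a \<Rightarrow> 'b \<Rightarrow> 'c::{banach,second_countable_topology}"
  assumes "finite (set_pmf A)" "finite (set_pmf B)"
  shows "expct A (\<lambda>a. expct B (f a)) = expct B (\<lambda>b. expct A (\<lambda>a. f a b))"
proof -
  have "expct A (\<lambda>a. expct B (f a)) = expct (pair_pmf A B) (\<lambda>(a, b). f a b)"
    using assms by (simp add: expct_pair)
  also have "\<dots> = expct (pair_pmf B A) (\<lambda>(b, a). f a b)"
    by (subst pair_commute_pmf[of A B]) (simp add: integral_map_pmf case_prod_unfold)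
  finally show ?thesis
    using assms by (simp add: expct_pair)
qed

text \<open>The edge sets of the random graphs below, as random subsets of the set of all pairs.\<close>

definition rsub :: "'e set \<Rightarrow> real \<Rightarrow> 'e set pmf" where
  "rsub E p = map_pmf (\<lambda>X. {e \<in> E. X e}) (Pi_pmf E False (\<lambda>_. bernoulli_pmf p))"

lemma set_pmf_rsub: "set_pmf (rsub E p) \<subseteq> Pow E"
  by (auto simp: rsub_def)

lemma finite_rsub [simp]: "finite E \<Longrightarrow> finite (set_pmf (rsub E p))"
  by (rule finite_subset[OF set_pmf_rsub]) auto

lemma rsub_sub: "g \<in> set_pmf (rsub E p) \<Longrightarrow> g \<subseteq> E"
  using set_pmf_rsub by blast

lemma rsub_union:
  assumes "finite A" "finite B" "A \<inter> B = {}"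
  shows "rsub (A \<union> B) p = map_pmf (\<lambda>(x, y). x \<union> y) (pair_pmf (rsub A p) (rsub B p))"
  unfolding rsub_def Pi_pmf_union[OF assms] pmf.map_comp pair_map_pmf1 pair_map_pmf2
  using assms by (intro map_pmf_cong refl) (auto simp: o_def)

lemma rsub_empty [simp]: "rsub {} p = return_pmf {}"
  by (simp add: rsub_def)

lemma rsub_singleton:
  assumes "0 \<le> p" "p \<le> 1"
  shows "expct (rsub {e} p) f = p *\<^sub>R f {e} + (1 - p) *\<^sub>R f {}"
proof -
  have "rsub {e} p = map_pmf (\<lambda>b. if b then {e} else {}) (bernoulli_pmf p)"
    by (simp add: rsub_def Pi_pmf_singleton pmf.map_comp o_def) 
       (intro map_pmf_cong refl, auto)
  then show ?thesis
    using assms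
    by (simp add: integral_map_pmf integral_measure_pmf[where A = UNIV] UNIV_bool add.commute)
qed

lemma rsub_split:
  assumes "finite E" "A \<subseteq> E"
  shows "expct (rsub E p) f = expct (rsub A p) (\<lambda>x. expct (rsub (E - A) p) (\<lambda>y. f (x \<union> y)))"
proof -
  have "finite A" "finite (E - A)" using assms finite_subset by auto
  moreover have "E = A \<union> (E - A)" using assms by auto
  then have "rsub E p = map_pmf (\<lambda>(x, y). x \<union> y) (pair_pmf (rsub A p) (rsub (E - A) p))"
    by (metis rsub_union Diff_disjoint calculation)
  ultimately show ?thesis
    by (simp add: integral_map_pmf expct_pair case_prod_beta)
qed

lemma rsub_full:
  assumes "finite U" "0 \<le> p" "p \<le> 1"
  shows "expct (rsub U p) (\<lambda>g. of_bool (U \<subseteq> g) *\<^sub>R f g) = p ^ card U *\<^sub>R f U"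
  using assms(1)
proof (induction U arbitrary: f)
  case empty
  then show ?case by simp
next
  case (insert e U)
  have "expct (rsub (insert e U) p) (\<lambda>g. of_bool (insert e U \<subseteq> g) *\<^sub>R f g)
      = expct (rsub {e} p) (\<lambda>x. expct (rsub U p) (\<lambda>y. of_bool (insert e U \<subseteq> x \<union> y) *\<^sub>R f (x \<union> y)))"
    using insert by (subst rsub_split[of _ "{e}"]) auto
  also have "\<dots> = p *\<^sub>R expct (rsub U p) (\<lambda>y. of_bool (insert e U \<subseteq> {e} \<union> y) *\<^sub>R f ({e} \<union> y))
       + (1 - p) *\<^sub>R expct (rsub U p) (\<lambda>y. of_bool (insert e U \<subseteq> y) *\<^sub>R f y)"
    using assms by (simp add: rsub_singleton)
  also have "expct (rsub U p) (\<lambda>y. of_bool (insert e U \<subseteq> y) *\<^sub>R f y) = expct (rsub U p) (\<lambda>y. 0)"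
    using insert.hyps by (intro expct_cong) (auto dest!: rsub_sub)
  also have "expct (rsub U p) (\<lambda>y. of_bool (insert e U \<subseteq> {e} \<union> y) *\<^sub>R f ({e} \<union> y))
      = expct (rsub U p) (\<lambda>y. of_bool (U \<subseteq> y) *\<^sub>R f (insert e y))"
    using insert.hyps by (intro expct_cong) (auto dest!: rsub_sub simp: subset_insert_iff)
  finally show ?case
    using insert by simp
qed

text \<open>Independence of the elements: given that \<open>U\<close> is present, the rest of the set is
  distributed as before.\<close>

lemma rsub_plant:
  assumes "finite E" "U \<subseteq> E" "0 \<le> p" "p \<le> 1"
  shows "expct (rsub E p) (\<lambda>g. of_bool (U \<subseteq> g) *\<^sub>R f g) = p ^ card U *\<^sub>R expct (rsub E p) (\<lambda>g. f (g \<union> U))"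
proof -
  have fU: "finite U" using assms finite_subset by auto
  have "expct (rsub E p) (\<lambda>g. of_bool (U \<subseteq> g) *\<^sub>R f g)
     = expct (rsub U p) (\<lambda>x. expct (rsub (E - U) p) (\<lambda>y. of_bool (U \<subseteq> x \<union> y) *\<^sub>R f (x \<union> y)))"
    using assms by (subst rsub_split[of _ U]) auto
  also have "\<dots> = expct (rsub U p) (\<lambda>x. of_bool (U \<subseteq> x) *\<^sub>R expct (rsub (E - U) p) (\<lambda>y. f (x \<union> y)))"
  proof (intro expct_cong)
    fix x assume "x \<in> set_pmf (rsub U p)"
    then have "expct (rsub (E - U) p) (\<lambda>y. of_bool (U \<subseteq> x \<union> y) *\<^sub>R f (x \<union> y))
       = expct (rsub (E - U) p) (\<lambda>y. of_bool (U \<subseteq> x) *\<^sub>R f (x \<union> y))"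
      by (intro expct_cong arg_cong2[where f = scaleR]) (auto dest!: rsub_sub)
    then show "expct (rsub (E - U) p) (\<lambda>y. of_bool (U \<subseteq> x \<union> y) *\<^sub>R f (x \<union> y))
       = of_bool (U \<subseteq> x) *\<^sub>R expct (rsub (E - U) p) (\<lambda>y. f (x \<union> y))" by simp
  qed
  also have "\<dots> = p ^ card U *\<^sub>R expct (rsub (E - U) p) (\<lambda>y. f (U \<union> y))"
    by (rule rsub_full[OF fU assms(3,4)])
  also have "expct (rsub (E - U) p) (\<lambda>y. f (U \<union> y)) = expct (rsub E p) (\<lambda>g. f (g \<union> U))"
  proof -
    have "expct (rsub E p) (\<lambda>g. f (g \<union> U))
       = expct (rsub U p) (\<lambda>x. expct (rsub (E - U) p) (\<lambda>y. f (x \<union> y \<union> U)))"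
      using assms by (subst rsub_split[of _ U]) auto
    also have "\<dots> = expct (rsub U p) (\<lambda>x. expct (rsub (E - U) p) (\<lambda>y. f (U \<union> y)))"
      by (intro expct_cong arg_cong[of _ _ f]) (auto dest!: rsub_sub)
    finally show ?thesis by simp
  qed
  finally show ?thesis .
qed

lemma rsub_contains:
  assumes "finite E" "U \<subseteq> E" "0 \<le> p" "p \<le> 1"
  shows "expct (rsub E p) (\<lambda>g. of_bool (U \<subseteq> g)) = (p ^ card U :: real)"
  using rsub_plant[OF assms, of "\<lambda>_. 1::real"] by simp

text \<open>The form of planting used for encodings: adding \<open>U\<close> by force inflates averages by at
  most \<open>p^(-|U|)\<close>.\<close>

lemma rsub_plant_le:
  fixes f :: "'e set \<Rightarrow> real"
  assumes "finite E" "U \<subseteq> E" "0 \<le> p" "p \<le> 1" "\<And>g. g \<subseteq> E \<Longrightarrow> 0 \<le> f g"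
  shows "p ^ card U * expct (rsub E p) (\<lambda>g. f (g \<union> U)) \<le> expct (rsub E p) f"
proof -
  have "p ^ card U * expct (rsub E p) (\<lambda>g. f (g \<union> U)) = expct (rsub E p) (\<lambda>g. of_bool (U \<subseteq> g) * f g)"
    using rsub_plant[OF assms(1-4), of f] by simp
  also have "\<dots> \<le> expct (rsub E p) f"
    using assms by (intro expct_mono) (auto dest!: rsub_sub)
  finally show ?thesis .
qed

text \<open>The same price for overwriting some coordinates of a random colouring by prescribed values.\<close>

lemma Pi_pmf_override_le:
  fixes f :: "('j \<Rightarrow> 'b) \<Rightarrow> real"
  assumes fin: "finite J" "M \<subseteq> J" "\<And>j. finite (set_pmf (P j))" and f: "\<And>c. 0 \<le> f c"
  shows "(\<Prod>j\<in>M. pmf (P j) (t j)) * expct (Pi_pmf J d P) (\<lambda>c. f (\<lambda>j. if j \<in> M then t j else c j))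
     \<le> expct (Pi_pmf J d P) f"
proof -
  have fM: "finite M" using fin finite_subset by auto
  have fP: "finite (set_pmf (Pi_pmf A d P))" if "finite A" for A
    using that fin by (simp add: set_Pi_pmf finite_PiE_dflt)
  have split: "expct (Pi_pmf J d P) h
     = expct (Pi_pmf M d P) (\<lambda>a. expct (Pi_pmf (J - M) d P) (\<lambda>b. h (\<lambda>j. if j \<in> M then a j else b j)))" for h :: "_ \<Rightarrow> real"
  proof -
    have "J = M \<union> (J - M)" using fin by auto
    then have "Pi_pmf J d P = map_pmf (\<lambda>(f,g) x. if x \<in> M then f x else g x)
             (pair_pmf (Pi_pmf M d P) (Pi_pmf (J - M) d P))"
      using Pi_pmf_union[of M "J - M" d P] fM fin by auto
    then show ?thesis
      using fM fin fP by (simp add: integral_map_pmf expct_pair case_prod_unfold cong: if_cong)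
  qed
  let ?t = "\<lambda>j. if j \<in> M then t j else d"
  let ?g = "expct (Pi_pmf (J - M) d P) (\<lambda>b. f (\<lambda>j. if j \<in> M then t j else b j))"
  have "expct (Pi_pmf J d P) (\<lambda>c. f (\<lambda>j. if j \<in> M then t j else c j)) = ?g"
    unfolding split by (simp cong: if_cong)
  moreover have "(\<Prod>j\<in>M. pmf (P j) (t j)) = pmf (Pi_pmf M d P) ?t"
    using fM by (subst pmf_Pi') auto
  moreover have "pmf (Pi_pmf M d P) ?t * ?g = expct (Pi_pmf M d P) (\<lambda>a. indicator {?t} a * ?g)"
    by (simp add: measure_pmf_single)
  moreover have "\<dots> \<le> expct (Pi_pmf M d P) (\<lambda>a. expct (Pi_pmf (J - M) d P) (\<lambda>b. f (\<lambda>j. if j \<in> M then a j else b j)))"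
    using fP fM by (intro expct_mono) (auto simp: indicator_def f intro!: expct_nonneg cong: if_cong)
  ultimately show ?thesis
    unfolding split[of f] by (simp add: measure_pmf_single)
qed

section \<open>Edges, blocks and partitions into blocks\<close>

lemma finite_all_edges [simp]: "finite A \<Longrightarrow> finite (all_edges A)"
  by (rule finite_subset[of _ "Pow A"]) (auto simp: all_edges_def)

lemma card_all_edges: "finite A \<Longrightarrow> card (all_edges A) = card A choose 2"
  unfolding all_edges_def by (rule n_subsets)

lemma all_edges_Int: "all_edges A \<inter> all_edges B = all_edges (A \<inter> B)"
  by (auto simp: all_edges_def)

lemma all_edges_mono: "A \<subseteq> B \<Longrightarrow> all_edges A \<subseteq> all_edges B"
  by (auto simp: all_edges_def)

lemma all_edges_small: "finite A \<Longrightarrow> card A \<le> 1 \<Longrightarrow> all_edges A = {}"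
  by (auto simp: all_edges_def dest: card_mono)

definition ksets :: "'a set \<Rightarrow> nat \<Rightarrow> 'a set set" where
  "ksets V r = {A. A \<subseteq> V \<and> card A = r}"

lemma finite_ksets [simp]: "finite V \<Longrightarrow> finite (ksets V r)"
  by (rule finite_subset[of _ "Pow V"]) (auto simp: ksets_def)

lemma card_ksets: "finite V \<Longrightarrow> card (ksets V r) = card V choose r"
  unfolding ksets_def by (rule n_subsets)

text \<open>A perfect matching of \<open>U\<close> in the complete \<open>r\<close>-uniform hypergraph; its
  members are called blocks.\<close>

definition pm :: "nat \<Rightarrow> 'a set \<Rightarrow> 'a set set \<Rightarrow> bool" where
  "pm r U Q \<longleftrightarrow> partition_on U Q \<and> (\<forall>A\<in>Q. card A = r)"

lemma pm_ksets: "pm r U Q \<Longrightarrow> Q \<subseteq> ksets U r"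
  by (auto simp: pm_def partition_on_def ksets_def)

lemma finite_pm: "pm r U Q \<Longrightarrow> finite U \<Longrightarrow> finite Q"
  using finite_elements pm_def by blast

lemma pm_disjoint: "pm r U Q \<Longrightarrow> A \<in> Q \<Longrightarrow> B \<in> Q \<Longrightarrow> A \<noteq> B \<Longrightarrow> A \<inter> B = {}"
  by (auto simp: pm_def partition_on_def disjoint_def)

lemma pm_card: "pm r U Q \<Longrightarrow> finite U \<Longrightarrow> card U = r * card Q"
  unfolding pm_def
  using card_partition[of Q r] finite_elements[of U Q]
  by (auto simp: partition_on_def disjoint_def mult.commute)

definition union_edges :: "'a set set \<Rightarrow> 'a set set" where
  "union_edges F = (\<Union>A\<in>F. all_edges A)"

lemma union_edges_mono: "F \<subseteq> G \<Longrightarrow> union_edges F \<subseteq> union_edges G"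
  by (auto simp: union_edges_def)

lemma card_union_edges:
  assumes "finite F" "\<And>A. A \<in> F \<Longrightarrow> card A = r" "r > 0" "\<And>A B. A \<in> F \<Longrightarrow> B \<in> F \<Longrightarrow> A \<noteq> B \<Longrightarrow> A \<inter> B = {}"
  shows "card (union_edges F) = card F * (r choose 2)"
proof -
  have fin: "finite A" if "A \<in> F" for A using assms that card_gt_0_iff by fastforce
  have "card (union_edges F) = (\<Sum>A\<in>F. card (all_edges A))"
    unfolding union_edges_def
  proof (rule card_UN_disjoint)
    show "\<forall>i\<in>F. \<forall>j\<in>F. i \<noteq> j \<longrightarrow> all_edges i \<inter> all_edges j = {}"
      using assms(4) by (auto simp: all_edges_Int all_edges_small)
  qed (use assms fin in auto)
  also have "\<dots> = (\<Sum>A\<in>F. r choose 2)"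
    using fin assms by (intro sum.cong) (auto simp: card_all_edges)
  finally show ?thesis by simp
qed

section \<open>The fragment encoding\<close>

definition coloured_cliques :: "'a set \<Rightarrow> nat \<Rightarrow> 'a set set \<Rightarrow> ('a set \<Rightarrow> nat) \<Rightarrow> nat \<Rightarrow> 'a set set" where
  "coloured_cliques V r g c i = {A \<in> ksets V r. all_edges A \<subseteq> g \<and> c A < i}"

text \<open>What planting the blocks of \<open>F\<close> creates beyond \<open>F\<close> itself. The decoder
  must not mistake these cliques for parts of \<open>F\<close>.\<close>

definition side_cliques :: "'a set \<Rightarrow> nat \<Rightarrow> 'a set set \<Rightarrow> 'a set set \<Rightarrow> 'a set set" where
  "side_cliques V r g F =
     {A \<in> ksets V r. all_edges A \<subseteq> g \<union> union_edges F \<and> \<not> all_edges A \<subseteq> g \<and> A \<notin> F}"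

lemma coloured_cliques_mono: "i \<le> j \<Longrightarrow> coloured_cliques V r g c i \<subseteq> coloured_cliques V r g c j"
  by (auto simp: coloured_cliques_def)

text \<open>An \<open>r\<close>-clique of \<open>g \<inter> h\<close> with colour below \<open>i\<close> is
  available after \<open>i\<close> rounds. Colour \<open>m\<close> is never reached in
  \<open>m\<close> rounds and has probability at least 1/2; it hides side cliques at the cost of a
  factor 2 each, and the assumption \<open>sides\<close> limits this to \<open>2^K\<close> per planted
  block. The vertex set \<open>U g\<close> to be tiled may depend on the graph;
  \<open>U_stable\<close> says that planting parts of a member of \<open>SS g h\<close> does not
  change it, so that it is known to the decoder.\<close>

locale encoding =
  fixes V :: "'a set" and r m K :: nat and p q \<sigma> :: real and \<kappa> :: "nat pmf"
    and U :: "'a set set \<Rightarrow> 'a set"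
    and SS :: "'a set set \<Rightarrow> 'a set set \<Rightarrow> 'a set set set"
  assumes finV: "finite V" and r: "0 < r" and m: "0 < m" and p01: "0 < p" "p \<le> 1" and q01: "0 < q" "q \<le> 1"
    and \<kappa>: "finite (set_pmf \<kappa>)" "1 / 2 \<le> pmf \<kappa> m" "\<And>i. i < m \<Longrightarrow> 1 / (2 * real m) \<le> pmf \<kappa> i"
    and U: "\<And>g. U g \<subseteq> V"
    and \<sigma>: "0 \<le> \<sigma>"
    and SS_pm: "\<And>g h S. S \<in> SS g h \<Longrightarrow> pm r (U g) S"
    and spread: "\<And>g h F. real (card {S \<in> SS g h. F \<subseteq> S}) \<le> \<sigma> ^ card F * real (card (SS g h))"
    and U_stable: "\<And>g h S F. S \<in> SS g h \<Longrightarrow> F \<subseteq> S \<Longrightarrow> U (g \<union> union_edges F) = U g"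
    and sides: "\<And>g h S F. S \<in> SS g h \<Longrightarrow> F \<subseteq> S \<Longrightarrow> card (side_cliques V r (g \<inter> h) F) \<le> K * card F"
begin

abbreviation "E \<equiv> all_edges V"
abbreviation "W g h c i \<equiv> coloured_cliques V r (g \<inter> h) c i"
abbreviation "colours \<equiv> Pi_pmf (ksets V r) 0 (\<lambda>_. \<kappa>)"

definition avg :: "('a set set \<Rightarrow> 'a set set \<Rightarrow> ('a set \<Rightarrow> nat) \<Rightarrow> real) \<Rightarrow> real" where
  "avg f = expct (rsub E p) (\<lambda>g. expct (rsub E q) (\<lambda>h. expct colours (\<lambda>c. f g h c)))"

lemma fin_pmfs [simp]: "finite (set_pmf (rsub E t))" "finite (set_pmf colours)"
  using finV \<kappa> by (auto simp: set_Pi_pmf intro!: finite_PiE_dflt)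

lemma avg_mono: 
  assumes "\<And>g h c. g \<subseteq> E \<Longrightarrow> h \<subseteq> E \<Longrightarrow> f g h c \<le> f' g h c"
  shows "avg f \<le> avg f'"
  unfolding avg_def using assms by (intro expct_mono) (auto dest!: rsub_sub)

lemma avg_sum: "avg (\<lambda>g h c. \<Sum>i\<in>I. f i g h c) = (\<Sum>i\<in>I. avg (f i))"
  unfolding avg_def by (simp add: expct_sum)

lemma avg_cmult: "avg (\<lambda>g h c. a * f g h c) = a * avg f"
  unfolding avg_def by simp

lemma avg_const: "avg (\<lambda>g h c. a) = a"
  unfolding avg_def by simp

definition plant :: "'a set set \<Rightarrow> nat \<Rightarrow> 'a set set \<Rightarrow> ('a set \<Rightarrow> nat) \<Rightarrow> ('a set \<Rightarrow> nat)" where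
  "plant F i B c = (\<lambda>A. if A \<in> F \<union> B then (if A \<in> F then i else m) else c A)"

text \<open>The price of planting \<open>b\<close> blocks: each has \<open>r choose 2\<close> edges that must
  appear in both \<open>g\<close> and \<open>h\<close>, one colour of probability at least
  \<open>1/(2m)\<close>, and at most \<open>K\<close> side cliques whose colour \<open>m\<close> costs
  a factor 2.\<close>

lemma avg_plant_le:
  assumes F: "F \<subseteq> ksets V r" "card F = b" "\<And>A B. A \<in> F \<Longrightarrow> B \<in> F \<Longrightarrow> A \<noteq> B \<Longrightarrow> A \<inter> B = {}"
    and i: "i < m" and f: "\<And>g h c. 0 \<le> f g h c"
  shows "avg (\<lambda>g h c. of_bool (card (side_cliques V r (g \<inter> h) F) \<le> K * b) *
           f (g \<union> union_edges F) (h \<union> union_edges F) (plant F i (side_cliques V r (g \<inter> h) F) c))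
       \<le> (2 * real m * 2 ^ K / (p * q) ^ (r choose 2)) ^ b * avg f"
proof -
  let ?e = "union_edges F" and ?s = "\<lambda>g h. side_cliques V r (g \<inter> h) F"
  let ?C = "(2 * real m * 2 ^ K) ^ b"
  have finF: "finite F" using F(1) finV finite_subset finite_ksets by blast
  have eE: "?e \<subseteq> E" using F(1) by (auto simp: union_edges_def ksets_def all_edges_def)
  have ce: "card ?e = b * (r choose 2)"
    using card_union_edges[of F r] finF F r by (auto simp: ksets_def)
  have col: "of_bool (card (?s g h) \<le> K * b) * expct colours (\<lambda>c. u (plant F i (?s g h) c))
      \<le> ?C * expct colours u" if u: "\<And>c. 0 \<le> u c" for g h and u :: "_ \<Rightarrow> real"
  proof (cases "card (?s g h) \<le> K * b")
    case False
    then show ?thesis using u m by (auto intro!: mult_nonneg_nonneg expct_nonneg)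
  next
    case True
    let ?B = "?s g h" and ?t = "\<lambda>A. if A \<in> F then i else m"
    have fB: "finite ?B" "?B \<subseteq> ksets V r" "F \<inter> ?B = {}"
      using finV by (auto simp: side_cliques_def)
    have "?C * (\<Prod>A\<in>F \<union> ?B. pmf \<kappa> (?t A)) \<ge> 1"
    proof -
      have "(\<Prod>A\<in>F \<union> ?B. pmf \<kappa> (?t A)) = (\<Prod>A\<in>F. pmf \<kappa> i) * (\<Prod>A\<in>?B. pmf \<kappa> m)"
      proof (subst prod.union_disjoint)
        have "\<And>A. A \<in> ?B \<Longrightarrow> A \<notin> F" using fB by auto
        then have "(\<Prod>A\<in>?B. pmf \<kappa> (?t A)) = (\<Prod>A\<in>?B. pmf \<kappa> m)"
          by (intro prod.cong refl) auto
        then show "(\<Prod>A\<in>F. pmf \<kappa> (?t A)) * (\<Prod>A\<in>?B. pmf \<kappa> (?t A))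
            = (\<Prod>A\<in>F. pmf \<kappa> i) * (\<Prod>A\<in>?B. pmf \<kappa> m)" by simp
      qed (use fB finF in auto)
      also have "\<dots> \<ge> (1 / (2 * real m)) ^ b * (1/2) ^ (K * b)"
      proof (intro mult_mono)
        show "(1 / (2 * real m)) ^ b \<le> (\<Prod>A\<in>F. pmf \<kappa> i)"
          using \<kappa>(3)[OF i] F(2) by (auto intro!: power_mono)
        have "(1/2::real) ^ (K * b) \<le> (1/2) ^ card ?B"
          using True by (intro power_decreasing) auto
        also have "\<dots> \<le> (\<Prod>A\<in>?B. pmf \<kappa> m)"
          using \<kappa>(2) by (auto intro!: power_mono)
        finally show "(1/2::real) ^ (K * b) \<le> (\<Prod>A\<in>?B. pmf \<kappa> m)" .
      qed auto
      finally have "(1 / (2 * real m)) ^ b * (1/2) ^ (K * b) \<le> (\<Prod>A\<in>F \<union> ?B. pmf \<kappa> (?t A))" .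
      then have "?C * ((1 / (2 * real m)) ^ b * (1/2) ^ (K * b)) \<le> ?C * (\<Prod>A\<in>F \<union> ?B. pmf \<kappa> (?t A))"
        by (intro mult_left_mono) auto
      moreover have "?C * ((1 / (2 * real m)) ^ b * (1/2) ^ (K * b)) = 1"
        using m by (simp add: power_mult_distrib power_divide power_mult field_simps)
      ultimately show ?thesis by simp
    qed
    then have "expct colours (\<lambda>c. u (plant F i ?B c))
       \<le> ?C * (\<Prod>A\<in>F \<union> ?B. pmf \<kappa> (?t A)) * expct colours (\<lambda>c. u (plant F i ?B c))"
      using mult_right_mono[of 1 _ "expct colours (\<lambda>c. u (plant F i ?B c))"] u by (simp add: expct_nonneg)
    also have "\<dots> \<le> ?C * expct colours u"
      unfolding mult.assoc plant_def
      using F(1) fB finV \<kappa> u m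
      by (intro mult_left_mono Pi_pmf_override_le[where f = u and t = ?t and M = "F \<union> ?B"]) auto
    finally show ?thesis using True by simp
  qed
  let ?f' = "\<lambda>g h. expct colours (f g h)"
  have pl: "expct (rsub E t) (\<lambda>g. u (g \<union> ?e)) \<le> expct (rsub E t) u / t ^ (b * (r choose 2))"
    if "0 < t" "t \<le> 1" "\<And>g. 0 \<le> u g" for t and u :: "_ \<Rightarrow> real"
    using rsub_plant_le[of E ?e t u] eE finV that ce by (simp add: field_simps)
  have "avg (\<lambda>g h c. of_bool (card (?s g h) \<le> K * b) * f (g \<union> ?e) (h \<union> ?e) (plant F i (?s g h) c))
     \<le> expct (rsub E p) (\<lambda>g. expct (rsub E q) (\<lambda>h. ?C * ?f' (g \<union> ?e) (h \<union> ?e)))"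
    unfolding avg_def using col f by (intro expct_mono) auto
  also have "\<dots> = ?C * expct (rsub E p) (\<lambda>g. expct (rsub E q) (\<lambda>h. ?f' (g \<union> ?e) (h \<union> ?e)))"
    by simp
  also have "\<dots> \<le> ?C * expct (rsub E p) (\<lambda>g. expct (rsub E q) (\<lambda>h. ?f' (g \<union> ?e) h) / q ^ (b * (r choose 2)))"
    using q01 f by (intro mult_left_mono expct_mono pl expct_nonneg) auto
  also have "\<dots> = ?C / q ^ (b * (r choose 2)) * expct (rsub E p) (\<lambda>g. expct (rsub E q) (\<lambda>h. ?f' (g \<union> ?e) h))"
    by simp
  also have "\<dots> \<le> ?C / q ^ (b * (r choose 2)) * (avg f / p ^ (b * (r choose 2)))"
    unfolding avg_def using p01 q01 f by (intro mult_left_mono pl[of p] expct_nonneg) auto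
  also have "\<dots> = (2 * real m * 2 ^ K / (p * q) ^ (r choose 2)) ^ b * avg f"
    by (simp add: power_divide power_mult_distrib power_mult mult.commute[of b])
  finally show ?thesis .
qed

text \<open>Partitions that had at most \<open>k\<close> blocks missing before round \<open>i\<close> and whose
  blocks still missing after the round can be supplied by \<open>S\<close>. A fragment of
  \<open>S\<close> is the set of blocks supplied in this way.\<close>

definition cand :: "'a set set \<Rightarrow> 'a set set \<Rightarrow> ('a set \<Rightarrow> nat) \<Rightarrow> nat \<Rightarrow> nat \<Rightarrow> 'a set set \<Rightarrow> 'a set set set" where
  "cand g h c i k S = {Q. pm r (U g) Q \<and> card (Q - W g h c i) \<le> k \<and> Q - W g h c (Suc i) \<subseteq> S}"

definition least_fragment :: "'a set set \<Rightarrow> 'a set set \<Rightarrow> ('a set \<Rightarrow> nat) \<Rightarrow> nat \<Rightarrow> nat \<Rightarrow> nat \<Rightarrow> 'a set set \<Rightarrow> bool" where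
  "least_fragment g h c i k b S \<longleftrightarrow> (\<exists>Q\<in>cand g h c i k S. card (Q - W g h c (Suc i)) = b) \<and>
      (\<forall>Q\<in>cand g h c i k S. b \<le> card (Q - W g h c (Suc i)))"

text \<open>The decoder picks some partition that is complete after the round; the choice depends only on the
  planted configuration. The fragment is a subset of the blocks of this partition that were missing
  before the round, hence one of at most \<open>k choose b\<close> sets.\<close>

definition decode :: "'a set set \<Rightarrow> 'a set set \<Rightarrow> ('a set \<Rightarrow> nat) \<Rightarrow> nat \<Rightarrow> nat \<Rightarrow> nat \<Rightarrow> 'a set set set" where
  "decode g h c i k b =
     (let P = (\<lambda>Q. pm r (U g) Q \<and> card (Q - W g h c i) \<le> k \<and> Q \<subseteq> W g h c (Suc i)) in
       if \<exists>Q. P Q then {F. F \<subseteq> (SOME Q. P Q) - W g h c i \<and> card F = b} else {})"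

lemma card_decode: "finite (decode g h c i k b)" "card (decode g h c i k b) \<le> k choose b"
proof -
  have "finite (decode g h c i k b) \<and> card (decode g h c i k b) \<le> k choose b"
  proof (cases "\<exists>Q. pm r (U g) Q \<and> card (Q - W g h c i) \<le> k \<and> Q \<subseteq> W g h c (Suc i)")
    case True
    define Q where "Q = (SOME Q. pm r (U g) Q \<and> card (Q - W g h c i) \<le> k \<and> Q \<subseteq> W g h c (Suc i))"
    have Q: "pm r (U g) Q \<and> card (Q - W g h c i) \<le> k \<and> Q \<subseteq> W g h c (Suc i)"
      unfolding Q_def using True by (rule someI_ex)
    have "finite Q" using Q finite_pm[of r "U g" Q] finite_subset[OF U finV] by simp
    moreover have "decode g h c i k b = {F. F \<subseteq> Q - W g h c i \<and> card F = b}"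
      unfolding decode_def Let_def Q_def using True by simp
    ultimately have fin: "finite (decode g h c i k b)" and "card (decode g h c i k b) = card (Q - W g h c i) choose b"
      by (simp_all add: n_subsets)
    note this(2)
    also have "\<dots> \<le> k choose b" using Q by (intro binomial_right_mono) auto
    finally show ?thesis using fin by simp
  next
    case False
    then have "decode g h c i k b = {}" unfolding decode_def Let_def by (simp only: if_False)
    then show ?thesis by simp
  qed
  then show "finite (decode g h c i k b)" "card (decode g h c i k b) \<le> k choose b" by auto
qed

text \<open>Planting \<open>F\<close> with colour \<open>i\<close> completes \<open>Q\<close> in this round and
  changes no earlier round. The decoder may pick a partition \<open>Q'\<close> different from
  \<open>Q\<close>, but what \<open>Q'\<close> lacked before planting is part of \<open>F\<close>, so
  \<open>Q'\<close> is a candidate for the same \<open>S\<close>, and minimality of \<open>F\<close>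
  forces it to lack all of \<open>F\<close>.\<close>

lemma decode_planted:
  assumes S: "S \<in> SS g h" and Q: "Q \<in> cand g h c i k S" and F: "F = Q - W g h c (Suc i)" "card F = b"
    and least: "\<And>Q. Q \<in> cand g h c i k S \<Longrightarrow> b \<le> card (Q - W g h c (Suc i))" and i: "i < m"
  shows "F \<in> decode (g \<union> union_edges F) (h \<union> union_edges F) (plant F i (side_cliques V r (g \<inter> h) F) c) i k b"
proof -
  let ?g = "g \<union> union_edges F" and ?h = "h \<union> union_edges F" 
  let ?c = "plant F i (side_cliques V r (g \<inter> h) F) c"
  have FS: "F \<subseteq> S" and pmQ: "pm r (U g) Q" and Qk: "card (Q - W g h c i) \<le> k"
    using Q F by (auto simp: cand_def)
  have gh: "?g \<inter> ?h = (g \<inter> h) \<union> union_edges F" by auto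
  have FV: "F \<subseteq> ksets V r" using pm_ksets[OF pmQ] F U by (fastforce simp: ksets_def)
  have Ug: "U ?g = U g" using U_stable[OF S FS] .
  have mono: "W g h c i \<subseteq> W g h c (Suc i)" by (rule coloured_cliques_mono) simp
  have WSi: "W ?g ?h ?c (Suc i) = W g h c (Suc i) \<union> F"
    unfolding gh using FV i
    by (auto simp: coloured_cliques_def plant_def side_cliques_def union_edges_def F(1))
  have Wi: "W ?g ?h ?c i = W g h c i"
    unfolding gh using FV i mono F(1)
    by (auto simp: coloured_cliques_def plant_def side_cliques_def)
  define P where "P = (\<lambda>Q. pm r (U ?g) Q \<and> card (Q - W ?g ?h ?c i) \<le> k \<and> Q \<subseteq> W ?g ?h ?c (Suc i))"
  have "P Q" unfolding P_def Ug Wi WSi using pmQ Qk F by auto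
  then have ex: "\<exists>Q. P Q" by blast
  define Q' where "Q' = (SOME Q. P Q)"
  have "P Q'" unfolding Q'_def using ex by (rule someI_ex)
  then have Q': "pm r (U g) Q'" "card (Q' - W g h c i) \<le> k" "Q' \<subseteq> W g h c (Suc i) \<union> F"
    unfolding P_def Ug Wi WSi by auto
  then have sub: "Q' - W g h c (Suc i) \<subseteq> F" by auto
  then have "Q' \<in> cand g h c i k S" using Q' FS by (auto simp: cand_def)
  then have "card F \<le> card (Q' - W g h c (Suc i))" using least F by auto
  moreover have "finite F" using FV finV finite_subset finite_ksets by blast
  ultimately have "Q' - W g h c (Suc i) = F" using sub by (simp add: card_seteq)
  then have "F \<subseteq> Q' - W ?g ?h ?c i" unfolding Wi using mono by auto
  then show ?thesis
    unfolding decode_def Let_def P_def[symmetric] using ex F(2) Q'_def by auto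
qed

lemma finite_SS: "finite (SS g h)"
proof (rule finite_subset)
  show "SS g h \<subseteq> Pow (Pow V)"
    using SS_pm pm_ksets U by (fastforce simp: ksets_def)
qed (use finV in auto)

abbreviation frac :: "'a set set \<Rightarrow> 'a set set \<Rightarrow> ('a set set \<Rightarrow> bool) \<Rightarrow> real" where
  "frac g h P \<equiv> real (card {S \<in> SS g h. P S}) / real (card (SS g h))"

text \<open>Summing over all possible fragments \<open>F\<close>: the spread bounds the share of
  \<open>S\<close> that contain \<open>F\<close>, planting bounds the probability of the event by that
  of the planted one, and after planting at most \<open>k choose b\<close> sets \<open>F\<close> are
  possible.\<close>

lemma round_bound:
  assumes i: "i < m"
  shows "avg (\<lambda>g h c. frac g h (least_fragment g h c i k b))
       \<le> real (k choose b) * (\<sigma> * (2 * real m * 2 ^ K / (p * q) ^ (r choose 2))) ^ b"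
proof -
  define FF where "FF = {F. F \<subseteq> ksets V r \<and> card F = b \<and> (\<forall>A\<in>F. \<forall>B\<in>F. A \<noteq> B \<longrightarrow> A \<inter> B = {})}"
  have finFF: "finite FF"
    by (rule finite_subset[of _ "Pow (ksets V r)"]) (use finV in \<open>auto simp: FF_def\<close>)
  let ?s = "\<lambda>g h F. side_cliques V r (g \<inter> h) F"
  define \<phi> where "\<phi> = (\<lambda>F g h c. of_bool (card (?s g h F) \<le> K * b) *
     (of_bool (F \<in> decode (g \<union> union_edges F) (h \<union> union_edges F) (plant F i (?s g h F) c) i k b) :: real))"
  have key: "frac g h (least_fragment g h c i k b) \<le> (\<Sum>F\<in>FF. \<sigma> ^ b * \<phi> F g h c)" for g h c
  proof -
    have sub: "{S \<in> SS g h. least_fragment g h c i k b S} \<subseteq> (\<Union>F\<in>{F\<in>FF. \<phi> F g h c = 1}. {S \<in> SS g h. F \<subseteq> S})"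
    proof
      fix S assume "S \<in> {S \<in> SS g h. least_fragment g h c i k b S}"
      then obtain Q where S: "S \<in> SS g h" and Q: "Q \<in> cand g h c i k S" "card (Q - W g h c (Suc i)) = b"
        and least: "\<And>Q. Q \<in> cand g h c i k S \<Longrightarrow> b \<le> card (Q - W g h c (Suc i))"
        by (auto simp: least_fragment_def)
      define F where "F = Q - W g h c (Suc i)"
      have FS: "F \<subseteq> S" and pmQ: "pm r (U g) Q" using Q by (auto simp: F_def cand_def)
      have "F \<subseteq> ksets V r" using pm_ksets[OF pmQ] U by (fastforce simp: ksets_def F_def)
      then have "F \<in> FF" using Q pm_disjoint[OF pmQ] by (auto simp: FF_def F_def)
      moreover have "\<phi> F g h c = 1"
        using decode_planted[OF S Q(1) F_def _ least i] Q(2) sides[OF S FS] by (auto simp: \<phi>_def F_def)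
      ultimately show "S \<in> (\<Union>F\<in>{F\<in>FF. \<phi> F g h c = 1}. {S \<in> SS g h. F \<subseteq> S})"
        using S FS by auto
    qed
    have "real (card {S \<in> SS g h. least_fragment g h c i k b S})
        \<le> real (card (\<Union>F\<in>{F\<in>FF. \<phi> F g h c = 1}. {S \<in> SS g h. F \<subseteq> S}))"
      using finFF finite_SS by (intro of_nat_mono card_mono sub) auto
    also have "\<dots> \<le> (\<Sum>F\<in>{F\<in>FF. \<phi> F g h c = 1}. real (card {S \<in> SS g h. F \<subseteq> S}))"
      using card_UN_le[of "{F\<in>FF. \<phi> F g h c = 1}" "\<lambda>F. {S \<in> SS g h. F \<subseteq> S}"] finFF
      by (simp flip: of_nat_sum)
    also have "\<dots> \<le> (\<Sum>F\<in>{F\<in>FF. \<phi> F g h c = 1}. \<sigma> ^ b * real (card (SS g h)))"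
    proof (intro sum_mono)
      fix F assume "F \<in> {F\<in>FF. \<phi> F g h c = 1}"
      then show "real (card {S \<in> SS g h. F \<subseteq> S}) \<le> \<sigma> ^ b * real (card (SS g h))"
        using spread[of g h F] by (auto simp: FF_def)
    qed
    also have "\<dots> = (\<Sum>F\<in>{F\<in>FF. \<phi> F g h c = 1}. \<sigma> ^ b * \<phi> F g h c * real (card (SS g h)))"
      by (intro sum.cong) auto
    also have "\<dots> \<le> (\<Sum>F\<in>FF. \<sigma> ^ b * \<phi> F g h c * real (card (SS g h)))"
      using finFF \<sigma> by (intro sum_mono2) (auto simp: \<phi>_def)
    finally have "real (card {S \<in> SS g h. least_fragment g h c i k b S})
       \<le> (\<Sum>F\<in>FF. \<sigma> ^ b * \<phi> F g h c) * real (card (SS g h))"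
      by (simp add: sum_distrib_right)
    moreover have "0 \<le> (\<Sum>F\<in>FF. \<sigma> ^ b * \<phi> F g h c)"
      using \<sigma> by (intro sum_nonneg) (auto simp: \<phi>_def)
    ultimately show ?thesis
      by (cases "card (SS g h) = 0") (auto simp: field_simps)
  qed
  define R where "R = 2 * real m * 2 ^ K / (p * q) ^ (r choose 2)"
  have R0: "0 \<le> R" using p01 q01 by (simp add: R_def)
  have "avg (\<lambda>g h c. frac g h (least_fragment g h c i k b)) \<le> (\<Sum>F\<in>FF. \<sigma> ^ b * avg (\<phi> F))"
    using avg_mono[OF key] by (simp add: avg_sum avg_cmult)
  also have "\<dots> \<le> (\<Sum>F\<in>FF. \<sigma> ^ b * (R ^ b * avg (\<lambda>g h c. of_bool (F \<in> decode g h c i k b))))"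
    unfolding \<phi>_def R_def using \<sigma> i by (intro sum_mono mult_left_mono avg_plant_le) (auto simp: FF_def)
  also have "\<dots> = (\<sigma> * R) ^ b * avg (\<lambda>g h c. \<Sum>F\<in>FF. of_bool (F \<in> decode g h c i k b))"
    by (simp add: avg_sum sum_distrib_left power_mult_distrib mult.assoc)
  also have "\<dots> \<le> (\<sigma> * R) ^ b * avg (\<lambda>g h c. real (k choose b))"
  proof (intro mult_left_mono avg_mono)
    fix g h c
    have "(\<Sum>F\<in>FF. of_bool (F \<in> decode g h c i k b)) = real (card (FF \<inter> decode g h c i k b))"
      using finFF by (subst sum_of_bool_eq) (auto intro!: arg_cong[of _ _ card])
    also have "\<dots> \<le> real (card (decode g h c i k b))"
      using card_decode(1) by (intro of_nat_mono card_mono) auto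
    also have "\<dots> \<le> real (k choose b)" using card_decode(2) by simp
    finally show "(\<Sum>F\<in>FF. of_bool (F \<in> decode g h c i k b)) \<le> real (k choose b)" .
  qed (use \<sigma> R0 in auto)
  finally show ?thesis unfolding R_def[symmetric] by (simp add: avg_const mult.commute)
qed


definition near :: "'a set set \<Rightarrow> 'a set set \<Rightarrow> ('a set \<Rightarrow> nat) \<Rightarrow> nat \<Rightarrow> nat \<Rightarrow> 'a set set \<Rightarrow> bool" where
  "near g h c i k S \<longleftrightarrow> (\<exists>Q. pm r (U g) Q \<and> Q - W g h c i \<subseteq> S \<and> card (Q - W g h c i) \<le> k)"

lemma near_step:
  assumes "near g h c i k S" "\<not> near g h c (Suc i) k' S"
  shows "\<exists>b\<in>{k'<..k}. least_fragment g h c i k b S"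
proof -
  let ?d = "\<lambda>Q. card (Q - W g h c (Suc i))"
  have mono: "W g h c i \<subseteq> W g h c (Suc i)" by (rule coloured_cliques_mono) simp
  obtain Q0 where "pm r (U g) Q0" "Q0 - W g h c i \<subseteq> S" "card (Q0 - W g h c i) \<le> k"
    using assms(1) by (auto simp: near_def)
  then have "Q0 \<in> cand g h c i k S" using mono by (auto simp: cand_def)
  then obtain Q where Q: "Q \<in> cand g h c i k S" "\<And>Q'. Q' \<in> cand g h c i k S \<Longrightarrow> ?d Q \<le> ?d Q'"
    using ex_has_least_nat[of "\<lambda>Q. Q \<in> cand g h c i k S" Q0 ?d] by blast
  then have "least_fragment g h c i k (?d Q) S" by (auto simp: least_fragment_def)
  moreover have "k' < ?d Q"
  proof (rule ccontr)
    assume "\<not> k' < ?d Q"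
    then have "near g h c (Suc i) k' S" using Q(1) unfolding near_def cand_def by (intro exI[of _ Q]) simp
    then show False using assms(2) by simp
  qed
  moreover have "?d Q \<le> k"
  proof -
    have "finite Q" using Q(1) finite_pm[of r "U g" Q] finite_subset[OF U finV] by (simp add: cand_def)
    then have "?d Q \<le> card (Q - W g h c i)" using mono by (intro card_mono) auto
    then show ?thesis using Q(1) by (simp add: cand_def)
  qed
  ultimately show ?thesis by auto
qed

lemma near_chain:
  assumes "near g h c 0 (ks 0) S" "\<not> near g h c j (ks j) S"
  shows "\<exists>i<j. \<exists>b\<in>{ks (Suc i)<..ks i}. least_fragment g h c i (ks i) b S"
  using assms
proof (induction j)
  case (Suc j)
  show ?case
  proof (cases "near g h c j (ks j) S")
    case True
    then show ?thesis using near_step[OF True Suc.prems(2)] by blast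
  next
    case False
    then show ?thesis using Suc by (meson less_Suc_eq)
  qed
qed simp

definition "\<rho> = \<sigma> * (2 * real m * 2 ^ K / (p * q) ^ (r choose 2))"

lemma \<rho>_nonneg: "0 \<le> \<rho>"
  unfolding \<rho>_def using \<sigma> p01 q01 by simp

text \<open>The allowance \<open>ks i = x + n0 / 2^i\<close> for missing blocks halves in every round until only
  \<open>x\<close> remain. If the final goal fails, then every \<open>S\<close> violates the allowance
  for the first time in some round, and there its least fragment has a size between two consecutive
  allowances.\<close>

lemma deficiency_tail:
  assumes n0: "card V \<le> n0" "n0 < 2 ^ m" "2 ^ (m - 1) \<le> n0" and \<rho>: "4 * \<rho> \<le> 1 / 2"
  shows "avg (\<lambda>g h c. of_bool (SS g h \<noteq> {} \<and> \<not> (\<exists>Q. pm r (U g) Q \<and> card (Q - W g h c m) \<le> x)))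
    \<le> 2 * (4 * \<rho>) ^ (x + 1)"
proof -
  define ks where "ks = (\<lambda>i. x + n0 div 2 ^ i)"
  have ksm: "ks m = x" using n0 by (simp add: ks_def)
  let ?lf = "\<lambda>g h c i b. frac g h (least_fragment g h c i (ks i) b)"
  have pointwise: "of_bool (SS g h \<noteq> {} \<and> \<not> (\<exists>Q. pm r (U g) Q \<and> card (Q - W g h c m) \<le> x))
     \<le> (\<Sum>i<m. \<Sum>b\<in>{ks (Suc i)<..ks i}. ?lf g h c i b)" for g h c
  proof (cases "SS g h \<noteq> {} \<and> \<not> (\<exists>Q. pm r (U g) Q \<and> card (Q - W g h c m) \<le> x)")
    case True
    have "SS g h \<subseteq> (\<Union>i<m. \<Union>b\<in>{ks (Suc i)<..ks i}. {S \<in> SS g h. least_fragment g h c i (ks i) b S})"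
    proof
      fix S assume S: "S \<in> SS g h"
      note pmS = SS_pm[OF S]
      have "card (U g) \<le> n0" using card_mono[OF finV U] n0 by (meson le_trans)
      then have "card S \<le> n0"
        using pm_card[OF pmS finite_subset[OF U finV]] r
        by (metis One_nat_def Suc_leI le_trans mult_le_mono1 nat_mult_1)
      then have "near g h c 0 (ks 0) S"
        using pmS by (auto simp: near_def coloured_cliques_def ks_def intro!: exI[of _ S])
      moreover have "\<not> near g h c m (ks m) S" using True ksm by (auto simp: near_def)
      ultimately show "S \<in> (\<Union>i<m. \<Union>b\<in>{ks (Suc i)<..ks i}. {S \<in> SS g h. least_fragment g h c i (ks i) b S})"
        using near_chain[of g h c ks S m] S by blast
    qed
    then have "card (SS g h) \<le> card (\<Union>i<m. \<Union>b\<in>{ks (Suc i)<..ks i}. {S \<in> SS g h. least_fragment g h c i (ks i) b S})"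
      using finite_SS by (intro card_mono) auto
    also have "\<dots> \<le> (\<Sum>i<m. \<Sum>b\<in>{ks (Suc i)<..ks i}. card {S \<in> SS g h. least_fragment g h c i (ks i) b S})"
      by (intro order.trans[OF card_UN_le] sum_mono) auto
    finally have "real (card (SS g h)) \<le> (\<Sum>i<m. \<Sum>b\<in>{ks (Suc i)<..ks i}. real (card {S \<in> SS g h. least_fragment g h c i (ks i) b S}))"
      by (simp flip: of_nat_sum)
    moreover have "0 < card (SS g h)" using True finite_SS by (simp add: card_gt_0_iff)
    ultimately have "1 \<le> (\<Sum>i<m. \<Sum>b\<in>{ks (Suc i)<..ks i}. ?lf g h c i b)"
      by (simp add: field_simps flip: sum_divide_distrib)
    then show ?thesis using True by simp
  qed (auto intro!: sum_nonneg)
  have "avg (\<lambda>g h c. of_bool (SS g h \<noteq> {} \<and> \<not> (\<exists>Q. pm r (U g) Q \<and> card (Q - W g h c m) \<le> x)))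
     \<le> (\<Sum>i<m. \<Sum>b\<in>{ks (Suc i)<..ks i}. avg (\<lambda>g h c. ?lf g h c i b))"
    using avg_mono[OF pointwise] by (simp add: avg_sum)
  also have "\<dots> \<le> (\<Sum>i<m. \<Sum>b\<in>{ks (Suc i)<..ks i}. real (ks i choose b) * \<rho> ^ b)"
    using round_bound by (intro sum_mono) (auto simp: \<rho>_def)
  also have "\<dots> \<le> (\<Sum>i<m. (4 * \<rho>) ^ (x + 1) * (1/2) ^ (m - Suc i))"
  proof (intro sum_mono)
    fix i assume i: "i \<in> {..<m}"
    have ksi: "ks i \<le> 2 * ks (Suc i) + 1"
    proof -
      have "n0 div 2 ^ Suc i = n0 div 2 ^ i div 2" by (metis div_mult2_eq power_Suc2)
      then show ?thesis by (simp add: ks_def)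
    qed
    have "(\<Sum>b\<in>{ks (Suc i)<..ks i}. real (ks i choose b) * \<rho> ^ b)
       \<le> (\<Sum>b\<in>{ks (Suc i)<..ks i}. real (ks i choose b) * \<rho> ^ (ks (Suc i) + 1))"
      using \<rho> \<rho>_nonneg by (intro sum_mono mult_left_mono power_decreasing) auto
    also have "\<dots> = real (\<Sum>b\<in>{ks (Suc i)<..ks i}. ks i choose b) * \<rho> ^ (ks (Suc i) + 1)"
      by (simp add: sum_distrib_right)
    also have "\<dots> \<le> real (2 ^ ks i) * \<rho> ^ (ks (Suc i) + 1)"
    proof (intro mult_right_mono of_nat_mono)
      have "(\<Sum>b\<in>{ks (Suc i)<..ks i}. ks i choose b) \<le> (\<Sum>b\<le>ks i. ks i choose b)"
        by (intro sum_mono2) auto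
      then show "(\<Sum>b\<in>{ks (Suc i)<..ks i}. ks i choose b) \<le> 2 ^ ks i" by (simp add: choose_row_sum)
    qed (use \<rho>_nonneg in auto)
    (* consecutive allowances differ by a factor of about 2, so the binomial coefficients only cost a factor 4 per block *)
    also have "\<dots> \<le> 2 ^ (2 * (ks (Suc i) + 1)) * \<rho> ^ (ks (Suc i) + 1)"
    proof (intro mult_right_mono)
      have "(2::real) ^ ks i \<le> 2 ^ (2 * (ks (Suc i) + 1))"
        using ksi by (intro power_increasing) auto
      then show "real (2 ^ ks i) \<le> 2 ^ (2 * (ks (Suc i) + 1))" by simp
    qed (use \<rho>_nonneg in auto)
    also have "\<dots> = (4 * \<rho>) ^ (ks (Suc i) + 1)"
      by (subst power_mult) (simp add: power_mult_distrib)
    also have "\<dots> = (4 * \<rho>) ^ (x + 1) * (4 * \<rho>) ^ (n0 div 2 ^ Suc i)"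
      by (simp add: ks_def power_add)
    also have "\<dots> \<le> (4 * \<rho>) ^ (x + 1) * (1/2) ^ (m - Suc i)"
    proof (intro mult_left_mono)
      have "m - Suc i \<le> n0 div 2 ^ Suc i"
      proof (cases "Suc i = m")
        case False
        then have "Suc i \<le> m - 1" using i by auto
        then have "2 ^ (m - 1 - Suc i) = 2 ^ (m - 1) div (2 ^ Suc i :: nat)"
          by (intro power_diff) auto
        also have "\<dots> \<le> n0 div 2 ^ Suc i" using n0 by (intro div_le_mono)
        finally have "2 ^ (m - 1 - Suc i) \<le> n0 div 2 ^ Suc i" .
        moreover have "m - 1 - Suc i < 2 ^ (m - 1 - Suc i)" by (rule less_exp)
        ultimately show ?thesis by linarith
      qed simp
      moreover have "(4 * \<rho>) ^ (n0 div 2 ^ Suc i) \<le> (1/2) ^ (n0 div 2 ^ Suc i)"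
        using \<rho> \<rho>_nonneg by (intro power_mono) auto
      moreover have "(1/2::real) ^ (n0 div 2 ^ Suc i) \<le> (1/2) ^ (m - Suc i)"
        using calculation(1) by (intro power_decreasing) auto
      ultimately show "(4 * \<rho>) ^ (n0 div 2 ^ Suc i) \<le> (1/2) ^ (m - Suc i)" by linarith
    qed (use \<rho>_nonneg in auto)
    finally show "(\<Sum>b\<in>{ks (Suc i)<..ks i}. real (ks i choose b) * \<rho> ^ b)
        \<le> (4 * \<rho>) ^ (x + 1) * (1/2) ^ (m - Suc i)" .
  qed
  also have "\<dots> = (4 * \<rho>) ^ (x + 1) * (\<Sum>i<m. (1/2) ^ i)"
    by (simp add: sum_distrib_left[symmetric] sum.nat_diff_reindex)
  also have "\<dots> \<le> (4 * \<rho>) ^ (x + 1) * 2"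
    using \<rho>_nonneg by (intro mult_left_mono) (auto simp: sum_gp_strict)
  finally show ?thesis by simp
qed

end

section \<open>Switchings of perfect matchings\<close>

definition enum :: "'a set \<Rightarrow> nat \<Rightarrow> 'a" where
  "enum A = (SOME f. bij_betw f {..<card A} A)"

lemma enum_bij: "finite A \<Longrightarrow> bij_betw (enum A) {..<card A} A"
  using someI_ex[OF ex_bij_betw_nat_finite[of A]] by (simp add: enum_def lessThan_atLeast0)

text \<open>A switching takes a block \<open>A\<close> and \<open>r - 1\<close> further blocks \<open>\<rho> 1,
  ..., \<rho> (r - 1)\<close>, writes them as the rows of an \<open>r\<close> by \<open>r\<close>
  array in a fixed enumeration of each block, and replaces the rows by the columns. Row 0 is
  \<open>A\<close>.\<close>

definition srow :: "'a set \<Rightarrow> (nat \<Rightarrow> 'a set) \<Rightarrow> nat \<Rightarrow> 'a set" where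
  "srow A \<rho> d = (if d = 0 then A else \<rho> d)"

definition scol :: "nat \<Rightarrow> 'a set \<Rightarrow> (nat \<Rightarrow> 'a set) \<Rightarrow> nat \<Rightarrow> 'a set" where
  "scol r A \<rho> t = (\<lambda>d. enum (srow A \<rho> d) t) ` {..<r}"

definition swap_rows :: "nat \<Rightarrow> 'a set \<Rightarrow> (nat \<Rightarrow> 'a set) \<Rightarrow> 'a set set \<Rightarrow> 'a set set" where
  "swap_rows r A \<rho> S = (S - srow A \<rho> ` {..<r}) \<union> scol r A \<rho> ` {..<r}"

context
  fixes r :: nat and Vs :: "'a set" and S :: "'a set set" and A :: "'a set" and \<rho> :: "nat \<Rightarrow> 'a set"
  assumes r: "0 < r" and finV: "finite Vs" and S: "pm r Vs S" and A: "A \<in> S"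
    and \<rho>: "\<And>d. d \<in> {1..<r} \<Longrightarrow> \<rho> d \<in> S - {A}" "inj_on \<rho> {1..<r}"
begin

lemma row_in: "d < r \<Longrightarrow> srow A \<rho> d \<in> S"
  using A \<rho>(1) by (auto simp: srow_def)

lemma row_inj: "d < r \<Longrightarrow> d' < r \<Longrightarrow> srow A \<rho> d = srow A \<rho> d' \<Longrightarrow> d = d'"
proof -
  assume *: "d < r" "d' < r" "srow A \<rho> d = srow A \<rho> d'"
  have ne: "\<rho> k \<noteq> A" if "k < r" "k \<noteq> 0" for k using \<rho>(1)[of k] that by auto
  show "d = d'"
    using * ne[of d] ne[of d'] inj_onD[OF \<rho>(2), of d d'] by (auto simp: srow_def split: if_splits)
qed

lemma row_props: 
  assumes "d < r" shows "finite (srow A \<rho> d)" "card (srow A \<rho> d) = r" "srow A \<rho> d \<subseteq> Vs"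
  using row_in[OF assms] S finV pm_ksets[OF S] by (auto simp: ksets_def dest: finite_subset)

lemma enum_row: "d < r \<Longrightarrow> bij_betw (enum (srow A \<rho> d)) {..<r} (srow A \<rho> d)"
  using enum_bij[of "srow A \<rho> d"] row_props by simp

lemma enum_row_in: "d < r \<Longrightarrow> t < r \<Longrightarrow> enum (srow A \<rho> d) t \<in> srow A \<rho> d"
  using enum_row bij_betwE by blast

lemma enum_row_inj:
  assumes "d < r" "d' < r" "t < r" "t' < r" "enum (srow A \<rho> d) t = enum (srow A \<rho> d') t'"
  shows "d = d' \<and> t = t'"
proof -
  have "srow A \<rho> d \<inter> srow A \<rho> d' \<noteq> {}" using assms enum_row_in by (metis disjoint_iff)
  then have "srow A \<rho> d = srow A \<rho> d'" using pm_disjoint[OF S] row_in assms by blast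
  then have "d = d'" using row_inj assms by blast
  then show ?thesis using assms bij_betw_imp_inj_on[OF enum_row] by (metis inj_on_eq_iff lessThan_iff)
qed

lemma card_column: "t < r \<Longrightarrow> card (scol r A \<rho> t) = r"
  unfolding scol_def by (subst card_image) (auto simp: inj_on_def dest: enum_row_inj)

lemma union_columns: "\<Union>(scol r A \<rho> ` {..<r}) = \<Union>(srow A \<rho> ` {..<r})"
proof -
  have "srow A \<rho> d = enum (srow A \<rho> d) ` {..<r}" if "d < r" for d
    using enum_row[OF that] by (simp add: bij_betw_def)
  then have "\<Union>(srow A \<rho> ` {..<r}) = (\<Union>d<r. enum (srow A \<rho> d) ` {..<r})" by auto
  also have "\<dots> = \<Union>(scol r A \<rho> ` {..<r})" by (auto simp: scol_def)
  finally show ?thesis by simp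
qed

lemma columns_disjoint: "t < r \<Longrightarrow> t' < r \<Longrightarrow> t \<noteq> t' \<Longrightarrow> scol r A \<rho> t \<inter> scol r A \<rho> t' = {}"
  by (auto simp: scol_def dest: enum_row_inj)

lemma column_meets: "t < r \<Longrightarrow> enum A t \<in> scol r A \<rho> t" "t < r \<Longrightarrow> enum A t \<in> A"
  using r enum_row_in[of 0 t] by (auto simp: scol_def srow_def intro!: image_eqI[of _ _ 0])

lemma rest_disjoint:
  assumes "B \<in> S - srow A \<rho> ` {..<r}" "t < r" shows "B \<inter> scol r A \<rho> t = {}"
proof -
  have "B \<inter> srow A \<rho> d = {}" if "d < r" for d
    by (rule pm_disjoint[OF S _ row_in[OF that]]) (use assms that in auto)
  then show ?thesis using enum_row_in[OF _ assms(2)] by (fastforce simp: scol_def)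
qed

lemma transpose_pm: "pm r Vs (swap_rows r A \<rho> S)"
proof -
  have Un: "\<Union>S = Vs" using S by (auto simp: pm_def partition_on_def)
  have "\<Union>(swap_rows r A \<rho> S) = \<Union>(S - srow A \<rho> ` {..<r}) \<union> \<Union>(srow A \<rho> ` {..<r})"
    unfolding swap_rows_def by (simp add: union_columns)
  also have "\<dots> = Vs" using Un row_in by blast
  finally have "\<Union>(swap_rows r A \<rho> S) = Vs" .
  moreover have "disjoint (swap_rows r A \<rho> S)"
    unfolding disjoint_def
  proof (intro ballI impI)
    fix B B' assume "B \<in> swap_rows r A \<rho> S" "B' \<in> swap_rows r A \<rho> S" "B \<noteq> B'"
    then show "B \<inter> B' = {}"
      unfolding swap_rows_def using pm_disjoint[OF S] rest_disjoint columns_disjoint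
      by (auto simp: Int_commute) blast+
  qed
  moreover have "card B = r" if "B \<in> swap_rows r A \<rho> S" for B
    using that S card_column by (auto simp: swap_rows_def pm_def)
  ultimately show ?thesis
    unfolding pm_def partition_on_def using r by force
qed

lemma meets_iff: "B \<in> swap_rows r A \<rho> S \<Longrightarrow> B \<inter> A \<noteq> {} \<longleftrightarrow> B \<in> scol r A \<rho> ` {..<r}"
proof
  assume B: "B \<in> swap_rows r A \<rho> S" and "B \<inter> A \<noteq> {}"
  moreover have "A \<in> srow A \<rho> ` {..<r}" using r by (auto simp: srow_def intro!: image_eqI[of _ _ 0])
  ultimately show "B \<in> scol r A \<rho> ` {..<r}"
    using pm_disjoint[OF S _ A] by (auto simp: swap_rows_def)
next
  assume "B \<in> scol r A \<rho> ` {..<r}"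
  then show "B \<inter> A \<noteq> {}" using column_meets by auto
qed

lemma columns_eq: "{B \<in> swap_rows r A \<rho> S. B \<inter> A \<noteq> {}} = scol r A \<rho> ` {..<r}"
proof -
  have "scol r A \<rho> ` {..<r} \<subseteq> swap_rows r A \<rho> S" by (auto simp: swap_rows_def)
  then show ?thesis using meets_iff by auto
qed

text \<open>The new blocks that meet \<open>A\<close> are exactly the columns, so the old matching can be read
  off from the new one together with \<open>A\<close> and \<open>\<rho>\<close>. This is why
  switchings are injective.\<close>

lemma transpose_recover:
  "S = (swap_rows r A \<rho> S - {B \<in> swap_rows r A \<rho> S. B \<inter> A \<noteq> {}}) \<union> srow A \<rho> ` {..<r}"
proof -
  have "(S - srow A \<rho> ` {..<r}) \<inter> scol r A \<rho> ` {..<r} = {}"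
  proof -
    have False if "B \<in> S - srow A \<rho> ` {..<r}" "t < r" "B = scol r A \<rho> t" for B t
      using rest_disjoint[OF that(1,2)] column_meets[OF that(2)] that(3) by auto
    then show ?thesis by auto
  qed
  then show ?thesis unfolding columns_eq using row_in by (auto simp: swap_rows_def)
qed

lemma rows_sub: "d < r \<Longrightarrow> srow A \<rho> d \<subseteq> \<Union>{B \<in> swap_rows r A \<rho> S. B \<inter> A \<noteq> {}}"
  unfolding columns_eq union_columns by auto

end

lemma exists_pm:
  assumes "finite Vs" "card Vs = r * N" "0 < r"
  shows "\<exists>S. pm r Vs S"
  using assms
proof (induction N arbitrary: Vs)
  case 0
  then show ?case by (auto simp: pm_def partition_on_def disjoint_def intro!: exI[of _ "{}"])
next
  case (Suc N)
  obtain A where A: "A \<subseteq> Vs" "card A = r" using obtain_subset_with_card_n[of r Vs] Suc.prems by auto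
  have "card (Vs - A) = r * N"
    using A Suc.prems by (subst card_Diff_subset) (auto dest: finite_subset)
  then obtain S where S: "pm r (Vs - A) S" using Suc by (metis finite_Diff)
  have "pm r Vs (insert A S)"
  proof -
    have "disjnt A (\<Union>S)" using S by (auto simp: pm_def disjnt_iff dest!: partition_onD1)
    moreover have "A \<noteq> {}" using A Suc.prems(3) by auto
    ultimately show ?thesis using S A by (simp add: pm_def partition_on_insert)
  qed
  then show ?case by blast
qed

text \<open>Drawing the rows from disjoint parts of a set of blocks makes every choice of rows injective, so
  that the choices can be counted as a product.\<close>

lemma disjoint_blocks:
  assumes "finite T"
  shows "\<exists>D :: nat \<Rightarrow> 'a set. (\<forall>d\<in>{1..<r}. D d \<subseteq> T \<and> card (D d) = card T div r) \<and> disjoint_family_on D {1..<r}"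
proof -
  let ?M = "card T div r"
  obtain f where f: "bij_betw f {..<card T} T" using enum_bij[OF assms] by blast
  define D where "D = (\<lambda>d. f ` {(d - 1) * ?M..<d * ?M})"
  have sub: "{(d - 1) * ?M..<d * ?M} \<subseteq> {..<card T}" if "d \<in> {1..<r}" for d
  proof -
    have "d * ?M \<le> r * ?M" using that by (intro mult_right_mono) auto
    also have "\<dots> \<le> card T" by simp
    finally show ?thesis by auto
  qed
  have inj: "inj_on f {..<card T}" using f by (simp add: bij_betw_def)
  have "D d \<subseteq> T \<and> card (D d) = ?M" if d: "d \<in> {1..<r}" for d
  proof
    show "D d \<subseteq> T" using f sub[OF d] by (auto simp: D_def bij_betw_def)
    have "card (D d) = card {(d - 1) * ?M..<d * ?M}"
      unfolding D_def by (intro card_image inj_on_subset[OF inj] sub d)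
    also have "\<dots> = ?M" using d by (simp add: diff_mult_distrib)
    finally show "card (D d) = ?M" .
  qed
  moreover have "disjoint_family_on D {1..<r}"
  unfolding disjoint_family_on_def
  proof (intro ballI impI)
    have dis: "{(d - 1) * ?M..<d * ?M} \<inter> {(d' - 1) * ?M..<d' * ?M} = {}" if "d < d'" for d d'
    proof -
      have "d * ?M \<le> (d' - 1) * ?M" using that by (intro mult_right_mono) auto
      then show ?thesis by auto
    qed
    fix d d' assume d: "d \<in> {1..<r}" "d' \<in> {1..<r}" "d \<noteq> d'"
    have "D d \<inter> D d' = f ` ({(d - 1) * ?M..<d * ?M} \<inter> {(d' - 1) * ?M..<d' * ?M})"
      unfolding D_def using inj_on_image_Int[OF inj sub[OF d(1)] sub[OF d(2)]] by simp
    also have "\<dots> = {}" using dis[of d d'] dis[of d' d] d(3) by (cases "d < d'") auto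
    finally show "D d \<inter> D d' = {}" .
  qed
  ultimately show ?thesis by blast
qed

definition pms :: "nat \<Rightarrow> 'a set \<Rightarrow> 'a set set \<Rightarrow> 'a set set \<Rightarrow> 'a set set set" where
  "pms r Vs AA F = {S. pm r Vs S \<and> S \<subseteq> AA \<and> F \<subseteq> S}"

lemma finite_pms: 
  assumes "finite Vs" shows "finite (pms r Vs AA F)"
proof (rule finite_subset)
  show "pms r Vs AA F \<subseteq> Pow (Pow Vs)" using pm_ksets by (fastforce simp: pms_def ksets_def)
qed (use assms in simp)

context
  fixes r :: nat and Vs :: "'a set" and AA :: "'a set set" and \<beta> :: nat
  assumes r: "0 < r" and finV: "finite Vs"
    and bad: "\<And>v. v \<in> Vs \<Longrightarrow> card {A \<in> ksets Vs r. v \<in> A \<and> A \<notin> AA} \<le> \<beta>"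
begin

text \<open>Each column contains a known vertex of \<open>A\<close>, so at most \<open>\<beta>\<close> forbidden
  sets can arise as the column of index \<open>t\<close>, and each of them determines the rows up to
  \<open>r^r\<close> choices because every row meets it. All other choices of rows have allowed
  columns only.\<close>

lemma many_switches:
  assumes S: "pm r Vs S" and A: "A \<in> S" and T: "T \<subseteq> S - {A}"
    and large: "2 * r ^ (r + 1) * \<beta> \<le> (card T div r) ^ (r - 1)"
  shows "\<exists>P. P \<subseteq> {1..<r} \<rightarrow>\<^sub>E T \<and> (\<forall>\<rho>\<in>P. inj_on \<rho> {1..<r} \<and> (\<forall>t<r. scol r A \<rho> t \<in> AA)) \<and>
     (card T div r) ^ (r - 1) \<le> 2 * card P"
proof -
  have finS: "finite S" using finite_pm[OF S finV] .
  have finT: "finite T" using T finS finite_subset by blast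
  obtain D :: "nat \<Rightarrow> 'a set set" where D: "\<forall>d\<in>{1..<r}. D d \<subseteq> T \<and> card (D d) = card T div r" 
      "disjoint_family_on D {1..<r}"
    using disjoint_blocks[OF finT, of r] by blast
  define X where "X = PiE {1..<r} D"
  have cX: "card X = (card T div r) ^ (r - 1)"
    unfolding X_def by (subst card_PiE) (use D in auto)
  have XT: "X \<subseteq> {1..<r} \<rightarrow>\<^sub>E T" unfolding X_def using D(1) by (intro PiE_mono) auto
  have finX: "finite X" by (rule finite_subset[OF XT]) (use finT in \<open>auto intro!: finite_PiE\<close>)
  have Xinj: "inj_on \<rho> {1..<r}" if "\<rho> \<in> X" for \<rho>
  proof (rule inj_onI)
    fix d d' assume d: "d \<in> {1..<r}" "d' \<in> {1..<r}" "\<rho> d = \<rho> d'"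
    then have "\<rho> d \<in> D d \<inter> D d'" using PiE_mem[OF that[unfolded X_def]] by (metis IntI)
    then show "d = d'" using D(2) d(1,2) unfolding disjoint_family_on_def by blast
  qed
  have \<rho>: "\<rho> d \<in> S - {A}" if "\<rho> \<in> X" "d \<in> {1..<r}" for \<rho> d
    using PiE_mem[OF subsetD[OF XT that(1)] that(2)] T by blast
  define B where "B = (\<lambda>t. {\<rho> \<in> X. scol r A \<rho> t \<notin> AA})"
  have cB: "card (B t) \<le> \<beta> * r ^ r" if t: "t < r" for t
  proof -
    let ?bad = "{C \<in> ksets Vs r. enum A t \<in> C \<and> C \<notin> AA}"
    let ?fib = "\<lambda>C. {1..<r} \<rightarrow>\<^sub>E {R \<in> S. R \<inter> C \<noteq> {}}"
    have AV: "A \<subseteq> Vs" "finite A" "card A = r"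
      using pm_ksets[OF S] A finV by (auto simp: ksets_def dest: finite_subset)
    have vin: "enum A t \<in> Vs"
      using enum_bij[OF AV(2)] AV t bij_betwE by (metis lessThan_iff subsetD)
    have "B t \<subseteq> (\<Union>C\<in>?bad. ?fib C)"
    proof
      fix \<rho> assume "\<rho> \<in> B t"
      then have X: "\<rho> \<in> X" and nA: "scol r A \<rho> t \<notin> AA" by (auto simp: B_def)
      note prem = r finV S A \<rho>[OF X] Xinj[OF X]
      have "scol r A \<rho> t \<subseteq> Vs"
        unfolding scol_def
      proof (intro image_subsetI)
        fix d assume "d \<in> {..<r}"
        then show "enum (srow A \<rho> d) t \<in> Vs"
          using enum_row_in[OF prem, of d t] row_props(3)[OF prem, of d] t by auto
      qed
      then have "scol r A \<rho> t \<in> ?bad"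
        using card_column[OF prem t] column_meets[OF prem t] nA by (auto simp: ksets_def)
      moreover have "\<rho> \<in> ?fib (scol r A \<rho> t)"
      proof -
        have "\<rho> d \<inter> scol r A \<rho> t \<noteq> {}" if "d \<in> {1..<r}" for d
        proof -
          have "enum (srow A \<rho> d) t \<in> srow A \<rho> d" using enum_row_in[OF prem, of d t] that t by simp
          moreover have "enum (srow A \<rho> d) t \<in> scol r A \<rho> t" using that by (auto simp: scol_def)
          moreover have "srow A \<rho> d = \<rho> d" using that by (simp add: srow_def)
          ultimately show ?thesis by auto
        qed
        then show ?thesis using X XT T by (auto simp: PiE_iff)
      qed
      ultimately show "\<rho> \<in> (\<Union>C\<in>?bad. ?fib C)" by blast
    qed
    moreover have fib: "card (?fib C) \<le> r ^ r \<and> finite (?fib C)" if C: "C \<in> ?bad" for C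
    proof -
      have Cf: "finite C" "card C = r" "C \<subseteq> Vs" using C finV by (auto simp: ksets_def dest: finite_subset)
      have "card {R \<in> S. R \<inter> C \<noteq> {}} \<le> card C"
      proof -
        define blk where "blk = (\<lambda>v. SOME R. R \<in> S \<and> v \<in> R)"
        have "{R \<in> S. R \<inter> C \<noteq> {}} \<subseteq> blk ` C"
        proof
          fix R assume R: "R \<in> {R \<in> S. R \<inter> C \<noteq> {}}"
          then obtain v where v: "v \<in> R" "v \<in> C" by auto
          have "blk v \<in> S \<and> v \<in> blk v" unfolding blk_def by (rule someI[of _ R]) (use R v in auto)
          then have "blk v = R" using pm_disjoint[OF S] R v by blast
          then show "R \<in> blk ` C" using v by auto
        qed
        then show ?thesis using Cf by (meson card_image_le card_mono finite_imageI le_trans)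
      qed
      then have "card (?fib C) \<le> r ^ (r - 1)"
        using Cf by (simp add: card_PiE power_mono)
      also have "\<dots> \<le> r ^ r" using r by (intro power_increasing) auto
      finally show ?thesis using finS by (auto intro!: finite_PiE)
    qed
    ultimately have "card (B t) \<le> card (\<Union>C\<in>?bad. ?fib C)"
      using finV by (intro card_mono) auto
    also have "\<dots> \<le> (\<Sum>C\<in>?bad. card (?fib C))"
      using finV by (intro card_UN_le) auto
    also have "\<dots> \<le> (\<Sum>C\<in>?bad. r ^ r)" using fib by (intro sum_mono) auto
    also have "\<dots> \<le> \<beta> * r ^ r" using bad[OF vin] by simp
    finally show ?thesis .
  qed
  define P where "P = X - (\<Union>t<r. B t)"
  have "card (\<Union>t<r. B t) \<le> (\<Sum>t<r. card (B t))" by (intro card_UN_le) auto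
  also have "\<dots> \<le> (\<Sum>t<r. \<beta> * r ^ r)" using cB by (intro sum_mono) auto
  also have "\<dots> = r ^ (r + 1) * \<beta>" by simp
  finally have "2 * card (\<Union>t<r. B t) \<le> (card T div r) ^ (r - 1)" using large by simp
  moreover have "card X - card (\<Union>t<r. B t) \<le> card P"
    unfolding P_def using finX by (intro diff_card_le_card_Diff) (auto simp: B_def)
  ultimately have "(card T div r) ^ (r - 1) \<le> 2 * card P" using cX by simp
  moreover have "\<forall>\<rho>\<in>P. inj_on \<rho> {1..<r} \<and> (\<forall>t<r. scol r A \<rho> t \<in> AA)"
    using Xinj by (auto simp: P_def B_def)
  moreover have "P \<subseteq> {1..<r} \<rightarrow>\<^sub>E T" using XT by (auto simp: P_def)
  ultimately show ?thesis by blast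
qed

text \<open>In a perfect matching with the fewest forbidden blocks, a forbidden block could be switched away.\<close>

lemma pms_nonempty:
  assumes N: "card Vs = r * N" and "2 * r ^ (r + 1) * \<beta> < ((N - 1) div r) ^ (r - 1)"
  shows "pms r Vs AA {} \<noteq> {}"
proof -
  obtain S0 where S0: "pm r Vs S0" using exists_pm[OF finV N r] by blast
  obtain S where S: "pm r Vs S" and least: "\<And>S'. pm r Vs S' \<Longrightarrow> card (S - AA) \<le> card (S' - AA)"
    using ex_has_least_nat[of "pm r Vs" S0 "\<lambda>S. card (S - AA)"] S0 by blast
  have "S \<subseteq> AA"
  proof (rule ccontr)
    assume "\<not> S \<subseteq> AA"
    then obtain A where A: "A \<in> S" "A \<notin> AA" by auto
    have finS: "finite S" using finite_pm[OF S finV] .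
    have cS: "card S = N" using pm_card[OF S finV] N r by simp
    have cT: "card (S - {A}) = N - 1" using A cS finS by simp
    obtain P where P: "P \<subseteq> {1..<r} \<rightarrow>\<^sub>E S - {A}" "\<forall>\<rho>\<in>P. inj_on \<rho> {1..<r} \<and> (\<forall>t<r. scol r A \<rho> t \<in> AA)"
        "(card (S - {A}) div r) ^ (r - 1) \<le> 2 * card P"
      using many_switches[OF S A(1), of "S - {A}"] assms cT by auto
    have "0 < card P" using P(3) assms(2) unfolding cT by linarith
    then have "P \<noteq> {}" by auto
    then obtain \<rho> where \<rho>: "\<rho> \<in> P" by auto
    have \<rho>S: "\<rho> d \<in> S - {A}" if "d \<in> {1..<r}" for d using subsetD[OF P(1) \<rho>] that by (rule PiE_mem)
    have inj: "inj_on \<rho> {1..<r}" using P(2) \<rho> by auto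
    have "pm r Vs (swap_rows r A \<rho> S)" by (rule transpose_pm[OF r finV S A(1) \<rho>S inj])
    moreover have "swap_rows r A \<rho> S - AA \<subset> S - AA"
    proof -
      have "A \<in> srow A \<rho> ` {..<r}" using r by (auto simp: srow_def intro!: image_eqI[of _ _ 0])
      moreover have "scol r A \<rho> ` {..<r} \<subseteq> AA" using P(2) \<rho> by blast
      ultimately show ?thesis using A unfolding swap_rows_def by blast
    qed
    then have "card (swap_rows r A \<rho> S - AA) < card (S - AA)"
      using finS by (intro psubset_card_mono) auto
    ultimately show False using least[of "swap_rows r A \<rho> S"] by simp
  qed
  then show ?thesis using S by (auto simp: pms_def)
qed

text \<open>Double counting of pairs of a matching through \<open>A\<close> and an allowed switching of
  \<open>A\<close> that avoids \<open>F\<close>. The switched matching still contains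
  \<open>F\<close>, and the rows lie in the at most \<open>r^2\<close> vertices of its blocks that
  meet \<open>A\<close>, so each target is hit at most \<open>2^(r^3)\<close> times.\<close>

lemma pms_ratio:
  assumes N: "card Vs = r * N" and AF: "A \<notin> F" and A: "finite A" "card A = r"
    and large: "2 * r ^ (r + 1) * \<beta> \<le> ((N - 1 - card F) div r) ^ (r - 1)"
  shows "card (pms r Vs AA (insert A F)) * ((N - 1 - card F) div r) ^ (r - 1) \<le> 2 ^ (r ^ 3 + 1) * card (pms r Vs AA F)"
proof -
  let ?M = "((N - 1 - card F) div r) ^ (r - 1)"
  let ?Q = "\<lambda>S P. P \<subseteq> {1..<r} \<rightarrow>\<^sub>E S - insert A F \<and> (\<forall>\<rho>\<in>P. inj_on \<rho> {1..<r} \<and> (\<forall>t<r. scol r A \<rho> t \<in> AA)) \<and> ?M \<le> 2 * card P"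
  have "\<exists>P. ?Q S P" if "S \<in> pms r Vs AA (insert A F)" for S
  proof -
    have S: "pm r Vs S" and AS: "A \<in> S" "F \<subseteq> S" using that by (auto simp: pms_def)
    have finS: "finite S" using finite_pm[OF S finV] .
    have cS: "card S = N" using pm_card[OF S finV] N r by simp
    have "card (S - insert A F) = N - 1 - card F"
      using AS AF cS finS finite_subset[OF AS(2) finS] by (subst card_Diff_subset) auto
    then show ?thesis using many_switches[OF S AS(1), of "S - insert A F"] large by auto
  qed
  then obtain P where P: "\<And>S. S \<in> pms r Vs AA (insert A F) \<Longrightarrow> ?Q S (P S)" by metis
  define dom where "dom = Sigma (pms r Vs AA (insert A F)) P"
  define Y where "Y = (\<lambda>S. \<Union>{B \<in> S. B \<inter> A \<noteq> {}})"
  define cod where "cod = Sigma (pms r Vs AA F) (\<lambda>S. {1..<r} \<rightarrow>\<^sub>E Pow (Y S))"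
  define \<Phi> where "\<Phi> = (\<lambda>(S, \<rho>). (swap_rows r A \<rho> S, \<rho>))"
  have dom: "pm r Vs S" "A \<in> S" "\<And>d. d \<in> {1..<r} \<Longrightarrow> \<rho> d \<in> S - insert A F" "inj_on \<rho> {1..<r}" 
      "\<forall>t<r. scol r A \<rho> t \<in> AA" "S \<subseteq> AA" "F \<subseteq> S" "\<rho> \<in> extensional {1..<r}" if "(S, \<rho>) \<in> dom" for S \<rho>
  proof -
    have S: "S \<in> pms r Vs AA (insert A F)" and "\<rho> \<in> P S" using that by (auto simp: dom_def)
    then have *: "\<rho> \<in> {1..<r} \<rightarrow>\<^sub>E S - insert A F" "inj_on \<rho> {1..<r}" "\<forall>t<r. scol r A \<rho> t \<in> AA"
      using P[OF S] by blast+
    show "pm r Vs S" "A \<in> S" "S \<subseteq> AA" "F \<subseteq> S" using S by (auto simp: pms_def)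
    show "\<rho> d \<in> S - insert A F" if "d \<in> {1..<r}" for d using *(1) that by (rule PiE_mem)
    show "\<rho> \<in> extensional {1..<r}" using *(1) by (simp add: PiE_def)
    show "inj_on \<rho> {1..<r}" "\<forall>t<r. scol r A \<rho> t \<in> AA" using * by auto
  qed
  have \<Phi>cod: "\<Phi> x \<in> cod" if "x \<in> dom" for x
  proof -
    obtain S \<rho> where x: "x = (S, \<rho>)" by force
    note d = dom[OF that[unfolded x]]
    have \<rho>: "\<rho> d \<in> S - {A}" if "d \<in> {1..<r}" for d using d(3)[OF that] by auto
    note prem = r finV d(1) d(2) \<rho> d(4)
    have "F \<subseteq> swap_rows r A \<rho> S"
      using d(3,7) AF by (fastforce simp: swap_rows_def srow_def)
    then have "swap_rows r A \<rho> S \<in> pms r Vs AA F"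
      using transpose_pm[OF prem] d(5,6) by (auto simp: pms_def swap_rows_def)
    moreover have "\<rho> \<in> {1..<r} \<rightarrow>\<^sub>E Pow (Y (swap_rows r A \<rho> S))"
    proof (rule PiE_I)
      fix k assume "k \<in> {1..<r}"
      then show "\<rho> k \<in> Pow (Y (swap_rows r A \<rho> S))"
        using rows_sub[OF prem, of k] by (auto simp: Y_def srow_def)
    qed (use d(8) in \<open>auto simp: extensional_def\<close>)
    ultimately show ?thesis by (simp add: x \<Phi>_def cod_def)
  qed
  have "inj_on \<Phi> dom"
  proof (rule inj_onI)
    fix x y assume x: "x \<in> dom" and y: "y \<in> dom" and eq: "\<Phi> x = \<Phi> y"
    obtain S \<rho> S' where xy: "x = (S, \<rho>)" "y = (S', \<rho>)" "swap_rows r A \<rho> S = swap_rows r A \<rho> S'"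
      using eq by (auto simp: \<Phi>_def split: prod.splits)
    note d = dom[OF x[unfolded xy]] and d' = dom[OF y[unfolded xy]]
    have \<rho>: "\<rho> d \<in> S - {A}" "\<rho> d \<in> S' - {A}" if "d \<in> {1..<r}" for d using d(3)[OF that] d'(3)[OF that] by auto
    have "S = (swap_rows r A \<rho> S - {B \<in> swap_rows r A \<rho> S. B \<inter> A \<noteq> {}}) \<union> srow A \<rho> ` {..<r}"
      by (rule transpose_recover[OF r finV d(1) d(2) \<rho>(1) d(4)])
    also have "\<dots> = S'" unfolding xy(3)
      by (rule transpose_recover[OF r finV d'(1) d'(2) \<rho>(2) d'(4), symmetric])
    finally have "S = S'" .
    then show "x = y" using xy by simp
  qed
  have cardY: "card (Y S) \<le> r * r \<and> finite (Y S)" if S: "S \<in> pms r Vs AA F" for S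
  proof -
    have pmS: "pm r Vs S" using S by (auto simp: pms_def)
    define blk where "blk = (\<lambda>v. SOME R. R \<in> S \<and> v \<in> R)"
    have "{R \<in> S. R \<inter> A \<noteq> {}} \<subseteq> blk ` A"
    proof
      fix R assume R: "R \<in> {R \<in> S. R \<inter> A \<noteq> {}}"
      then obtain v where v: "v \<in> R" "v \<in> A" by auto
      have "blk v \<in> S \<and> v \<in> blk v" unfolding blk_def by (rule someI[of _ R]) (use R v in auto)
      then have "blk v = R" using pm_disjoint[OF pmS] R v by blast
      then show "R \<in> blk ` A" using v by auto
    qed
    then have c: "card {R \<in> S. R \<inter> A \<noteq> {}} \<le> r"
      using A by (metis card_image_le card_mono finite_imageI le_trans)
    have "finite S" using finite_pm[OF pmS finV] .
    then have "card (Y S) \<le> (\<Sum>R\<in>{R \<in> S. R \<inter> A \<noteq> {}}. card R)"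
      unfolding Y_def using card_UN_le[of "{R \<in> S. R \<inter> A \<noteq> {}}" id] by simp
    also have "\<dots> = (\<Sum>R\<in>{R \<in> S. R \<inter> A \<noteq> {}}. r)"
      using pmS by (intro sum.cong) (auto simp: pm_def)
    also have "\<dots> \<le> r * r" using c by simp
    finally show ?thesis
      using pm_ksets[OF pmS] finV finite_subset[of "Y S" Vs] by (auto simp: Y_def ksets_def)
  qed
  have finP: "finite (P S)" if "S \<in> pms r Vs AA (insert A F)" for S
  proof -
    have "finite S" using that finite_pm finV by (auto simp: pms_def)
    then show ?thesis using P[OF that] by (meson finite_Diff finite_PiE finite_atLeastLessThan finite_subset)
  qed
  have "card (pms r Vs AA (insert A F)) * ?M \<le> (\<Sum>S\<in>pms r Vs AA (insert A F). 2 * card (P S))"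
    using P sum_mono[of "pms r Vs AA (insert A F)" "\<lambda>_. ?M" "\<lambda>S. 2 * card (P S)"] by simp
  also have "\<dots> = 2 * card dom"
    unfolding dom_def using finP finite_pms[OF finV] by (simp add: sum_distrib_left)
  also have "card dom \<le> card cod"
  proof (rule card_inj_on_le[OF \<open>inj_on \<Phi> dom\<close>])
    show "finite cod" unfolding cod_def using cardY finite_pms[OF finV] by (intro finite_SigmaI finite_PiE) auto
  qed (use \<Phi>cod in auto)
  also have "card cod = (\<Sum>S\<in>pms r Vs AA F. (2 ^ card (Y S)) ^ (r - 1))"
    unfolding cod_def using cardY finite_pms[OF finV]
    by (subst card_SigmaI) (auto simp: card_PiE card_Pow intro!: finite_PiE sum.cong)
  also have "\<dots> \<le> (\<Sum>S\<in>pms r Vs AA F. 2 ^ (r ^ 3))"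
  proof (intro sum_mono)
    fix S assume S: "S \<in> pms r Vs AA F"
    have "(2 ^ card (Y S)) ^ (r - 1) = (2::nat) ^ (card (Y S) * (r - 1))" by (simp add: power_mult)
    also have "\<dots> \<le> 2 ^ (r ^ 3)"
      using cardY[OF S] by (intro power_increasing) (auto simp: power3_eq_cube intro!: mult_mono)
    finally show "(2 ^ card (Y S)) ^ (r - 1) \<le> (2::nat) ^ (r ^ 3)" .
  qed
  finally show ?thesis by (simp add: mult_ac)
qed

end

section \<open>Allowed perfect matchings are spread\<close>

lemma falling_product_ge:
  assumes "b \<le> N"
  shows "(real N / 3) ^ b \<le> (\<Prod>j<b. real (N - j))"
  using assms
proof (induction b arbitrary: N)
  case (Suc b)
  then obtain k where k: "N = Suc k" "b \<le> k" by (cases N) auto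
  have "(real N / 3) ^ Suc b \<le> real N * (real k / 3) ^ b"
  proof (cases "k = 0")
    case False
    have "(real N / real k) ^ b \<le> exp 1"
    proof -
      have "(real N / real k) ^ b = (1 + 1 / real k) ^ b" using False k by (simp add: field_simps)
      also have "\<dots> \<le> (1 + 1 / real k) ^ k" using k by (intro power_increasing) auto
      also have "\<dots> \<le> exp (1 / real k) ^ k" by (intro power_mono) auto
      also have "\<dots> = exp 1" using False by (simp flip: exp_of_nat_mult)
      finally show ?thesis .
    qed
    also have "exp 1 \<le> (3::real)" by (rule exp_le)
    finally have "real N ^ b \<le> 3 * real k ^ b" using False by (simp add: power_divide field_simps)
    then have "real N * real N ^ b \<le> real N * (3 * real k ^ b)" by (intro mult_left_mono) auto
    then show ?thesis by (simp add: power_divide field_simps)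
  qed (use k in auto)
  also have "\<dots> \<le> real N * (\<Prod>j<b. real (k - j))"
    using Suc.IH[OF k(2)] by (intro mult_left_mono) auto
  also have "\<dots> = (\<Prod>j<Suc b. real (N - j))"
    by (subst prod.lessThan_Suc_shift) (simp add: k)
  finally show ?case .
qed simp

definition spread_const :: "nat \<Rightarrow> real" where
  "spread_const r = 2 * (2 ^ (r ^ 3 + 1) * (4 * real r) ^ (r - 1)) * 3 ^ (r - 1)"

text \<open>The ratio bound is applied once for every element of \<open>F\<close>. It breaks down for the last
  \<open>M0\<close> blocks, where too few blocks remain for switching; they are estimated trivially,
  and \<open>few\<close> says that the loss is absorbed by a factor 2 for each of the other blocks.\<close>

lemma pms_spread:
  fixes \<beta> N M0 :: nat and Vs :: "'a set"
  assumes r: "0 < r" and finV: "finite Vs"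
    and bad: "\<And>v. v \<in> Vs \<Longrightarrow> card {A \<in> ksets Vs r. v \<in> A \<and> A \<notin> AA} \<le> \<beta>"
    and N: "card Vs = r * N" and M0: "r \<le> M0" "M0 < N"
    and large: "2 * r ^ (r + 1) * \<beta> \<le> (M0 div r) ^ (r - 1)"
    and few: "N ^ ((r - 1) * M0) \<le> 2 ^ (N - M0)"
  shows "real (card (pms r Vs AA F)) \<le> (spread_const r / real N ^ (r - 1)) ^ card F * real (card (pms r Vs AA {}))"
proof (cases "finite F")
  case False
  have "\<not> F \<subseteq> S" if "pm r Vs S" for S using finite_pm[OF that finV] finite_subset[of F S] False by blast
  then have "pms r Vs AA F = {}" unfolding pms_def by blast
  then show ?thesis using False by simp
next
  case finF: True
  note ratio = pms_ratio[OF r finV bad N]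
  define c where "c = 2 ^ (r ^ 3 + 1) * (4 * real r) ^ (r - 1)"
  have c1: "1 \<le> c" 
  proof -
    have "1 \<le> (4 * real r) ^ (r - 1)" using r by (intro one_le_power) auto
    moreover have "(1::real) \<le> 2 ^ (r ^ 3 + 1)" by (rule one_le_power) simp
    ultimately have "1 * 1 \<le> 2 ^ (r ^ 3 + 1) * (4 * real r) ^ (r - 1)" by (intro mult_mono) auto
    then show ?thesis by (simp add: c_def)
  qed
  let ?p = "\<lambda>b. \<Prod>j<min b (N - M0). c / real (N - j) ^ (r - 1)"
  have p0: "0 \<le> ?p b" for b using c1 by (intro prod_nonneg) auto
  have step: "real (card (pms r Vs AA F)) \<le> ?p (card F) * real (card (pms r Vs AA {}))"
    using finF
  proof (induction F)
    case (insert A F)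
    show ?case
    proof (cases "finite A \<and> card A = r")
      case False
      then have "pms r Vs AA (insert A F) = {}"
        using pm_ksets finV by (fastforce simp: pms_def ksets_def dest: finite_subset)
      then have "card (pms r Vs AA (insert A F)) = 0" by simp
      then show ?thesis using p0[of "card (insert A F)"] by simp
    next
      case A: True
      show ?thesis
      proof (cases "card F < N - M0")
        case True
        let ?M = "N - 1 - card F"
        have MM: "M0 \<le> ?M" using True by simp
        then have "M0 div r \<le> ?M div r" by (rule div_le_mono)
        then have "(M0 div r) ^ (r - 1) \<le> (?M div r) ^ (r - 1)" by (rule power_mono) simp
        then have "card (pms r Vs AA (insert A F)) * (?M div r) ^ (r - 1) \<le> 2 ^ (r ^ 3 + 1) * card (pms r Vs AA F)"
          using A insert.hyps large by (intro ratio) auto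
        then have *: "real (card (pms r Vs AA (insert A F))) * real (?M div r) ^ (r - 1)
             \<le> 2 ^ (r ^ 3 + 1) * real (card (pms r Vs AA F))"
          by (metis of_nat_le_iff of_nat_mult of_nat_power of_nat_numeral)
        have "real (N - card F) \<le> 4 * real r * real (?M div r)"
        proof -
          have "?M = r * (?M div r) + ?M mod r" by simp
          moreover have "?M mod r < r" using r by simp
          moreover have "r \<le> r * (?M div r)" 
            using M0 MM r by (metis div_greater_zero_iff le_trans mult_le_mono2 mult_1_right Suc_leI One_nat_def)
          ultimately have "N - card F \<le> 4 * (r * (?M div r))" using True by linarith
          then show ?thesis by (metis (no_types, opaque_lifting) mult.assoc of_nat_le_iff of_nat_mult of_nat_numeral)
        qed
        then have "real (N - card F) ^ (r - 1) \<le> (4 * real r) ^ (r - 1) * real (?M div r) ^ (r - 1)"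
          unfolding power_mult_distrib[symmetric] by (rule power_mono) simp
        then have "real (card (pms r Vs AA (insert A F))) * real (N - card F) ^ (r - 1)
             \<le> real (card (pms r Vs AA (insert A F))) * ((4 * real r) ^ (r - 1) * real (?M div r) ^ (r - 1))"
          by (rule mult_left_mono) simp
        also have "\<dots> = (4 * real r) ^ (r - 1) * (real (card (pms r Vs AA (insert A F))) * real (?M div r) ^ (r - 1))"
          by (simp add: mult_ac)
        also have "\<dots> \<le> (4 * real r) ^ (r - 1) * (2 ^ (r ^ 3 + 1) * real (card (pms r Vs AA F)))"
          by (rule mult_left_mono[OF *]) simp
        also have "\<dots> = c * real (card (pms r Vs AA F))" by (simp add: c_def mult_ac)
        also have "\<dots> \<le> c * (?p (card F) * real (card (pms r Vs AA {})))"
          using insert.IH c1 by (intro mult_left_mono) auto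
        finally have "real (card (pms r Vs AA (insert A F)))
             \<le> c * (?p (card F) * real (card (pms r Vs AA {}))) / real (N - card F) ^ (r - 1)"
          using True by (simp add: field_simps)
        also have "\<dots> = ?p (card (insert A F)) * real (card (pms r Vs AA {}))"
        proof -
          have "min (card (insert A F)) (N - M0) = Suc (card F)" "min (card F) (N - M0) = card F"
            using True insert.hyps by auto
          then show ?thesis by simp
        qed
        finally show ?thesis .
      next
        case False
        have "card (pms r Vs AA (insert A F)) \<le> card (pms r Vs AA F)"
          using finite_pms[OF finV] by (intro card_mono) (auto simp: pms_def)
        moreover have "min (card (insert A F)) (N - M0) = min (card F) (N - M0)"
          using False insert.hyps by auto
        ultimately show ?thesis using insert.IH by simp
      qed
    qed
  qed simp
  show ?thesis
  proof (cases "card F \<le> N")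
    case False
    have "pms r Vs AA F = {}"
    proof (rule ccontr)
      assume "pms r Vs AA F \<noteq> {}"
      then obtain S where S: "pm r Vs S" "F \<subseteq> S" by (auto simp: pms_def)
      then have "card F \<le> card S" using finite_pm[OF S(1) finV] by (intro card_mono) auto
      then show False using pm_card[OF S(1) finV] N r False by simp
    qed
    then show ?thesis by (auto simp: spread_const_def)
  next
    case True
    define b where "b = card F"
    define b' where "b' = min b (N - M0)"
    have b'N: "b' \<le> N" using True by (auto simp: b'_def b_def)
    have N0: "0 < real N" using M0 by simp
    define x where "x = c * 3 ^ (r - 1) / real N ^ (r - 1)"
    have "?p b = c ^ b' / (\<Prod>j<b'. real (N - j)) ^ (r - 1)"
      by (simp add: b'_def prod_dividef prod_power_distrib)
    also have "\<dots> \<le> c ^ b' / ((real N / 3) ^ b') ^ (r - 1)"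
      using N0 c1 falling_product_ge[OF b'N] 
      by (intro divide_left_mono power_mono mult_pos_pos zero_less_power prod_pos) (auto simp: b'_def)
    also have "\<dots> = x ^ b'"
      by (simp add: x_def power_divide power_mult_distrib power_mult[symmetric] mult.commute)
    also have "\<dots> \<le> (2 * x) ^ b"
    proof (cases "b \<le> N - M0")
      case True
      have "0 \<le> x" using c1 by (simp add: x_def)
      then have "x ^ b \<le> (2 * x) ^ b" by (intro power_mono) auto
      then show ?thesis using True by (simp add: b'_def)
    next
      case False
      then have b': "b' = N - M0" and bb': "b - b' \<le> M0" using \<open>card F \<le> N\<close> by (auto simp: b'_def b_def)
      have x0: "0 < x" using c1 N0 by (auto simp: x_def)
      have "(1 / x) ^ (b - b') \<le> (real N ^ (r - 1)) ^ (b - b')"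
      proof (rule power_mono)
        have "1 \<le> c * 3 ^ (r - 1)" using mult_mono[of 1 c 1 "3 ^ (r - 1)"] c1 by simp
        then show "1 / x \<le> real N ^ (r - 1)" using N0 by (simp add: x_def field_simps mult_le_cancel_left1)
      qed (use x0 in auto)
      also have "\<dots> = real N ^ ((r - 1) * (b - b'))" by (simp add: power_mult)
      also have "\<dots> \<le> real N ^ ((r - 1) * M0)" using bb' N0 by (intro power_increasing mult_left_mono) auto
      also have "\<dots> \<le> 2 ^ (N - M0)" using few by (metis of_nat_le_iff of_nat_numeral of_nat_power)
      also have "\<dots> \<le> 2 ^ b" using False by (intro power_increasing) auto
      finally have "x ^ b * (1 / x) ^ (b - b') \<le> x ^ b * 2 ^ b" using x0 by (intro mult_left_mono) auto
      moreover have "x ^ b * (1 / x) ^ (b - b') = x ^ b'"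
      proof -
        have "x ^ b = x ^ b' * x ^ (b - b')" using False b' by (simp flip: power_add)
        then show ?thesis using x0 by (simp add: power_divide)
      qed
      ultimately show ?thesis by (simp add: power_mult_distrib mult.commute)
    qed
    also have "2 * x = spread_const r / real N ^ (r - 1)" by (simp add: x_def spread_const_def c_def)
    finally have "?p b \<le> (spread_const r / real N ^ (r - 1)) ^ b" .
    then show ?thesis using step unfolding b_def by (meson mult_right_mono of_nat_0_le_iff order_trans)
  qed
qed

section \<open>Moments of counts of planted structures\<close>

text \<open>Expand the power into a sum over sequences of structures and add them one after the other: given
  that the union of at most \<open>k\<close> of them is present, the expected number of structures is
  at most \<open>M\<close>.\<close>

lemma subset_count_moment:
  fixes c :: "'t \<Rightarrow> 'e set" and M p :: real
  assumes E: "finite E" "0 \<le> p" "p \<le> 1" and T: "finite T" "\<And>t. t \<in> T \<Longrightarrow> c t \<subseteq> E"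
    and M: "\<And>J. J \<subseteq> T \<Longrightarrow> card J \<le> k \<Longrightarrow> (\<Sum>t\<in>T. p ^ card (c t - \<Union>(c ` J))) \<le> M"
  shows "expct (rsub E p) (\<lambda>g. real (card {t \<in> T. c t \<subseteq> g}) ^ k) \<le> M ^ k"
proof -
  let ?Y = "\<lambda>g. real (card {t \<in> T. c t \<subseteq> g})"
  have "0 \<le> (\<Sum>t\<in>T. p ^ card (c t - \<Union>(c ` {})))" using E by (intro sum_nonneg) auto
  then have M0: "0 \<le> M" using M[of "{}"] by simp
  have "expct (rsub E p) (\<lambda>g. of_bool (\<Union>(c ` J) \<subseteq> g) * ?Y g ^ j) \<le> p ^ card (\<Union>(c ` J)) * M ^ j"
    if "j + card J \<le> k" "J \<subseteq> T" for j J
    using that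
  proof (induction j arbitrary: J)
    case 0
    have "\<Union>(c ` J) \<subseteq> E" using 0(2) T(2) by auto
    then show ?case
      by (simp only: power_0 mult_1_right rsub_contains[OF E(1) _ E(2,3)] order_refl)
  next
    case (Suc j)
    let ?U = "\<Union>(c ` J)"
    have UE: "?U \<subseteq> E" using Suc.prems(2) T(2) by auto
    have finU: "finite ?U" by (rule finite_subset[OF UE E(1)])
    have "?Y g = (\<Sum>t\<in>T. of_bool (c t \<subseteq> g))" for g
      using T by (simp add: sum_of_bool_eq Int_def)
    then have "expct (rsub E p) (\<lambda>g. of_bool (?U \<subseteq> g) * ?Y g ^ Suc j)
       = expct (rsub E p) (\<lambda>g. \<Sum>t\<in>T. of_bool (\<Union>(c ` insert t J) \<subseteq> g) * ?Y g ^ j)"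
      by (intro expct_cong) (auto simp: sum_distrib_left sum_distrib_right intro!: sum.cong)
    also have "\<dots> = (\<Sum>t\<in>T. expct (rsub E p) (\<lambda>g. of_bool (\<Union>(c ` insert t J) \<subseteq> g) * ?Y g ^ j))"
      using E by (simp add: expct_sum)
    also have "\<dots> \<le> (\<Sum>t\<in>T. p ^ card (\<Union>(c ` insert t J)) * M ^ j)"
    proof (intro sum_mono Suc.IH)
      fix t assume "t \<in> T"
      then show "insert t J \<subseteq> T" using Suc.prems by auto
      have "card (insert t J) \<le> Suc (card J)" by (rule card_insert_le_m1) auto
      then show "j + card (insert t J) \<le> k" using Suc.prems by linarith
    qed
    also have "\<dots> = (\<Sum>t\<in>T. p ^ card ?U * M ^ j * p ^ card (c t - ?U))"
    proof (intro sum.cong refl)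
      fix t assume "t \<in> T"
      then have "finite (c t)" using finite_subset[OF T(2) E(1)] by simp
      moreover have "\<Union>(c ` insert t J) = ?U \<union> (c t - ?U)" by auto
      ultimately have "card (\<Union>(c ` insert t J)) = card ?U + card (c t - ?U)"
        using finU by (metis Diff_disjoint card_Un_disjoint finite_Diff)
      then show "p ^ card (\<Union>(c ` insert t J)) * M ^ j = p ^ card ?U * M ^ j * p ^ card (c t - ?U)"
        by (simp only: power_add) (simp add: mult_ac)
    qed
    also have "\<dots> = p ^ card ?U * M ^ j * (\<Sum>t\<in>T. p ^ card (c t - ?U))"
      by (simp add: sum_distrib_left)
    also have "\<dots> \<le> p ^ card ?U * M ^ j * M"
      using M[of J] Suc.prems E M0 by (intro mult_left_mono) auto
    finally show ?case by (simp add: mult_ac)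
  qed
  from this[of k "{}"] show ?thesis by simp
qed

lemma subset_count_tail:
  fixes c :: "'t \<Rightarrow> 'e set" and M p :: real
  assumes E: "finite E" "0 \<le> p" "p \<le> 1" and T: "finite T" "\<And>t. t \<in> T \<Longrightarrow> c t \<subseteq> E"
    and M: "\<And>J. J \<subseteq> T \<Longrightarrow> card J \<le> k \<Longrightarrow> (\<Sum>t\<in>T. p ^ card (c t - \<Union>(c ` J))) \<le> M"
    and "0 < M" "0 < L"
  shows "expct (rsub E p) (\<lambda>g. of_bool (L * M \<le> real (card {t \<in> T. c t \<subseteq> g}))) \<le> (1 / L) ^ k"
proof -
  let ?Y = "\<lambda>g. real (card {t \<in> T. c t \<subseteq> g})"
  have "expct (rsub E p) (\<lambda>g. of_bool (L * M \<le> ?Y g)) \<le> expct (rsub E p) (\<lambda>g. ?Y g ^ k / (L * M) ^ k)"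
  proof (intro expct_mono)
    fix g
    show "of_bool (L * M \<le> ?Y g) \<le> ?Y g ^ k / (L * M) ^ k"
    proof (cases "L * M \<le> ?Y g")
      case True
      then have "(L * M) ^ k \<le> ?Y g ^ k" using assms by (intro power_mono) auto
      then show ?thesis using True assms by (simp add: field_simps)
    qed (use assms in auto)
  qed (use E in auto)
  also have "\<dots> = expct (rsub E p) (\<lambda>g. ?Y g ^ k) / (L * M) ^ k" by simp
  also have "\<dots> \<le> M ^ k / (L * M) ^ k"
    using subset_count_moment[OF E T M] assms by (intro divide_right_mono) auto
  also have "\<dots> = (1 / L) ^ k" using assms by (simp add: power_mult_distrib power_divide)
  finally show ?thesis .
qed

section \<open>Patterns\<close>

definition inj_tuples :: "'a set \<Rightarrow> nat \<Rightarrow> (nat \<Rightarrow> 'a) set" where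
  "inj_tuples V R = {x \<in> {..<R} \<rightarrow>\<^sub>E V. inj_on x {..<R}}"

text \<open>A map \<open>\<beta>\<close> partitions the positions \<open>0, ..., R - 1\<close> into classes; the
  vertices of a class may share a planted block. For a clique with vertices \<open>x i\<close> the
  graph has to provide only the edges between different classes.\<close>

definition cross :: "nat \<Rightarrow> (nat \<Rightarrow> nat) \<Rightarrow> (nat \<Rightarrow> 'a) \<Rightarrow> 'a set set" where
  "cross R \<beta> x = {{x i, x j} | i j. i < R \<and> j < R \<and> \<beta> i \<noteq> \<beta> j}"

text \<open>If the vertices in the positions \<open>P\<close> are already used, only the edges with an end
  outside \<open>P\<close> are certain to be new.\<close>

definition new_pairs :: "nat \<Rightarrow> (nat \<Rightarrow> nat) \<Rightarrow> nat set \<Rightarrow> (nat \<times> nat) set" where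
  "new_pairs R \<beta> P = {(i, j). i < j \<and> j < R \<and> \<beta> i \<noteq> \<beta> j \<and> \<not> (i \<in> P \<and> j \<in> P)}"

lemma finite_inj_tuples [simp]: "finite V \<Longrightarrow> finite (inj_tuples V R)"
  unfolding inj_tuples_def by (rule finite_subset[of _ "{..<R} \<rightarrow>\<^sub>E V"]) (auto intro!: finite_PiE)

lemma cross_edges: 
  assumes x: "x \<in> inj_tuples V R" 
  shows "cross R \<beta> x \<subseteq> all_edges V"
proof
    fix e assume "e \<in> cross R \<beta> x"
    then obtain i j where e: "e = {x i, x j}" "i < R" "j < R" "\<beta> i \<noteq> \<beta> j" by (auto simp: cross_def)
    then have "x i \<noteq> x j" using x by (auto simp: inj_tuples_def inj_on_def)
    then show "e \<in> all_edges V" using x e by (auto simp: inj_tuples_def all_edges_def)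
qed

lemma finite_new_pairs [simp]: "finite (new_pairs R \<beta> P)"
  by (rule finite_subset[of _ "{..<R} \<times> {..<R}"]) (auto simp: new_pairs_def)

lemma new_pairs_le_card:
  assumes x: "x \<in> inj_tuples V R" and P: "{i. i < R \<and> x i \<in> \<Union>U} \<subseteq> P" and fin: "finite V"
  shows "card (new_pairs R \<beta> P) \<le> card (cross R \<beta> x - U)"
proof (rule card_inj_on_le[where f = "\<lambda>(i, j). {x i, x j}"])
  have inj: "inj_on x {..<R}" using x by (simp add: inj_tuples_def)
  show "inj_on (\<lambda>(i, j). {x i, x j}) (new_pairs R \<beta> P)"
  proof (rule inj_onI, clarify)
    fix i j i' j' assume *: "(i, j) \<in> new_pairs R \<beta> P" "(i', j') \<in> new_pairs R \<beta> P" "{x i, x j} = {x i', x j'}"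
    then have lt: "i < j" "j < R" "i' < j'" "j' < R" by (auto simp: new_pairs_def)
    have eq: "x a = x b \<longleftrightarrow> a = b" if "a < R" "b < R" for a b
      using inj that by (auto simp: inj_on_def)
    show "i = i' \<and> j = j'"
      using *(3) lt eq[of i i'] eq[of i j'] eq[of j i'] eq[of j j'] by (auto simp: doubleton_eq_iff)
  qed
  show "(\<lambda>(i, j). {x i, x j}) ` new_pairs R \<beta> P \<subseteq> cross R \<beta> x - U"
  proof clarify
    fix i j assume ij: "(i, j) \<in> new_pairs R \<beta> P"
    then have lt: "i < R" "j < R" "\<beta> i \<noteq> \<beta> j" "\<not> (i \<in> P \<and> j \<in> P)" by (auto simp: new_pairs_def)
    have "{x i, x j} \<notin> U"
    proof
      assume "{x i, x j} \<in> U"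
      then have "x i \<in> \<Union>U" "x j \<in> \<Union>U" by auto
      then show False using P lt by blast
    qed
    moreover have "{x i, x j} \<in> cross R \<beta> x" using lt by (auto simp: cross_def)
    ultimately show "{x i, x j} \<in> cross R \<beta> x - U" by simp
  qed
  show "finite (cross R \<beta> x - U)"
    using finite_subset[OF cross_edges[OF x]] fin by auto
qed

lemma card_tuples_with:
  assumes "finite V" "card V \<le> n" "finite Q" "card Q \<le> u" "P \<subseteq> {..<R}"
  shows "card {x \<in> {..<R} \<rightarrow>\<^sub>E V. \<forall>i\<in>P. x i \<in> Q} \<le> u ^ card P * n ^ (R - card P)"
proof -
  have finP: "finite P" using assms(5) finite_subset by blast
  have "{x \<in> {..<R} \<rightarrow>\<^sub>E V. \<forall>i\<in>P. x i \<in> Q} \<subseteq> PiE {..<R} (\<lambda>i. if i \<in> P then Q else V)"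
    by (auto simp: PiE_iff extensional_def)
  then have "card {x \<in> {..<R} \<rightarrow>\<^sub>E V. \<forall>i\<in>P. x i \<in> Q} \<le> card (PiE {..<R} (\<lambda>i. if i \<in> P then Q else V))"
    using assms by (intro card_mono finite_PiE) auto
  also have "\<dots> = (\<Prod>i\<in>{..<R}. card (if i \<in> P then Q else V))" by (rule card_PiE) auto
  also have "\<dots> = (\<Prod>i\<in>P. card Q) * (\<Prod>i\<in>{..<R} - P. card V)"
  proof -
    have "{..<R} = P \<union> ({..<R} - P)" using assms(5) by auto
    then have "(\<Prod>i\<in>{..<R}. card (if i \<in> P then Q else V))
       = (\<Prod>i\<in>P. card (if i \<in> P then Q else V)) * (\<Prod>i\<in>{..<R} - P. card (if i \<in> P then Q else V))"
      using finP by (metis Diff_disjoint finite_Diff finite_lessThan prod.union_disjoint)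
    then show ?thesis by simp
  qed
  also have "\<dots> = card Q ^ card P * card V ^ (R - card P)"
    using assms(5) by (simp add: card_Diff_subset[OF finP])
  also have "\<dots> \<le> u ^ card P * n ^ (R - card P)"
    using assms by (intro mult_mono power_mono) auto
  finally show ?thesis .
qed

lemma card_union_cross:
  assumes "finite J" "card J \<le> k" "J \<subseteq> inj_tuples V R"
  shows "card (\<Union>(\<Union>(cross R \<beta> ` J))) \<le> R * k" "finite (\<Union>(\<Union>(cross R \<beta> ` J)))"
proof -
  have sub: "\<Union>(\<Union>(cross R \<beta> ` J)) \<subseteq> (\<Union>x\<in>J. x ` {..<R})" by (auto simp: cross_def)
  have "card (\<Union>x\<in>J. x ` {..<R}) \<le> (\<Sum>x\<in>J. card (x ` {..<R}))" using assms by (intro card_UN_le)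
  also have "\<dots> \<le> (\<Sum>x\<in>J. R)" using card_image_le[of "{..<R}"] by (intro sum_mono) simp
  also have "\<dots> \<le> R * k" using assms by (simp add: mult.commute)
  finally show "card (\<Union>(\<Union>(cross R \<beta> ` J))) \<le> R * k"
    using card_mono[OF _ sub] assms by (meson finite_UN_I finite_imageI finite_lessThan le_trans)
  show "finite (\<Union>(\<Union>(cross R \<beta> ` J)))"
    by (rule finite_subset[OF sub]) (use assms in auto)
qed

text \<open>This sum is the conditional expectation required by \<open>subset_count_moment\<close>, when
  \<open>U\<close> is the union of earlier copies of the pattern. The terms are grouped by the set
  \<open>P\<close> of positions that meet the vertices of \<open>U\<close>.\<close>

lemma pattern_sum_le:
  fixes p :: real
  assumes V: "finite V" "card V \<le> n" and p: "0 \<le> p" "p \<le> 1"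
    and Q: "finite (\<Union>U)" "card (\<Union>U) \<le> u"
  shows "(\<Sum>x\<in>inj_tuples V R. p ^ card (cross R \<beta> x - U))
     \<le> (\<Sum>P\<in>Pow {..<R}. real u ^ card P * real n ^ (R - card P) * p ^ card (new_pairs R \<beta> P))"
proof -
  define pos where "pos = (\<lambda>x :: nat \<Rightarrow> 'a. {i. i < R \<and> x i \<in> \<Union>U})"
  have "(\<Sum>x\<in>inj_tuples V R. p ^ card (cross R \<beta> x - U))
     \<le> (\<Sum>x\<in>inj_tuples V R. p ^ card (new_pairs R \<beta> (pos x)))"
    using p by (intro sum_mono power_decreasing new_pairs_le_card[OF _ _ V(1)]) (auto simp: pos_def)
  also have "\<dots> = (\<Sum>P\<in>Pow {..<R}. \<Sum>x\<in>{x \<in> inj_tuples V R. pos x = P}. p ^ card (new_pairs R \<beta> (pos x)))"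
    using V by (intro sum.group[symmetric]) (auto simp: pos_def)
  also have "\<dots> = (\<Sum>P\<in>Pow {..<R}. real (card {x \<in> inj_tuples V R. pos x = P}) * p ^ card (new_pairs R \<beta> P))"
    by (intro sum.cong) auto
  also have "\<dots> \<le> (\<Sum>P\<in>Pow {..<R}. real u ^ card P * real n ^ (R - card P) * p ^ card (new_pairs R \<beta> P))"
  proof (intro sum_mono mult_right_mono)
    fix P assume P: "P \<in> Pow {..<R}"
    have "card {x \<in> inj_tuples V R. pos x = P} \<le> card {x \<in> {..<R} \<rightarrow>\<^sub>E V. \<forall>i\<in>P. x i \<in> \<Union>U}"
      using V by (intro card_mono) (auto simp: inj_tuples_def pos_def intro!: finite_PiE)
    also have "\<dots> \<le> u ^ card P * n ^ (R - card P)" using P by (intro card_tuples_with V Q) auto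
    finally have "real (card {x \<in> inj_tuples V R. pos x = P}) \<le> real (u ^ card P * n ^ (R - card P))" by (rule of_nat_mono)
    then show "real (card {x \<in> inj_tuples V R. pos x = P}) \<le> real u ^ card P * real n ^ (R - card P)" by simp
  qed (use p in auto)
  finally show ?thesis .
qed

lemma rooted_pattern_sum_le:
  fixes p :: real
  assumes V: "finite V" "card V \<le> n" and p: "0 \<le> p" "p \<le> 1" and R: "0 < R"
    and Q: "finite (\<Union>U)" "card (\<Union>U) < u"
  shows "(\<Sum>x\<in>{x \<in> inj_tuples V R. x 0 = v}. p ^ card (cross R \<beta> x - U))
     \<le> (\<Sum>P\<in>{P. P \<subseteq> {..<R} \<and> 0 \<in> P}. real u ^ card P * real n ^ (R - card P) * p ^ card (new_pairs R \<beta> P))"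
proof -
  define pos where "pos = (\<lambda>x :: nat \<Rightarrow> 'a. {i. i < R \<and> x i \<in> insert v (\<Union>U)})"
  let ?T = "{x \<in> inj_tuples V R. x 0 = v}"
  let ?PP = "{P. P \<subseteq> {..<R} \<and> 0 \<in> P}"
  have Q': "finite (insert v (\<Union>U))" "card (insert v (\<Union>U)) \<le> u"
    using Q by (auto simp: card_insert_if)
  have finPP: "finite ?PP" by (rule finite_subset[of _ "Pow {..<R}"]) auto
  have "(\<Sum>x\<in>?T. p ^ card (cross R \<beta> x - U)) \<le> (\<Sum>x\<in>?T. p ^ card (new_pairs R \<beta> (pos x)))"
    using p by (intro sum_mono power_decreasing new_pairs_le_card[OF _ _ V(1)]) (auto simp: pos_def)
  also have "\<dots> = (\<Sum>P\<in>?PP. \<Sum>x\<in>{x \<in> ?T. pos x = P}. p ^ card (new_pairs R \<beta> (pos x)))"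
    using V R finPP by (intro sum.group[symmetric]) (auto simp: pos_def)
  also have "\<dots> = (\<Sum>P\<in>?PP. real (card {x \<in> ?T. pos x = P}) * p ^ card (new_pairs R \<beta> P))"
    by (intro sum.cong) auto
  also have "\<dots> \<le> (\<Sum>P\<in>?PP. real u ^ card P * real n ^ (R - card P) * p ^ card (new_pairs R \<beta> P))"
  proof (intro sum_mono mult_right_mono)
    fix P assume P: "P \<in> ?PP"
    have "card {x \<in> ?T. pos x = P} \<le> card {x \<in> {..<R} \<rightarrow>\<^sub>E V. \<forall>i\<in>P. x i \<in> insert v (\<Union>U)}"
      using V by (intro card_mono) (auto simp: inj_tuples_def pos_def intro!: finite_PiE)
    also have "\<dots> \<le> u ^ card P * n ^ (R - card P)" using P by (intro card_tuples_with V Q') auto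
    finally have "real (card {x \<in> ?T. pos x = P}) \<le> real (u ^ card P * n ^ (R - card P))" by (rule of_nat_mono)
    then show "real (card {x \<in> ?T. pos x = P}) \<le> real u ^ card P * real n ^ (R - card P)" by simp
  qed (use p in auto)
  finally show ?thesis .
qed

section \<open>The exponent computation\<close>

lemma card_new_pairs:
  fixes \<beta> :: "nat \<Rightarrow> nat"
  assumes P: "P \<subseteq> {..<R}" 
  defines "B \<equiv> \<beta> ` {..<R}" and "s \<equiv> \<lambda>b. int (card {i. i < R \<and> \<beta> i = b})" 
    and "a \<equiv> \<lambda>b. int (card {i \<in> P. \<beta> i = b})"
  shows "2 * int (card (new_pairs R \<beta> P)) = int R ^ 2 - int (card P) ^ 2 - (\<Sum>b\<in>B. s b ^ 2 - a b ^ 2)"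
    and "int R = (\<Sum>b\<in>B. s b)" and "int (card P) = (\<Sum>b\<in>B. a b)"
proof -
  have finP: "finite P" using P finite_subset by blast
  have finB: "finite B" by (simp add: B_def)
  let ?S = "\<lambda>b. {i. i < R \<and> \<beta> i = b}" and ?A = "\<lambda>b. {i \<in> P. \<beta> i = b}"
  have finS: "finite (?S b)" "finite (?A b)" for b using finP by auto
  let ?N = "new_pairs R \<beta> P" 
  let ?N' = "(\<lambda>(i, j). (j, i)) ` ?N"
  let ?D = "(\<Union>b\<in>B. ?S b \<times> ?S b)" and ?DP = "(\<Union>b\<in>B. ?A b \<times> ?A b)"
  have all: "{..<R} \<times> {..<R} = (?N \<union> ?N') \<union> (?D \<union> (P \<times> P))"
    using P by (fastforce simp: new_pairs_def B_def image_iff)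
  have dis: "(?N \<union> ?N') \<inter> (?D \<union> (P \<times> P)) = {}" by (auto simp: new_pairs_def)
  have "?N \<inter> ?N' = {}" by (auto simp: new_pairs_def)
  then have cN: "card (?N \<union> ?N') = 2 * card ?N"
  proof -
    have "inj_on (\<lambda>(i, j). (j, i)) ?N" by (auto simp: inj_on_def)
    from card_image[OF this] \<open>?N \<inter> ?N' = {}\<close> show ?thesis by (subst card_Un_disjoint) auto
  qed
  have cD: "card ?D = (\<Sum>b\<in>B. card (?S b) ^ 2)"
    using finB finS by (subst card_UN_disjoint) (auto simp: power2_eq_square card_cartesian_product)
  have cDP: "card ?DP = (\<Sum>b\<in>B. card (?A b) ^ 2)"
    using finB finS by (subst card_UN_disjoint) (auto simp: power2_eq_square card_cartesian_product)
  have "?D \<inter> (P \<times> P) = ?DP" using P by (auto simp: B_def)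
  then have cDD: "card ?D + card P ^ 2 = card (?D \<union> (P \<times> P)) + card ?DP"
    using card_Un_Int[of ?D "P \<times> P"] finB finS finP by (simp add: card_cartesian_product power2_eq_square)
  have finD: "finite (?D \<union> (P \<times> P))" using finB finS finP by auto
  have "R ^ 2 = card ({..<R} \<times> {..<R})" by (simp add: card_cartesian_product power2_eq_square)
  also have "\<dots> = 2 * card ?N + card (?D \<union> (P \<times> P))"
    unfolding all by (subst card_Un_disjoint[OF _ finD dis]) (auto simp: cN)
  finally have "R ^ 2 + card ?DP = 2 * card ?N + card ?D + card P ^ 2" using cDD by simp
  then have "int (R ^ 2 + card ?DP) = int (2 * card ?N + card ?D + card P ^ 2)" by simp
  then show "2 * int (card ?N) = int R ^ 2 - int (card P) ^ 2 - (\<Sum>b\<in>B. s b ^ 2 - a b ^ 2)"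
    unfolding cD cDP by (simp add: s_def a_def sum_subtractf)
  have "card {..<R} = (\<Sum>b\<in>B. card (?S b))"
  proof -
    have "{..<R} = (\<Union>b\<in>B. ?S b)" by (auto simp: B_def)
    then show ?thesis using finB finS by (subst card_UN_disjoint[symmetric]) auto
  qed
  then show "int R = (\<Sum>b\<in>B. s b)" by (simp add: s_def flip: of_nat_sum)
  have "card P = (\<Sum>b\<in>B. card (?A b))"
  proof -
    have "P = (\<Union>b\<in>B. ?A b)" using P by (auto simp: B_def)
    then show ?thesis using finB finS by (subst card_UN_disjoint[symmetric]) auto
  qed
  then show "int (card P) = (\<Sum>b\<in>B. a b)" by (simp add: a_def flip: of_nat_sum)
qed

text \<open>At edge probability \<open>n^(-2/R)\<close> the term for \<open>P\<close> has order \<open>n\<close>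
  to the left side divided by \<open>R\<close>. The classes of sizes \<open>s b\<close> lower the
  exponent by the last sum, the defect of the pattern; this gain makes patterns with two large classes
  rare. The summand for \<open>P = {}\<close> is the extra factor \<open>n\<close> for choosing a
  first copy.\<close>

lemma pattern_exponent:
  fixes \<beta> :: "nat \<Rightarrow> nat"
  assumes P: "P \<subseteq> {..<R}" 
  defines "B \<equiv> \<beta> ` {..<R}" and "s \<equiv> \<lambda>b. int (card {i. i < R \<and> \<beta> i = b})"
  shows "int R * (int R - int (card P)) - 2 * int (card (new_pairs R \<beta> P))
     \<le> int R * (int R - int (card B)) + (if P = {} then int R else 0) - (\<Sum>b\<in>B. (s b - 1) * (int R - s b))"
proof -
  define a where "a = (\<lambda>b. int (card {i \<in> P. \<beta> i = b}))"
  define q where "q = int (card P)"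
  note f = card_new_pairs[OF P, of \<beta>, folded B_def s_def a_def q_def]
  have finP: "finite P" using P finite_subset by blast
  have "q = (\<Sum>b\<in>B. a b)" using f(3) .
  also have "\<dots> \<le> (\<Sum>b\<in>B. a b ^ 2)"
  proof (intro sum_mono)
    fix b
    let ?c = "card {i \<in> P. \<beta> i = b}"
    have "int ?c \<le> int (?c * ?c)" by (intro of_nat_mono le_square)
    then show "a b \<le> a b ^ 2" by (simp add: a_def power2_eq_square)
  qed
  finally have qa: "q \<le> (\<Sum>b\<in>B. a b ^ 2)" .
  have "(\<Sum>b\<in>B. (s b - 1) * (int R - s b)) = (\<Sum>b\<in>B. (int R + 1) * s b - s b ^ 2 - int R)"
    by (intro sum.cong) (auto simp: algebra_simps power2_eq_square)
  also have "\<dots> = (int R + 1) * (\<Sum>b\<in>B. s b) - (\<Sum>b\<in>B. s b ^ 2) - int (card B) * int R"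
    by (simp add: sum_subtractf sum_distrib_left)
  finally have sb: "(\<Sum>b\<in>B. (s b - 1) * (int R - s b)) = (int R + 1) * int R - (\<Sum>b\<in>B. s b ^ 2) - int (card B) * int R"
    using f(2) by simp
  have qR: "int R - q * (int R + 1 - q) \<le> (if P = {} then int R else 0)"
  proof (cases "P = {}")
    case False
    then have "1 \<le> q" using finP by (simp add: q_def card_gt_0_iff Suc_leI)
    moreover have "q \<le> int R" using P by (simp add: q_def subset_eq_atLeast0_lessThan_card lessThan_atLeast0)
    ultimately have "0 \<le> (q - 1) * (int R - q)" by simp
    then show ?thesis using False by (simp add: algebra_simps)
  qed (simp add: q_def)
  define S2 A2 Z where "S2 = (\<Sum>b\<in>B. s b ^ 2)" and "A2 = (\<Sum>b\<in>B. a b ^ 2)"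
    and "Z = (\<Sum>b\<in>B. (s b - 1) * (int R - s b))"
  have f1: "2 * int (card (new_pairs R \<beta> P)) = int R ^ 2 - q ^ 2 - (S2 - A2)"
    using card_new_pairs(1)[OF P, of \<beta>] by (simp add: B_def s_def a_def q_def S2_def A2_def sum_subtractf)
  show ?thesis
    using f1 qa sb qR unfolding q_def[symmetric] S2_def[symmetric] A2_def[symmetric] Z_def[symmetric]
    by (simp add: algebra_simps power2_eq_square)
qed

section \<open>Sets whose planting creates a clique\<close>

lemma card_ksets_containing:
  assumes "finite V" "J \<subseteq> V" "0 < card V"
  shows "real (card {A \<in> ksets V r. J \<subseteq> A}) \<le> real (card V) powr (real r - real (card J))"
proof (cases "card J \<le> r")
  case True
  have "card {A \<in> ksets V r. J \<subseteq> A} \<le> card (ksets V (r - card J))"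
  proof (rule card_inj_on_le[where f = "\<lambda>A. A - J"])
    show "inj_on (\<lambda>A. A - J) {A \<in> ksets V r. J \<subseteq> A}" by (rule inj_onI) blast
    show "(\<lambda>A. A - J) ` {A \<in> ksets V r. J \<subseteq> A} \<subseteq> ksets V (r - card J)"
      using finite_subset[OF assms(2,1)] by (auto simp: ksets_def card_Diff_subset)
  qed (use assms in simp)
  also have "\<dots> \<le> card V ^ (r - card J)"
    using assms by (cases "r - card J \<le> card V") (auto simp: card_ksets binomial_le_pow binomial_eq_0)
  finally have "real (card {A \<in> ksets V r. J \<subseteq> A}) \<le> real (card V ^ (r - card J))" by (rule of_nat_mono)
  then show ?thesis using True assms by (simp add: powr_realpow[symmetric] of_nat_diff)
next
  case False
  have "card J \<le> r" if "A \<in> ksets V r" "J \<subseteq> A" for A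
    using that assms card_mono[of A J] by (auto simp: ksets_def dest: finite_subset)
  then have "{A \<in> ksets V r. J \<subseteq> A} = {}" using False by auto
  then show ?thesis by (simp only: card.empty) simp
qed

lemma enum_from:
  assumes "finite I" "v \<in> I"
  shows "\<exists>f. bij_betw f {..<card I} I \<and> f 0 = v"
proof -
  obtain f where f: "bij_betw f {..<card I} I" using enum_bij[OF assms(1)] by blast
  then have "v \<in> f ` {..<card I}" using assms(2) by (simp add: bij_betw_def)
  then obtain i where i: "i < card I" "f i = v" by auto
  let ?g = "f \<circ> Transposition.transpose 0 i"
  have "bij_betw (Transposition.transpose 0 i) {..<card I} {..<card I}"
    using i by (intro bij_betw_byWitness[where f' = "Transposition.transpose 0 i"])
       (auto simp: Transposition.transpose_def)
  then have "bij_betw ?g {..<card I} I" using f by (rule bij_betw_trans)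
  moreover have "?g 0 = v" using i by simp
  ultimately show ?thesis by blast
qed

definition block_pattern :: "nat \<Rightarrow> nat \<Rightarrow> nat" where
  "block_pattern s i = (if i < s then 0 else i)"

lemma enum_with_block:
  assumes C: "finite C" "card C = R" and I: "I \<subseteq> C" "v \<in> I" "card I = s" and V: "C \<subseteq> V"
  shows "\<exists>x \<in> inj_tuples V R. x ` {..<R} = C \<and> x ` {..<s} = I \<and> x 0 = v"
proof -
  have finI: "finite I" "finite (C - I)" using C I finite_subset by auto
  have sR: "s \<le> R" using C I card_mono by metis
  obtain f where f: "bij_betw f {..<s} I" "f 0 = v" using enum_from[OF finI(1) I(2)] I(3) by auto
  have cCI: "card (C - I) = R - s" using C I finI by (simp add: card_Diff_subset)
  obtain f' where f': "bij_betw f' {..<R - s} (C - I)" using enum_bij[OF finI(2)] cCI by metis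
  define x where "x = (\<lambda>i. if i < s then f i else if i < R then f' (i - s) else undefined)"
  have xs: "x ` {..<s} = I" using f(1) by (auto simp: x_def bij_betw_def)
  have xr: "x ` {s..<R} = C - I"
  proof -
    have "x ` {s..<R} = f' ` ((\<lambda>i. i - s) ` {s..<R})" unfolding image_image by (intro image_cong) (auto simp: x_def)
    also have "(\<lambda>i. i - s) ` {s..<R} = {..<R - s}"
    proof (intro equalityI subsetI)
      fix j assume "j \<in> {..<R - s}"
      then show "j \<in> (\<lambda>i. i - s) ` {s..<R}" by (intro image_eqI[of _ _ "j + s"]) auto
    qed auto
    finally show ?thesis using f' by (simp add: bij_betw_def)
  qed
  have un: "{..<R} = {..<s} \<union> {s..<R}" using sR by auto
  have xC: "x ` {..<R} = C" unfolding un image_Un xs xr using I by auto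
  moreover have "inj_on x {..<R}" by (rule eq_card_imp_inj_on) (auto simp: xC C)
  moreover have "s > 0" using I finI card_gt_0_iff by blast
  moreover have "x \<in> {..<R} \<rightarrow>\<^sub>E V" using xC V sR by (auto simp: x_def image_subset_iff PiE_iff extensional_def)
  ultimately show ?thesis using xs f(2) by (intro bexI[of _ x]) (auto simp: inj_tuples_def x_def)
qed

text \<open>Sets to be kept out of the partitions: the clique would appear however the other blocks are chosen.\<close>

definition bad_set :: "'a set \<Rightarrow> nat \<Rightarrow> 'a set set \<Rightarrow> 'a set \<Rightarrow> bool" where
  "bad_set V R g A \<longleftrightarrow> (\<exists>C\<in>ksets V R. C \<noteq> A \<and> all_edges C \<subseteq> g \<union> all_edges A \<and> \<not> all_edges C \<subseteq> g)"

definition rooted_count :: "'a set \<Rightarrow> nat \<Rightarrow> (nat \<Rightarrow> nat) \<Rightarrow> 'a \<Rightarrow> 'a set set \<Rightarrow> nat" where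
  "rooted_count V R \<beta> v g = card {x \<in> inj_tuples V R. x 0 = v \<and> cross R \<beta> x \<subseteq> g}"

definition pattern_count :: "'a set \<Rightarrow> nat \<Rightarrow> (nat \<Rightarrow> nat) \<Rightarrow> 'a set set \<Rightarrow> nat" where
  "pattern_count V R \<beta> g = card {x \<in> inj_tuples V R. cross R \<beta> x \<subseteq> g}"

lemma bad_set_pattern:
  assumes finV: "finite V" and A: "A \<in> ksets V r" "bad_set V R g A" and rR: "r \<le> R"
  shows "\<exists>s I. s \<in> {2..<R} \<and> I \<subseteq> A \<and> card I = s \<and> 
     (\<forall>v\<in>I. \<exists>x\<in>inj_tuples V R. x 0 = v \<and> x ` {..<s} = I \<and> cross R (block_pattern s) x \<subseteq> g)"
proof -
  obtain C where C: "C \<in> ksets V R" "C \<noteq> A" "all_edges C \<subseteq> g \<union> all_edges A" "\<not> all_edges C \<subseteq> g"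
    using A by (auto simp: bad_set_def)
  define I where "I = C \<inter> A"
  have finC: "finite C" "finite A" "C \<subseteq> V" using C A finV by (auto simp: ksets_def dest: finite_subset)
  have finI: "finite I" using finC by (simp add: I_def)
  obtain e where "e \<in> all_edges C" "e \<notin> g" using C by auto
  then have "e \<in> all_edges A" "e \<in> all_edges C" using C by auto
  then have "e \<subseteq> I" "card e = 2" by (auto simp: all_edges_def I_def)
  then have s2: "2 \<le> card I" using card_mono[OF finI] by metis
  have "card I < R"
  proof (rule ccontr)
    assume "\<not> card I < R"
    then have "I = C" using C finC by (intro card_seteq) (auto simp: I_def ksets_def)
    then have "C \<subseteq> A" by (auto simp: I_def)
    moreover have "card A \<le> card C" using A C rR by (simp add: ksets_def)
    ultimately show False using C finC card_seteq by blast
  qed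
  moreover have "\<exists>x\<in>inj_tuples V R. x 0 = v \<and> x ` {..<card I} = I \<and> cross R (block_pattern (card I)) x \<subseteq> g"
    if v: "v \<in> I" for v
  proof -
    have "card C = R" using C by (simp add: ksets_def)
    then obtain x where x: "x \<in> inj_tuples V R" "x ` {..<R} = C" "x ` {..<card I} = I" "x 0 = v"
      using enum_with_block[of C R I v "card I" V] finC v by (auto simp: I_def)
    have inj: "inj_on x {..<R}" using x by (simp add: inj_tuples_def)
    have inI: "x i \<in> I \<longleftrightarrow> i < card I" if "i < R" for i
    proof
      assume "x i \<in> I"
      then obtain j where "j < card I" "x i = x j" using x(3) by (auto simp: image_iff)
      then have "i = j" using inj_onD[OF inj, of i j] that \<open>card I < R\<close> by simp
      then show "i < card I" using \<open>j < card I\<close> by simp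
    qed (use x(3) in auto)
    have "cross R (block_pattern (card I)) x \<subseteq> g"
    proof
      fix e assume "e \<in> cross R (block_pattern (card I)) x"
      then obtain i j where e: "e = {x i, x j}" "i < R" "j < R" "block_pattern (card I) i \<noteq> block_pattern (card I) j"
        by (auto simp: cross_def)
      then have "x i \<noteq> x j" using inj by (auto simp: inj_on_def)
      then have "e \<in> all_edges C" using e x by (auto simp: all_edges_def)
      moreover have "e \<notin> all_edges A"
      proof
        assume "e \<in> all_edges A"
        then have "x i \<in> I" "x j \<in> I" using e x(2) by (auto simp: all_edges_def I_def)
        then show False using inI e by (auto simp: block_pattern_def)
      qed
      ultimately show "e \<in> g" using C by auto
    qed
    then show ?thesis using x by blast
  qed
  ultimately show ?thesis using s2 by (intro exI[of _ "card I"] exI[of _ I]) (auto simp: I_def)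
qed

text \<open>A bad set shares \<open>s\<close> vertices with the clique that it creates, and the other edges of
  this clique form a copy of the block pattern in \<open>g\<close>. The shared part either contains
  \<open>v\<close>, which may be taken as its root, or it has any of \<open>n\<close> roots but leaves
  one vertex less of the bad set to choose.\<close>

lemma bad_degree_le:
  fixes \<Lambda> :: real
  assumes finV: "finite V" and n: "card V = n" "0 < n" and rR: "r \<le> R" "R \<le> r + 1" and \<Lambda>: "0 \<le> \<Lambda>"
    and cnt: "\<And>s v. s \<in> {2..<R} \<Longrightarrow> v \<in> V \<Longrightarrow> 
      real (rooted_count V R (block_pattern s) v g) \<le> \<Lambda> * real n powr (real s - 1 - 1 / real R)"
    and v: "v \<in> V"
  shows "real (card {A \<in> ksets V r. v \<in> A \<and> bad_set V R g A}) \<le> 2 * real R * \<Lambda> * real n powr (real r - 1 - 1 / real R)"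
proof -
  let ?T = "\<lambda>s w. {x \<in> inj_tuples V R. x 0 = w \<and> cross R (block_pattern s) x \<subseteq> g}"
  let ?S1 = "\<lambda>s x. {A \<in> ksets V r. x ` {..<s} \<subseteq> A}"
  let ?S2 = "\<lambda>s x. {A \<in> ksets V r. insert v (x ` {..<s}) \<subseteq> A}"
  let ?T2 = "\<lambda>s w. {x \<in> ?T s w. v \<notin> x ` {..<s}}"
  let ?U = "\<lambda>s. (\<Union>x\<in>?T s v. ?S1 s x) \<union> (\<Union>w\<in>V. \<Union>x\<in>?T2 s w. ?S2 s x)"
  have sub: "{A \<in> ksets V r. v \<in> A \<and> bad_set V R g A} \<subseteq> (\<Union>s\<in>{2..<R}. ?U s)"
  proof
    fix A assume "A \<in> {A \<in> ksets V r. v \<in> A \<and> bad_set V R g A}"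
    then have A: "A \<in> ksets V r" "v \<in> A" "bad_set V R g A" by auto
    obtain s I where sI: "s \<in> {2..<R} \<and> I \<subseteq> A \<and> card I = s \<and>
       (\<forall>v\<in>I. \<exists>x\<in>inj_tuples V R. x 0 = v \<and> x ` {..<s} = I \<and> cross R (block_pattern s) x \<subseteq> g)"
      using bad_set_pattern[OF finV A(1,3) rR(1)] by (elim exE)
    then have s: "s \<in> {2..<R}" and I: "I \<subseteq> A" "card I = s" by auto
    have x: "\<exists>x\<in>inj_tuples V R. x 0 = v \<and> x ` {..<s} = I \<and> cross R (block_pattern s) x \<subseteq> g" if "v \<in> I" for v
      using sI that by simp
    have "A \<in> ?U s"
    proof (cases "v \<in> I")
      case True
      then show ?thesis using x[OF True] A I by auto
    next
      case False
      have "I \<noteq> {}" using I s by auto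
      then obtain w where w: "w \<in> I" by auto
      then have "w \<in> V" using A I by (auto simp: ksets_def)
      obtain y where y: "y \<in> inj_tuples V R" "y 0 = w" "y ` {..<s} = I" "cross R (block_pattern s) y \<subseteq> g"
        using x[OF w] by auto
      have "y \<in> ?T2 s w" "A \<in> ?S2 s y" using y A I False by simp_all
      then have "A \<in> (\<Union>w\<in>V. \<Union>x\<in>?T2 s w. ?S2 s x)" using \<open>w \<in> V\<close> by blast
      then show ?thesis by (rule UnI2)
    qed
    then show "A \<in> (\<Union>s\<in>{2..<R}. ?U s)" using s by blast
  qed
  have fin: "finite (?S1 s x)" "finite (?S2 s x)" "finite (?T s w)" "finite (?T2 s w)" for s x w using finV by auto
  have n0: "0 < real n" using n by simp
  have trm: "real (card (?U s)) \<le> 2 * \<Lambda> * real n powr (real r - 1 - 1 / real R)" if s: "s \<in> {2..<R}" for s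
  proof -
    have cimg: "card (x ` {..<s}) = s" "x ` {..<s} \<subseteq> V" if "x \<in> ?T s w" for x w
    proof -
      have "inj_on x {..<R}" "x \<in> {..<R} \<rightarrow>\<^sub>E V" using that by (auto simp: inj_tuples_def)
      then show "card (x ` {..<s}) = s" "x ` {..<s} \<subseteq> V"
        using s by (auto simp: card_image PiE_iff inj_on_subset[of x "{..<R}" "{..<s}"])
    qed
    have "real (card (\<Union>x\<in>?T s v. ?S1 s x)) \<le> real (\<Sum>x\<in>?T s v. card (?S1 s x))"
      using fin by (intro of_nat_mono card_UN_le)
    also have "\<dots> = (\<Sum>x\<in>?T s v. real (card (?S1 s x)))" by simp
    also have "\<dots> \<le> (\<Sum>x\<in>?T s v. real n powr (real r - real s))"
    proof (rule sum_mono)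
      fix x assume x: "x \<in> ?T s v"
      show "real (card (?S1 s x)) \<le> real n powr (real r - real s)"
        using card_ksets_containing[OF finV cimg(2)[OF x], of r] n cimg(1)[OF x] by simp
    qed
    also have "\<dots> = real (rooted_count V R (block_pattern s) v g) * real n powr (real r - real s)"
      by (simp add: rooted_count_def)
    also have "\<dots> \<le> \<Lambda> * real n powr (real s - 1 - 1 / real R) * real n powr (real r - real s)"
      using cnt[OF s v] by (intro mult_right_mono) auto
    also have "\<dots> = \<Lambda> * real n powr (real r - 1 - 1 / real R)"
      unfolding mult.assoc powr_add[symmetric] by (simp add: algebra_simps)
    finally have 1: "real (card (\<Union>x\<in>?T s v. ?S1 s x)) \<le> \<Lambda> * real n powr (real r - 1 - 1 / real R)" .
    have "real (card (\<Union>w\<in>V. \<Union>x\<in>?T2 s w. ?S2 s x)) \<le> real (\<Sum>w\<in>V. card (\<Union>x\<in>?T2 s w. ?S2 s x))"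
      using finV by (intro of_nat_mono card_UN_le)
    also have "\<dots> = (\<Sum>w\<in>V. real (card (\<Union>x\<in>?T2 s w. ?S2 s x)))" by simp
    also have "\<dots> \<le> (\<Sum>w\<in>V. \<Lambda> * real n powr (real r - 2 - 1 / real R))"
    proof (rule sum_mono)
      fix w assume w: "w \<in> V"
      have "real (card (\<Union>x\<in>?T2 s w. ?S2 s x)) \<le> real (\<Sum>x\<in>?T2 s w. card (?S2 s x))"
        using fin by (intro of_nat_mono card_UN_le)
      also have "\<dots> = (\<Sum>x\<in>?T2 s w. real (card (?S2 s x)))" by simp
      also have "\<dots> \<le> (\<Sum>x\<in>?T2 s w. real n powr (real r - (real s + 1)))"
      proof (rule sum_mono)
        fix x assume x: "x \<in> ?T2 s w"
        then have "insert v (x ` {..<s}) \<subseteq> V" "card (insert v (x ` {..<s})) = s + 1"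
          using cimg[of x w] v by auto
        then show "real (card (?S2 s x)) \<le> real n powr (real r - (real s + 1))"
          using card_ksets_containing[OF finV, of "insert v (x ` {..<s})" r] n by (simp add: add.commute)
      qed
      also have "\<dots> \<le> (\<Sum>x\<in>?T s w. real n powr (real r - (real s + 1)))"
        using fin by (intro sum_mono2) auto
      also have "\<dots> = real (rooted_count V R (block_pattern s) w g) * real n powr (real r - (real s + 1))"
        by (simp add: rooted_count_def)
      also have "\<dots> \<le> \<Lambda> * real n powr (real s - 1 - 1 / real R) * real n powr (real r - (real s + 1))"
        using cnt[OF s w] by (intro mult_right_mono) auto
      also have "\<dots> = \<Lambda> * real n powr (real r - 2 - 1 / real R)"
        unfolding mult.assoc powr_add[symmetric] by (simp add: algebra_simps)
      finally show "real (card (\<Union>x\<in>?T2 s w. ?S2 s x)) \<le> \<Lambda> * real n powr (real r - 2 - 1 / real R)" .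
    qed
    also have "\<dots> = \<Lambda> * (real n powr 1 * real n powr (real r - 2 - 1 / real R))"
      using n n0 by simp
    also have "\<dots> = \<Lambda> * real n powr (real r - 1 - 1 / real R)"
      unfolding mult.assoc powr_add[symmetric] by (simp add: algebra_simps)
    finally have 2: "real (card (\<Union>w\<in>V. \<Union>x\<in>?T2 s w. ?S2 s x)) \<le> \<Lambda> * real n powr (real r - 1 - 1 / real R)" .
    have "card (?U s) \<le> card (\<Union>x\<in>?T s v. ?S1 s x) + card (\<Union>w\<in>V. \<Union>x\<in>?T2 s w. ?S2 s x)"
      by (rule card_Un_le)
    then have "real (card (?U s)) \<le> real (card (\<Union>x\<in>?T s v. ?S1 s x)) + real (card (\<Union>w\<in>V. \<Union>x\<in>?T2 s w. ?S2 s x))"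
      unfolding of_nat_add[symmetric] by (rule of_nat_mono)
    then show ?thesis using 1 2 by simp
  qed
  have "card {A \<in> ksets V r. v \<in> A \<and> bad_set V R g A} \<le> card (\<Union>s\<in>{2..<R}. ?U s)"
    using finV fin by (intro card_mono sub) auto
  also have "\<dots> \<le> (\<Sum>s\<in>{2..<R}. card (?U s))" by (intro card_UN_le) auto
  finally have "real (card {A \<in> ksets V r. v \<in> A \<and> bad_set V R g A}) \<le> (\<Sum>s\<in>{2..<R}. real (card (?U s)))"
    by (simp flip: of_nat_sum)
  also have "\<dots> \<le> (\<Sum>s\<in>{2..<R}. 2 * \<Lambda> * real n powr (real r - 1 - 1 / real R))"
    using trm by (intro sum_mono)
  also have "\<dots> = real (R - 2) * (2 * \<Lambda> * real n powr (real r - 1 - 1 / real R))" by simp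
  also have "\<dots> \<le> real R * (2 * \<Lambda> * real n powr (real r - 1 - 1 / real R))"
    using \<Lambda> by (intro mult_right_mono) auto
  finally show ?thesis by simp
qed

section \<open>Cliques using several planted blocks\<close>

definition second_order :: "'a set \<Rightarrow> nat \<Rightarrow> 'a set set \<Rightarrow> 'a set set \<Rightarrow> bool" where
  "second_order V R g S \<longleftrightarrow> (\<exists>C\<in>ksets V R. all_edges C \<subseteq> g \<union> union_edges S \<and>
      (\<exists>A\<in>S. \<exists>B\<in>S. A \<noteq> B \<and> 2 \<le> card (C \<inter> A) \<and> 2 \<le> card (C \<inter> B)))"

lemma edge_common: "finite C \<Longrightarrow> e \<in> all_edges C \<Longrightarrow> e \<in> all_edges A \<Longrightarrow> 2 \<le> card (C \<inter> A)"
  using card_mono[of "C \<inter> A" e] by (auto simp: all_edges_def)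

text \<open>If only one block contributed edges, it would be a bad set.\<close>

lemma new_clique_cases:
  assumes finV: "finite V" and C: "C \<in> ksets V R" "all_edges C \<subseteq> g \<union> union_edges S" "\<not> all_edges C \<subseteq> g"
    and good: "\<And>A. A \<in> S \<Longrightarrow> \<not> bad_set V R g A"
  shows "C \<in> S \<or> (\<exists>A\<in>S. \<exists>B\<in>S. A \<noteq> B \<and> 2 \<le> card (C \<inter> A) \<and> 2 \<le> card (C \<inter> B))"
proof (rule disjCI)
  assume no: "\<not> (\<exists>A\<in>S. \<exists>B\<in>S. A \<noteq> B \<and> 2 \<le> card (C \<inter> A) \<and> 2 \<le> card (C \<inter> B))"
  have finC: "finite C" using C finV by (auto simp: ksets_def dest: finite_subset)
  obtain e A where A: "e \<in> all_edges C" "e \<notin> g" "A \<in> S" "e \<in> all_edges A"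
    using C by (fastforce simp: union_edges_def)
  have only: "\<not> e' \<in> all_edges B" if "e' \<in> all_edges C" "B \<in> S" "B \<noteq> A" for e' B
    using no edge_common[OF finC] A that by metis
  have "all_edges C \<subseteq> g \<union> all_edges A"
  proof
    fix e' assume e': "e' \<in> all_edges C"
    then have "e' \<in> g \<or> (\<exists>B\<in>S. e' \<in> all_edges B)" using C by (auto simp: union_edges_def)
    then show "e' \<in> g \<union> all_edges A" using only[OF e'] by auto
  qed
  then have "C = A" using good[OF A(3)] C by (auto simp: bad_set_def)
  then show "C \<in> S" using A by simp
qed

definition block_class :: "nat \<Rightarrow> (nat \<Rightarrow> nat) \<Rightarrow> nat \<Rightarrow> nat set" where
  "block_class R \<beta> b = {i. i < R \<and> \<beta> i = b}"

definition large_blocks :: "nat \<Rightarrow> (nat \<Rightarrow> nat) \<Rightarrow> nat set" where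
  "large_blocks R \<beta> = {b. 2 \<le> card (block_class R \<beta> b)}"

lemma finite_block_class [simp]: "finite (block_class R \<beta> b)"
  by (simp add: block_class_def)

lemma large_blocks_sub: "large_blocks R \<beta> \<subseteq> \<beta> ` {..<R}"
proof
  fix b assume "b \<in> large_blocks R \<beta>"
  then have "block_class R \<beta> b \<noteq> {}" by (auto simp: large_blocks_def)
  then show "b \<in> \<beta> ` {..<R}" by (auto simp: block_class_def)
qed

lemma finite_large_blocks [simp]: "finite (large_blocks R \<beta>)"
  by (rule finite_subset[OF large_blocks_sub]) auto

lemma sum_large_blocks:
  "(\<Sum>b\<in>large_blocks R \<beta>. real (card (block_class R \<beta> b)) - 1) = real R - real (card (\<beta> ` {..<R}))"
proof -
  let ?s = "\<lambda>b. card (block_class R \<beta> b)"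
  have "(\<Sum>b\<in>large_blocks R \<beta>. real (?s b) - 1) = (\<Sum>b\<in>\<beta> ` {..<R}. real (?s b) - 1)"
  proof (intro sum.mono_neutral_left ballI)
    fix b assume b: "b \<in> \<beta> ` {..<R} - large_blocks R \<beta>"
    then have "block_class R \<beta> b \<noteq> {}" by (auto simp: block_class_def)
    then have "0 < ?s b" by (simp add: card_gt_0_iff)
    moreover have "?s b < 2" using b by (simp add: large_blocks_def)
    ultimately have "?s b = 1" by linarith
    then show "real (?s b) - 1 = 0" by simp
  qed (use large_blocks_sub in auto)
  also have "\<dots> = real (\<Sum>b\<in>\<beta> ` {..<R}. ?s b) - real (card (\<beta> ` {..<R}))"
    by (simp add: sum_subtractf)
  also have "(\<Sum>b\<in>\<beta> ` {..<R}. ?s b) = card (\<Union>b\<in>\<beta> ` {..<R}. block_class R \<beta> b)"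
    by (subst card_UN_disjoint) (auto simp: block_class_def)
  also have "(\<Union>b\<in>\<beta> ` {..<R}. block_class R \<beta> b) = {..<R}" by (auto simp: block_class_def)
  finally show ?thesis by simp
qed

text \<open>Two positions are in the same class if their vertices lie in one block of \<open>S\<close>; each
  class is named by its least position so that \<open>\<beta>\<close> maps into \<open>{..<R}\<close>.
  Large classes determine their blocks \<open>f b\<close>, which are distinct as the blocks are
  disjoint.\<close>

lemma second_order_pattern:
  assumes finV: "finite V" and so: "second_order V R g S"
    and disj: "\<forall>A\<in>S. \<forall>B\<in>S. A \<noteq> B \<longrightarrow> A \<inter> B = {}"
  shows "\<exists>\<beta> x f. \<beta> \<in> {..<R} \<rightarrow>\<^sub>E {..<R} \<and> 2 \<le> card (large_blocks R \<beta>) \<and> x \<in> inj_tuples V R \<and> cross R \<beta> x \<subseteq> g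
     \<and> f \<in> large_blocks R \<beta> \<rightarrow>\<^sub>E S \<and> inj_on f (large_blocks R \<beta>) \<and>
     (\<forall>b\<in>large_blocks R \<beta>. x ` block_class R \<beta> b \<subseteq> f b)"
proof -
  have dis: "A \<inter> B = {}" if "A \<in> S" "B \<in> S" "A \<noteq> B" for A B using disj that by blast
  obtain C A0 B0 where C: "C \<in> ksets V R" "all_edges C \<subseteq> g \<union> union_edges S"
    and AB: "A0 \<in> S" "B0 \<in> S" "A0 \<noteq> B0" "2 \<le> card (C \<inter> A0)" "2 \<le> card (C \<inter> B0)"
    using so by (auto simp: second_order_def)
  have finC: "finite C" "card C = R" "C \<subseteq> V" using C finV by (auto simp: ksets_def dest: finite_subset)
  have "C \<inter> A0 \<noteq> {}" using AB(4) by auto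
  then obtain v where "v \<in> C" by auto
  then obtain x where x: "x \<in> inj_tuples V R" "x ` {..<R} = C"
    using enum_with_block[of C R "{v}" v 1 V] finC by auto
  have inj: "inj_on x {..<R}" using x by (simp add: inj_tuples_def)
  define rel where "rel = (\<lambda>i j. i = j \<or> (\<exists>A\<in>S. x i \<in> A \<and> x j \<in> A))"
  have sym: "rel i j \<Longrightarrow> rel j i" for i j by (auto simp: rel_def)
  have same: "A = B" if "A \<in> S" "B \<in> S" "y \<in> A" "y \<in> B" for A B y using dis that by blast
  have trans: "rel i j \<Longrightarrow> rel j k \<Longrightarrow> rel i k" for i j k
    unfolding rel_def using same by metis
  define \<beta> where "\<beta> = (\<lambda>i. if i < R then LEAST j. rel i j else undefined)"
  have \<beta>rel: "rel i (\<beta> i)" "\<beta> i \<le> i" if "i < R" for i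
    using that LeastI[of "rel i" i] Least_le[of "rel i" i] by (auto simp: \<beta>_def rel_def)
  have \<beta>eq: "\<beta> i = \<beta> j \<longleftrightarrow> rel i j" if "i < R" "j < R" for i j
  proof
    assume "\<beta> i = \<beta> j"
    then show "rel i j" using \<beta>rel(1)[OF that(1)] \<beta>rel(1)[OF that(2)] sym trans by metis
  next
    assume "rel i j"
    then have "rel i = rel j" using sym trans by (intro ext) metis
    then show "\<beta> i = \<beta> j" using that by (simp add: \<beta>_def)
  qed
  have \<beta>E: "\<beta> \<in> {..<R} \<rightarrow>\<^sub>E {..<R}"
    using \<beta>rel(2) by (auto simp: PiE_iff extensional_def \<beta>_def intro: le_less_trans)
  have cr: "cross R \<beta> x \<subseteq> g"
  proof
    fix e assume "e \<in> cross R \<beta> x"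
    then obtain i j where e: "e = {x i, x j}" "i < R" "j < R" "\<beta> i \<noteq> \<beta> j" by (auto simp: cross_def)
    then have "\<not> rel i j" using \<beta>eq by simp
    then have "x i \<noteq> x j" using inj e by (auto simp: inj_on_def rel_def)
    then have "e \<in> all_edges C" using e x by (auto simp: all_edges_def)
    moreover have "e \<notin> union_edges S" using \<open>\<not> rel i j\<close> e by (auto simp: union_edges_def all_edges_def rel_def)
    ultimately show "e \<in> g" using C by auto
  qed
  have cls: "\<exists>b. block_class R \<beta> b = {i. i < R \<and> x i \<in> A} \<and> b \<in> large_blocks R \<beta>"
    if A: "A \<in> S" "2 \<le> card (C \<inter> A)" for A
  proof -
    have img: "x ` {i. i < R \<and> x i \<in> A} = C \<inter> A" using x(2) by auto
    have "card (C \<inter> A) = card {i. i < R \<and> x i \<in> A}"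
      unfolding img[symmetric] by (intro card_image inj_on_subset[OF inj]) auto
    then have c2: "2 \<le> card {i. i < R \<and> x i \<in> A}" using A by simp
    then have "{i. i < R \<and> x i \<in> A} \<noteq> {}" by (metis card.empty not_numeral_le_zero)
    then obtain i where i: "i < R" "x i \<in> A" by auto
    have reli: "rel j i \<longleftrightarrow> x j \<in> A" for j using i A(1) same by (auto simp: rel_def)
    have cl: "\<beta> j = \<beta> i \<longleftrightarrow> x j \<in> A" if "j < R" for j using \<beta>eq[OF that i(1)] reli by simp
    have "j \<in> block_class R \<beta> (\<beta> i) \<longleftrightarrow> j \<in> {i. i < R \<and> x i \<in> A}" for j
      unfolding block_class_def mem_Collect_eq using cl[of j] by argo
    then have "block_class R \<beta> (\<beta> i) = {i. i < R \<and> x i \<in> A}" by (rule set_eqI)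
    then show ?thesis using c2 by (auto simp: large_blocks_def)
  qed
  have "2 \<le> card (large_blocks R \<beta>)"
  proof -
    obtain a where a: "block_class R \<beta> a = {i. i < R \<and> x i \<in> A0}" "a \<in> large_blocks R \<beta>"
      using cls[OF AB(1,4)] by blast
    obtain b where b: "block_class R \<beta> b = {i. i < R \<and> x i \<in> B0}" "b \<in> large_blocks R \<beta>"
      using cls[OF AB(2,5)] by blast
    have "a \<noteq> b"
    proof
      assume "a = b"
      then have "block_class R \<beta> a = {}" using a b dis[OF AB(1,2,3)] by auto
      then show False using a(2) by (simp add: large_blocks_def)
    qed
    then have "card {a, b} = 2" by simp
    then show ?thesis using a b card_mono[of "large_blocks R \<beta>" "{a, b}"] by simp
  qed
  moreover have "\<exists>A\<in>S. x ` block_class R \<beta> b \<subseteq> A" if b: "b \<in> large_blocks R \<beta>" for b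
  proof -
    have "\<exists>i j. i \<noteq> j \<and> i \<in> block_class R \<beta> b \<and> j \<in> block_class R \<beta> b"
      using b card_le_Suc0_iff_eq[of "block_class R \<beta> b"] by (auto simp: large_blocks_def) 
    then obtain i j where ij: "i \<noteq> j" "i < R" "j < R" "\<beta> i = b" "\<beta> j = b" by (auto simp: block_class_def)
    then have "rel i j" using \<beta>eq[of i j] by simp
    then obtain A where A: "A \<in> S" "x i \<in> A" using ij by (auto simp: rel_def)
    have "x k \<in> A" if "k < R" "\<beta> k = b" for k
      using \<beta>eq[of k i] that ij A same by (auto simp: rel_def)
    then show ?thesis using A by (auto simp: block_class_def)
  qed
  then obtain f0 where f0: "\<And>b. b \<in> large_blocks R \<beta> \<Longrightarrow> f0 b \<in> S \<and> x ` block_class R \<beta> b \<subseteq> f0 b"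
    by metis
  define f where "f = restrict f0 (large_blocks R \<beta>)"
  have "f \<in> large_blocks R \<beta> \<rightarrow>\<^sub>E S" using f0 by (auto simp: f_def)
  moreover have "inj_on f (large_blocks R \<beta>)"
  proof (rule inj_onI)
    fix a b assume ab: "a \<in> large_blocks R \<beta>" "b \<in> large_blocks R \<beta>" "f a = f b"
    then obtain i j where ij: "i < R" "\<beta> i = a" "j < R" "\<beta> j = b"
      using large_blocks_sub by blast
    have "x i \<in> f a" "x j \<in> f b" using f0 ab ij by (auto simp: f_def block_class_def)
    then have "rel i j" using f0 ab by (auto simp: rel_def f_def)
    then have "\<beta> i = \<beta> j" using \<beta>eq[OF ij(1) ij(3)] by simp
    then show "a = b" using ij by simp
  qed
  moreover have "\<forall>b\<in>large_blocks R \<beta>. x ` block_class R \<beta> b \<subseteq> f b" using f0 by (auto simp: f_def)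
  ultimately show ?thesis using \<beta>E cr x(1) by blast
qed

text \<open>First moment over a spread family: a copy of the pattern needs blocks through its large classes. For
  a class of size \<open>s\<close> there are \<open>n^(r-s)\<close> such blocks, each present in a
  share \<open>C0 / n^(r-1)\<close>, which gives \<open>n^(1-s)\<close>; over all large classes this
  is \<open>n\<close> to the number of classes minus \<open>R\<close>, the inverse of the
  normalisation of the pattern counts.\<close>

lemma second_order_fraction:
  fixes C0 \<delta> :: real and PP :: "'a set set set"
  assumes finV: "finite V" and n: "card V = n" "0 < n" and r: "0 < r"
    and PP: "finite PP" "\<And>S. S \<in> PP \<Longrightarrow> S \<subseteq> ksets V r"
      "\<And>S A B. S \<in> PP \<Longrightarrow> A \<in> S \<Longrightarrow> B \<in> S \<Longrightarrow> A \<noteq> B \<Longrightarrow> A \<inter> B = {}"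
    and C0: "1 \<le> C0" and spread: "\<And>F. real (card {S \<in> PP. F \<subseteq> S}) \<le> (C0 / real n ^ (r - 1)) ^ card F * real (card PP)"
    and \<delta>: "0 \<le> \<delta>" and cnt: "\<And>\<beta>. \<beta> \<in> {..<R} \<rightarrow>\<^sub>E {..<R} \<Longrightarrow> 2 \<le> card (large_blocks R \<beta>) \<Longrightarrow>
        real (pattern_count V R \<beta> g) \<le> \<delta> * real n powr (real R - real (card (\<beta> ` {..<R})))"
  shows "real (card {S \<in> PP. second_order V R g S}) \<le> (real R * C0) ^ R * \<delta> * real (card PP)"
proof -
  define BB where "BB = {\<beta> \<in> {..<R} \<rightarrow>\<^sub>E {..<R}. 2 \<le> card (large_blocks R \<beta>)}"
  define XX where "XX = (\<lambda>\<beta>. {x \<in> inj_tuples V R. cross R \<beta> x \<subseteq> g})"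
  define FF where "FF = (\<lambda>\<beta> x. PiE (large_blocks R \<beta>) (\<lambda>b. {A \<in> ksets V r. x ` block_class R \<beta> b \<subseteq> A}))"
  define FI where "FI = (\<lambda>\<beta> x. {f \<in> FF \<beta> x. inj_on f (large_blocks R \<beta>)})"
  let ?SS = "\<lambda>\<beta> x f. {S \<in> PP. f ` large_blocks R \<beta> \<subseteq> S}"
  have n0: "0 < real n" using n by simp
  have finFF: "finite (FF \<beta> x)" for \<beta> x unfolding FF_def using finV by (intro finite_PiE) auto
  have fin: "finite BB" "finite (XX \<beta>)" "finite (FI \<beta> x)" for \<beta> x
    using finV finFF by (auto simp: BB_def XX_def FI_def intro!: finite_subset[of BB "{..<R} \<rightarrow>\<^sub>E {..<R}"] finite_PiE)
  have sub: "{S \<in> PP. second_order V R g S} \<subseteq> (\<Union>\<beta>\<in>BB. \<Union>x\<in>XX \<beta>. \<Union>f\<in>FI \<beta> x. ?SS \<beta> x f)"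
  proof
    fix S assume "S \<in> {S \<in> PP. second_order V R g S}"
    then have S: "S \<in> PP" "second_order V R g S" by auto
    obtain \<beta> x f where *: "\<beta> \<in> {..<R} \<rightarrow>\<^sub>E {..<R} \<and> 2 \<le> card (large_blocks R \<beta>) \<and> x \<in> inj_tuples V R \<and> cross R \<beta> x \<subseteq> g
     \<and> f \<in> large_blocks R \<beta> \<rightarrow>\<^sub>E S \<and> inj_on f (large_blocks R \<beta>) \<and>
     (\<forall>b\<in>large_blocks R \<beta>. x ` block_class R \<beta> b \<subseteq> f b)"
      using second_order_pattern[OF finV S(2)] PP(3)[OF S(1)] by (metis (no_types, lifting))
    then have "f \<in> FI \<beta> x" using PP(2)[OF S(1)] by (auto simp: FI_def FF_def PiE_iff)
    moreover have "\<beta> \<in> BB" "x \<in> XX \<beta>" using * by (auto simp: BB_def XX_def)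
    moreover have "S \<in> ?SS \<beta> x f" using * S by (auto simp: PiE_iff)
    ultimately show "S \<in> (\<Union>\<beta>\<in>BB. \<Union>x\<in>XX \<beta>. \<Union>f\<in>FI \<beta> x. ?SS \<beta> x f)" by blast
  qed
  have fbound: "real (card (\<Union>f\<in>FI \<beta> x. ?SS \<beta> x f)) \<le> C0 ^ R * real n powr (- (real R - real (card (\<beta> ` {..<R})))) * real (card PP)"
    if \<beta>: "\<beta> \<in> BB" and x: "x \<in> XX \<beta>" for \<beta> x
  proof -
    let ?L = "large_blocks R \<beta>" and ?s = "\<lambda>b. card (block_class R \<beta> b)"
    have inj: "inj_on x {..<R}" "x ` {..<R} \<subseteq> V" using x by (auto simp: XX_def inj_tuples_def PiE_iff)
    have "card (\<Union>f\<in>FI \<beta> x. ?SS \<beta> x f) \<le> (\<Sum>f\<in>FI \<beta> x. card (?SS \<beta> x f))"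
      using fin by (intro card_UN_le)
    then have "real (card (\<Union>f\<in>FI \<beta> x. ?SS \<beta> x f)) \<le> (\<Sum>f\<in>FI \<beta> x. real (card (?SS \<beta> x f)))"
      unfolding of_nat_sum[symmetric] by (rule of_nat_mono)
    also have "\<dots> \<le> (\<Sum>f\<in>FI \<beta> x. (C0 / real n ^ (r - 1)) ^ card ?L * real (card PP))"
    proof (rule sum_mono)
      fix f assume "f \<in> FI \<beta> x"
      then have "card (f ` ?L) = card ?L" by (auto simp: FI_def card_image)
      then show "real (card (?SS \<beta> x f)) \<le> (C0 / real n ^ (r - 1)) ^ card ?L * real (card PP)"
        using spread[of "f ` ?L"] by simp
    qed
    also have "\<dots> = real (card (FI \<beta> x)) * ((C0 / real n ^ (r - 1)) ^ card ?L * real (card PP))" by simp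
    also have "\<dots> \<le> (\<Prod>b\<in>?L. real n powr (real r - real (?s b))) * ((C0 / real n ^ (r - 1)) ^ card ?L * real (card PP))"
    proof (intro mult_right_mono)
      have "real (card (FI \<beta> x)) \<le> real (card (FF \<beta> x))"
        using finFF by (intro of_nat_mono card_mono) (auto simp: FI_def)
      also have "\<dots> = (\<Prod>b\<in>?L. real (card {A \<in> ksets V r. x ` block_class R \<beta> b \<subseteq> A}))"
        unfolding FF_def by (subst card_PiE) auto
      also have "\<dots> \<le> (\<Prod>b\<in>?L. real n powr (real r - real (?s b)))"
      proof (intro prod_mono conjI)
        fix b
        have sub: "block_class R \<beta> b \<subseteq> {..<R}" by (auto simp: block_class_def)
        have "card (x ` block_class R \<beta> b) = ?s b"
          by (intro card_image inj_on_subset[OF inj(1) sub])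
        moreover have "x ` block_class R \<beta> b \<subseteq> V" using inj(2) sub by blast
        ultimately show "real (card {A \<in> ksets V r. x ` block_class R \<beta> b \<subseteq> A}) \<le> real n powr (real r - real (?s b))"
          using card_ksets_containing[OF finV, of "x ` block_class R \<beta> b" r] n by simp
      qed auto
      finally show "real (card (FI \<beta> x)) \<le> (\<Prod>b\<in>?L. real n powr (real r - real (?s b)))" .
    qed (use C0 in auto)
    also have "\<dots> = (\<Prod>b\<in>?L. real n powr (real r - real (?s b)) * (C0 / real n ^ (r - 1))) * real (card PP)"
      unfolding prod.distrib prod_constant mult.assoc ..
    also have "(\<Prod>b\<in>?L. real n powr (real r - real (?s b)) * (C0 / real n ^ (r - 1))) = (\<Prod>b\<in>?L. C0 * real n powr (- (real (?s b) - 1)))"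
    proof (intro prod.cong refl)
      fix b
      have "real n ^ (r - 1) = real n powr (real r - 1)"
        using n0 r by (simp add: powr_realpow[symmetric] of_nat_diff)
      then have "real n powr (real r - real (?s b)) * (C0 / real n ^ (r - 1)) = C0 * (real n powr (real r - real (?s b)) / real n powr (real r - 1))"
        by simp
      also have "\<dots> = C0 * real n powr (- (real (?s b) - 1))" unfolding powr_diff[symmetric] by simp
      finally show "real n powr (real r - real (?s b)) * (C0 / real n ^ (r - 1)) = C0 * real n powr (- (real (?s b) - 1))" .
    qed
    also have "\<dots> = C0 ^ card ?L * real n powr (\<Sum>b\<in>?L. - (real (?s b) - 1))"
      using n0 by (simp add: prod.distrib powr_sum)
    also have "(\<Sum>b\<in>?L. - (real (?s b) - 1)) = - (real R - real (card (\<beta> ` {..<R})))"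
      using sum_large_blocks[of R \<beta>] by (simp only: sum_negf)
    also have "C0 ^ card ?L * real n powr - (real R - real (card (\<beta> ` {..<R}))) * real (card PP)
       \<le> C0 ^ R * real n powr - (real R - real (card (\<beta> ` {..<R}))) * real (card PP)"
    proof (intro mult_right_mono power_increasing)
      have "card ?L \<le> card (\<beta> ` {..<R})" using large_blocks_sub by (intro card_mono) auto
      also have "\<dots> \<le> R" using card_image_le[of "{..<R}" \<beta>] by simp
      finally show "card ?L \<le> R" .
    qed (use C0 in auto)
    finally show ?thesis .
  qed
  have "card {S \<in> PP. second_order V R g S} \<le> card (\<Union>\<beta>\<in>BB. \<Union>x\<in>XX \<beta>. \<Union>f\<in>FI \<beta> x. ?SS \<beta> x f)"
    using PP(1) fin by (intro card_mono sub) auto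
  also have "\<dots> \<le> (\<Sum>\<beta>\<in>BB. \<Sum>x\<in>XX \<beta>. card (\<Union>f\<in>FI \<beta> x. ?SS \<beta> x f))"
    using fin by (intro order.trans[OF card_UN_le] sum_mono card_UN_le)
  finally have "real (card {S \<in> PP. second_order V R g S})
     \<le> (\<Sum>\<beta>\<in>BB. \<Sum>x\<in>XX \<beta>. real (card (\<Union>f\<in>FI \<beta> x. ?SS \<beta> x f)))"
    unfolding of_nat_sum[symmetric] by (rule of_nat_mono)
  also have "\<dots> \<le> (\<Sum>\<beta>\<in>BB. \<Sum>x\<in>XX \<beta>. C0 ^ R * real n powr (- (real R - real (card (\<beta> ` {..<R})))) * real (card PP))"
    using fbound by (intro sum_mono)
  also have "\<dots> = (\<Sum>\<beta>\<in>BB. real (pattern_count V R \<beta> g) * (C0 ^ R * real n powr (- (real R - real (card (\<beta> ` {..<R})))) * real (card PP)))"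
    by (simp add: XX_def pattern_count_def)
  also have "\<dots> \<le> (\<Sum>\<beta>\<in>BB. \<delta> * real n powr (real R - real (card (\<beta> ` {..<R}))) * (C0 ^ R * real n powr (- (real R - real (card (\<beta> ` {..<R})))) * real (card PP)))"
    using cnt C0 by (intro sum_mono mult_right_mono) (auto simp: BB_def)
  also have "\<dots> = (\<Sum>\<beta>\<in>BB. \<delta> * C0 ^ R * real (card PP))"
  proof (intro sum.cong refl)
    fix \<beta> 
    let ?e = "real R - real (card (\<beta> ` {..<R}))"
    have "real n powr ?e * real n powr (- ?e) = real n powr (?e + - ?e)" by (rule powr_add[symmetric])
    then have "real n powr ?e * real n powr (- ?e) = 1" using n0 by simp
    then show "\<delta> * real n powr ?e * (C0 ^ R * real n powr - ?e * real (card PP)) = \<delta> * C0 ^ R * real (card PP)"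
      by (metis (no_types, lifting) mult.assoc mult.commute mult.left_commute mult_1)
  qed
  also have "\<dots> = real (card BB) * (\<delta> * C0 ^ R * real (card PP))" by simp
  also have "\<dots> \<le> real (R ^ R) * (\<delta> * C0 ^ R * real (card PP))"
  proof (intro mult_right_mono of_nat_mono)
    have "card BB \<le> card ({..<R} \<rightarrow>\<^sub>E {..<R})" by (intro card_mono finite_PiE) (auto simp: BB_def)
    then show "card BB \<le> R ^ R" by (simp add: card_PiE)
  qed (use \<delta> C0 in auto)
  also have "\<dots> = (real R * C0) ^ R * \<delta> * real (card PP)" by (simp add: power_mult_distrib)
  finally show ?thesis .
qed

section \<open>Links between blocks of size four\<close>

definition joins :: "'a set \<Rightarrow> 'a set \<Rightarrow> 'a set set" where
  "joins I J = {{i, j} | i j. i \<in> I \<and> j \<in> J}"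

text \<open>The case \<open>r = 4\<close> is critical: at edge probability \<open>n^(-1/2)\<close> the expected
  number of four-cliques that use two planted blocks is of constant order, up to logarithms. They
  cannot be excluded and are only shown to be few at every block.\<close>

definition linked :: "'a set set \<Rightarrow> 'a set \<Rightarrow> 'a set \<Rightarrow> bool" where
  "linked g A B \<longleftrightarrow> (\<exists>I\<in>ksets A 2. \<exists>J\<in>ksets B 2. joins I J \<subseteq> g)"

text \<open>The threshold 7 is large enough for \<open>n^8\<close> choices of eight disjoint blocks, weighted by
  their spread, to be beaten by the probability \<open>n^(-14)\<close> of 28 edges.\<close>

definition many_links :: "'a set set \<Rightarrow> 'a set set \<Rightarrow> bool" where
  "many_links g S \<longleftrightarrow> (\<exists>A\<in>S. 7 \<le> card {B \<in> S. B \<noteq> A \<and> linked g A B})"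

text \<open>A side clique consists of two vertices from each of two linked blocks: at most 6 partners for each
  block, and \<open>8 choose 4 = 70\<close> four-sets in the union of two blocks.\<close>

lemma side_cliques_linked:
  assumes finV: "finite V" and S: "S \<subseteq> ksets V 4" "\<And>A B. A \<in> S \<Longrightarrow> B \<in> S \<Longrightarrow> A \<noteq> B \<Longrightarrow> A \<inter> B = {}"
    and few: "\<not> many_links g S" and good: "\<And>A. A \<in> S \<Longrightarrow> \<not> bad_set V 4 g A" and F: "F \<subseteq> S"
  shows "card (side_cliques V 4 g F) \<le> 420 * card F"
proof -
  have finS: "finite S" using S finV finite_subset by (metis finite_ksets)
  have finF: "finite F" using F finS finite_subset by blast
  let ?L = "\<lambda>A. {B \<in> S. B \<noteq> A \<and> linked g A B}"
  have sub: "side_cliques V 4 g F \<subseteq> (\<Union>A\<in>F. \<Union>B\<in>?L A. ksets (A \<union> B) 4)"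
  proof
    fix C assume C: "C \<in> side_cliques V 4 g F"
    then have C': "C \<in> ksets V 4" "all_edges C \<subseteq> g \<union> union_edges F" "\<not> all_edges C \<subseteq> g" "C \<notin> F"
      by (auto simp: side_cliques_def)
    have finC: "finite C" "card C = 4" using C' finV by (auto simp: ksets_def dest: finite_subset)
    obtain A B where AB: "A \<in> F" "B \<in> F" "A \<noteq> B" "2 \<le> card (C \<inter> A)" "2 \<le> card (C \<inter> B)"
      using new_clique_cases[OF finV C'(1,2,3)] good F C'(4) by blast
    have dis: "A \<inter> B = {}" using S(2)[of A B] AB F by auto
    have "card (C \<inter> A \<union> C \<inter> B) = card (C \<inter> A) + card (C \<inter> B)"
      using dis finC by (intro card_Un_disjoint) auto
    moreover have "card (C \<inter> A \<union> C \<inter> B) \<le> card C" using finC by (intro card_mono) auto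
    ultimately have c2: "card (C \<inter> A) = 2" "card (C \<inter> B) = 2" and "card (C \<inter> A \<union> C \<inter> B) = card C"
      using AB finC by auto
    then have CAB: "C \<inter> A \<union> C \<inter> B = C" using finC by (intro card_subset_eq) auto
    have "joins (C \<inter> A) (C \<inter> B) \<subseteq> g"
    proof
      fix e assume "e \<in> joins (C \<inter> A) (C \<inter> B)"
      then obtain i j where e: "e = {i, j}" "i \<in> C" "i \<in> A" "j \<in> C" "j \<in> B" by (auto simp: joins_def)
      moreover have "i \<noteq> j" using e dis by auto
      ultimately have "e \<in> all_edges C" by (auto simp: all_edges_def)
      moreover have "e \<notin> all_edges D" if "D \<in> F" for D
      proof
        assume "e \<in> all_edges D"
        then have "i \<in> D" "j \<in> D" using e by (auto simp: all_edges_def)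
        then have "D = A" "D = B" using S(2)[of D A] S(2)[of D B] that AB F e by auto
        then show False using AB by simp
      qed
      ultimately show "e \<in> g" using C' by (auto simp: union_edges_def)
    qed
    moreover have "C \<inter> A \<in> ksets A 2" "C \<inter> B \<in> ksets B 2" using c2 by (auto simp: ksets_def)
    ultimately have "linked g A B" unfolding linked_def by blast
    moreover have "C \<in> ksets (A \<union> B) 4" using CAB finC by (auto simp: ksets_def)
    moreover have "B \<in> S" using AB F by auto
    ultimately show "C \<in> (\<Union>A\<in>F. \<Union>B\<in>?L A. ksets (A \<union> B) 4)" using AB by blast
  qed
  have fin4: "finite A" "card A = 4" if "A \<in> S" for A
    using that S finV by (auto simp: ksets_def dest: finite_subset)
  have inner: "card (\<Union>B\<in>?L A. ksets (A \<union> B) 4) \<le> 420" if A: "A \<in> F" for A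
  proof -
    have "card (\<Union>B\<in>?L A. ksets (A \<union> B) 4) \<le> (\<Sum>B\<in>?L A. card (ksets (A \<union> B) 4))"
      using finS by (intro card_UN_le) auto
    also have "\<dots> \<le> (\<Sum>B\<in>?L A. 70)"
    proof (rule sum_mono)
      fix B assume B: "B \<in> ?L A"
      have AS: "A \<in> S" using A F by auto
      have "card (A \<union> B) \<le> 8" using card_Un_le[of A B] fin4[of A] fin4[of B] B AS by auto
      then have "card (ksets (A \<union> B) 4) \<le> 8 choose 4"
        using fin4[of A] fin4[of B] B AS by (subst card_ksets) (auto intro: binomial_right_mono)
      also have "8 choose 4 = (70::nat)" by code_simp
      finally show "card (ksets (A \<union> B) 4) \<le> 70" .
    qed
    also have "\<dots> \<le> 6 * 70"
    proof -
      have "card (?L A) \<le> 6" using few A F by (force simp: many_links_def)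
      then show ?thesis by simp
    qed
    finally show ?thesis by simp
  qed
  have "card (side_cliques V 4 g F) \<le> card (\<Union>A\<in>F. \<Union>B\<in>?L A. ksets (A \<union> B) 4)"
    using finF finS fin4 F by (intro card_mono sub finite_UN_I finite_ksets finite_UnI) auto
  also have "\<dots> \<le> (\<Sum>A\<in>F. card (\<Union>B\<in>?L A. ksets (A \<union> B) 4))" using finF by (intro card_UN_le)
  also have "\<dots> \<le> (\<Sum>A\<in>F. 420)" using inner by (intro sum_mono)
  finally show ?thesis by simp
qed

lemma card_joins:
  assumes "I \<inter> J = {}" "card I = 2" "card J = 2"
  shows "card (joins I J) = 4"
proof -
  have fin: "finite I" "finite J" using assms by (auto intro: card_ge_0_finite)
  have "joins I J = (\<lambda>(i, j). {i, j}) ` (I \<times> J)" by (auto simp: joins_def)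
  moreover have "inj_on (\<lambda>(i, j). {i, j}) (I \<times> J)"
    using assms(1) by (auto simp: inj_on_def doubleton_eq_iff)
  ultimately show ?thesis using assms fin by (simp add: card_image card_cartesian_product)
qed

text \<open>There are 36 ways to choose the four edges of each link, and the links use disjoint sets of edges.\<close>

lemma linked_prob:
  fixes p q :: real
  assumes finV: "finite V" and p: "0 \<le> p" "p \<le> 1" "0 \<le> q" "q \<le> 1"
    and A: "A \<in> ksets V 4" and BB: "BB \<subseteq> ksets V 4" "card BB = 7"
      "\<And>B. B \<in> BB \<Longrightarrow> A \<inter> B = {}" "\<And>B C. B \<in> BB \<Longrightarrow> C \<in> BB \<Longrightarrow> B \<noteq> C \<Longrightarrow> B \<inter> C = {}"
  shows "expct (rsub (all_edges V) p) (\<lambda>g. expct (rsub (all_edges V) q) (\<lambda>h. of_bool (\<forall>B\<in>BB. linked (g \<inter> h) A B)))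
     \<le> 36 ^ 7 * (p * q) ^ 28"
proof -
  let ?E = "all_edges V"
  define CH where "CH = PiE BB (\<lambda>B. ksets A 2 \<times> ksets B 2)"
  define UU where "UU = (\<lambda>\<phi> :: 'a set \<Rightarrow> 'a set \<times> 'a set. \<Union>B\<in>BB. joins (fst (\<phi> B)) (snd (\<phi> B)))"
  have finBB: "finite BB" using BB(2) by (intro card_ge_0_finite) simp
  have f4: "finite B" "card B = 4" "B \<subseteq> V" if "B \<in> insert A BB" for B
    using that A BB finV by (auto simp: ksets_def dest: finite_subset)
  have finCH: "finite CH" unfolding CH_def using finBB f4 by (intro finite_PiE) auto
  have cCH: "card CH = 36 ^ 7"
  proof -
    have "card (ksets A 2 \<times> ksets B 2) = 36" if "B \<in> BB" for B
    proof -
      have "4 choose 2 = (6::nat)" by code_simp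
      then show ?thesis using f4[of A] f4[of B] that by (simp add: card_cartesian_product card_ksets)
    qed
    then show ?thesis unfolding CH_def using finBB BB(2) by (simp add: card_PiE)
  qed
  have \<phi>: "fst (\<phi> B) \<in> ksets A 2" "snd (\<phi> B) \<in> ksets B 2" if "\<phi> \<in> CH" "B \<in> BB" for \<phi> B
    using PiE_mem[OF that(1)[unfolded CH_def] that(2)] by auto
  have UE: "UU \<phi> \<subseteq> ?E" if "\<phi> \<in> CH" for \<phi>
  proof
    fix e assume "e \<in> UU \<phi>"
    then obtain B i j where B: "B \<in> BB" "e = {i, j}" "i \<in> fst (\<phi> B)" "j \<in> snd (\<phi> B)" by (auto simp: UU_def joins_def)
    then have "i \<in> A" "j \<in> B" using \<phi>[OF that B(1)] by (auto simp: ksets_def)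
    moreover have "i \<noteq> j" using calculation BB(3)[OF B(1)] by auto
    ultimately show "e \<in> ?E" using B f4(3)[of A] f4(3)[of B] by (auto simp: all_edges_def)
  qed
  have cU: "card (UU \<phi>) = 28" if \<phi>': "\<phi> \<in> CH" for \<phi>
  proof -
    have sub: "fst (\<phi> B) \<subseteq> A" "snd (\<phi> B) \<subseteq> B" "card (fst (\<phi> B)) = 2" "card (snd (\<phi> B)) = 2" if "B \<in> BB" for B
      using \<phi>[OF \<phi>' that] by (auto simp: ksets_def)
    have c4: "card (joins (fst (\<phi> B)) (snd (\<phi> B))) = 4" if "B \<in> BB" for B
      using sub[OF that] BB(3)[OF that] by (intro card_joins) auto
    have "card (UU \<phi>) = (\<Sum>B\<in>BB. card (joins (fst (\<phi> B)) (snd (\<phi> B))))"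
      unfolding UU_def
    proof (rule card_UN_disjoint[OF finBB])
      show "\<forall>B\<in>BB. finite (joins (fst (\<phi> B)) (snd (\<phi> B)))" using c4 by (auto intro: card_ge_0_finite)
      show "\<forall>B\<in>BB. \<forall>C\<in>BB. B \<noteq> C \<longrightarrow> joins (fst (\<phi> B)) (snd (\<phi> B)) \<inter> joins (fst (\<phi> C)) (snd (\<phi> C)) = {}"
      proof (intro ballI impI)
        fix B C assume BC: "B \<in> BB" "C \<in> BB" "B \<noteq> C"
        have False if m: "e \<in> joins (fst (\<phi> B)) (snd (\<phi> B))" "e \<in> joins (fst (\<phi> C)) (snd (\<phi> C))" for e
        proof -
          obtain i j where e: "e = {i, j}" "i \<in> A" "j \<in> B" using m(1) sub[OF BC(1)] by (auto simp: joins_def)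
          obtain i' j' where e': "e = {i', j'}" "i' \<in> A" "j' \<in> C" using m(2) sub[OF BC(2)] by (auto simp: joins_def)
          show False using e e' BB(3)[OF BC(1)] BB(3)[OF BC(2)] BB(4)[OF BC] by (auto simp: doubleton_eq_iff)
        qed
        then show "joins (fst (\<phi> B)) (snd (\<phi> B)) \<inter> joins (fst (\<phi> C)) (snd (\<phi> C)) = {}" by blast
      qed
    qed
    also have "\<dots> = (\<Sum>B\<in>BB. 4)" using c4 by (intro sum.cong) auto
    finally show ?thesis using BB(2) by simp
  qed
  have point: "of_bool (\<forall>B\<in>BB. linked g A B) \<le> (\<Sum>\<phi>\<in>CH. of_bool (UU \<phi> \<subseteq> g) :: real)" for g
  proof (cases "\<forall>B\<in>BB. linked g A B")
    case True
    then have "\<exists>IJ. fst IJ \<in> ksets A 2 \<and> snd IJ \<in> ksets B 2 \<and> joins (fst IJ) (snd IJ) \<subseteq> g" if "B \<in> BB" for B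
      using that by (force simp: linked_def)
    then obtain \<phi>0 where \<phi>0: "\<And>B. B \<in> BB \<Longrightarrow> fst (\<phi>0 B) \<in> ksets A 2 \<and> snd (\<phi>0 B) \<in> ksets B 2 \<and> joins (fst (\<phi>0 B)) (snd (\<phi>0 B)) \<subseteq> g"
      by metis
    have "restrict \<phi>0 BB \<in> CH" unfolding CH_def using \<phi>0 by (auto simp: mem_Times_iff)
    moreover have "UU (restrict \<phi>0 BB) \<subseteq> g" using \<phi>0 by (auto simp: UU_def)
    ultimately have "(\<Sum>\<phi>\<in>{restrict \<phi>0 BB}. 1) \<le> (\<Sum>\<phi>\<in>CH. of_bool (UU \<phi> \<subseteq> g) :: real)"
      using finCH by (intro order.trans[OF _ sum_mono2[of CH "{restrict \<phi>0 BB}"]]) auto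
    then show ?thesis using True by simp
  qed (auto intro!: sum_nonneg)
  have "expct (rsub ?E p) (\<lambda>g. expct (rsub ?E q) (\<lambda>h. of_bool (\<forall>B\<in>BB. linked (g \<inter> h) A B)))
     \<le> expct (rsub ?E p) (\<lambda>g. expct (rsub ?E q) (\<lambda>h. \<Sum>\<phi>\<in>CH. of_bool (UU \<phi> \<subseteq> g) * (of_bool (UU \<phi> \<subseteq> h) :: real)))"
  proof (intro expct_mono)
    fix g h
    have "(of_bool (UU \<phi> \<subseteq> g \<inter> h) :: real) = of_bool (UU \<phi> \<subseteq> g) * of_bool (UU \<phi> \<subseteq> h)" for \<phi> by auto
    then show "of_bool (\<forall>B\<in>BB. linked (g \<inter> h) A B) \<le> (\<Sum>\<phi>\<in>CH. of_bool (UU \<phi> \<subseteq> g) * of_bool (UU \<phi> \<subseteq> h) :: real)"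
      using point[of "g \<inter> h"] by simp
  qed (use finV in auto)
  also have "\<dots> = (\<Sum>\<phi>\<in>CH. expct (rsub ?E p) (\<lambda>g. of_bool (UU \<phi> \<subseteq> g)) * expct (rsub ?E q) (\<lambda>h. of_bool (UU \<phi> \<subseteq> h)))"
    using finV by (simp add: expct_sum)
  also have "\<dots> = (\<Sum>\<phi>\<in>CH. p ^ 28 * q ^ 28)"
    using rsub_contains[of ?E _ p] rsub_contains[of ?E _ q] finV p UE cU by (intro sum.cong) auto
  also have "\<dots> = 36 ^ 7 * (p * q) ^ 28" using cCH by (simp add: power_mult_distrib)
  finally show ?thesis .
qed

lemma many_links_fraction:
  fixes p q \<sigma> :: real and PP :: "'a set set \<Rightarrow> 'a set set \<Rightarrow> 'a set set set"
  assumes finV: "finite V" and p: "0 \<le> p" "p \<le> 1" "0 \<le> q" "q \<le> 1" and \<sigma>: "0 \<le> \<sigma>"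
    and PP: "\<And>g h. finite (PP g h)" "\<And>g h S. S \<in> PP g h \<Longrightarrow> S \<subseteq> ksets V 4"
      "\<And>g h S A B. S \<in> PP g h \<Longrightarrow> A \<in> S \<Longrightarrow> B \<in> S \<Longrightarrow> A \<noteq> B \<Longrightarrow> A \<inter> B = {}"
    and spread: "\<And>g h F. real (card {S \<in> PP g h. F \<subseteq> S}) \<le> \<sigma> ^ card F * real (card (PP g h))"
  shows "expct (rsub (all_edges V) p) (\<lambda>g. expct (rsub (all_edges V) q) (\<lambda>h.
        real (card {S \<in> PP g h. many_links (g \<inter> h) S}) / real (card (PP g h))))
     \<le> (real (card V) ^ 4 * \<sigma>) ^ 8 * (36 ^ 7 * (p * q) ^ 28)"
proof -
  let ?E = "all_edges V" and ?K = "ksets V 4" and ?n = "real (card V)"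
  define TT where "TT = {(A, BB). A \<in> ?K \<and> BB \<subseteq> ?K \<and> card BB = 7 \<and> (\<forall>B\<in>BB. A \<inter> B = {}) \<and> (\<forall>B\<in>BB. \<forall>C\<in>BB. B \<noteq> C \<longrightarrow> B \<inter> C = {})}"
  have TTsub: "TT \<subseteq> ?K \<times> {BB. BB \<subseteq> ?K \<and> card BB = 7}" by (auto simp: TT_def)
  have finTT: "finite TT" by (rule finite_subset[OF TTsub]) (use finV in \<open>auto intro!: finite_cartesian_product\<close>)
  have cK: "card ?K \<le> card V ^ 4"
    using finV by (cases "4 \<le> card V") (auto simp: card_ksets binomial_le_pow binomial_eq_0)
  have cTT: "real (card TT) \<le> (?n ^ 4) ^ 8"
  proof -
    have "card TT \<le> card (?K \<times> {BB. BB \<subseteq> ?K \<and> card BB = 7})"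
      using finV by (intro card_mono TTsub) (auto intro!: finite_cartesian_product)
    also have "\<dots> = card ?K * (card ?K choose 7)" using finV by (simp add: card_cartesian_product n_subsets)
    also have "\<dots> \<le> card ?K * card ?K ^ 7"
      by (cases "7 \<le> card ?K") (auto simp: binomial_le_pow binomial_eq_0)
    also have "\<dots> = card ?K ^ 8" by (simp flip: power_Suc)
    also have "\<dots> \<le> (card V ^ 4) ^ 8" using cK by (rule power_mono) simp
    finally have "real (card TT) \<le> real ((card V ^ 4) ^ 8)" by (rule of_nat_mono)
    then show ?thesis by simp
  qed
  have point: "real (card {S \<in> PP g h. many_links (g \<inter> h) S}) / real (card (PP g h))
     \<le> (\<Sum>t\<in>TT. \<sigma> ^ 8 * of_bool (\<forall>B\<in>snd t. linked (g \<inter> h) (fst t) B))" for g h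
  proof -
    let ?l = "\<lambda>t. \<forall>B\<in>snd t. linked (g \<inter> h) (fst t) B"
    let ?F = "\<lambda>t. insert (fst t) (snd t)"
    have "{S \<in> PP g h. many_links (g \<inter> h) S} \<subseteq> (\<Union>t\<in>{t \<in> TT. ?l t}. {S \<in> PP g h. ?F t \<subseteq> S})"
    proof
      fix S assume "S \<in> {S \<in> PP g h. many_links (g \<inter> h) S}"
      then have S: "S \<in> PP g h" "many_links (g \<inter> h) S" by auto
      then obtain A where A: "A \<in> S" "7 \<le> card {B \<in> S. B \<noteq> A \<and> linked (g \<inter> h) A B}" by (auto simp: many_links_def)
      obtain BB where BB: "BB \<subseteq> {B \<in> S. B \<noteq> A \<and> linked (g \<inter> h) A B}" "card BB = 7"
        by (rule obtain_subset_with_card_n[OF A(2)]) (rule that)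
      have BBS: "B \<in> S" "B \<noteq> A" if "B \<in> BB" for B using BB(1) that by auto
      have "(A, BB) \<in> TT"
        unfolding TT_def mem_Collect_eq prod.case
      proof (intro conjI ballI impI)
        show "A \<in> ?K" "BB \<subseteq> ?K" using PP(2)[OF S(1)] A(1) BBS(1) by auto
        show "A \<inter> B = {}" if "B \<in> BB" for B using PP(3)[OF S(1) A(1) BBS(1)[OF that]] BBS(2)[OF that] by metis
        show "B \<inter> C = {}" if "B \<in> BB" "C \<in> BB" "B \<noteq> C" for B C
          using PP(3)[OF S(1) BBS(1)[OF that(1)] BBS(1)[OF that(2)] that(3)] .
      qed (rule BB(2))
      moreover have "?l (A, BB)" "?F (A, BB) \<subseteq> S" using BB A by auto
      ultimately show "S \<in> (\<Union>t\<in>{t \<in> TT. ?l t}. {S \<in> PP g h. ?F t \<subseteq> S})" using S by blast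
    qed
    then have "card {S \<in> PP g h. many_links (g \<inter> h) S} \<le> card (\<Union>t\<in>{t \<in> TT. ?l t}. {S \<in> PP g h. ?F t \<subseteq> S})"
      using finTT PP(1) by (intro card_mono) auto
    also have "\<dots> \<le> (\<Sum>t\<in>{t \<in> TT. ?l t}. card {S \<in> PP g h. ?F t \<subseteq> S})"
      using finTT by (intro card_UN_le) auto
    finally have "real (card {S \<in> PP g h. many_links (g \<inter> h) S}) \<le> (\<Sum>t\<in>{t \<in> TT. ?l t}. real (card {S \<in> PP g h. ?F t \<subseteq> S}))"
      unfolding of_nat_sum[symmetric] by (rule of_nat_mono)
    also have "\<dots> \<le> (\<Sum>t\<in>{t \<in> TT. ?l t}. \<sigma> ^ 8 * real (card (PP g h)))"
    proof (rule sum_mono)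
      fix t assume t: "t \<in> {t \<in> TT. ?l t}"
      then have "fst t \<notin> snd t" 
      proof -
        have "card (fst t) = 4" "\<forall>B\<in>snd t. fst t \<inter> B = {}"
          using t unfolding TT_def ksets_def by (simp_all add: case_prod_beta)
        then show ?thesis by (metis Int_absorb card.empty zero_neq_numeral)
      qed
      moreover have "card (snd t) = 7" using t by (auto simp: TT_def)
      ultimately have "card (?F t) = 8" using card_ge_0_finite[of "snd t"] by simp
      then show "real (card {S \<in> PP g h. ?F t \<subseteq> S}) \<le> \<sigma> ^ 8 * real (card (PP g h))"
        using spread[of g h "?F t"] by simp
    qed
    also have "\<dots> = (\<Sum>t\<in>{t \<in> TT. ?l t}. \<sigma> ^ 8 * of_bool (?l t)) * real (card (PP g h))"
      by (simp add: sum_distrib_right)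
    also have "(\<Sum>t\<in>{t \<in> TT. ?l t}. \<sigma> ^ 8 * of_bool (?l t)) \<le> (\<Sum>t\<in>TT. \<sigma> ^ 8 * of_bool (?l t))"
      using finTT \<sigma> by (intro sum_mono2) auto
    finally have "real (card {S \<in> PP g h. many_links (g \<inter> h) S}) \<le> (\<Sum>t\<in>TT. \<sigma> ^ 8 * of_bool (?l t)) * real (card (PP g h))"
      by (simp add: mult_right_mono)
    moreover have "0 \<le> (\<Sum>t\<in>TT. \<sigma> ^ 8 * of_bool (?l t))" using \<sigma> by (intro sum_nonneg) auto
    ultimately show ?thesis by (cases "card (PP g h) = 0") (auto simp: field_simps)
  qed
  have "expct (rsub ?E p) (\<lambda>g. expct (rsub ?E q) (\<lambda>h. real (card {S \<in> PP g h. many_links (g \<inter> h) S}) / real (card (PP g h))))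
     \<le> expct (rsub ?E p) (\<lambda>g. expct (rsub ?E q) (\<lambda>h. \<Sum>t\<in>TT. \<sigma> ^ 8 * of_bool (\<forall>B\<in>snd t. linked (g \<inter> h) (fst t) B)))"
    using finV point by (intro expct_mono) auto
  also have "\<dots> = (\<Sum>t\<in>TT. \<sigma> ^ 8 * expct (rsub ?E p) (\<lambda>g. expct (rsub ?E q) (\<lambda>h. of_bool (\<forall>B\<in>snd t. linked (g \<inter> h) (fst t) B))))"
    using finV by (simp add: expct_sum)
  also have "\<dots> \<le> (\<Sum>t\<in>TT. \<sigma> ^ 8 * (36 ^ 7 * (p * q) ^ 28))"
  proof (intro sum_mono mult_left_mono)
    fix t assume t: "t \<in> TT"
    show "expct (rsub ?E p) (\<lambda>g. expct (rsub ?E q) (\<lambda>h. of_bool (\<forall>B\<in>snd t. linked (g \<inter> h) (fst t) B))) \<le> 36 ^ 7 * (p * q) ^ 28"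
    proof (rule linked_prob[OF finV p])
      have T: "fst t \<in> ?K" "snd t \<subseteq> ?K" "card (snd t) = 7" "\<forall>B\<in>snd t. fst t \<inter> B = {}"
          "\<forall>B\<in>snd t. \<forall>C\<in>snd t. B \<noteq> C \<longrightarrow> B \<inter> C = {}"
        using t unfolding TT_def by (simp_all add: case_prod_beta)
      show "fst t \<in> ?K" "snd t \<subseteq> ?K" "card (snd t) = 7" using T by auto
      show "fst t \<inter> B = {}" if "B \<in> snd t" for B using T(4) that by blast
      show "B \<inter> C = {}" if "B \<in> snd t" "C \<in> snd t" "B \<noteq> C" for B C using T(5) that by blast
    qed
  qed (use \<sigma> in auto)
  also have "\<dots> = real (card TT) * (\<sigma> ^ 8 * (36 ^ 7 * (p * q) ^ 28))" by simp
  also have "\<dots> \<le> (?n ^ 4) ^ 8 * (\<sigma> ^ 8 * (36 ^ 7 * (p * q) ^ 28))"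
    using cTT \<sigma> p by (intro mult_right_mono) auto
  also have "\<dots> = (?n ^ 4 * \<sigma>) ^ 8 * (36 ^ 7 * (p * q) ^ 28)" by (simp only: power_mult_distrib mult.assoc)
  finally show ?thesis .
qed

section \<open>The core and its clean partitions\<close>

lemma rsub_Int:
  assumes "finite E" "0 \<le> p" "p \<le> 1" "0 \<le> q" "q \<le> 1"
  shows "expct (rsub E p) (\<lambda>g. expct (rsub E q) (\<lambda>h. f (g \<inter> h))) = expct (rsub E (p * q)) f"
  using assms(1)
proof (induction E arbitrary: f)
  case (insert e E)
  have pq: "0 \<le> p * q" "p * q \<le> 1" using assms by (auto simp: mult_le_one)
  have ins: "expct (rsub (insert e E) t) u = t *\<^sub>R expct (rsub E t) (\<lambda>y. u (insert e y)) + (1 - t) *\<^sub>R expct (rsub E t) u"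
    if "0 \<le> t" "t \<le> 1" for t and u :: "_ \<Rightarrow> 'b"
    using insert.hyps that by (subst rsub_split[of _ "{e}"]) (auto simp: rsub_singleton)
  have eE: "e \<notin> y" if "y \<in> set_pmf (rsub E t)" for y t using rsub_sub[OF that] insert.hyps by auto
  let ?a = "expct (rsub E (p * q)) (\<lambda>y. f (insert e y))" and ?b = "expct (rsub E (p * q)) f"
  have 1: "expct (rsub (insert e E) q) (\<lambda>h. f (insert e g \<inter> h))
      = q *\<^sub>R expct (rsub E q) (\<lambda>h. f (insert e (g \<inter> h))) + (1 - q) *\<^sub>R expct (rsub E q) (\<lambda>h. f (g \<inter> h))" for g
    using ins[of q "\<lambda>h. f (insert e g \<inter> h)"] assms eE
    by (simp add: Int_insert_left_if0 Int_insert_left_if1 eE cong: expct_cong)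
  have 2: "expct (rsub (insert e E) q) (\<lambda>h. f (g \<inter> h)) = expct (rsub E q) (\<lambda>h. f (g \<inter> h))" if "e \<notin> g" for g
    using ins[of q "\<lambda>h. f (g \<inter> h)"] assms that by (simp add: scaleR_left_distrib[symmetric])
  have "expct (rsub (insert e E) p) (\<lambda>g. expct (rsub (insert e E) q) (\<lambda>h. f (g \<inter> h)))
     = p *\<^sub>R expct (rsub E p) (\<lambda>g. q *\<^sub>R expct (rsub E q) (\<lambda>h. f (insert e (g \<inter> h))) + (1 - q) *\<^sub>R expct (rsub E q) (\<lambda>h. f (g \<inter> h)))
      + (1 - p) *\<^sub>R expct (rsub E p) (\<lambda>g. expct (rsub E q) (\<lambda>h. f (g \<inter> h)))"
    unfolding ins[OF assms(2,3)] 1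
    by (intro arg_cong2[where f = plus] refl arg_cong[where f = "scaleR (1 - p)"] expct_cong 2) (auto dest: eE)
  also have "\<dots> = p *\<^sub>R (q *\<^sub>R ?a + (1 - q) *\<^sub>R ?b) + (1 - p) *\<^sub>R ?b"
    using insert.hyps insert.IH[of f] insert.IH[of "\<lambda>y. f (insert e y)"] by (simp add: expct_add)
  also have "\<dots> = (p * q) *\<^sub>R ?a + (1 - p * q) *\<^sub>R ?b" by (simp add: algebra_simps)
  also have "\<dots> = expct (rsub (insert e E) (p * q)) f" using ins[OF pq] by simp
  finally show ?case .
qed simp

lemma colour_distribution:
  assumes "0 < m"
  shows "\<exists>\<kappa> :: nat pmf. finite (set_pmf \<kappa>) \<and> 1 / 2 \<le> pmf \<kappa> m \<and> (\<forall>i<m. 1 / (2 * real m) \<le> pmf \<kappa> i)"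
proof -
  let ?f = "\<lambda>k. if k < m then k else m"
  let ?\<kappa> = "map_pmf ?f (pmf_of_set {..<2 * m})"
  have "0 \<in> {..<2 * m}" using assms by simp
  then have ne: "{..<2 * m} \<noteq> {}" by blast
  have "pmf ?\<kappa> i = real (card ({..<2 * m} \<inter> ?f -` {i})) / (2 * real m)" for i
    using ne by (simp add: pmf_map measure_pmf_of_set)
  moreover have "{..<2 * m} \<inter> ?f -` {m} = {m..<2 * m}" by (auto split: if_splits)
  moreover have "{..<2 * m} \<inter> ?f -` {i} = {i}" if "i < m" for i using that by (auto split: if_splits)
  ultimately have "pmf ?\<kappa> m = 1 / 2" "\<forall>i<m. pmf ?\<kappa> i = 1 / (2 * real m)" using assms by auto
  then show ?thesis using ne by (intro exI[of _ ?\<kappa>]) auto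
qed

definition cliques :: "'a set \<Rightarrow> nat \<Rightarrow> 'a set set \<Rightarrow> 'a set set" where
  "cliques V s g = {C \<in> ksets V s. all_edges C \<subseteq> g}"

definition is_packing :: "'a set set \<Rightarrow> 'a set set \<Rightarrow> bool" where
  "is_packing Z P \<longleftrightarrow> P \<subseteq> Z \<and> disjoint P"

definition packing_number :: "'a set set \<Rightarrow> nat" where
  "packing_number Z = Max (card ` {P. is_packing Z P})"

definition max_packing :: "'a set set \<Rightarrow> 'a set set" where
  "max_packing Z = (SOME P. is_packing Z P \<and> card P = packing_number Z)"

lemma finite_packings: "finite Z \<Longrightarrow> finite {P. is_packing Z P}"
  by (rule finite_subset[of _ "Pow Z"]) (auto simp: is_packing_def)

lemma packing_number_ge: "finite Z \<Longrightarrow> is_packing Z P \<Longrightarrow> card P \<le> packing_number Z"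
  unfolding packing_number_def using finite_packings[of Z] by (intro Max_ge) auto

lemma max_packing: 
  assumes "finite Z"
  shows "is_packing Z (max_packing Z)" "card (max_packing Z) = packing_number Z"
proof -
  have "is_packing Z {}" by (simp add: is_packing_def)
  then have "packing_number Z \<in> card ` {P. is_packing Z P}"
    unfolding packing_number_def using finite_packings[OF assms] by (intro Max_in) auto
  then have "\<exists>P. is_packing Z P \<and> card P = packing_number Z" by auto
  then show "is_packing Z (max_packing Z)" "card (max_packing Z) = packing_number Z"
    unfolding max_packing_def by (metis (mono_tags, lifting) someI_ex)+
qed

definition residual :: "'a set \<Rightarrow> nat \<Rightarrow> 'a set set \<Rightarrow> 'a set" where
  "residual V r g = V - \<Union>(max_packing (cliques V (r + 1) g))"

text \<open>A largest subset of the residual set whose size is divisible by \<open>r\<close>. It depends on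
  \<open>g\<close> only through the \<open>(r+1)\<close>-cliques, which makes it stable under planting
  that creates none of these.\<close>

definition core :: "'a set \<Rightarrow> nat \<Rightarrow> 'a set set \<Rightarrow> 'a set" where
  "core V r g = (SOME U. U \<subseteq> residual V r g \<and> card U = r * (card (residual V r g) div r))"

lemma core:
  shows "core V r g \<subseteq> residual V r g" "card (core V r g) = r * (card (residual V r g) div r)"
proof -
  have "\<exists>U. U \<subseteq> residual V r g \<and> card U = r * (card (residual V r g) div r)"
    using obtain_subset_with_card_n[of "r * (card (residual V r g) div r)" "residual V r g"]
    by (metis times_div_less_eq_dividend)
  then show "core V r g \<subseteq> residual V r g" "card (core V r g) = r * (card (residual V r g) div r)"
    unfolding core_def by (metis (mono_tags, lifting) someI_ex)+
qed

lemma core_sub: "core V r g \<subseteq> V"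
  using core(1)[of V r g] by (auto simp: residual_def)

lemma core_cong: "cliques V (r + 1) g = cliques V (r + 1) g' \<Longrightarrow> core V r g = core V r g'"
  by (simp add: core_def residual_def)

definition allowed :: "'a set \<Rightarrow> nat \<Rightarrow> 'a set set \<Rightarrow> 'a set set \<Rightarrow> 'a set set" where
  "allowed V r g h = {A \<in> ksets V r. \<not> bad_set V (r + 1) g A \<and> \<not> bad_set V r (g \<inter> h) A}"

text \<open>The event on which the switching bounds apply.\<close>

definition few_bad :: "'a set \<Rightarrow> nat \<Rightarrow> nat \<Rightarrow> 'a set set \<Rightarrow> 'a set set \<Rightarrow> bool" where
  "few_bad V r \<beta> g h \<longleftrightarrow> card V \<le> 2 * card (core V r g) \<and>
     (\<forall>v\<in>V. card {A \<in> ksets V r. v \<in> A \<and> A \<notin> allowed V r g h} \<le> \<beta>)"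

definition factors :: "'a set \<Rightarrow> nat \<Rightarrow> nat \<Rightarrow> 'a set set \<Rightarrow> 'a set set \<Rightarrow> 'a set set set" where
  "factors V r \<beta> g h = (if few_bad V r \<beta> g h then pms r (core V r g) (allowed V r g h) {} else {})"

definition clean :: "'a set \<Rightarrow> nat \<Rightarrow> 'a set set \<Rightarrow> 'a set set \<Rightarrow> 'a set set \<Rightarrow> bool" where
  "clean V r g h S \<longleftrightarrow> \<not> second_order V (r + 1) g S \<and>
     (if r = 4 then \<not> many_links (g \<inter> h) S else \<not> second_order V r (g \<inter> h) S)"

text \<open>The family is used only if clean partitions are at least half of all, because then it inherits the
  spread of the full family up to a factor 2; otherwise it is set to be empty, and this case is
  treated as a failure.\<close>

definition clean_factors :: "'a set \<Rightarrow> nat \<Rightarrow> nat \<Rightarrow> 'a set set \<Rightarrow> 'a set set \<Rightarrow> 'a set set set" where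
  "clean_factors V r \<beta> g h = (let T = {S \<in> factors V r \<beta> g h. clean V r g h S} in
      if card (factors V r \<beta> g h) \<le> 2 * card T then T else {})"

definition factor_const :: "nat \<Rightarrow> real" where
  "factor_const r = spread_const r * (2 * real r) ^ (r - 1)"

context
  fixes V :: "'a set" and r n \<beta> M0 :: nat
  assumes finV: "finite V" and n: "card V = n" and r2: "2 \<le> r"
    and M0: "r \<le> M0" "M0 < n div (2 * r)"
    and few: "n ^ ((r - 1) * M0) \<le> 2 ^ (n div (2 * r) - M0)"
    and large: "2 * r ^ (r + 1) * \<beta> < (M0 div r) ^ (r - 1)"
begin

lemma factors_props:
  assumes "S \<in> factors V r \<beta> g h"
  shows "pm r (core V r g) S" "S \<subseteq> ksets V r" "S \<subseteq> allowed V r g h"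
    "\<And>A B. A \<in> S \<Longrightarrow> B \<in> S \<Longrightarrow> A \<noteq> B \<Longrightarrow> A \<inter> B = {}"
proof -
  show pm: "pm r (core V r g) S" and "S \<subseteq> allowed V r g h"
    using assms by (auto simp: factors_def pms_def split: if_splits)
  show "S \<subseteq> ksets V r" using pm_ksets[OF pm] core_sub by (fastforce simp: ksets_def)
  show "\<And>A B. A \<in> S \<Longrightarrow> B \<in> S \<Longrightarrow> A \<noteq> B \<Longrightarrow> A \<inter> B = {}" by (rule pm_disjoint[OF pm])
qed

lemma finite_factors: "finite (factors V r \<beta> g h)"
  using finite_pms[of "core V r g" r] finite_subset[OF core_sub finV] by (simp add: factors_def)

lemma few_bad_core:
  assumes "few_bad V r \<beta> g h"
  defines "N \<equiv> card (residual V r g) div r"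
  shows "card (core V r g) = r * N" "n div (2 * r) \<le> N" "N \<le> n" "real n \<le> 2 * real r * real N"
    "\<And>v. v \<in> core V r g \<Longrightarrow> card {A \<in> ksets (core V r g) r. v \<in> A \<and> A \<notin> allowed V r g h} \<le> \<beta>"
proof -
  show cN: "card (core V r g) = r * N" using core(2) by (simp add: N_def)
  have "n \<le> 2 * (r * N)" using assms(1) cN n by (simp add: few_bad_def)
  then show "n div (2 * r) \<le> N" using r2 div_le_mono[of n "2 * r * N" "2 * r"] by simp
  show "real n \<le> 2 * real r * real N"
    using of_nat_mono[OF \<open>n \<le> 2 * (r * N)\<close>, where 'a = real] by simp
  have "r * N \<le> n" using card_mono[OF finV core_sub] cN n by metis
  then show "N \<le> n" using r2 by (metis le_trans mult_le_mono1 nat_mult_1 Suc_1 Suc_leD)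
  show "card {A \<in> ksets (core V r g) r. v \<in> A \<and> A \<notin> allowed V r g h} \<le> \<beta>" if v: "v \<in> core V r g" for v
  proof -
    have "card {A \<in> ksets (core V r g) r. v \<in> A \<and> A \<notin> allowed V r g h} \<le> card {A \<in> ksets V r. v \<in> A \<and> A \<notin> allowed V r g h}"
      using finV core_sub[of V r g] by (intro card_mono) (auto simp: ksets_def)
    also have "\<dots> \<le> \<beta>" using assms(1) v core_sub[of V r g] by (auto simp: few_bad_def)
    finally show ?thesis .
  qed
qed

lemma factors_nonempty: "few_bad V r \<beta> g h \<Longrightarrow> factors V r \<beta> g h \<noteq> {}"
proof -
  assume fb: "few_bad V r \<beta> g h"
  note c = few_bad_core[OF fb]
  let ?N = "card (residual V r g) div r"
  have "M0 \<le> ?N - 1" using M0 c(2) by linarith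
  then have "(M0 div r) ^ (r - 1) \<le> ((?N - 1) div r) ^ (r - 1)" by (intro power_mono div_le_mono) auto
  then have "2 * r ^ (r + 1) * \<beta> < ((?N - 1) div r) ^ (r - 1)" using large by linarith
  then have "pms r (core V r g) (allowed V r g h) {} \<noteq> {}"
    using r2 finite_subset[OF core_sub finV] c by (intro pms_nonempty[where N = ?N and \<beta> = \<beta>]) auto
  then show ?thesis using fb by (simp add: factors_def)
qed

lemma spread_const_ge1: "1 \<le> spread_const r" 
proof -
  have "1 \<le> (4 * real r) ^ (r - 1)" using r2 by (intro one_le_power) auto
  moreover have "(1::real) \<le> 2 ^ (r ^ 3 + 1)" "(1::real) \<le> 3 ^ (r - 1)" by (rule one_le_power, simp)+
  ultimately have "1 * 1 * 1 \<le> 2 ^ (r ^ 3 + 1) * (4 * real r) ^ (r - 1) * 3 ^ (r - 1)" by (intro mult_mono) auto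
  then show ?thesis by (simp add: spread_const_def)
qed

lemma factor_const_ge1: "1 \<le> factor_const r"
proof -
  have "1 \<le> (2 * real r) ^ (r - 1)" using r2 by (intro one_le_power) auto
  then have "1 * 1 \<le> spread_const r * (2 * real r) ^ (r - 1)" using spread_const_ge1 by (intro mult_mono) auto
  then show ?thesis by (simp add: factor_const_def)
qed

lemma n_pos: "0 < n" using M0 by (cases n) auto

lemma factors_spread:
  "real (card {S \<in> factors V r \<beta> g h. F \<subseteq> S}) \<le> (factor_const r / real n ^ (r - 1)) ^ card F * real (card (factors V r \<beta> g h))"
proof (cases "few_bad V r \<beta> g h")
  case True
  note c = few_bad_core[OF True]
  let ?N = "card (residual V r g) div r"
  have N0: "0 < real ?N" using c(2) M0 by simp
  have "?N ^ ((r - 1) * M0) \<le> n ^ ((r - 1) * M0)" using c(3) by (rule power_mono) simp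
  also have "\<dots> \<le> 2 ^ (n div (2 * r) - M0)" by (rule few)
  also have "\<dots> \<le> 2 ^ (?N - M0)" using c(2) by (intro power_increasing) auto
  finally have fewN: "?N ^ ((r - 1) * M0) \<le> 2 ^ (?N - M0)" .
  have "real (card (pms r (core V r g) (allowed V r g h) F)) 
     \<le> (spread_const r / real ?N ^ (r - 1)) ^ card F * real (card (pms r (core V r g) (allowed V r g h) {}))"
    using r2 M0 c large fewN finite_subset[OF core_sub finV] by (intro pms_spread[where ?M0.0 = M0 and \<beta> = \<beta>]) auto
  also have "\<dots> \<le> (factor_const r / real n ^ (r - 1)) ^ card F * real (card (pms r (core V r g) (allowed V r g h) {}))"
  proof (intro mult_right_mono power_mono)
    have "real n ^ (r - 1) \<le> (2 * real r * real ?N) ^ (r - 1)" using c(4) by (intro power_mono) auto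
    then have "real n ^ (r - 1) * spread_const r \<le> (2 * real r) ^ (r - 1) * real ?N ^ (r - 1) * spread_const r"
      using spread_const_ge1 by (intro mult_right_mono) (auto simp: power_mult_distrib)
    then show "spread_const r / real ?N ^ (r - 1) \<le> factor_const r / real n ^ (r - 1)"
      using N0 n_pos by (simp add: factor_const_def field_simps)
  qed (use spread_const_ge1 in auto)
  finally show ?thesis using True by (simp add: factors_def pms_def)
qed (simp add: factors_def)

lemma clean_factors_sub: "S \<in> clean_factors V r \<beta> g h \<Longrightarrow> S \<in> factors V r \<beta> g h \<and> clean V r g h S"
  by (auto simp: clean_factors_def Let_def split: if_splits)

lemma clean_factors_spread:
  "real (card {S \<in> clean_factors V r \<beta> g h. F \<subseteq> S}) \<le> (2 * factor_const r / real n ^ (r - 1)) ^ card F * real (card (clean_factors V r \<beta> g h))"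
proof (cases "clean_factors V r \<beta> g h = {} \<or> card F = 0")
  case True
  then consider "clean_factors V r \<beta> g h = {}" | "F = {}" | "infinite F"
    using card_eq_0_iff[of F] by blast
  then show ?thesis
  proof cases
    case 3
    have "\<not> F \<subseteq> S" if "S \<in> clean_factors V r \<beta> g h" for S
    proof -
      have "S \<subseteq> ksets V r" using clean_factors_sub[OF that] factors_props(2) by blast
      then have "finite S" using finV finite_subset[of S "ksets V r"] by simp
      then show ?thesis using 3 finite_subset by blast
    qed
    then have "{S \<in> clean_factors V r \<beta> g h. F \<subseteq> S} = {}" by blast
    then show ?thesis using factor_const_ge1 by (simp only: card.empty) simp
  qed auto
next
  case False
  let ?\<sigma> = "factor_const r / real n ^ (r - 1)"
  have half: "card (factors V r \<beta> g h) \<le> 2 * card (clean_factors V r \<beta> g h)"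
    using False by (auto simp: clean_factors_def Let_def split: if_splits)
  have "real (card {S \<in> clean_factors V r \<beta> g h. F \<subseteq> S}) \<le> real (card {S \<in> factors V r \<beta> g h. F \<subseteq> S})"
    using finite_factors clean_factors_sub by (intro of_nat_mono card_mono) auto
  also have "\<dots> \<le> ?\<sigma> ^ card F * real (card (factors V r \<beta> g h))" by (rule factors_spread)
  also have "\<dots> \<le> ?\<sigma> ^ card F * (2 * real (card (clean_factors V r \<beta> g h)))"
    using half factor_const_ge1 by (intro mult_left_mono) auto
  also have "\<dots> \<le> ?\<sigma> ^ card F * (2 ^ card F * real (card (clean_factors V r \<beta> g h)))"
  proof (intro mult_left_mono mult_right_mono)
    show "(2::real) \<le> 2 ^ card F" using False power_increasing[of 1 "card F" "2::real"] by simp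
  qed (use factor_const_ge1 in auto)
  also have "\<dots> = (2 * factor_const r / real n ^ (r - 1)) ^ card F * real (card (clean_factors V r \<beta> g h))"
    by (simp add: power_divide power_mult_distrib mult_ac)
  finally show ?thesis .
qed

text \<open>A new \<open>(r+1)\<close>-clique would use two blocks, since allowed blocks create none on their
  own, and clean partitions exclude that. The blocks themselves are too small to be
  \<open>(r+1)\<close>-cliques.\<close>

lemma clean_stable:
  assumes S: "S \<in> clean_factors V r \<beta> g h" and F: "F \<subseteq> S"
  shows "core V r (g \<union> union_edges F) = core V r g"
proof (rule core_cong)
  have S': "S \<in> factors V r \<beta> g h" "clean V r g h S" using clean_factors_sub[OF S] by auto
  have good: "\<not> bad_set V (r + 1) g A" if "A \<in> S" for A
    using factors_props(3)[OF S'(1)] that by (auto simp: allowed_def)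
  have "all_edges C \<subseteq> g" if C: "C \<in> ksets V (r + 1)" "all_edges C \<subseteq> g \<union> union_edges F" for C
  proof (rule ccontr)
    assume nC: "\<not> all_edges C \<subseteq> g"
    have sub: "all_edges C \<subseteq> g \<union> union_edges S" using C(2) union_edges_mono[OF F] by blast
    have "C \<notin> S"
    proof
      assume "C \<in> S"
      then have "card C = r" using factors_props(2)[OF S'(1)] by (auto simp: ksets_def)
      then show False using C(1) by (simp add: ksets_def)
    qed
    then have "\<exists>A\<in>S. \<exists>B\<in>S. A \<noteq> B \<and> 2 \<le> card (C \<inter> A) \<and> 2 \<le> card (C \<inter> B)"
      using new_clique_cases[OF finV C(1) sub nC good] by blast
    then have "second_order V (r + 1) g S"
      unfolding second_order_def using C(1) sub by blast
    then show False using S'(2) by (simp add: clean_def)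
  qed
  then show "cliques V (r + 1) (g \<union> union_edges F) = cliques V (r + 1) g" by (auto simp: cliques_def)
qed

lemma clean_sides:
  assumes S: "S \<in> clean_factors V r \<beta> g h" and F: "F \<subseteq> S"
  shows "card (side_cliques V r (g \<inter> h) F) \<le> 420 * card F"
proof -
  have S': "S \<in> factors V r \<beta> g h" "clean V r g h S" using clean_factors_sub[OF S] by auto
  have good: "\<not> bad_set V r (g \<inter> h) A" if "A \<in> S" for A
    using factors_props(3)[OF S'(1)] that by (auto simp: allowed_def)
  show ?thesis
  proof (cases "r = 4")
    case True
    have "\<not> many_links (g \<inter> h) S" using S'(2) True by (simp add: clean_def)
    then show ?thesis using side_cliques_linked[OF finV _ _ _ _ F] factors_props[OF S'(1)] good True by simp
  next
    case False
    have "side_cliques V r (g \<inter> h) F = {}"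
    proof (rule ccontr)
      assume "side_cliques V r (g \<inter> h) F \<noteq> {}"
      then obtain C where C: "C \<in> ksets V r" "all_edges C \<subseteq> (g \<inter> h) \<union> union_edges F" "\<not> all_edges C \<subseteq> g \<inter> h" "C \<notin> F"
        by (auto simp: side_cliques_def)
      have goodF: "\<not> bad_set V r (g \<inter> h) A" if "A \<in> F" for A using good F that by auto
      have "\<exists>A\<in>F. \<exists>B\<in>F. A \<noteq> B \<and> 2 \<le> card (C \<inter> A) \<and> 2 \<le> card (C \<inter> B)"
        using new_clique_cases[OF finV C(1,2,3) goodF] C(4) by blast
      then have "second_order V r (g \<inter> h) S"
        using C(1,2) F union_edges_mono[OF F] unfolding second_order_def by (intro bexI[of _ C]) blast+
      then show False using S'(2) False by (simp add: clean_def)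
    qed
    then show ?thesis by simp
  qed
qed

lemma clean_encoding:
  assumes "0 < m" "0 < p" "p \<le> 1" "0 < q" "q \<le> 1"
    "finite (set_pmf \<kappa>)" "1 / 2 \<le> pmf \<kappa> m" "\<And>i. i < m \<Longrightarrow> 1 / (2 * real m) \<le> pmf \<kappa> i"
  shows "encoding V r m 420 p q (2 * factor_const r / real n ^ (r - 1)) \<kappa> (core V r) (clean_factors V r \<beta>)"
proof
  show "0 \<le> 2 * factor_const r / real n ^ (r - 1)" using factor_const_ge1 by simp
  show "pm r (core V r g) S" if "S \<in> clean_factors V r \<beta> g h" for g h S
    using clean_factors_sub[OF that] factors_props by blast
  show "core V r g \<subseteq> V" for g by (rule core_sub)
qed (use assms finV r2 clean_factors_spread clean_stable clean_sides in auto)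

lemma clean_factors_empty:
  assumes "clean_factors V r \<beta> g h = {}" "few_bad V r \<beta> g h"
  shows "1 / 4 \<le> real (card {S \<in> factors V r \<beta> g h. second_order V (r + 1) g S}) / real (card (factors V r \<beta> g h)) \<or>
    1 / 4 \<le> real (card {S \<in> factors V r \<beta> g h. if r = 4 then many_links (g \<inter> h) S else second_order V r (g \<inter> h) S}) / real (card (factors V r \<beta> g h))"
proof -
  let ?P = "factors V r \<beta> g h"
  let ?A = "{S \<in> ?P. second_order V (r + 1) g S}"
  let ?B = "{S \<in> ?P. if r = 4 then many_links (g \<inter> h) S else second_order V r (g \<inter> h) S}"
  let ?T = "{S \<in> ?P. clean V r g h S}"
  have c0: "0 < card ?P" using factors_nonempty[OF assms(2)] finite_factors by (simp add: card_gt_0_iff)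
  have "2 * card ?T < card ?P"
  proof (rule ccontr)
    assume "\<not> 2 * card ?T < card ?P"
    then have "?T = {}" using assms(1) by (simp add: clean_factors_def Let_def)
    then have "card ?T = 0" by (simp only: card.empty)
    then show False using c0 \<open>\<not> 2 * card ?T < card ?P\<close> by simp
  qed
  moreover have "card ?P \<le> card ?T + (card ?A + card ?B)"
  proof -
    have "?P \<subseteq> ?T \<union> (?A \<union> ?B)" by (auto simp: clean_def)
    then have "card ?P \<le> card (?T \<union> (?A \<union> ?B))" using finite_factors by (intro card_mono) auto
    also have "\<dots> \<le> card ?T + card (?A \<union> ?B)" by (rule card_Un_le)
    also have "card (?A \<union> ?B) \<le> card ?A + card ?B" by (rule card_Un_le)
    finally show ?thesis by simp
  qed
  ultimately have "card ?P \<le> 4 * card ?A \<or> card ?P \<le> 4 * card ?B" by linarith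
  then have "real (card ?P) \<le> 4 * real (card ?A) \<or> real (card ?P) \<le> 4 * real (card ?B)" by linarith
  then show ?thesis using c0 by (simp add: field_simps)
qed

end

section \<open>Tail bounds for pattern counts\<close>

definition defect :: "nat \<Rightarrow> (nat \<Rightarrow> nat) \<Rightarrow> real" where
  "defect R \<beta> = (\<Sum>b\<in>\<beta> ` {..<R}. (real (card (block_class R \<beta> b)) - 1) * (real R - real (card (block_class R \<beta> b))))"

lemma card_block_class_bounds:
  assumes "b \<in> \<beta> ` {..<R}" shows "1 \<le> card (block_class R \<beta> b)" "card (block_class R \<beta> b) \<le> R"
proof -
  have "block_class R \<beta> b \<noteq> {}" using assms by (auto simp: block_class_def)
  then show "1 \<le> card (block_class R \<beta> b)" by (simp add: Suc_leI card_gt_0_iff)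
  have "card (block_class R \<beta> b) \<le> card {..<R}" by (intro card_mono) (auto simp: block_class_def)
  then show "card (block_class R \<beta> b) \<le> R" by simp
qed

lemma defect_ge:
  assumes "B \<subseteq> \<beta> ` {..<R}"
  shows "(\<Sum>b\<in>B. (real (card (block_class R \<beta> b)) - 1) * (real R - real (card (block_class R \<beta> b)))) \<le> defect R \<beta>"
  unfolding defect_def using assms card_block_class_bounds[of _ \<beta> R]
  by (intro sum_mono2) (auto intro!: mult_nonneg_nonneg)

text \<open>At most \<open>k\<close> copies of a pattern use fewer than \<open>u\<close> vertices. The bound
  \<open>Yb\<close> absorbs powers of \<open>y\<close>, which may be polylogarithmic instead of small.\<close>

context
  fixes V :: "'a set" and R n k u :: nat and p y Yb :: real
  assumes finV: "finite V" and n: "card V = n" "0 < n" and R: "0 < R" and p: "0 \<le> p" "p \<le> 1"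
    and y: "0 \<le> y" "p \<le> y * real n powr (- 2 / real R)"
    and Yb: "1 \<le> Yb" "\<And>D. D \<le> R ^ 2 \<Longrightarrow> y ^ D \<le> Yb" and u: "u = R * k + 1"
begin

lemma u_pos: "1 \<le> real u" using u by simp

text \<open>Restates \<open>pattern_exponent\<close> for the actual edge probability \<open>p \<le> y
  n^(-2/R)\<close>; each new edge contributes a factor \<open>y\<close>.\<close>

lemma pattern_term:
  assumes P: "P \<subseteq> {..<R}"
  shows "real n ^ (R - card P) * p ^ card (new_pairs R \<beta> P)
     \<le> y ^ card (new_pairs R \<beta> P) * real n powr (real R - real (card (\<beta> ` {..<R})) + (if P = {} then 1 else 0) - defect R \<beta> / real R)"
proof -
  let ?D = "card (new_pairs R \<beta> P)" and ?l = "card (\<beta> ` {..<R})"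
  have cP: "card P \<le> R" using P card_mono[of "{..<R}" P] by simp
  have n0: "0 < real n" "1 \<le> real n" using n by auto
  have R0: "0 < real R" using R by simp
  have Z: "real_of_int (\<Sum>b\<in>\<beta> ` {..<R}. (int (card {i. i < R \<and> \<beta> i = b}) - 1) * (int R - int (card {i. i < R \<and> \<beta> i = b}))) = defect R \<beta>"
    by (simp add: defect_def block_class_def)
  have "real_of_int (int R * (int R - int (card P)) - 2 * int ?D)
     \<le> real_of_int (int R * (int R - int ?l) + (if P = {} then int R else 0) - (\<Sum>b\<in>\<beta> ` {..<R}. (int (card {i. i < R \<and> \<beta> i = b}) - 1) * (int R - int (card {i. i < R \<and> \<beta> i = b}))))"
    using pattern_exponent[OF P, of \<beta>] by (simp only: of_int_le_iff)
  then have "real R * (real R - real (card P)) - 2 * real ?D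
     \<le> real R * (real R - real ?l) + (if P = {} then real R else 0) - defect R \<beta>"
    unfolding of_int_diff of_int_add Z by (simp split: if_splits)
  then have "(real R * (real R - real (card P)) - 2 * real ?D) / real R
     \<le> (real R * (real R - real ?l) + (if P = {} then real R else 0) - defect R \<beta>) / real R"
    using R0 by (intro divide_right_mono) auto
  then have ex: "(real R - real (card P)) + (- 2 / real R) * real ?D
     \<le> real R - real ?l + (if P = {} then 1 else 0) - defect R \<beta> / real R"
    using R0 by (simp add: field_simps split: if_splits)
  have npow: "real n ^ (R - card P) = real n powr (real R - real (card P))"
    using n0 cP by (simp add: powr_realpow[symmetric] of_nat_diff)
  have "p ^ ?D \<le> (y * real n powr (- 2 / real R)) ^ ?D" using p y by (intro power_mono) auto
  also have "\<dots> = y ^ ?D * real n powr ((- 2 / real R) * real ?D)"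
    using n0 by (simp add: power_mult_distrib powr_realpow[symmetric] powr_powr)
  finally have "real n ^ (R - card P) * p ^ ?D \<le> real n ^ (R - card P) * (y ^ ?D * real n powr ((- 2 / real R) * real ?D))"
    by (intro mult_left_mono) auto
  also have "real n ^ (R - card P) * (y ^ ?D * real n powr ((- 2 / real R) * real ?D))
      = y ^ ?D * real n powr ((real R - real (card P)) + (- 2 / real R) * real ?D)"
    unfolding npow by (simp only: powr_add mult_ac)
  also have "\<dots> \<le> y ^ ?D * real n powr (real R - real ?l + (if P = {} then 1 else 0) - defect R \<beta> / real R)"
    using ex y n0 by (intro mult_left_mono powr_mono) auto
  finally show ?thesis .
qed

lemma card_new_pairs_le: "card (new_pairs R \<beta> P) \<le> R ^ 2"
proof -
  have "card (new_pairs R \<beta> P) \<le> card ({..<R} \<times> {..<R})" by (intro card_mono) (auto simp: new_pairs_def)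
  then show ?thesis by (simp add: power2_eq_square card_cartesian_product)
qed

lemma pattern_term_nonempty:
  assumes P: "P \<subseteq> {..<R}" "P \<noteq> {}"
  shows "real u ^ card P * real n ^ (R - card P) * p ^ card (new_pairs R \<beta> P)
     \<le> real u ^ R * Yb * real n powr (real R - real (card (\<beta> ` {..<R})) - defect R \<beta> / real R)"
proof -
  let ?e = "real R - real (card (\<beta> ` {..<R})) - defect R \<beta> / real R"
  have cP: "card P \<le> R" using P card_mono[of "{..<R}" P] by simp
  have "real n ^ (R - card P) * p ^ card (new_pairs R \<beta> P) \<le> y ^ card (new_pairs R \<beta> P) * real n powr ?e"
    using pattern_term[OF P(1), of \<beta>] P(2) by simp
  also have "\<dots> \<le> Yb * real n powr ?e" using Yb(2)[OF card_new_pairs_le] by (intro mult_right_mono) auto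
  finally have *: "real n ^ (R - card P) * p ^ card (new_pairs R \<beta> P) \<le> Yb * real n powr ?e" .
  have "real u ^ card P \<le> real u ^ R" using cP u by (intro power_increasing) auto
  then have "real u ^ card P * (real n ^ (R - card P) * p ^ card (new_pairs R \<beta> P)) \<le> real u ^ R * (Yb * real n powr ?e)"
    by (rule mult_mono[OF _ *]) (use p in auto)
  then show ?thesis by (simp add: mult_ac)
qed

lemma cross_small: 
  assumes "J \<subseteq> inj_tuples V R" "card J \<le> k"
  shows "finite (\<Union>(\<Union>(cross R \<beta> ` J)))" "card (\<Union>(\<Union>(cross R \<beta> ` J))) < u"
proof -
  have "finite J" using assms(1) finV finite_subset[of J "inj_tuples V R"] by simp
  then show "finite (\<Union>(\<Union>(cross R \<beta> ` J)))" "card (\<Union>(\<Union>(cross R \<beta> ` J))) < u"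
    using card_union_cross[of J k V R \<beta>] assms u by auto
qed

text \<open>The defect \<open>(s - 1) (R - s)\<close> is at least 1, so the rooted count falls short of
  \<open>n^(s-1)\<close> by a factor of about \<open>n^(1/R)\<close>, which is what makes bad sets
  rare. The root counts as a used vertex, hence \<open>P\<close> is never empty.\<close>

lemma rooted_tail:
  assumes s: "s \<in> {2..<R}" and L: "0 < L"
  shows "expct (rsub (all_edges V) p) (\<lambda>g. of_bool (L * (2 ^ R * real u ^ R * Yb * real n powr (real s - 1 - 1 / real R))
       \<le> real (rooted_count V R (block_pattern s) v g))) \<le> (1 / L) ^ k"
proof -
  let ?\<beta> = "block_pattern s" and ?T = "{x \<in> inj_tuples V R. x 0 = v}"
  let ?M = "2 ^ R * real u ^ R * Yb * real n powr (real s - 1 - 1 / real R)"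
  have img: "?\<beta> ` {..<R} = insert 0 {s..<R}"
  proof (intro equalityI subsetI)
    fix b assume "b \<in> insert 0 {s..<R}"
    then show "b \<in> ?\<beta> ` {..<R}" using s
      by (cases "b = 0") (auto simp: block_pattern_def intro!: image_eqI[of _ _ 0] image_eqI[of _ _ b])
  qed (auto simp: block_pattern_def)
  have l: "card (?\<beta> ` {..<R}) = R - s + 1" unfolding img using s by (subst card_insert_disjoint) auto
  have c0: "block_class R ?\<beta> 0 = {..<s}" using s by (auto simp: block_class_def block_pattern_def)
  have "(real s - 1) * (real R - real s) \<le> defect R ?\<beta>"
    using defect_ge[of "{0}" ?\<beta> R] c0 img by simp
  moreover have "1 * 1 \<le> (real s - 1) * (real R - real s)" using s by (intro mult_mono) auto
  ultimately have Z: "1 / real R \<le> defect R ?\<beta> / real R" using R by (intro divide_right_mono) auto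
  have Rl: "real R - real (card (?\<beta> ` {..<R})) = real s - 1" using l s by (simp add: of_nat_diff)
  have M: "(\<Sum>x\<in>?T. p ^ card (cross R ?\<beta> x - \<Union>(cross R ?\<beta> ` J))) \<le> ?M" if J: "J \<subseteq> ?T" "card J \<le> k" for J
  proof -
    have "J \<subseteq> inj_tuples V R" using J by auto
    note sm = cross_small[OF this J(2), of ?\<beta>]
    have "(\<Sum>x\<in>?T. p ^ card (cross R ?\<beta> x - \<Union>(cross R ?\<beta> ` J)))
       \<le> (\<Sum>P\<in>{P. P \<subseteq> {..<R} \<and> 0 \<in> P}. real u ^ card P * real n ^ (R - card P) * p ^ card (new_pairs R ?\<beta> P))"
      using sm n p R by (intro rooted_pattern_sum_le[OF finV]) auto
    also have "\<dots> \<le> (\<Sum>P\<in>{P. P \<subseteq> {..<R} \<and> 0 \<in> P}. real u ^ R * Yb * real n powr (real s - 1 - 1 / real R))"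
    proof (rule sum_mono)
      fix P assume P: "P \<in> {P. P \<subseteq> {..<R} \<and> 0 \<in> P}"
      have "real u ^ card P * real n ^ (R - card P) * p ^ card (new_pairs R ?\<beta> P)
         \<le> real u ^ R * Yb * real n powr (real s - 1 - defect R ?\<beta> / real R)"
        using pattern_term_nonempty[of P ?\<beta>] P Rl by auto
      also have "\<dots> \<le> real u ^ R * Yb * real n powr (real s - 1 - 1 / real R)"
        using Z n Yb by (intro mult_left_mono powr_mono) auto
      finally show "real u ^ card P * real n ^ (R - card P) * p ^ card (new_pairs R ?\<beta> P)
         \<le> real u ^ R * Yb * real n powr (real s - 1 - 1 / real R)" .
    qed
    also have "\<dots> = real (card {P. P \<subseteq> {..<R} \<and> 0 \<in> P}) * (real u ^ R * Yb * real n powr (real s - 1 - 1 / real R))"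
      by simp
    also have "\<dots> \<le> 2 ^ R * (real u ^ R * Yb * real n powr (real s - 1 - 1 / real R))"
    proof (intro mult_right_mono)
      have "card {P. P \<subseteq> {..<R} \<and> 0 \<in> P} \<le> card (Pow {..<R})" by (intro card_mono) auto
      then have "card {P. P \<subseteq> {..<R} \<and> 0 \<in> P} \<le> 2 ^ R" by (simp add: card_Pow)
      then show "real (card {P. P \<subseteq> {..<R} \<and> 0 \<in> P}) \<le> 2 ^ R" by (metis of_nat_le_iff of_nat_numeral of_nat_power)
    qed (use Yb in auto)
    finally show ?thesis by (simp add: mult_ac)
  qed
  have "expct (rsub (all_edges V) p) (\<lambda>g. of_bool (L * ?M \<le> real (card {x \<in> ?T. cross R ?\<beta> x \<subseteq> g}))) \<le> (1 / L) ^ k"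
  proof (rule subset_count_tail[where M = ?M])
    show "0 < ?M" using u_pos Yb n by (intro mult_pos_pos zero_less_power) auto
    show "cross R ?\<beta> x \<subseteq> all_edges V" if "x \<in> ?T" for x using that by (intro cross_edges) simp
  qed (use finV p M L in auto)
  then show ?thesis by (simp add: rooted_count_def conj_assoc)
qed

lemma unrooted_tail:
  assumes M: "y ^ card (new_pairs R \<beta> {}) * real n powr (real R - real (card (\<beta> ` {..<R})) + 1 - defect R \<beta> / real R)
      + 2 ^ R * real u ^ R * Yb * real n powr (real R - real (card (\<beta> ` {..<R})) - defect R \<beta> / real R) \<le> M"
    and L: "0 < L"
  shows "expct (rsub (all_edges V) p) (\<lambda>g. of_bool (L * M \<le> real (pattern_count V R \<beta> g))) \<le> (1 / L) ^ k"
proof -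
  let ?T = "inj_tuples V R" and ?e = "real R - real (card (\<beta> ` {..<R})) - defect R \<beta> / real R"
  let ?b = "real u ^ R * Yb * real n powr ?e" and ?e1 = "real R - real (card (\<beta> ` {..<R})) + 1 - defect R \<beta> / real R"
  have b0: "0 < ?b" using u_pos Yb n by (intro mult_pos_pos zero_less_power) auto
  have M0: "0 < M" 
  proof -
    have "0 \<le> y ^ card (new_pairs R \<beta> {}) * real n powr ?e1" using y by simp
    moreover have "0 < 2 ^ R * ?b" using b0 by simp
    ultimately show ?thesis using M by (simp add: mult.assoc)
  qed
  have S: "(\<Sum>x\<in>?T. p ^ card (cross R \<beta> x - \<Union>(cross R \<beta> ` J))) \<le> M" if J: "J \<subseteq> ?T" "card J \<le> k" for J
  proof -
    let ?t = "\<lambda>P. real u ^ card P * real n ^ (R - card P) * p ^ card (new_pairs R \<beta> P)"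
    note sm = cross_small[OF J, of \<beta>]
    have "(\<Sum>x\<in>?T. p ^ card (cross R \<beta> x - \<Union>(cross R \<beta> ` J))) \<le> (\<Sum>P\<in>Pow {..<R}. ?t P)"
      using sm n p by (intro pattern_sum_le[OF finV]) auto
    also have "\<dots> = ?t {} + (\<Sum>P\<in>Pow {..<R} - {{}}. ?t P)"
      by (subst sum.remove[of _ "{}"]) auto
    also have "\<dots> \<le> y ^ card (new_pairs R \<beta> {}) * real n powr ?e1 + (\<Sum>P\<in>Pow {..<R} - {{}}. ?b)"
    proof (intro add_mono sum_mono)
      show "?t {} \<le> y ^ card (new_pairs R \<beta> {}) * real n powr ?e1"
        using pattern_term[of "{}" \<beta>] by simp
      show "?t P \<le> ?b" if "P \<in> Pow {..<R} - {{}}" for P using pattern_term_nonempty[of P \<beta>] that by auto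
    qed
    also have "(\<Sum>P\<in>Pow {..<R} - {{}}. ?b) \<le> 2 ^ R * ?b"
    proof -
      have "card (Pow {..<R} - {{}}) \<le> card (Pow {..<R})" by (intro card_mono) auto
      then have "card (Pow {..<R} - {{}}) \<le> 2 ^ R" by (simp add: card_Pow)
      then have "real (card (Pow {..<R} - {{}})) \<le> 2 ^ R" by (metis of_nat_le_iff of_nat_numeral of_nat_power)
      then have "real (card (Pow {..<R} - {{}})) * ?b \<le> 2 ^ R * ?b" using b0 by (intro mult_right_mono) auto
      then show ?thesis by (simp only: sum_constant)
    qed
    finally show ?thesis using M by (simp add: mult.assoc)
  qed
  show ?thesis unfolding pattern_count_def
  proof (rule subset_count_tail[where M = M])
    show "cross R \<beta> x \<subseteq> all_edges V" if "x \<in> ?T" for x using that by (rule cross_edges)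
  qed (use finV p S L M0 in auto)
qed

text \<open>Two classes of size at least 2 force \<open>R \<ge> 4\<close> and defect at least \<open>2 (R -
  2)\<close>, which exceeds \<open>R\<close> except for \<open>R = 4\<close>; there the bound equals
  \<open>R\<close> and the gain has to come from \<open>y\<close>.\<close>

lemma two_block_tail:
  assumes two: "2 \<le> card (large_blocks R \<beta>)" and y4: "R = 4 \<Longrightarrow> y \<le> 1" and L: "0 < L"
  defines "\<delta> \<equiv> (if R = 4 then y else Yb * real n powr (- 1 / real R)) + 2 ^ R * real u ^ R * Yb * real n powr (- 1 / real R)"
  shows "expct (rsub (all_edges V) p) (\<lambda>g. of_bool (L * (\<delta> * real n powr (real R - real (card (\<beta> ` {..<R})))) \<le> real (pattern_count V R \<beta> g)))
     \<le> (1 / L) ^ k"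
proof (rule unrooted_tail[OF _ L])
  let ?l = "real R - real (card (\<beta> ` {..<R}))"
  have n1: "1 \<le> real n" "0 < real n" using n by auto
  obtain B where B: "B \<subseteq> large_blocks R \<beta>" "card B = 2"
    by (rule obtain_subset_with_card_n[OF two]) (rule that)
  obtain a b where ab: "B = {a, b}" "a \<noteq> b" using B(2) by (auto simp: card_2_iff)
  let ?s = "\<lambda>b. card (block_class R \<beta> b)"
  have lb: "2 \<le> ?s a" "2 \<le> ?s b" "a \<in> \<beta> ` {..<R}" "b \<in> \<beta> ` {..<R}"
    using B ab large_blocks_sub by (auto simp: large_blocks_def)
  have "?s a + ?s b = card (block_class R \<beta> a \<union> block_class R \<beta> b)"
    using ab by (intro card_Un_disjoint[symmetric]) (auto simp: block_class_def)
  also have "\<dots> \<le> card {..<R}" by (intro card_mono) (auto simp: block_class_def)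
  finally have sab: "?s a + ?s b \<le> R" by simp
  have R4: "4 \<le> R" using sab lb by linarith
  have quad: "real R - 2 \<le> (real s - 1) * (real R - real s)" if "2 \<le> s" "s + 2 \<le> R" for s
  proof -
    have "0 \<le> (real s - 2) * (real R - real s - 1)" using that by (intro mult_nonneg_nonneg) auto
    then show ?thesis by (simp add: algebra_simps)
  qed
  have "2 * (real R - 2) \<le> (\<Sum>b\<in>{a, b}. (real (?s b) - 1) * (real R - real (?s b)))"
    using ab quad[of "?s a"] quad[of "?s b"] lb sab by simp
  also have "\<dots> \<le> defect R \<beta>" using lb by (intro defect_ge) auto
  finally have Z: "2 * (real R - 2) \<le> defect R \<beta>" .
  have R0: "0 < real R" using R by simp
  have "2 * (real R - 2) / real R \<le> defect R \<beta> / real R" using Z R0 by (intro divide_right_mono) auto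
  moreover have "2 * (real R - 2) / real R = 1 - (4 - real R) / real R" using R0 by (simp add: field_simps)
  ultimately have ZR: "1 - defect R \<beta> / real R \<le> (4 - real R) / real R" by simp
  have "1 / real R \<le> defect R \<beta> / real R" using Z R4 by (intro divide_right_mono) auto
  then have Z1: "- (defect R \<beta> / real R) \<le> - 1 / real R" by simp
  have first: "y ^ card (new_pairs R \<beta> {}) * real n powr (?l + 1 - defect R \<beta> / real R)
     \<le> (if R = 4 then y else Yb * real n powr (- 1 / real R)) * real n powr ?l"
  proof (cases "R = 4")
    case True
    have "new_pairs R \<beta> {} \<noteq> {}"
    proof -
      obtain i j where ij: "i < R" "\<beta> i = a" "j < R" "\<beta> j = b" using lb by auto
      show ?thesis
      proof (cases "i < j")
        case True
        then have "(i, j) \<in> new_pairs R \<beta> {}" using ij ab by (auto simp: new_pairs_def)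
        then show ?thesis by blast
      next
        case False
        then have "j < i" using ij ab by (cases "i = j") auto
        then have "(j, i) \<in> new_pairs R \<beta> {}" using ij ab by (auto simp: new_pairs_def)
        then show ?thesis by blast
      qed
    qed
    then have "1 \<le> card (new_pairs R \<beta> {})" by (simp add: Suc_leI card_gt_0_iff)
    then have "y ^ card (new_pairs R \<beta> {}) \<le> y" using y y4 True power_decreasing[of 1 "card (new_pairs R \<beta> {})" y] by simp
    moreover have "real n powr (?l + 1 - defect R \<beta> / real R) \<le> real n powr ?l"
      using Z True n1 by (intro powr_mono) auto
    ultimately show ?thesis using True y by (auto intro!: mult_mono)
  next
    case False
    have "(4 - real R) / real R \<le> - 1 / real R" using R4 False by (intro divide_right_mono) auto
    then have "1 - defect R \<beta> / real R \<le> - 1 / real R" using ZR by linarith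
    then have "real n powr (?l + 1 - defect R \<beta> / real R) \<le> real n powr (- 1 / real R + ?l)"
      using n1 by (intro powr_mono) auto
    then have "y ^ card (new_pairs R \<beta> {}) * real n powr (?l + 1 - defect R \<beta> / real R) \<le> Yb * real n powr (- 1 / real R + ?l)"
      using Yb(2)[OF card_new_pairs_le] Yb y by (intro mult_mono) auto
    then show ?thesis using False by (simp only: powr_add mult.assoc if_False)
  qed
  have "real n powr (?l - defect R \<beta> / real R) \<le> real n powr (- 1 / real R + ?l)"
    using Z1 n1 by (intro powr_mono) auto
  then have sec: "2 ^ R * real u ^ R * Yb * real n powr (?l - defect R \<beta> / real R) \<le> 2 ^ R * real u ^ R * Yb * (real n powr (- 1 / real R) * real n powr ?l)"
    unfolding powr_add[symmetric] using Yb by (intro mult_left_mono) auto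
  show "y ^ card (new_pairs R \<beta> {}) * real n powr (?l + 1 - defect R \<beta> / real R)
      + 2 ^ R * real u ^ R * Yb * real n powr (?l - defect R \<beta> / real R) \<le> \<delta> * real n powr ?l"
    unfolding \<delta>_def distrib_right using add_mono[OF first sec] by (simp only: mult.assoc)
qed

text \<open>The pattern with singleton classes counts cliques; its defect is 0, so the leading term is at most
  \<open>y n\<close>.\<close>

lemma clique_tail:
  assumes R2: "2 \<le> R" and y1: "y \<le> 1" and L: "0 < L"
  shows "expct (rsub (all_edges V) p) (\<lambda>g. of_bool (L * (y * real n + 2 ^ R * real u ^ R * Yb) \<le> real (card (cliques V R g)))) \<le> (1 / L) ^ k"
proof -
  let ?M = "y * real n + 2 ^ R * real u ^ R * Yb"
  have bc: "block_class R id b = {b}" if "b < R" for b using that by (auto simp: block_class_def)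
  have "defect R id = 0" by (simp add: defect_def bc)
  moreover have "(0, 1) \<in> new_pairs R id {}" using R2 by (auto simp: new_pairs_def)
  then have "new_pairs R id {} \<noteq> {}" by blast
  then have "1 \<le> card (new_pairs R id {})" by (simp add: Suc_leI card_gt_0_iff)
  then have "y ^ card (new_pairs R id {}) \<le> y" using y y1 power_decreasing[of 1 "card (new_pairs R id {})" y] by simp
  ultimately have "expct (rsub (all_edges V) p) (\<lambda>g. of_bool (L * ?M \<le> real (pattern_count V R id g))) \<le> (1 / L) ^ k"
    using n by (intro unrooted_tail[OF _ L]) (auto intro!: add_mono mult_right_mono)
  moreover have "expct (rsub (all_edges V) p) (\<lambda>g. of_bool (L * ?M \<le> real (card (cliques V R g))))
     \<le> expct (rsub (all_edges V) p) (\<lambda>g. of_bool (L * ?M \<le> real (pattern_count V R id g)) :: real)"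
  proof (intro expct_mono)
    fix g
    have "card (cliques V R g) \<le> pattern_count V R id g"
      unfolding pattern_count_def
    proof (rule surj_card_le[where f = "\<lambda>x. x ` {..<R}"])
      show "cliques V R g \<subseteq> (\<lambda>x. x ` {..<R}) ` {x \<in> inj_tuples V R. cross R id x \<subseteq> g}"
      proof
        fix C assume C: "C \<in> cliques V R g"
        then have C': "finite C" "card C = R" "C \<subseteq> V" "all_edges C \<subseteq> g" 
          using finV by (auto simp: cliques_def ksets_def dest: finite_subset)
        then obtain v where "v \<in> C" using R by fastforce
        then obtain x where x: "x \<in> inj_tuples V R" "x ` {..<R} = C"
          using enum_with_block[of C R "{v}" v 1 V] C' by auto
        have "x \<in> inj_tuples C R" using x by (auto simp: inj_tuples_def PiE_iff)
        then have "cross R id x \<subseteq> g" using cross_edges[of x C R id] C' by auto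
        then show "C \<in> (\<lambda>x. x ` {..<R}) ` {x \<in> inj_tuples V R. cross R id x \<subseteq> g}" using x by auto
      qed
    qed (use finV in auto)
    then have "real (card (cliques V R g)) \<le> real (pattern_count V R id g)" by (rule of_nat_mono)
    then show "of_bool (L * ?M \<le> real (card (cliques V R g))) \<le> (of_bool (L * ?M \<le> real (pattern_count V R id g)) :: real)"
      by auto
  qed (use finV in auto)
  ultimately show ?thesis by linarith
qed

end

section \<open>Clean partitions exist with high probability\<close>

lemma core_large:
  assumes finV: "finite V" and n: "card V = n" and r: "0 < r" 
    and few: "8 * ((r + 1) * card (cliques V (r + 1) g)) \<le> n" and nr: "8 * r \<le> n"
  shows "n \<le> 2 * card (core V r g)"
proof -
  let ?Z = "cliques V (r + 1) g"
  have finZ: "finite ?Z" using finV by (simp add: cliques_def)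
  have mp: "max_packing ?Z \<subseteq> ?Z" using max_packing(1)[OF finZ] by (simp add: is_packing_def)
  have "card (\<Union>(max_packing ?Z)) \<le> (\<Sum>C\<in>max_packing ?Z. card C)"
    using finite_subset[OF mp finZ] card_UN_le[of "max_packing ?Z" id] by simp
  also have "\<dots> = (\<Sum>C\<in>max_packing ?Z. r + 1)"
    using mp by (intro sum.cong) (auto simp: cliques_def ksets_def)
  also have "\<dots> = (r + 1) * card (max_packing ?Z)" by (simp only: sum_constant mult.commute of_nat_id)
  also have "\<dots> \<le> (r + 1) * card ?Z" by (intro mult_le_mono2 card_mono[OF finZ mp])
  finally have "8 * card (\<Union>(max_packing ?Z)) \<le> n" using few by linarith
  moreover have "n - card (\<Union>(max_packing ?Z)) \<le> card (residual V r g)"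
    unfolding residual_def n[symmetric]
    by (rule diff_card_le_card_Diff) (use finV mp in \<open>auto simp: cliques_def ksets_def intro: finite_subset[of _ V]\<close>)
  moreover have "card (residual V r g) \<le> card (core V r g) + r"
  proof -
    have "card (residual V r g) = card (core V r g) + card (residual V r g) mod r"
      using core(2)[of V r g] by simp
    then show ?thesis using r by (metis add_left_mono less_imp_le mod_less_divisor)
  qed
  ultimately show ?thesis using nr by linarith
qed

text \<open>The parameters \<open>y1\<close> and \<open>y2\<close> compare the densities of \<open>g\<close> and
  \<open>g \<inter> h\<close> with \<open>n^(-2/(r+1))\<close> and \<open>n^(-2/r)\<close>;
  \<open>k\<close> is the order of the moments and \<open>L\<close> the factor by which a count
  exceeds its mean in a bad event. The conditions \<open>H1\<close> to \<open>H4\<close> turn these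
  counts into few bad sets at each vertex, a large core, and few partitions in which two blocks create
  an \<open>(r+1)\<close>-clique or an \<open>r\<close>-clique.\<close>

context
  fixes V :: "'a set" and r n \<beta> M0 k :: nat and p q y1 y2 Yb L :: real
  assumes finV: "finite V" and n: "card V = n" and r2: "2 \<le> r"
    and M0: "r \<le> M0" "M0 < n div (2 * r)"
    and few: "n ^ ((r - 1) * M0) \<le> 2 ^ (n div (2 * r) - M0)"
    and large: "2 * r ^ (r + 1) * \<beta> < (M0 div r) ^ (r - 1)"
    and p: "0 < p" "p \<le> 1" and q: "0 < q" "q \<le> 1"
    and y1: "0 \<le> y1" "y1 \<le> 1" "p \<le> y1 * real n powr (- 2 / real (r + 1))"
    and y2: "0 \<le> y2" "p * q \<le> y2 * real n powr (- 2 / real r)"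
    and Yb: "1 \<le> Yb" "\<And>D. D \<le> r ^ 2 \<Longrightarrow> y2 ^ D \<le> Yb" and L: "0 < L"
    and H1: "2 * real (r + 1) * (L * (2 ^ (r + 1) * real ((r + 1) * k + 1) ^ (r + 1))) * real n powr (real r - 1 - 1 / real (r + 1))
       + 2 * real r * (L * (2 ^ r * real (r * k + 1) ^ r * Yb)) * real n powr (real r - 1 - 1 / real r) \<le> real \<beta>"
    and H2: "8 * real (r + 1) * (L * (y1 * real n + 2 ^ (r + 1) * real ((r + 1) * k + 1) ^ (r + 1))) \<le> real n" "8 * r \<le> n"
    and H3: "(real (r + 1) * factor_const r) ^ (r + 1) * (L * (y1 + (1 + 2 ^ (r + 1) * real ((r + 1) * k + 1) ^ (r + 1)) * real n powr (- 1 / real (r + 1)))) < 1 / 4"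
    and H4: "(real r * factor_const r) ^ r * (L * ((1 + 2 ^ r * real (r * k + 1) ^ r) * Yb * real n powr (- 1 / real r))) < 1 / 4"
begin

lemmas fix_params = finV n r2 M0 few large

text \<open>These are the levels in \<open>rooted_tail\<close>, \<open>two_block_tail\<close> and
  \<open>clique_tail\<close>.\<close>

definition "rooted_bound R Y s = L * (2 ^ R * real (R * k + 1) ^ R * Y * real n powr (real s - 1 - 1 / real R))"

definition "tail_factor R Y y = (if R = 4 then y else Y * real n powr (- 1 / real R)) + 2 ^ R * real (R * k + 1) ^ R * Y * real n powr (- 1 / real R)"

definition "pattern_bound R Y y (\<gamma> :: nat \<Rightarrow> nat) = L * (tail_factor R Y y * real n powr (real R - real (card (\<gamma> ` {..<R}))))"

definition "clique_bound = L * (y1 * real n + 2 ^ (r + 1) * real ((r + 1) * k + 1) ^ (r + 1) * 1)"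

abbreviation "patterns R \<equiv> {\<gamma> \<in> {..<R} \<rightarrow>\<^sub>E {..<R}. 2 \<le> card (large_blocks R \<gamma>)}"

lemma card_pos: "0 < n" using M0 by (cases n) auto

lemma few_bad_holds:
  assumes X: "\<not> clique_bound \<le> real (card (cliques V (r + 1) g))"
    and c1: "\<And>s v. s \<in> {2..<r + 1} \<Longrightarrow> v \<in> V \<Longrightarrow> \<not> rooted_bound (r + 1) 1 s \<le> real (rooted_count V (r + 1) (block_pattern s) v g)"
    and c2: "\<And>s v. s \<in> {2..<r} \<Longrightarrow> v \<in> V \<Longrightarrow> \<not> rooted_bound r Yb s \<le> real (rooted_count V r (block_pattern s) v (g \<inter> h))"
  shows "few_bad V r \<beta> g h"
proof -
  have "real (8 * ((r + 1) * card (cliques V (r + 1) g))) = 8 * real (r + 1) * real (card (cliques V (r + 1) g))"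
    by (simp only: of_nat_mult of_nat_numeral mult.assoc)
  also have "\<dots> \<le> 8 * real (r + 1) * clique_bound"
    by (rule mult_left_mono) (use X in linarith, simp)
  also have "\<dots> \<le> real n" using H2(1) by (simp add: clique_bound_def)
  finally have "8 * ((r + 1) * card (cliques V (r + 1) g)) \<le> n" by (simp only: of_nat_le_iff)
  then have "card V \<le> 2 * card (core V r g)" using core_large[OF finV n _ _ H2(2)] r2 n by simp
  moreover have "card {A \<in> ksets V r. v \<in> A \<and> A \<notin> allowed V r g h} \<le> \<beta>" if v: "v \<in> V" for v
  proof -
    let ?B1 = "{A \<in> ksets V r. v \<in> A \<and> bad_set V (r + 1) g A}" and ?B2 = "{A \<in> ksets V r. v \<in> A \<and> bad_set V r (g \<inter> h) A}"
    have "real (card ?B1) \<le> 2 * real (r + 1) * (L * (2 ^ (r + 1) * real ((r + 1) * k + 1) ^ (r + 1))) * real n powr (real r - 1 - 1 / real (r + 1))"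
    proof (rule bad_degree_le[OF finV n card_pos _ _ _ _ v])
      fix s v assume "s \<in> {2..<r + 1}" "v \<in> V"
      then show "real (rooted_count V (r + 1) (block_pattern s) v g)
         \<le> L * (2 ^ (r + 1) * real ((r + 1) * k + 1) ^ (r + 1)) * real n powr (real s - 1 - 1 / real (r + 1))"
        using c1[of s v] by (simp add: rooted_bound_def mult.assoc)
    qed (use L in auto)
    moreover have "real (card ?B2) \<le> 2 * real r * (L * (2 ^ r * real (r * k + 1) ^ r * Yb)) * real n powr (real r - 1 - 1 / real r)"
    proof (rule bad_degree_le[OF finV n card_pos _ _ _ _ v])
      fix s v assume "s \<in> {2..<r}" "v \<in> V"
      then show "real (rooted_count V r (block_pattern s) v (g \<inter> h))
         \<le> L * (2 ^ r * real (r * k + 1) ^ r * Yb) * real n powr (real s - 1 - 1 / real r)"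
        using c2[of s v] by (simp add: rooted_bound_def mult.assoc)
    qed (use L Yb in auto)
    moreover have "card {A \<in> ksets V r. v \<in> A \<and> A \<notin> allowed V r g h} \<le> card ?B1 + card ?B2"
    proof -
      have "{A \<in> ksets V r. v \<in> A \<and> A \<notin> allowed V r g h} \<subseteq> ?B1 \<union> ?B2" by (auto simp: allowed_def)
      then have "card {A \<in> ksets V r. v \<in> A \<and> A \<notin> allowed V r g h} \<le> card (?B1 \<union> ?B2)"
        using finV by (intro card_mono) auto
      also have "\<dots> \<le> card ?B1 + card ?B2" by (rule card_Un_le)
      finally show ?thesis .
    qed
    then have "real (card {A \<in> ksets V r. v \<in> A \<and> A \<notin> allowed V r g h}) \<le> real (card ?B1) + real (card ?B2)"
      unfolding of_nat_add[symmetric] by (rule of_nat_mono)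
    ultimately have "real (card {A \<in> ksets V r. v \<in> A \<and> A \<notin> allowed V r g h}) \<le> real \<beta>" using H1 by linarith
    then show ?thesis by simp
  qed
  ultimately show ?thesis by (simp add: few_bad_def)
qed

lemma second_order_rare:
  assumes c3: "\<And>\<gamma>. \<gamma> \<in> patterns (r + 1) \<Longrightarrow> \<not> pattern_bound (r + 1) 1 y1 \<gamma> \<le> real (pattern_count V (r + 1) \<gamma> g)"
  shows "real (card {S \<in> factors V r \<beta> g h. second_order V (r + 1) g S}) / real (card (factors V r \<beta> g h)) < 1 / 4"
proof -
  let ?P = "factors V r \<beta> g h"
  have d0: "0 \<le> L * tail_factor (r + 1) 1 y1" using L y1 by (auto simp: tail_factor_def)
  have "real (card {S \<in> ?P. second_order V (r + 1) g S}) \<le> (real (r + 1) * factor_const r) ^ (r + 1) * (L * tail_factor (r + 1) 1 y1) * real (card ?P)"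
  proof (rule second_order_fraction[OF finV n card_pos _ finite_factors[OF fix_params] factors_props(2)[OF fix_params] factors_props(4)[OF fix_params] factor_const_ge1[OF fix_params] factors_spread[OF fix_params] d0])
    fix \<gamma> assume "\<gamma> \<in> {..<r + 1} \<rightarrow>\<^sub>E {..<r + 1}" "2 \<le> card (large_blocks (r + 1) \<gamma>)"
    then show "real (pattern_count V (r + 1) \<gamma> g) \<le> L * tail_factor (r + 1) 1 y1 * real n powr (real (r + 1) - real (card (\<gamma> ` {..<r + 1})))"
      using c3[of \<gamma>] by (simp add: pattern_bound_def mult.assoc)
  qed (use r2 in auto)
  also have "(real (r + 1) * factor_const r) ^ (r + 1) * (L * tail_factor (r + 1) 1 y1) * real (card ?P)
     \<le> (real (r + 1) * factor_const r) ^ (r + 1) * (L * (y1 + (1 + 2 ^ (r + 1) * real ((r + 1) * k + 1) ^ (r + 1)) * real n powr (- 1 / real (r + 1)))) * real (card ?P)"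
  proof (intro mult_right_mono mult_left_mono)
    show "tail_factor (r + 1) 1 y1 \<le> y1 + (1 + 2 ^ (r + 1) * real ((r + 1) * k + 1) ^ (r + 1)) * real n powr (- 1 / real (r + 1))"
      using y1(1) by (auto simp: tail_factor_def distrib_right)
  qed (use L factor_const_ge1[OF fix_params] in auto)
  finally have *: "real (card {S \<in> ?P. second_order V (r + 1) g S}) \<le> 
     (real (r + 1) * factor_const r) ^ (r + 1) * (L * (y1 + (1 + 2 ^ (r + 1) * real ((r + 1) * k + 1) ^ (r + 1)) * real n powr (- 1 / real (r + 1)))) * real (card ?P)" .
  show ?thesis
  proof (cases "card ?P = 0")
    case False
    then show ?thesis using order.strict_trans1[OF * mult_strict_right_mono[OF H3, of "real (card ?P)"]] by (simp add: field_simps)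
  qed simp
qed

lemma second_order_sides_rare:
  assumes r4: "r \<noteq> 4" 
    and c4: "\<And>\<gamma>. \<gamma> \<in> patterns r \<Longrightarrow> \<not> pattern_bound r Yb y2 \<gamma> \<le> real (pattern_count V r \<gamma> (g \<inter> h))"
  shows "real (card {S \<in> factors V r \<beta> g h. second_order V r (g \<inter> h) S}) / real (card (factors V r \<beta> g h)) < 1 / 4"
proof -
  let ?P = "factors V r \<beta> g h"
  let ?d = "(1 + 2 ^ r * real (r * k + 1) ^ r) * Yb * real n powr (- 1 / real r)"
  have de: "tail_factor r Yb y2 = ?d" using r4 by (simp add: tail_factor_def distrib_right)
  have d0: "0 \<le> L * ?d" using L Yb by simp
  have *: "real (card {S \<in> ?P. second_order V r (g \<inter> h) S}) \<le> (real r * factor_const r) ^ r * (L * ?d) * real (card ?P)"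
  proof (rule second_order_fraction[OF finV n card_pos _ finite_factors[OF fix_params] factors_props(2)[OF fix_params] factors_props(4)[OF fix_params] factor_const_ge1[OF fix_params] factors_spread[OF fix_params] d0])
    fix \<gamma> assume "\<gamma> \<in> {..<r} \<rightarrow>\<^sub>E {..<r}" "2 \<le> card (large_blocks r \<gamma>)"
    then show "real (pattern_count V r \<gamma> (g \<inter> h)) \<le> L * ?d * real n powr (real r - real (card (\<gamma> ` {..<r})))"
      using c4[of \<gamma>] unfolding pattern_bound_def de by (simp add: mult.assoc)
  qed (use r2 in auto)
  show ?thesis
  proof (cases "card ?P = 0")
    case False
    then show ?thesis using order.strict_trans1[OF * mult_strict_right_mono[OF H4, of "real (card ?P)"]] by (simp add: field_simps)
  qed simp
qed

text \<open>If all counts stay below their bounds, then there are few bad sets and clean partitions form a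
  majority. The counts in \<open>g\<close> and those in \<open>g \<inter> h\<close> are estimated
  separately, as \<open>g \<inter> h\<close> is a random set of density \<open>p q\<close>; the case
  \<open>r = 4\<close> pays for links through Markov's inequality.\<close>

lemma clean_factors_empty_prob:
  "expct (rsub (all_edges V) p) (\<lambda>g. expct (rsub (all_edges V) q) (\<lambda>h. of_bool (clean_factors V r \<beta> g h = {})))
   \<le> (2 * real r * real n + 1 + real (r + 1) ^ (r + 1) + real r ^ r) * (1 / L) ^ k
     + 4 * (real n ^ 4 * (factor_const r / real n ^ (r - 1))) ^ 8 * (36 ^ 7 * (p * q) ^ 28) * of_bool (r = 4)"
proof -
  let ?E = "all_edges V"
  let ?a1 = "\<lambda>s v g. of_bool (rooted_bound (r + 1) 1 s \<le> real (rooted_count V (r + 1) (block_pattern s) v g)) :: real"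
  let ?a2 = "\<lambda>s v g. of_bool (rooted_bound r Yb s \<le> real (rooted_count V r (block_pattern s) v g)) :: real"
  let ?a3 = "\<lambda>g. of_bool (clique_bound \<le> real (card (cliques V (r + 1) g))) :: real"
  let ?a4 = "\<lambda>\<gamma> g. of_bool (pattern_bound (r + 1) 1 y1 \<gamma> \<le> real (pattern_count V (r + 1) \<gamma> g)) :: real"
  let ?a5 = "\<lambda>\<gamma> g. of_bool (pattern_bound r Yb y2 \<gamma> \<le> real (pattern_count V r \<gamma> g)) * of_bool (r \<noteq> 4) :: real"
  define fr where "fr = (\<lambda>g h. real (card {S \<in> factors V r \<beta> g h. many_links (g \<inter> h) S}) / real (card (factors V r \<beta> g h)))"
  have fr0: "0 \<le> fr g h" for g h by (simp add: fr_def)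
  let ?ml = "\<lambda>g h. 4 * fr g h * of_bool (r = 4)"
  define A1 where "A1 = (\<lambda>g. \<Sum>s\<in>{2..<r + 1}. \<Sum>v\<in>V. ?a1 s v g)"
  define A2 where "A2 = (\<lambda>g. \<Sum>s\<in>{2..<r}. \<Sum>v\<in>V. ?a2 s v g)"
  define A4 where "A4 = (\<lambda>g. \<Sum>\<gamma>\<in>patterns (r + 1). ?a4 \<gamma> g)"
  define A5 where "A5 = (\<lambda>g. \<Sum>\<gamma>\<in>patterns r. ?a5 \<gamma> g)"
  have finP: "finite (patterns R)" for R by (rule finite_subset[of _ "{..<R} \<rightarrow>\<^sub>E {..<R}"]) (auto intro!: finite_PiE)
  have cP: "real (card (patterns R)) \<le> real R ^ R" for R
  proof -
    have "card (patterns R) \<le> card ({..<R} \<rightarrow>\<^sub>E {..<R})" by (intro card_mono finite_PiE) auto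
    then have "card (patterns R) \<le> R ^ R" by (simp add: card_PiE)
    then show ?thesis by (metis of_nat_le_iff of_nat_power)
  qed
  have zero_le_of_bool: "0 \<le> (of_bool P :: real)" for P by simp
  have nonneg: "0 \<le> A1 g" "0 \<le> A2 g" "0 \<le> A4 g" "0 \<le> A5 g" for g
    unfolding A1_def A2_def A4_def A5_def by (intro sum_nonneg mult_nonneg_nonneg zero_le_of_bool)+
  have point: "of_bool (clean_factors V r \<beta> g h = {}) \<le> (A1 g + ?a3 g + A4 g) + (A2 (g \<inter> h) + A5 (g \<inter> h)) + ?ml g h" for g h
  proof (cases "clean_factors V r \<beta> g h = {}")
    case True
    have ml0: "0 \<le> ?ml g h" using fr0 by simp
    have one: "1 \<le> sum f I" if "finite I" "i \<in> I" "f i = 1" "\<And>j. 0 \<le> f j" for f :: "_ \<Rightarrow> real" and I i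
      using member_le_sum[of i I f] that by simp
    show ?thesis
    proof (rule ccontr)
      assume "\<not> ?thesis"
      then have lt: "(A1 g + ?a3 g + A4 g) + (A2 (g \<inter> h) + A5 (g \<inter> h)) + ?ml g h < 1" using True by simp
      then have lt1: "A1 g < 1" "?a3 g < 1" "A4 g < 1" "A2 (g \<inter> h) < 1" "A5 (g \<inter> h) < 1" "?ml g h < 1"
        using nonneg[of g] nonneg[of "g \<inter> h"] ml0 zero_le_of_bool[of "clique_bound \<le> real (card (cliques V (r + 1) g))"]
        by linarith+
      have c1: "\<not> rooted_bound (r + 1) 1 s \<le> real (rooted_count V (r + 1) (block_pattern s) v g)" if "s \<in> {2..<r + 1}" "v \<in> V" for s v
      proof
        assume "rooted_bound (r + 1) 1 s \<le> real (rooted_count V (r + 1) (block_pattern s) v g)"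
        then have "1 \<le> (\<Sum>v\<in>V. ?a1 s v g)" using that finV by (intro one[of V v]) auto
        also have "\<dots> \<le> A1 g" unfolding A1_def using that by (intro member_le_sum) (auto intro!: sum_nonneg)
        finally show False using lt1 by simp
      qed
      have c2: "\<not> rooted_bound r Yb s \<le> real (rooted_count V r (block_pattern s) v (g \<inter> h))" if "s \<in> {2..<r}" "v \<in> V" for s v
      proof
        assume "rooted_bound r Yb s \<le> real (rooted_count V r (block_pattern s) v (g \<inter> h))"
        then have "1 \<le> (\<Sum>v\<in>V. ?a2 s v (g \<inter> h))" using that finV by (intro one[of V v]) auto
        also have "\<dots> \<le> A2 (g \<inter> h)" unfolding A2_def using that by (intro member_le_sum) (auto intro!: sum_nonneg)
        finally show False using lt1 by simp
      qed
      have c3: "\<not> pattern_bound (r + 1) 1 y1 \<gamma> \<le> real (pattern_count V (r + 1) \<gamma> g)" if "\<gamma> \<in> patterns (r + 1)" for \<gamma>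
      proof
        assume a: "pattern_bound (r + 1) 1 y1 \<gamma> \<le> real (pattern_count V (r + 1) \<gamma> g)"
        have "1 \<le> A4 g" unfolding A4_def by (rule one[OF finP that]) (use a in auto)
        then show False using lt1 by simp
      qed
      have X: "\<not> clique_bound \<le> real (card (cliques V (r + 1) g))" using lt1(2) by auto
      have fb: "few_bad V r \<beta> g h" by (rule few_bad_holds[OF X c1 c2])
      have so: "real (card {S \<in> factors V r \<beta> g h. second_order V (r + 1) g S}) / real (card (factors V r \<beta> g h)) < 1 / 4"
        by (rule second_order_rare[OF c3])
      show False
      proof (cases "r = 4")
        case r4: True
        have "real (card {S \<in> factors V r \<beta> g h. many_links (g \<inter> h) S}) / real (card (factors V r \<beta> g h)) < 1 / 4"
        proof -
          have "fr g h < 1 / 4" using lt1(6) r4 by simp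
          then show ?thesis by (simp only: fr_def)
        qed
        then show False using clean_factors_empty[OF fix_params True fb] so r4 by simp
      next
        case r4: False
        have c4: "\<not> pattern_bound r Yb y2 \<gamma> \<le> real (pattern_count V r \<gamma> (g \<inter> h))" if "\<gamma> \<in> patterns r" for \<gamma>
        proof
          assume a: "pattern_bound r Yb y2 \<gamma> \<le> real (pattern_count V r \<gamma> (g \<inter> h))"
          have "1 \<le> A5 (g \<inter> h)" unfolding A5_def by (rule one[OF finP that]) (use a r4 in auto)
          then show False using lt1 by simp
        qed
        show False using clean_factors_empty[OF fix_params True fb] so second_order_sides_rare[OF r4 c4] r4 by simp
      qed
    qed
  qed (use nonneg fr0 in \<open>auto intro!: add_nonneg_nonneg\<close>)
  have pq: "0 \<le> p * q" "p * q \<le> 1" using p q by (auto simp: mult_le_one)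
  have Y1: "\<And>D. D \<le> (r + 1) ^ 2 \<Longrightarrow> y1 ^ D \<le> 1" using y1 by (intro power_le_one)
  have fE: "finite (set_pmf (rsub ?E t))" for t using finV by simp
  let ?\<epsilon> = "(1 / L) ^ k"
  have e0: "0 \<le> ?\<epsilon>" using L by simp
  have t1: "expct (rsub ?E p) A1 \<le> real r * real n * ?\<epsilon>"
  proof -
    have "expct (rsub ?E p) A1 = (\<Sum>s\<in>{2..<r + 1}. \<Sum>v\<in>V. expct (rsub ?E p) (?a1 s v))"
      unfolding A1_def by (simp only: expct_sum[OF fE])
    also have "\<dots> \<le> (\<Sum>s\<in>{2..<r + 1}. \<Sum>v\<in>V. ?\<epsilon>)"
      unfolding rooted_bound_def using p y1 Y1 by (intro sum_mono rooted_tail[OF finV n card_pos _ _ _ _ _ _ _ refl _ L]) auto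
    also have "\<dots> = real (card {2..<r + 1}) * real n * ?\<epsilon>" by (simp only: sum_constant n mult.assoc)
    also have "\<dots> \<le> real r * real n * ?\<epsilon>" using e0 by (intro mult_right_mono) auto
    finally show ?thesis .
  qed
  have t2: "expct (rsub ?E (p * q)) A2 \<le> real r * real n * ?\<epsilon>"
  proof -
    have "expct (rsub ?E (p * q)) A2 = (\<Sum>s\<in>{2..<r}. \<Sum>v\<in>V. expct (rsub ?E (p * q)) (?a2 s v))"
      unfolding A2_def by (simp only: expct_sum[OF fE])
    also have "\<dots> \<le> (\<Sum>s\<in>{2..<r}. \<Sum>v\<in>V. ?\<epsilon>)"
      unfolding rooted_bound_def using pq y2 Yb r2 by (intro sum_mono rooted_tail[OF finV n card_pos _ _ _ _ _ _ _ refl _ L]) auto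
    also have "\<dots> = real (card {2..<r}) * real n * ?\<epsilon>" by (simp only: sum_constant n mult.assoc)
    also have "\<dots> \<le> real r * real n * ?\<epsilon>" using e0 by (intro mult_right_mono) auto
    finally show ?thesis .
  qed
  have t3: "expct (rsub ?E p) ?a3 \<le> ?\<epsilon>"
    unfolding clique_bound_def using p y1 Y1 r2 by (intro clique_tail[OF finV n card_pos _ _ _ _ _ _ _ refl _ _ L]) auto
  have t4: "expct (rsub ?E p) A4 \<le> real (r + 1) ^ (r + 1) * ?\<epsilon>"
  proof -
    have "expct (rsub ?E p) A4 = (\<Sum>\<gamma>\<in>patterns (r + 1). expct (rsub ?E p) (?a4 \<gamma>))"
      unfolding A4_def by (simp only: expct_sum[OF fE])
    also have "\<dots> \<le> (\<Sum>\<gamma>\<in>patterns (r + 1). ?\<epsilon>)"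
      unfolding pattern_bound_def tail_factor_def using p y1 Y1 by (intro sum_mono two_block_tail[OF finV n card_pos _ _ _ _ _ _ _ refl _ _ L]) auto
    also have "\<dots> = real (card (patterns (r + 1))) * ?\<epsilon>" by (simp only: sum_constant)
    also have "\<dots> \<le> real (r + 1) ^ (r + 1) * ?\<epsilon>" by (rule mult_right_mono[OF cP e0])
    finally show ?thesis .
  qed
  have t5: "expct (rsub ?E (p * q)) A5 \<le> real r ^ r * ?\<epsilon>"
  proof -
    have "expct (rsub ?E (p * q)) A5 = (\<Sum>\<gamma>\<in>patterns r. expct (rsub ?E (p * q)) (?a5 \<gamma>))"
      unfolding A5_def by (simp only: expct_sum[OF fE])
    also have "\<dots> \<le> (\<Sum>\<gamma>\<in>patterns r. ?\<epsilon>)"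
    proof (rule sum_mono)
      fix \<gamma> assume g: "\<gamma> \<in> patterns r"
      show "expct (rsub ?E (p * q)) (?a5 \<gamma>) \<le> ?\<epsilon>"
      proof (cases "r = 4")
        case False
        have "expct (rsub ?E (p * q)) (\<lambda>g. of_bool (pattern_bound r Yb y2 \<gamma> \<le> real (pattern_count V r \<gamma> g))) \<le> ?\<epsilon>"
          unfolding pattern_bound_def tail_factor_def
          using pq y2 Yb r2 g False by (intro two_block_tail[OF finV n card_pos _ _ _ _ _ _ _ refl _ _ L]) auto
        then show ?thesis using False by simp
      qed (use e0 in simp)
    qed
    also have "\<dots> = real (card (patterns r)) * ?\<epsilon>" by (simp only: sum_constant)
    also have "\<dots> \<le> real r ^ r * ?\<epsilon>" by (rule mult_right_mono[OF cP e0])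
    finally show ?thesis .
  qed
  have t6: "expct (rsub ?E p) (\<lambda>g. expct (rsub ?E q) (\<lambda>h. ?ml g h)) \<le> 4 * (real n ^ 4 * (factor_const r / real n ^ (r - 1))) ^ 8 * (36 ^ 7 * (p * q) ^ 28) * of_bool (r = 4)"
  proof (cases "r = 4")
    case True
    have "expct (rsub ?E p) (\<lambda>g. expct (rsub ?E q) (\<lambda>h. fr g h))
      \<le> (real (card V) ^ 4 * (factor_const r / real n ^ (r - 1))) ^ 8 * (36 ^ 7 * (p * q) ^ 28)"
      unfolding fr_def
      using p q factor_const_ge1[OF fix_params] factors_props(2,4)[OF fix_params] factors_spread[OF fix_params] finite_factors[OF fix_params] True
      by (intro many_links_fraction[OF finV]) auto
    then have "4 * expct (rsub ?E p) (\<lambda>g. expct (rsub ?E q) (\<lambda>h. fr g h))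
      \<le> 4 * ((real n ^ 4 * (factor_const r / real n ^ (r - 1))) ^ 8 * (36 ^ 7 * (p * q) ^ 28))"
      unfolding n by (rule mult_left_mono) simp
    moreover have "expct (rsub ?E p) (\<lambda>g. expct (rsub ?E q) (\<lambda>h. ?ml g h)) = 4 * expct (rsub ?E p) (\<lambda>g. expct (rsub ?E q) (\<lambda>h. fr g h))"
      using True by simp
    ultimately show ?thesis using True by (simp only: mult.assoc simp_thms of_bool_eq mult_1_right)
  qed simp
  have "expct (rsub ?E p) (\<lambda>g. expct (rsub ?E q) (\<lambda>h. of_bool (clean_factors V r \<beta> g h = {})))
     \<le> expct (rsub ?E p) (\<lambda>g. expct (rsub ?E q) (\<lambda>h. (A1 g + ?a3 g + A4 g) + (A2 (g \<inter> h) + A5 (g \<inter> h)) + ?ml g h))"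
    using point fE by (intro expct_mono) auto
  also have "\<dots> = expct (rsub ?E p) A1 + expct (rsub ?E p) ?a3 + expct (rsub ?E p) A4 
     + expct (rsub ?E p) (\<lambda>g. expct (rsub ?E q) (\<lambda>h. A2 (g \<inter> h) + A5 (g \<inter> h))) + expct (rsub ?E p) (\<lambda>g. expct (rsub ?E q) (\<lambda>h. ?ml g h))"
    using fE by (simp add: expct_add)
  also have "expct (rsub ?E p) (\<lambda>g. expct (rsub ?E q) (\<lambda>h. A2 (g \<inter> h) + A5 (g \<inter> h))) = expct (rsub ?E (p * q)) (\<lambda>g. A2 g + A5 g)"
    using finV p q by (intro rsub_Int) auto
  also have "\<dots> = expct (rsub ?E (p * q)) A2 + expct (rsub ?E (p * q)) A5" using fE by (simp add: expct_add)
  finally show ?thesis using t1 t2 t3 t4 t5 t6 by (simp add: algebra_simps)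
qed

end

section \<open>The deficiency of the core\<close>

definition deficiency :: "'a set \<Rightarrow> nat \<Rightarrow> 'a set set \<Rightarrow> nat" where
  "deficiency V r g = (LEAST x. \<exists>Q. pm r (core V r g) Q \<and> card (Q - cliques V r g) \<le> x)"

lemma core_pm:
  assumes "finite V" "0 < r"
  shows "\<exists>Q. pm r (core V r g) Q"
  using exists_pm[OF finite_subset[OF core_sub assms(1)] core(2) assms(2)] .

lemma deficiency:
  assumes "finite V" "0 < r"
  shows "\<exists>Q. pm r (core V r g) Q \<and> card (Q - cliques V r g) \<le> deficiency V r g"
  unfolding deficiency_def
proof (rule LeastI_ex)
  show "\<exists>x Q. pm r (core V r g) Q \<and> card (Q - cliques V r g) \<le> x" using core_pm[OF assms, of g] by blast
qed

lemma deficiency_le: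
  assumes "finite V" "0 < r"
  shows "deficiency V r g \<le> card V"
proof -
  obtain Q where Q: "pm r (core V r g) Q" using core_pm[OF assms] by blast
  have finc: "finite (core V r g)" using finite_subset[OF core_sub assms(1)] .
  have "card (Q - cliques V r g) \<le> card Q" using finite_pm[OF Q finc] by (intro card_mono) auto
  also have "\<dots> \<le> r * card Q" using assms by simp
  also have "\<dots> = card (core V r g)" using pm_card[OF Q finc] by simp
  also have "\<dots> \<le> card V" by (intro card_mono assms core_sub)
  finally show ?thesis unfolding deficiency_def using Q by (intro Least_le) blast
qed

lemma sum_odd: "(\<Sum>x<d. 2 * real x + 1) = real d ^ 2"
  by (induction d) (auto simp: power2_eq_square algebra_simps)

lemma sum_odd_half: "(\<Sum>x<N. (2 * real x + 1) * (1/2) ^ x) \<le> 6"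
proof -
  have "(\<Sum>x<N. (2 * real x + 1) * (1/2) ^ x) = 6 - (4 * real N + 6) * (1/2) ^ N"
  proof (induction N)
    case (Suc N)
    then show ?case unfolding sum.lessThan_Suc Suc.IH by (simp add: field_simps)
  qed simp
  then show ?thesis by simp
qed

text \<open>Uses \<open>d^2 = \<Sum>x<d. 2 x + 1\<close> to integrate the tail \<open>(1/2)^x\<close> of the
  encoding bound. Without clean partitions the trivial bound \<open>n\<close> is taken.\<close>

lemma deficiency_second_moment_le:
  fixes V :: "'a set"
  assumes finV: "finite V" and n: "card V = n" and r2: "2 \<le> r"
    and M0: "r \<le> M0" "M0 < n div (2 * r)"
    and few: "n ^ ((r - 1) * M0) \<le> 2 ^ (n div (2 * r) - M0)"
    and large: "2 * r ^ (r + 1) * \<beta> < (M0 div r) ^ (r - 1)"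
    and p: "0 < p" "p \<le> 1" and q: "0 < q" "q \<le> 1"
    and pow: "n < 2 ^ m" "2 ^ (m - 1) \<le> n"
    and small: "4 * ((2 * factor_const r / real n ^ (r - 1)) * (2 * real m * 2 ^ 420 / (p * q) ^ (r choose 2))) \<le> 1 / 2"
  shows "expct (rsub (all_edges V) p) (\<lambda>g. real (deficiency V r g) ^ 2)
     \<le> real n ^ 2 * expct (rsub (all_edges V) p) (\<lambda>g. expct (rsub (all_edges V) q) (\<lambda>h. of_bool (clean_factors V r \<beta> g h = {}))) + 6"
proof -
  have n0: "0 < n" using M0 by (cases n) auto
  have m0: "0 < m" using pow n0 by (cases m) auto
  obtain \<kappa> :: "nat pmf" where \<kappa>: "finite (set_pmf \<kappa>)" "1 / 2 \<le> pmf \<kappa> m" "\<And>i. i < m \<Longrightarrow> 1 / (2 * real m) \<le> pmf \<kappa> i"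
    using colour_distribution[OF m0] by blast
  interpret encoding V r m 420 p q "2 * factor_const r / real n ^ (r - 1)" \<kappa> "core V r" "clean_factors V r \<beta>"
    by (rule clean_encoding[OF finV n r2 M0 few large m0 p q \<kappa>])
  have rho: "4 * \<rho> \<le> 1 / 2" unfolding \<rho>_def by (rule small)
  let ?SS = "clean_factors V r \<beta>"
  define t where "t = (\<lambda>x g h c. of_bool (?SS g h \<noteq> {} \<and> \<not> (\<exists>Q. pm r (core V r g) Q \<and> card (Q - W g h c m) \<le> x)) :: real)"
  have t0: "0 \<le> t x g h c" for x g h c by (simp add: t_def)
  have point: "real (deficiency V r g) ^ 2 \<le> real n ^ 2 * of_bool (?SS g h = {}) + (\<Sum>x<n. (2 * real x + 1) * t x g h c)" for g h c
  proof (cases "?SS g h = {}")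
    case True
    have "real (deficiency V r g) ^ 2 \<le> real n ^ 2"
      using deficiency_le[OF finV, of r g] r2 n by (intro power_mono) auto
    then show ?thesis using True by (simp add: t_def)
  next
    case False
    let ?d = "deficiency V r g"
    have tx: "t x g h c = 1" if x: "x < ?d" for x
    proof -
      have "\<not> (pm r (core V r g) Q \<and> card (Q - W g h c m) \<le> x)" for Q
      proof
        assume Q: "pm r (core V r g) Q \<and> card (Q - W g h c m) \<le> x"
        have "finite Q" using Q finite_pm[of r "core V r g" Q] finite_subset[OF core_sub finV] by simp
        then have "card (Q - cliques V r g) \<le> card (Q - W g h c m)"
          by (intro card_mono) (auto simp: cliques_def coloured_cliques_def)
        then have "?d \<le> x" unfolding deficiency_def using Q by (intro Least_le exI[of _ Q]) simp
        then show False using x by simp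
      qed
      then show ?thesis using False by (simp add: t_def)
    qed
    have dn: "?d \<le> n" using deficiency_le[OF finV, of r g] r2 n by simp
    have "real ?d ^ 2 = (\<Sum>x<?d. 2 * real x + 1)" by (simp add: sum_odd)
    also have "\<dots> = (\<Sum>x<?d. (2 * real x + 1) * t x g h c)" using tx by (intro sum.cong) auto
    also have "\<dots> \<le> (\<Sum>x<n. (2 * real x + 1) * t x g h c)"
      using dn t0 by (intro sum_mono2) auto
    finally show ?thesis using False by simp
  qed
  have "expct (rsub E p) (\<lambda>g. real (deficiency V r g) ^ 2) = avg (\<lambda>g h c. real (deficiency V r g) ^ 2)"
    by (simp add: avg_def)
  also have "\<dots> \<le> avg (\<lambda>g h c. real n ^ 2 * of_bool (?SS g h = {}) + (\<Sum>x<n. (2 * real x + 1) * t x g h c))"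
    by (rule avg_mono) (rule point)
  also have "\<dots> = real n ^ 2 * expct (rsub E p) (\<lambda>g. expct (rsub E q) (\<lambda>h. of_bool (?SS g h = {}))) + (\<Sum>x<n. (2 * real x + 1) * avg (t x))"
    unfolding avg_def by (simp add: expct_add expct_sum)
  also have "(\<Sum>x<n. (2 * real x + 1) * avg (t x)) \<le> (\<Sum>x<n. (2 * real x + 1) * (1/2) ^ x)"
  proof (intro sum_mono mult_left_mono)
    fix x
    have "avg (t x) \<le> 2 * (4 * \<rho>) ^ (x + 1)"
      unfolding t_def by (rule deficiency_tail[OF _ pow rho]) (simp add: n)
    also have "\<dots> \<le> 2 * (1 / 2) ^ (x + 1)"
      by (intro mult_left_mono power_mono rho mult_nonneg_nonneg \<rho>_nonneg) simp_all
    finally show "avg (t x) \<le> (1/2) ^ x" by simp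
  qed auto
  also have "\<dots> \<le> 6" by (rule sum_odd_half)
  finally show ?thesis by simp
qed

section \<open>Choice of parameters\<close>

lemma polylog_small:
  fixes A c \<epsilon> :: real and j :: nat
  assumes "0 < c" "0 < \<epsilon>"
  shows "\<forall>\<^sub>F n in sequentially. A * ln (real n) ^ j * real n powr (- c) \<le> \<epsilon>"
proof -
  have "((\<lambda>x::real. A * (ln x powr real j * x powr (- c))) \<longlongrightarrow> A * 0) at_top"
    using assms by (intro tendsto_mult tendsto_const) real_asymp
  then have "((\<lambda>n::nat. A * (ln (real n) powr real j * real n powr (- c))) \<longlongrightarrow> A * 0) sequentially"
    by (rule filterlim_compose) (rule filterlim_real_sequentially)
  then have "\<forall>\<^sub>F n in sequentially. A * (ln (real n) powr real j * real n powr (- c)) < \<epsilon>"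
    using assms by (intro order_tendstoD(2)) auto
  moreover have "\<forall>\<^sub>F n in sequentially. 3 \<le> n" by (rule eventually_ge_at_top)
  ultimately show ?thesis
  proof eventually_elim
    case (elim n)
    then have "0 < ln (real n)" by (intro ln_gt_zero) auto
    then show ?case using elim by (simp add: powr_realpow mult.assoc)
  qed
qed

lemma binary_length:
  assumes "3 \<le> n"
  shows "\<exists>m. n < 2 ^ m \<and> 2 ^ (m - 1) \<le> n \<and> 1 \<le> m \<and> real m \<le> 3 * ln (real n)"
proof -
  define m where "m = (LEAST m. n < 2 ^ m)"
  have lt: "n < 2 ^ m" unfolding m_def by (rule LeastI[of _ n]) (rule less_exp)
  have m1: "1 \<le> m" using lt assms by (cases m) auto
  then have "m - 1 < m" by simp
  then have le: "2 ^ (m - 1) \<le> n" using not_less_Least[of "m - 1" "\<lambda>m. n < 2 ^ m"] by (simp add: m_def)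
  have n1: "1 \<le> ln (real n)"
    using assms e_less_272 by (subst ln_ge_iff) auto
  have "(2::real) ^ (m - 1) \<le> real n" using of_nat_mono[OF le, where 'a = real] by simp
  then have "ln ((2::real) ^ (m - 1)) \<le> ln (real n)" using assms by (subst ln_le_cancel_iff) auto
  then have "real (m - 1) * ln 2 \<le> ln (real n)" by (simp add: ln_realpow)
  moreover have "real (m - 1) * (1 / 2) \<le> real (m - 1) * ln 2"
    using ln2_ge_two_thirds by (intro mult_left_mono) auto
  ultimately have "real m \<le> 3 * ln (real n)" using n1 m1 by (simp add: of_nat_diff)
  then show ?thesis using lt le m1 by blast
qed

lemma ln_ge1: "3 \<le> n \<Longrightarrow> 1 \<le> ln (real n)"
  using e_less_272 by (subst ln_ge_iff) auto

lemma div_ge: "0 < d \<Longrightarrow> real n / real d - 1 \<le> real (n div d)"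
proof -
  assume "0 < d"
  then have "real (n mod d) / real d \<le> 1" by (simp add: less_imp_le)
  then show ?thesis using of_nat_of_nat_div_aux[of n d, where 'a = real] by linarith
qed

text \<open>The number \<open>M0\<close> of blocks that are given up is \<open>n^(1-c)\<close> with \<open>c =
  1/(4 r^2)\<close>. This is small enough for \<open>M0 log n = o(n)\<close> and, as \<open>c (r - 1)
  < 1/(2 (r + 1))\<close>, large enough for \<open>M0^(r-1)\<close> to dominate the bound
  \<open>\<beta>\<close> on bad sets at a vertex.\<close>

lemma switching_parameters:
  fixes r :: nat
  assumes r: "2 \<le> r"
  shows "\<forall>\<^sub>F n in sequentially. \<exists>M0 \<beta>. r \<le> M0 \<and> M0 < n div (2 * r) \<and>
     n ^ ((r - 1) * M0) \<le> 2 ^ (n div (2 * r) - M0) \<and>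
     2 * r ^ (r + 1) * \<beta> < (M0 div r) ^ (r - 1) \<and>
     real n powr (real r - 1 - 1 / (2 * real (r + 1))) \<le> real \<beta>"
proof -
  define c where "c = 1 / (4 * real r ^ 2)"
  define d where "d = 1 / (2 * real (r + 1)) - c * (real r - 1)"
  have "2 ^ 2 \<le> real r ^ 2" using r by (intro power_mono) auto
  then have r4: "4 \<le> real r ^ 2" by simp
  then have "0 < real r ^ 2" by linarith
  with r4 have c0: "0 < c" "c < 1 / 2" unfolding c_def by (simp_all add: divide_less_eq del: zero_less_power2)
  have d0: "0 < d"
  proof -
    have "c * (real r - 1) < c * real r" using c0 by simp
    also have "\<dots> = 1 / (4 * real r)" using r by (simp add: c_def power2_eq_square)
    also have "\<dots> \<le> 1 / (2 * real (r + 1))" using r by (intro divide_left_mono) auto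
    finally show ?thesis by (simp add: d_def)
  qed
  have e1: "\<forall>\<^sub>F n in sequentially. (24 * real r ^ 2) * ln (real n) ^ 1 * real n powr (- c) \<le> 1"
    by (rule polylog_small) (use c0 in auto)
  have e2: "\<forall>\<^sub>F n in sequentially. (2 * real r ^ (r + 1) * 2 * (2 * real r) ^ (r - 1)) * ln (real n) ^ 0 * real n powr (- d) \<le> 1 / 2"
    by (rule polylog_small) (use d0 in auto)
  have e3: "\<forall>\<^sub>F n in sequentially. (2 * real r) * ln (real n) ^ 0 * real n powr (- (1 - c)) \<le> 1"
    by (rule polylog_small) (use c0 in auto)
  show ?thesis
    using e1 e2 e3 eventually_ge_at_top[of "max 3 (4 * r)"]
  proof eventually_elim
    case (elim n)
    let ?x = "real n"
    have n3: "3 \<le> n" "4 * r \<le> n" and x0: "1 \<le> ?x" "0 < ?x" using elim by auto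
    have l1: "1 \<le> ln ?x" using ln_ge1[OF n3(1)] .
    obtain m where m: "n < 2 ^ m" "1 \<le> m" "real m \<le> 3 * ln ?x" using binary_length[OF n3(1)] by blast
    define M0 where "M0 = nat \<lceil>?x powr (1 - c)\<rceil>"
    define \<beta> where "\<beta> = nat \<lceil>?x powr (real r - 1 - 1 / (2 * real (r + 1)))\<rceil>"
    have M0l: "?x powr (1 - c) \<le> real M0" unfolding M0_def by linarith
    have xm: "?x powr (1 - c) = ?x * ?x powr (- c)" using x0 by (simp add: powr_diff powr_minus field_simps)
    have one: "1 \<le> ?x powr a" if "0 \<le> a" for a using x0 that ge_one_powr_ge_zero by auto
    have M0u: "real M0 \<le> 2 * ?x powr (1 - c)" using one[of "1 - c"] c0 unfolding M0_def by linarith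
    have big: "2 * real r \<le> ?x powr (1 - c)"
    proof -
      have "2 * real r = ?x powr (1 - c) * (2 * real r * ?x powr (- (1 - c)))"
        using x0 by (simp add: powr_add[symmetric])
      also have "\<dots> \<le> ?x powr (1 - c) * 1" using elim(3) by (intro mult_left_mono) auto
      finally show ?thesis by simp
    qed
    have be: "0 \<le> real r - 1 - 1 / (2 * real (r + 1))" 
    proof -
      have "1 / (2 * real (r + 1)) \<le> 1" by (simp add: field_simps)
      then show ?thesis using r by linarith
    qed
    have \<beta>u: "real \<beta> \<le> 2 * ?x powr (real r - 1 - 1 / (2 * real (r + 1)))"
      using one[OF be] unfolding \<beta>_def by linarith
    have rM: "2 * r \<le> M0" using big M0l by linarith
    have N: "?x / (4 * real r) \<le> real (n div (2 * r))"
    proof -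
      have "?x / (2 * real r) - 1 \<le> real (n div (2 * r))" using div_ge[of "2 * r" n] r by simp
      moreover have "1 \<le> ?x / (4 * real r)" using n3 r by (simp add: field_simps flip: of_nat_mult)
      moreover have "?x / (2 * real r) = 2 * (?x / (4 * real r))" using r by (simp add: field_simps)
      ultimately show ?thesis by linarith
    qed
    have key: "M0 * (m * (r - 1) + 1) \<le> n div (2 * r)"
    proof -
      have "real (m * (r - 1) + 1) \<le> 3 * ln ?x * real (r - 1) + 3 * ln ?x"
        using mult_right_mono[OF m(3), of "real (r - 1)"] l1 unfolding of_nat_add of_nat_mult of_nat_1 by linarith
      also have "\<dots> = 3 * real r * ln ?x" using r by (simp add: of_nat_diff algebra_simps)
      finally have "real (M0 * (m * (r - 1) + 1)) \<le> (2 * ?x powr (1 - c)) * (3 * real r * ln ?x)"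
        unfolding of_nat_mult using M0u by (intro mult_mono) auto
      also have "\<dots> = ?x / (4 * real r) * (24 * real r ^ 2 * ln ?x ^ 1 * ?x powr (- c))"
        using r by (simp add: xm power2_eq_square field_simps)
      also have "\<dots> \<le> ?x / (4 * real r) * 1" using elim(1) by (intro mult_left_mono) auto
      also have "\<dots> \<le> real (n div (2 * r))" using N by simp
      finally show ?thesis by (simp only: of_nat_le_iff)
    qed
    have "2 \<le> m * (r - 1) + 1" using m r by (cases m; cases "r - 1") auto
    then have "M0 * 2 \<le> M0 * (m * (r - 1) + 1)" by (rule mult_le_mono2)
    then have lt: "M0 < n div (2 * r)" using key rM r by linarith
    have few: "n ^ ((r - 1) * M0) \<le> 2 ^ (n div (2 * r) - M0)"
    proof -
      have "n ^ ((r - 1) * M0) \<le> (2 ^ m) ^ ((r - 1) * M0)" using m by (intro power_mono) auto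
      also have "\<dots> = 2 ^ (m * ((r - 1) * M0))" by (simp add: power_mult)
      also have "\<dots> \<le> 2 ^ (n div (2 * r) - M0)"
      proof (rule power_increasing)
        have "m * ((r - 1) * M0) + M0 = M0 * (m * (r - 1) + 1)" by (simp add: algebra_simps)
        then show "m * ((r - 1) * M0) \<le> n div (2 * r) - M0" using key by linarith
      qed simp
      finally show ?thesis .
    qed
    have half: "?x powr (1 - c) / (2 * real r) \<le> real (M0 div r)"
    proof -
      have "real M0 / real r - 1 \<le> real (M0 div r)" using div_ge[of r M0] r by simp
      moreover have "?x powr (1 - c) / real r \<le> real M0 / real r" using M0l by (intro divide_right_mono) auto
      moreover have "1 \<le> ?x powr (1 - c) / (2 * real r)" using big r by (simp add: field_simps)
      moreover have "?x powr (1 - c) / real r = 2 * (?x powr (1 - c) / (2 * real r))" using r by (simp add: field_simps)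
      ultimately show ?thesis by linarith
    qed
    have large: "real (2 * r ^ (r + 1) * \<beta>) < real ((M0 div r) ^ (r - 1))"
    proof -
      let ?P = "?x powr ((1 - c) * (real r - 1))"
      have P0: "0 < ?P" using x0 by simp
      have P: "(?x powr (1 - c)) ^ (r - 1) = ?P"
      proof -
        have "(?x powr (1 - c)) ^ (r - 1) = (?x powr (1 - c)) powr real (r - 1)"
          using x0 by (intro powr_realpow[symmetric]) simp
        also have "\<dots> = ?P" using r unfolding powr_powr by (simp add: of_nat_diff)
        finally show ?thesis .
      qed
      have xd: "?x powr (real r - 1 - 1 / (2 * real (r + 1))) = ?P * ?x powr (- d)"
        unfolding powr_add[symmetric] d_def by (rule arg_cong[where f = "\<lambda>a. ?x powr a"]) (simp add: algebra_simps)
      have "real (2 * r ^ (r + 1) * \<beta>) \<le> 2 * real r ^ (r + 1) * (2 * (?P * ?x powr (- d)))"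
        using \<beta>u xd r by (simp only: of_nat_mult of_nat_power of_nat_numeral) (intro mult_left_mono, auto)
      also have "\<dots> = ?P / (2 * real r) ^ (r - 1) * ((2 * real r ^ (r + 1) * 2 * (2 * real r) ^ (r - 1)) * ln ?x ^ 0 * ?x powr (- d))"
        using r by (simp add: field_simps)
      also have "\<dots> \<le> ?P / (2 * real r) ^ (r - 1) * (1 / 2)" using elim(2) by (intro mult_left_mono) auto
      also have "\<dots> < ?P / (2 * real r) ^ (r - 1)" using P0 r by (simp add: field_simps)
      also have "\<dots> = (?x powr (1 - c) / (2 * real r)) ^ (r - 1)" by (simp only: power_divide P)
      also have "\<dots> \<le> real (M0 div r) ^ (r - 1)" using half by (intro power_mono) auto
      finally show ?thesis by (simp only: of_nat_power)
    qed
    have "?x powr (real r - 1 - 1 / (2 * real (r + 1))) \<le> real \<beta>" unfolding \<beta>_def by linarith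
    then show ?case using rM lt few large unfolding of_nat_less_iff by (intro exI[of _ M0] exI[of _ \<beta>]) simp
  qed
qed

section \<open>The second moment of the deficiency\<close>

definition window_const :: "nat \<Rightarrow> real" where
  "window_const R = 2 ^ R * (3 * real R) ^ R"

lemma window_const_nonneg: "0 \<le> window_const R" by (simp add: window_const_def)

lemma window_bound:
  assumes "1 \<le> R" "1 \<le> l" "real k \<le> 2 * l"
  shows "2 ^ R * real (R * k + 1) ^ R \<le> window_const R * l ^ R"
proof -
  have "real R * real k \<le> real R * (2 * l)" using assms by (intro mult_left_mono) auto
  moreover have "1 * 1 \<le> real R * l" using assms by (intro mult_mono) auto
  ultimately have "real (R * k + 1) \<le> 3 * real R * l" by simp
  then have "real (R * k + 1) ^ R \<le> (3 * real R * l) ^ R" by (rule power_mono) simp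
  then show ?thesis by (simp add: window_const_def power_mult_distrib mult.assoc)
qed

text \<open>Moments of order \<open>k = \<lceil>ln n\<rceil>\<close> with \<open>L = e^6\<close> give failure
  probabilities \<open>n^(-6)\<close>, enough to pay for the trivial bound \<open>n^2\<close> and for
  all vertices and patterns. The second edge set thins \<open>p\<close> down to \<open>p2 = min p
  (n^(-2/r) (ln n)^2)\<close>; this leaves only polylogarithmic factors in the counts of \<open>g
  \<inter> h\<close>, and \<open>n^(r-1) p2^(r choose 2)\<close> is still a large multiple of
  \<open>ln n\<close>, as needed for about \<open>log_2 n\<close> rounds.\<close>

lemma deficiency_second_moment_at:
  fixes n r :: nat and p :: real
  defines "x \<equiv> real n" and "l \<equiv> ln (real n)" and "L \<equiv> exp 6" and "y \<equiv> p * real n powr (2 / real (r + 1))"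
  assumes r: "2 \<le> r" and n3: "3 \<le> n" "8 * r \<le> n" and p: "0 < p" "p \<le> 1"
    and M0: "r \<le> M0" "M0 < n div (2 * r)"
    and few: "n ^ ((r - 1) * M0) \<le> 2 ^ (n div (2 * r) - M0)"
    and large: "2 * r ^ (r + 1) * \<beta> < (M0 div r) ^ (r - 1)"
    and \<beta>: "x powr (real r - 1 - 1 / (2 * real (r + 1))) \<le> real \<beta>"
    and dense: "96 * factor_const r * 2 ^ 420 * l \<le> x ^ (r - 1) * p ^ (r choose 2)"
      "96 * factor_const r * 2 ^ 420 \<le> l"
    and y: "y \<le> 1" "8 * real (r + 1) * L * y \<le> 1 / 2" "(real (r + 1) * factor_const r) ^ (r + 1) * L * y \<le> 1 / 10"
    and e1: "2 * real (r + 1) * L * window_const (r + 1) * l ^ (r + 1) * x powr (- 1 / (2 * real (r + 1))) \<le> 1 / 2"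
    and e2: "2 * real r * L * window_const r * l ^ (r + 2 * r ^ 2) * x powr (- 1 / (2 * real (r + 1))) \<le> 1 / 2"
    and e3: "8 * real (r + 1) * L * window_const (r + 1) * l ^ (r + 1) * x powr (- 1) \<le> 1 / 2"
    and e4: "(real (r + 1) * factor_const r) ^ (r + 1) * L * (1 + window_const (r + 1)) * l ^ (r + 1) * x powr (- 1 / real (r + 1)) \<le> 1 / 10"
    and e5: "(real r * factor_const r) ^ r * L * (1 + window_const r) * l ^ (r + 2 * r ^ 2) * x powr (- 1 / real r) \<le> 1 / 10"
    and e6: "(2 * real r + 1 + real (r + 1) ^ (r + 1) + real r ^ r) * x powr (- 3) \<le> 1 / 2"
    and e7: "(4 * factor_const r ^ 8 * 36 ^ 7) * l ^ 56 * x powr (- 4) \<le> 1 / 2"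
  shows "expct (rsub (all_edges {1..n}) p) (\<lambda>g. real (deficiency {1..n} r g) ^ 2) \<le> 7"
proof -
  have x0: "1 \<le> x" "0 < x" using n3 by (auto simp: x_def)
  have l1: "1 \<le> l" using ln_ge1[OF n3(1)] by (simp add: l_def)
  have lx: "x = exp l" using x0 by (simp add: l_def x_def)
  have L0: "0 < L" by (simp add: L_def)
  have fc0: "1 \<le> factor_const r"
    using factor_const_ge1[of "{1..n}" n r M0 \<beta>] r M0 few large by simp
  have y0: "0 \<le> y" using p by (simp add: y_def)
  define k where "k = nat \<lceil>l\<rceil>"
  have k: "l \<le> real k" "real k \<le> 2 * l" using l1 unfolding k_def by linarith+
  define p2 where "p2 = min p (x powr (- 2 / real r) * l ^ 2)"
  define q where "q = p2 / p"
  have p2: "0 < p2" "p2 \<le> p" "p2 \<le> l ^ 2 * x powr (- 2 / real r)" using p x0 l1 by (auto simp: p2_def mult.commute)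
  have q: "0 < q" "q \<le> 1" "p * q = p2" using p p2 by (auto simp: q_def)
  define Yb where "Yb = l ^ (2 * r ^ 2)"
  have Yb: "1 \<le> Yb" "\<And>D. D \<le> r ^ 2 \<Longrightarrow> (l ^ 2) ^ D \<le> Yb"
    using l1 by (auto simp: Yb_def power_mult[symmetric] intro!: one_le_power power_increasing)
  obtain m where m: "n < 2 ^ m" "2 ^ (m - 1) \<le> n" "1 \<le> m" "real m \<le> 3 * l"
    using binary_length[OF n3(1)] by (auto simp: l_def)
  have w1: "2 ^ (r + 1) * real ((r + 1) * k + 1) ^ (r + 1) \<le> window_const (r + 1) * l ^ (r + 1)"
    by (rule window_bound[OF _ l1 k(2)]) simp
  have w2: "2 ^ r * real (r * k + 1) ^ r \<le> window_const r * l ^ r"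
    by (rule window_bound[OF _ l1 k(2)]) (use r in simp)
  have lr1: "1 \<le> l ^ j" for j using l1 by simp
  have dec: "x powr a \<le> x powr b" if "a \<le> b" for a b using that x0 by (intro powr_mono) auto
  let ?e = "real r - 1 - 1 / (2 * real (r + 1))"
  have H1: "2 * real (r + 1) * (L * (2 ^ (r + 1) * real ((r + 1) * k + 1) ^ (r + 1))) * x powr (real r - 1 - 1 / real (r + 1))
       + 2 * real r * (L * (2 ^ r * real (r * k + 1) ^ r * Yb)) * x powr (real r - 1 - 1 / real r) \<le> real \<beta>"
  proof -
    have "2 * real (r + 1) * (L * (2 ^ (r + 1) * real ((r + 1) * k + 1) ^ (r + 1))) * x powr (real r - 1 - 1 / real (r + 1))
       \<le> 2 * real (r + 1) * (L * (window_const (r + 1) * l ^ (r + 1))) * (x powr (- 1 / (2 * real (r + 1))) * x powr ?e)"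
    proof (rule mult_mono[OF mult_left_mono[OF mult_left_mono[OF w1]]])
      have split: "a - i = - j + (a - j)" if "i = j + j" for a i j :: real using that by simp
      have "real r - 1 - 1 / real (r + 1) = - (1 / (2 * real (r + 1))) + ?e" by (rule split) (simp add: field_simps)
      also have "- (1 / (2 * real (r + 1))) = - 1 / (2 * real (r + 1))" by simp
      finally have "x powr (real r - 1 - 1 / real (r + 1)) = x powr (- 1 / (2 * real (r + 1))) * x powr ?e" by (simp only: powr_add)
      then show "x powr (real r - 1 - 1 / real (r + 1)) \<le> x powr (- 1 / (2 * real (r + 1))) * x powr ?e"
        by (rule eq_refl)
    qed (use L0 window_const_nonneg l1 in auto)
    also have "\<dots> = (2 * real (r + 1) * L * window_const (r + 1) * l ^ (r + 1) * x powr (- 1 / (2 * real (r + 1)))) * x powr ?e"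
      by (simp only: mult_ac)
    also have "\<dots> \<le> 1 / 2 * x powr ?e" by (intro mult_right_mono e1) simp
    finally have 1: "2 * real (r + 1) * (L * (2 ^ (r + 1) * real ((r + 1) * k + 1) ^ (r + 1))) * x powr (real r - 1 - 1 / real (r + 1)) \<le> 1 / 2 * x powr ?e" .
    have "2 * real r * (L * (2 ^ r * real (r * k + 1) ^ r * Yb)) * x powr (real r - 1 - 1 / real r)
       \<le> 2 * real r * (L * (window_const r * l ^ r * Yb)) * (x powr (- 1 / (2 * real (r + 1))) * x powr ?e)"
    proof (rule mult_mono[OF mult_left_mono[OF mult_left_mono[OF mult_right_mono[OF w2]]]])
      have "1 / real (r + 1) \<le> 1 / real r" using r by (intro divide_left_mono) auto
      moreover have split: "a - i' \<le> - j + (a - j)" if "i \<le> i'" "i = j + j" for a i i' j :: real using that by simp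
      ultimately have "real r - 1 - 1 / real r \<le> - (1 / (2 * real (r + 1))) + ?e"
        by (intro split[of "1 / real (r + 1)"]) (simp_all add: field_simps)
      also have "- (1 / (2 * real (r + 1))) = - 1 / (2 * real (r + 1))" by simp
      finally have exps: "real r - 1 - 1 / real r \<le> - 1 / (2 * real (r + 1)) + ?e" .
      from dec[OF exps] show "x powr (real r - 1 - 1 / real r) \<le> x powr (- 1 / (2 * real (r + 1))) * x powr ?e"
        by (simp only: powr_add)
    qed (use L0 window_const_nonneg l1 Yb in auto)
    also have "\<dots> = (2 * real r * L * window_const r * l ^ (r + 2 * r ^ 2) * x powr (- 1 / (2 * real (r + 1)))) * x powr ?e"
      by (simp only: mult_ac power_add Yb_def)
    also have "\<dots> \<le> 1 / 2 * x powr ?e" by (intro mult_right_mono e2) simp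
    finally show ?thesis using 1 \<beta> by linarith
  qed
  have H2: "8 * real (r + 1) * (L * (y * x + 2 ^ (r + 1) * real ((r + 1) * k + 1) ^ (r + 1))) \<le> x"
  proof -
    have "8 * real (r + 1) * (L * (y * x + 2 ^ (r + 1) * real ((r + 1) * k + 1) ^ (r + 1)))
       \<le> 8 * real (r + 1) * (L * (y * x + window_const (r + 1) * l ^ (r + 1)))"
      by (rule mult_left_mono[OF mult_left_mono[OF add_left_mono[OF w1]]]) (use L0 in auto)
    also have "\<dots> = (8 * real (r + 1) * L * y) * x + (8 * real (r + 1) * L * window_const (r + 1) * l ^ (r + 1) * x powr (- 1)) * x"
      using x0 by (simp add: powr_minus distrib_left)
    also have "\<dots> \<le> 1 / 2 * x + 1 / 2 * x" by (intro add_mono mult_right_mono y e3) (use x0 in auto)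
    finally show ?thesis by simp
  qed
  have H3: "(real (r + 1) * factor_const r) ^ (r + 1) * (L * (y + (1 + 2 ^ (r + 1) * real ((r + 1) * k + 1) ^ (r + 1)) * x powr (- 1 / real (r + 1)))) < 1 / 4"
  proof -
    let ?c = "(real (r + 1) * factor_const r) ^ (r + 1)"
    have "?c * (L * (y + (1 + 2 ^ (r + 1) * real ((r + 1) * k + 1) ^ (r + 1)) * x powr (- 1 / real (r + 1))))
       \<le> ?c * (L * (y + (l ^ (r + 1) + window_const (r + 1) * l ^ (r + 1)) * x powr (- 1 / real (r + 1))))"
      by (rule mult_left_mono[OF mult_left_mono[OF add_left_mono[OF mult_right_mono[OF add_mono[OF lr1 w1]]]]]) (use L0 fc0 in auto)
    also have "\<dots> = ?c * L * y + ?c * L * (1 + window_const (r + 1)) * l ^ (r + 1) * x powr (- 1 / real (r + 1))"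
      by (simp only: distrib_left distrib_right mult_1_left mult.assoc)
    finally show ?thesis using y(3) e4 by linarith
  qed
  have H4: "(real r * factor_const r) ^ r * (L * ((1 + 2 ^ r * real (r * k + 1) ^ r) * Yb * x powr (- 1 / real r))) < 1 / 4"
  proof -
    let ?c = "(real r * factor_const r) ^ r"
    have "?c * (L * ((1 + 2 ^ r * real (r * k + 1) ^ r) * Yb * x powr (- 1 / real r)))
       \<le> ?c * (L * ((l ^ r + window_const r * l ^ r) * Yb * x powr (- 1 / real r)))"
      by (rule mult_left_mono[OF mult_left_mono[OF mult_right_mono[OF mult_right_mono[OF add_mono[OF lr1 w2]]]]]) (use L0 fc0 Yb in auto)
    also have "\<dots> = ?c * L * (1 + window_const r) * l ^ (r + 2 * r ^ 2) * x powr (- 1 / real r)"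
      by (simp only: Yb_def power_add distrib_left distrib_right mult_1_left mult_ac)
    finally show ?thesis using e5 by linarith
  qed
  have py: "p \<le> y * x powr (- 2 / real (r + 1))"
    using x0 by (simp add: y_def x_def mult.assoc powr_add[symmetric])
  have P: "expct (rsub (all_edges {1..n}) p) (\<lambda>g. expct (rsub (all_edges {1..n}) q) (\<lambda>h. of_bool (clean_factors {1..n} r \<beta> g h = {})))
   \<le> (2 * real r * x + 1 + real (r + 1) ^ (r + 1) + real r ^ r) * (1 / L) ^ k
     + 4 * (x ^ 4 * (factor_const r / x ^ (r - 1))) ^ 8 * (36 ^ 7 * (p * q) ^ 28) * of_bool (r = 4)"
    unfolding x_def
    by (rule clean_factors_empty_prob[OF _ _ r M0 few large p q(1,2) y0 y(1) py[unfolded x_def] _ _ Yb L0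
          H1[unfolded x_def] H2[unfolded x_def] n3(2) H3[unfolded x_def] H4[unfolded x_def]])
       (use p2 q(3) in \<open>auto simp: x_def\<close>)
  have "x ^ 2 * ((2 * real r * x + 1 + real (r + 1) ^ (r + 1) + real r ^ r) * (1 / L) ^ k) \<le> 1 / 2"
  proof -
    have "(1 / L) ^ k = exp (- (6 * real k))"
      by (simp add: L_def exp_of_nat_mult[symmetric] exp_minus field_simps)
    also have "\<dots> \<le> exp (- (6 * l))" using k by simp
    also have "\<dots> = x powr (- 6)" using x0 by (simp add: powr_def l_def x_def)
    finally have Lk: "(1 / L) ^ k \<le> x powr (- 6)" .
    have "2 * real r * x + 1 + real (r + 1) ^ (r + 1) + real r ^ r \<le> 2 * real r * x + 1 * x + real (r + 1) ^ (r + 1) * x + real r ^ r * x"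
      using mult_left_mono[OF x0(1), of "real (r + 1) ^ (r + 1)"] mult_left_mono[OF x0(1), of "real r ^ r"] x0(1)
      by (intro add_mono order_refl) simp_all
    also have "\<dots> = (2 * real r + 1 + real (r + 1) ^ (r + 1) + real r ^ r) * x" by (simp add: distrib_right)
    finally have "x ^ 2 * ((2 * real r * x + 1 + real (r + 1) ^ (r + 1) + real r ^ r) * (1 / L) ^ k)
       \<le> x ^ 2 * (((2 * real r + 1 + real (r + 1) ^ (r + 1) + real r ^ r) * x) * x powr (- 6))"
      by (intro mult_left_mono mult_mono Lk) (use x0 L0 in auto)
    also have "\<dots> = (2 * real r + 1 + real (r + 1) ^ (r + 1) + real r ^ r) * (x powr 3 * x powr (- 6))"
      using x0 by (simp add: powr_numeral power2_eq_square power3_eq_cube)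
    also have "\<dots> = (2 * real r + 1 + real (r + 1) ^ (r + 1) + real r ^ r) * x powr (- 3)"
      by (simp add: powr_add[symmetric])
    finally show ?thesis using e6 by linarith
  qed
  moreover have "x ^ 2 * (4 * (x ^ 4 * (factor_const r / x ^ (r - 1))) ^ 8 * (36 ^ 7 * (p * q) ^ 28) * of_bool (r = 4)) \<le> 1 / 2"
  proof (cases "r = 4")
    case True
    have "(p * q) ^ 28 \<le> (l ^ 2 * x powr (- 2 / real r)) ^ 28" using p2 q(3) by (intro power_mono) auto
    also have "\<dots> = l ^ 56 * (x powr (- (1 / 2))) ^ 28"
      using True by (simp only: power_mult_distrib power_mult[symmetric]) simp
    also have "(x powr (- (1 / 2))) ^ 28 = x powr (- 14)"
      using x0 by (subst powr_power) auto
    finally have pq: "(p * q) ^ 28 \<le> l ^ 56 * x powr (- 14)" .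
    have "x ^ 4 * (factor_const r / x ^ (r - 1)) = factor_const r * x"
      using x0 by (simp add: True power4_eq_xxxx power3_eq_cube)
    then have "x ^ 2 * (4 * (x ^ 4 * (factor_const r / x ^ (r - 1))) ^ 8 * (36 ^ 7 * (p * q) ^ 28) * of_bool (r = 4))
       \<le> x ^ 2 * (4 * (factor_const r * x) ^ 8 * (36 ^ 7 * (l ^ 56 * x powr (- 14))) * 1)"
      using x0 fc0 by (simp only:) (intro mult_mono mult_left_mono pq, auto)
    also have "\<dots> = (4 * factor_const r ^ 8 * 36 ^ 7) * l ^ 56 * (x ^ 10 * x powr (- 14))"
      by (simp only: power_mult_distrib mult_ac) (simp add: power_add[symmetric])
    also have "x ^ 10 * x powr (- 14) = x powr (- 4)"
      using x0 by (simp add: powr_numeral[symmetric] powr_add[symmetric] del: powr_numeral)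
    finally show ?thesis using e7 by linarith
  qed simp
  ultimately have PP: "x ^ 2 * expct (rsub (all_edges {1..n}) p) (\<lambda>g. expct (rsub (all_edges {1..n}) q) (\<lambda>h. of_bool (clean_factors {1..n} r \<beta> g h = {}))) \<le> 1"
    using mult_left_mono[OF P, of "x ^ 2"] unfolding distrib_left by (auto simp: mult.assoc)
  define K where "K = (2::real) ^ 420"
  have K0: "0 < K" by (simp add: K_def)
  have dens2: "96 * factor_const r * K * l \<le> x ^ (r - 1) * p2 ^ (r choose 2)"
  proof (cases "p \<le> x powr (- 2 / real r) * l ^ 2")
    case True
    then show ?thesis using dense(1) by (simp add: p2_def K_def)
  next
    case False
    then have p2e: "p2 = x powr (- 2 / real r) * l ^ 2" by (simp add: p2_def)
    have "real (r choose 2) = real r * (real r - 1) / 2"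
      using r by (simp add: choose_two real_of_nat_div of_nat_diff)
    then have ex: "real (r choose 2) * (- 2 / real r) = - real (r - 1)"
      using r by (simp add: of_nat_diff field_simps)
    have "p2 ^ (r choose 2) = x powr (real (r choose 2) * (- 2 / real r)) * (l ^ 2) ^ (r choose 2)"
      using x0 unfolding p2e power_mult_distrib by (subst powr_power) auto
    also have "x powr (real (r choose 2) * (- 2 / real r)) = 1 / x ^ (r - 1)"
      unfolding ex using x0 by (simp add: powr_minus powr_realpow field_simps)
    finally have "x ^ (r - 1) * p2 ^ (r choose 2) = (l ^ 2) ^ (r choose 2)" using x0 by simp
    moreover have "l ^ 2 \<le> (l ^ 2) ^ (r choose 2)" using r lr1[of 2] by (intro self_le_power) auto
    moreover have "96 * factor_const r * K * l \<le> l ^ 2"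
      using mult_right_mono[OF dense(2), of l] l1 by (simp only: K_def power2_eq_square)
    ultimately show ?thesis by linarith
  qed
  have small: "4 * ((2 * factor_const r / real n ^ (r - 1)) * (2 * real m * K / (p * q) ^ (r choose 2))) \<le> 1 / 2"
  proof -
    have D0: "0 < x ^ (r - 1) * p2 ^ (r choose 2)" using x0 p2 by simp
    have "4 * ((2 * factor_const r / real n ^ (r - 1)) * (2 * real m * K / (p * q) ^ (r choose 2)))
       = 16 * factor_const r * K * real m / (x ^ (r - 1) * p2 ^ (r choose 2))"
      by (simp add: q(3) x_def)
    also have "\<dots> \<le> 16 * factor_const r * K * (3 * l) / (x ^ (r - 1) * p2 ^ (r choose 2))"
      using m(4) fc0 K0 D0 by (intro divide_right_mono mult_left_mono) auto
    also have "\<dots> \<le> 1 / 2" using D0 dens2 by (simp add: divide_le_eq)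
    finally show ?thesis .
  qed
  have "expct (rsub (all_edges {1..n}) p) (\<lambda>g. real (deficiency {1..n} r g) ^ 2)
     \<le> x ^ 2 * expct (rsub (all_edges {1..n}) p) (\<lambda>g. expct (rsub (all_edges {1..n}) q) (\<lambda>h. of_bool (clean_factors {1..n} r \<beta> g h = {}))) + 6"
    unfolding x_def
    by (rule deficiency_second_moment_le[OF _ _ r M0 few large p q(1,2) m(1,2) small[unfolded K_def]]) auto
  then show ?thesis using PP by linarith
qed

section \<open>The window of edge probabilities\<close>

locale clique_window =
  fixes r :: nat and p :: "nat \<Rightarrow> real"
  assumes r2: "r \<ge> 2"
    and p01: "\<And>n. 0 \<le> p n \<and> p n \<le> 1"
    and lower: "(\<lambda>n. real n powr (- 2 / real r) * ln (real n) powr (1 / real (r choose 2))) \<in> o(p)"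
    and upper: "p \<in> o(\<lambda>n. real n powr (- 2 / real (r + 1)))"
begin

lemma choose_two_pos: "0 < r choose 2"
  using r2 by (simp add: zero_less_binomial)

lemma choose_two_exponent: "real (r choose 2) * (- 2 / real r) = - real (r - 1)"
proof -
  have "real (r choose 2) = real r * (real r - 1) / 2"
    using r2 by (simp add: choose_two real_of_nat_div of_nat_diff)
  then show ?thesis using r2 by (simp add: of_nat_diff field_simps)
qed

lemma eventually_dense:
  assumes T: "1 \<le> T"
  shows "\<forall>\<^sub>F n in sequentially. 0 < p n \<and> T * ln (real n) \<le> real n ^ (r - 1) * p n ^ (r choose 2)"
proof -
  have "\<forall>\<^sub>F n in sequentially. norm (real n powr (- 2 / real r) * ln (real n) powr (1 / real (r choose 2))) \<le> (1 / T) * norm (p n)"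
    by (rule landau_o.smallD[OF lower]) (use T in auto)
  then show ?thesis using eventually_ge_at_top[of 3]
  proof eventually_elim
    case (elim n)
    let ?x = "real n" and ?C = "r choose 2"
    have l1: "1 \<le> ln ?x" and x0: "0 < ?x" using ln_ge1 elim by auto
    define a where "a = ?x powr (- 2 / real r) * ln ?x powr (1 / real ?C)"
    have "ln ?x \<noteq> 0" using l1 by linarith
    then have a0: "0 < a" unfolding a_def using x0 by (intro mult_pos_pos) (simp_all only: powr_gt_zero, simp)
    have le: "T * a \<le> p n" using elim(1) a0 T p01[of n] unfolding a_def[symmetric] by (simp add: field_simps)
    have "a ^ ?C = ?x powr (real ?C * (- 2 / real r)) * ln ?x powr (real ?C * (1 / real ?C))"
      unfolding a_def power_mult_distrib using x0 l1 by (simp only: powr_power)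
    also have "ln ?x powr (real ?C * (1 / real ?C)) = ln ?x" using choose_two_pos l1 by simp
    finally have aC: "?x ^ (r - 1) * a ^ ?C = ln ?x"
      unfolding choose_two_exponent using x0 by (simp add: powr_minus powr_realpow)
    have "T * ln ?x \<le> T ^ ?C * ln ?x"
      using T l1 choose_two_pos by (intro mult_right_mono self_le_power) auto
    also have "\<dots> = ?x ^ (r - 1) * (T * a) ^ ?C" using aC by (simp add: power_mult_distrib mult.left_commute)
    also have "\<dots> \<le> ?x ^ (r - 1) * p n ^ ?C" using le T a0 by (intro mult_left_mono power_mono) auto
    finally show ?case using le a0 T by (smt (verit) mult_pos_pos)
  qed
qed

lemma eventually_sparse:
  assumes "0 < \<epsilon>"
  shows "\<forall>\<^sub>F n in sequentially. p n * real n powr (2 / real (r + 1)) \<le> \<epsilon>"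
proof -
  have "\<forall>\<^sub>F n in sequentially. norm (p n) \<le> \<epsilon> * norm (real n powr (- 2 / real (r + 1)))"
    by (rule landau_o.smallD[OF upper assms])
  then show ?thesis using eventually_ge_at_top[of 1]
  proof eventually_elim
    case (elim n)
    have "p n * real n powr (2 / real (r + 1)) \<le> (\<epsilon> * real n powr (- 2 / real (r + 1))) * real n powr (2 / real (r + 1))"
      using elim(1) p01[of n] by (intro mult_right_mono) auto
    also have "\<dots> = \<epsilon>" using elim(2) by (simp add: mult.assoc powr_add[symmetric])
    finally show ?case .
  qed
qed

lemma eventually_ln_large: "\<forall>\<^sub>F n in sequentially. A \<le> ln (real n)"
proof -
  have "filterlim (\<lambda>n. ln (real n)) at_top sequentially"
    by (rule filterlim_compose[OF ln_at_top filterlim_real_sequentially])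
  then show ?thesis by (simp add: filterlim_at_top)
qed

theorem deficiency_second_moment:
  "\<forall>\<^sub>F n in sequentially. expct (rsub (all_edges {1..n}) (p n)) (\<lambda>g. real (deficiency {1..n} r g) ^ 2) \<le> 7"
proof -
  let ?T = "96 * factor_const r * 2 ^ 420"
  let ?c1 = "8 * real (r + 1) * exp 6" and ?c2 = "(real (r + 1) * factor_const r) ^ (r + 1) * exp 6"
  define K where "K = (2::real) ^ 420"
  have K0: "1 \<le> K" unfolding K_def by (rule one_le_power) simp
  have fc: "0 < factor_const r" using r2 by (simp add: factor_const_def spread_const_def)
  have c1: "0 < ?c1" and c2: "0 < ?c2" using fc by auto
  have polylog: "\<forall>\<^sub>F n in sequentially. A * ln (real n) ^ j * real n powr (- 1 / d) \<le> \<epsilon>" if "0 < d" "0 < \<epsilon>" for A d \<epsilon> :: real and j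
    using polylog_small[of "1 / d" \<epsilon> A j] that by simp
  have polylog': "\<forall>\<^sub>F n in sequentially. A * ln (real n) ^ j * real n powr (- d) \<le> \<epsilon>" if "0 < d" "0 < \<epsilon>" for A d \<epsilon> :: real and j
    using polylog_small[of d \<epsilon> A j] that by simp
  have d: "\<forall>\<^sub>F n in sequentially. 0 < p n \<and> max 1 (96 * factor_const r * K) * ln (real n) \<le> real n ^ (r - 1) * p n ^ (r choose 2)"
    by (rule eventually_dense) simp
  have e1: "\<forall>\<^sub>F n in sequentially. 2 * real (r + 1) * exp 6 * window_const (r + 1) * ln (real n) ^ (r + 1) * real n powr (- 1 / (2 * real (r + 1))) \<le> 1 / 2"
    by (rule polylog) simp_all
  have e2: "\<forall>\<^sub>F n in sequentially. 2 * real r * exp 6 * window_const r * ln (real n) ^ (r + 2 * r ^ 2) * real n powr (- 1 / (2 * real (r + 1))) \<le> 1 / 2"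
    by (rule polylog) simp_all
  have e3: "\<forall>\<^sub>F n in sequentially. 8 * real (r + 1) * exp 6 * window_const (r + 1) * ln (real n) ^ (r + 1) * real n powr (- 1) \<le> 1 / 2"
    by (rule polylog') simp_all
  have e4: "\<forall>\<^sub>F n in sequentially. (real (r + 1) * factor_const r) ^ (r + 1) * exp 6 * (1 + window_const (r + 1)) * ln (real n) ^ (r + 1) * real n powr (- 1 / real (r + 1)) \<le> 1 / 10"
    by (rule polylog) simp_all
  have e5: "\<forall>\<^sub>F n in sequentially. (real r * factor_const r) ^ r * exp 6 * (1 + window_const r) * ln (real n) ^ (r + 2 * r ^ 2) * real n powr (- 1 / real r) \<le> 1 / 10"
    by (rule polylog) (use r2 in simp_all)
  have e6: "\<forall>\<^sub>F n in sequentially. (2 * real r + 1 + real (r + 1) ^ (r + 1) + real r ^ r) * ln (real n) ^ 0 * real n powr (- 3) \<le> 1 / 2"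
    by (rule polylog') simp_all
  have e7: "\<forall>\<^sub>F n in sequentially. (4 * factor_const r ^ 8 * 36 ^ 7) * ln (real n) ^ 56 * real n powr (- 4) \<le> 1 / 2"
    by (rule polylog') simp_all
  have s1: "\<forall>\<^sub>F n in sequentially. p n * real n powr (2 / real (r + 1)) \<le> 1" by (rule eventually_sparse) simp
  have s2: "\<forall>\<^sub>F n in sequentially. p n * real n powr (2 / real (r + 1)) \<le> 1 / (2 * ?c1)" by (rule eventually_sparse) simp
  have s3: "\<forall>\<^sub>F n in sequentially. p n * real n powr (2 / real (r + 1)) \<le> 1 / (10 * ?c2)"
    by (rule eventually_sparse) (use c2 in simp)
  show ?thesis
    using switching_parameters[OF r2] d eventually_ln_large[of "96 * factor_const r * K"] s1 s2 s3 e1 e2 e3 e4 e5 e6 e7 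
      eventually_ge_at_top[of "max 3 (8 * r)"]
  proof eventually_elim
    case (elim n)
    obtain M0 \<beta> where M: "r \<le> M0" "M0 < n div (2 * r)" "n ^ ((r - 1) * M0) \<le> 2 ^ (n div (2 * r) - M0)"
      "2 * r ^ (r + 1) * \<beta> < (M0 div r) ^ (r - 1)" "real n powr (real r - 1 - 1 / (2 * real (r + 1))) \<le> real \<beta>"
      using elim(1) by blast
    have n3: "3 \<le> n" "8 * r \<le> n" using elim(14) by auto
    have p0: "0 < p n" using elim(2) by blast
    have "96 * factor_const r * K * ln (real n) \<le> max 1 (96 * factor_const r * K) * ln (real n)"
      using ln_ge1[OF n3(1)] by (intro mult_right_mono) auto
    also have "\<dots> \<le> real n ^ (r - 1) * p n ^ (r choose 2)" using elim(2) by blast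
    finally have dense: "96 * factor_const r * K * ln (real n) \<le> real n ^ (r - 1) * p n ^ (r choose 2)" .
    have y2: "?c1 * (p n * real n powr (2 / real (r + 1))) \<le> 1 / 2"
      by (rule order_trans[OF mult_left_mono[OF elim(5)]]) (use c1 in auto)
    have y3: "?c2 * (p n * real n powr (2 / real (r + 1))) \<le> 1 / 10"
    proof -
      have scale: "c * z \<le> 1 / 10" if "z \<le> 1 / (10 * c)" "0 < c" for c z :: real using that by (simp add: field_simps)
      show ?thesis by (rule scale[OF elim(6) c2])
    qed
    have e6': "(2 * real r + 1 + real (r + 1) ^ (r + 1) + real r ^ r) * real n powr (- 3) \<le> 1 / 2"
      using elim(12) by (simp only: power_0 mult_1_right)
    show ?case
      by (rule deficiency_second_moment_at[OF r2 n3 p0 _ M dense[unfolded K_def] elim(3)[unfolded K_def] elim(4) y2 y3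
          elim(7-11) e6' elim(13)]) (use p01 in simp)
  qed
qed

end

section \<open>Variance of functions of a random set\<close>

definition vari :: "'a pmf \<Rightarrow> ('a \<Rightarrow> real) \<Rightarrow> real" where
  "vari M f = expct M (\<lambda>x. f x ^ 2) - expct M f ^ 2"

lemma expct_rsub_insert:
  fixes f :: "'e set \<Rightarrow> 'b::{banach,second_countable_topology}"
  assumes "finite E" "e \<notin> E" "0 \<le> p" "p \<le> 1"
  shows "expct (rsub (insert e E) p) f = expct (rsub E p) (\<lambda>g. p *\<^sub>R f (insert e g) + (1 - p) *\<^sub>R f g)"
proof -
  have "expct (rsub (insert e E) p) f = expct (rsub {e} p) (\<lambda>x. expct (rsub E p) (\<lambda>y. f (x \<union> y)))"
    using assms by (subst rsub_split[of _ "{e}"]) auto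
  also have "\<dots> = expct (rsub E p) (\<lambda>y. expct (rsub {e} p) (\<lambda>x. f (x \<union> y)))"
    using assms by (intro expct_swap) auto
  finally show ?thesis using assms by (simp add: rsub_singleton)
qed

text \<open>Induction on the ground set: averaging over one element splits off the variance that it causes, and
  the conditional mean of \<open>f\<close> has increments of smaller mean square by convexity.\<close>

lemma efron_stein:
  fixes f :: "'e set \<Rightarrow> real"
  assumes "finite E" and p: "0 \<le> p" "p \<le> 1"
  shows "vari (rsub E p) f \<le> (\<Sum>e\<in>E. p * expct (rsub E p) (\<lambda>g. (f (insert e g) - f (g - {e})) ^ 2))"
  using assms(1)
proof (induction E arbitrary: f)
  case empty
  then show ?case by (simp add: vari_def)
next
  case (insert e E)
  define h where "h = (\<lambda>g. p * f (insert e g) + (1 - p) * f g)"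
  let ?R = "rsub E p" and ?D = "\<lambda>f a g. (f (insert a g) - f (g - {a}) :: real)"
  note I = expct_rsub_insert[OF insert.hyps(1,2) p]
  have "vari (rsub (insert e E) p) f = expct ?R (\<lambda>g. p * f (insert e g) ^ 2 + (1 - p) * f g ^ 2 - h g ^ 2) + vari ?R h"
    using insert.hyps by (simp add: vari_def I expct_diff h_def)
  also have "expct ?R (\<lambda>g. p * f (insert e g) ^ 2 + (1 - p) * f g ^ 2 - h g ^ 2) \<le> expct ?R (\<lambda>g. p * (f (insert e g) - f g) ^ 2)"
  proof (intro expct_mono)
    fix g
    have "p * f (insert e g) ^ 2 + (1 - p) * f g ^ 2 - h g ^ 2 = p * (1 - p) * (f (insert e g) - f g) ^ 2"
      by (simp add: h_def power2_eq_square algebra_simps)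
    also have "\<dots> \<le> p * 1 * (f (insert e g) - f g) ^ 2" using p by (intro mult_right_mono mult_left_mono) auto
    finally show "p * f (insert e g) ^ 2 + (1 - p) * f g ^ 2 - h g ^ 2 \<le> p * (f (insert e g) - f g) ^ 2" by simp
  qed (use insert.hyps in simp)
  also have "\<dots> = p * expct (rsub (insert e E) p) (\<lambda>g. ?D f e g ^ 2)"
  proof -
    have "expct (rsub (insert e E) p) (\<lambda>g. ?D f e g ^ 2) = expct ?R (\<lambda>g. (f (insert e g) - f g) ^ 2)"
      unfolding I
    proof (intro expct_cong)
      fix g assume "g \<in> set_pmf ?R"
      then have "g - {e} = g" using insert.hyps(2) by (auto dest!: rsub_sub)
      then show "p *\<^sub>R ?D f e (insert e g) ^ 2 + (1 - p) *\<^sub>R ?D f e g ^ 2 = (f (insert e g) - f g) ^ 2"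
        by (simp add: algebra_simps)
    qed
    then show ?thesis by simp
  qed
  also have "vari ?R h \<le> (\<Sum>a\<in>E. p * expct ?R (\<lambda>g. ?D h a g ^ 2))" by (rule insert.IH)
  also have "\<dots> \<le> (\<Sum>a\<in>E. p * expct (rsub (insert e E) p) (\<lambda>g. ?D f a g ^ 2))"
  proof (intro sum_mono mult_left_mono p)
    fix a assume a: "a \<in> E"
    show "expct ?R (\<lambda>g. ?D h a g ^ 2) \<le> expct (rsub (insert e E) p) (\<lambda>g. ?D f a g ^ 2)"
      unfolding I
    proof (intro expct_mono)
      fix g
      have ae: "insert e g - {a} = insert e (g - {a})" using a insert.hyps by auto
      have eq: "?D h a g = p * ?D f a (insert e g) + (1 - p) * ?D f a g"
        unfolding h_def ae by (simp add: algebra_simps insert_commute)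
      have conv: "(p * u + (1 - p) * v) ^ 2 \<le> p * u ^ 2 + (1 - p) * v ^ 2" for u v :: real
      proof -
        have "p * u ^ 2 + (1 - p) * v ^ 2 - (p * u + (1 - p) * v) ^ 2 = p * (1 - p) * (u - v) ^ 2"
          by (simp add: power2_eq_square algebra_simps)
        moreover have "0 \<le> p * (1 - p) * (u - v) ^ 2" using p by (intro mult_nonneg_nonneg) auto
        ultimately show ?thesis by linarith
      qed
      show "?D h a g ^ 2 \<le> p *\<^sub>R ?D f a (insert e g) ^ 2 + (1 - p) *\<^sub>R ?D f a g ^ 2"
        unfolding eq using conv by simp
    qed (use insert.hyps in simp)
  qed
  finally show ?case using insert.hyps by simp
qed

section \<open>Pairs of cliques\<close>

text \<open>The expected number of ordered pairs of \<open>s\<close>-cliques with an overlap of size in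
  \<open>J\<close>.\<close>

definition pair_weight :: "'a set \<Rightarrow> nat \<Rightarrow> nat set \<Rightarrow> real \<Rightarrow> real" where
  "pair_weight V s J p = (\<Sum>C\<in>ksets V s. \<Sum>C'\<in>{C' \<in> ksets V s. card (C \<inter> C') \<in> J}. p ^ card (all_edges C \<union> all_edges C'))"

lemma ksets_finite: "finite V \<Longrightarrow> C \<in> ksets V s \<Longrightarrow> finite C"
  by (auto simp: ksets_def intro: finite_subset)

lemma choose_le_power: "n choose k \<le> n ^ k"
  by (cases "k \<le> n") (auto intro: binomial_le_pow simp: binomial_eq_0)

lemma card_ksets_meeting:
  assumes "finite V" "C \<in> ksets V s"
  shows "card {C' \<in> ksets V s. card (C \<inter> C') = j} \<le> (s choose j) * card V ^ (s - j)"
proof -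
  have finC: "finite C" and cC: "card C = s" using assms ksets_finite by (auto simp: ksets_def)
  let ?A = "{C' \<in> ksets V s. card (C \<inter> C') = j}"
  have "?A \<subseteq> (\<lambda>(T, D). T \<union> D) ` (ksets C j \<times> ksets V (s - j))"
  proof
    fix C' assume C': "C' \<in> ?A"
    then have fin: "finite C'" "card C' = s" "C' \<subseteq> V" using assms ksets_finite by (auto simp: ksets_def)
    have "card (C' - C) = s - j" using C' fin finC card_Diff_subset_Int[of C' C] by (simp add: Int_commute)
    then have "(C \<inter> C', C' - C) \<in> ksets C j \<times> ksets V (s - j)" using C' fin by (auto simp: ksets_def)
    moreover have "C' = (\<lambda>(T, D). T \<union> D) (C \<inter> C', C' - C)" by auto
    ultimately show "C' \<in> (\<lambda>(T, D). T \<union> D) ` (ksets C j \<times> ksets V (s - j))" by (rule rev_image_eqI)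
  qed
  then have "card ?A \<le> card ((\<lambda>(T, D). T \<union> D) ` (ksets C j \<times> ksets V (s - j)))"
    using assms finC by (intro card_mono) auto
  also have "\<dots> \<le> card (ksets C j \<times> ksets V (s - j))" using assms finC by (intro card_image_le) auto
  also have "\<dots> = (s choose j) * (card V choose (s - j))"
    using assms finC cC by (simp add: card_cartesian_product card_ksets)
  also have "\<dots> \<le> (s choose j) * card V ^ (s - j)"
  proof (intro mult_left_mono)
    show "card V choose (s - j) \<le> card V ^ (s - j)"
      by (rule choose_le_power)
  qed simp
  finally show ?thesis .
qed

lemma card_all_edges_Un:
  assumes "finite V" "C \<in> ksets V s" "C' \<in> ksets V s"
  shows "card (all_edges C \<union> all_edges C') = (s choose 2) + ((s choose 2) - (card (C \<inter> C') choose 2))"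
    "card (C \<inter> C') choose 2 \<le> s choose 2"
proof -
  have fin: "finite C" "finite C'" "card C = s" "card C' = s" using assms ksets_finite by (auto simp: ksets_def)
  have "card (all_edges C) + card (all_edges C') = card (all_edges C \<union> all_edges C') + card (all_edges C \<inter> all_edges C')"
    using fin by (intro card_Un_Int) auto
  then have "2 * (s choose 2) = card (all_edges C \<union> all_edges C') + (card (C \<inter> C') choose 2)"
    using fin by (simp add: all_edges_Int card_all_edges)
  moreover have "card (C \<inter> C') \<le> s" using card_mono[of C "C \<inter> C'"] fin by auto
  then show "card (C \<inter> C') choose 2 \<le> s choose 2" by (rule binomial_right_mono)
  ultimately show "card (all_edges C \<union> all_edges C') = (s choose 2) + ((s choose 2) - (card (C \<inter> C') choose 2))" by linarith
qed

lemma pair_weight_le: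
  assumes finV: "finite V" and p: "0 \<le> p" and J: "finite J"
  shows "pair_weight V s J p \<le> \<mu> s (card V) p * (\<Sum>j\<in>J. real (s choose j) * (real (card V) ^ (s - j) * p ^ ((s choose 2) - (j choose 2))))"
proof -
  have "(\<Sum>C'\<in>{C' \<in> ksets V s. card (C \<inter> C') \<in> J}. p ^ card (all_edges C \<union> all_edges C'))
     \<le> p ^ (s choose 2) * (\<Sum>j\<in>J. real (s choose j) * (real (card V) ^ (s - j) * p ^ ((s choose 2) - (j choose 2))))"
    if C: "C \<in> ksets V s" for C
  proof -
    have "(\<Sum>C'\<in>{C' \<in> ksets V s. card (C \<inter> C') \<in> J}. p ^ card (all_edges C \<union> all_edges C'))
      = (\<Sum>C'\<in>{C' \<in> ksets V s. card (C \<inter> C') \<in> J}. p ^ (s choose 2) * p ^ ((s choose 2) - (card (C \<inter> C') choose 2)))"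
      using card_all_edges_Un(1)[OF finV C] by (intro sum.cong) (auto simp: power_add)
    also have "\<dots> = (\<Sum>j\<in>J. \<Sum>C'\<in>{C' \<in> {C' \<in> ksets V s. card (C \<inter> C') \<in> J}. card (C \<inter> C') = j}. p ^ (s choose 2) * p ^ ((s choose 2) - (card (C \<inter> C') choose 2)))"
      using finV J by (intro sum.group[symmetric]) auto
    also have "\<dots> = (\<Sum>j\<in>J. real (card {C' \<in> ksets V s. card (C \<inter> C') = j}) * (p ^ (s choose 2) * p ^ ((s choose 2) - (j choose 2))))"
    proof (intro sum.cong refl)
      fix j assume "j \<in> J"
      then have "{C' \<in> {C' \<in> ksets V s. card (C \<inter> C') \<in> J}. card (C \<inter> C') = j} = {C' \<in> ksets V s. card (C \<inter> C') = j}" by auto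
      then show "(\<Sum>C'\<in>{C' \<in> {C' \<in> ksets V s. card (C \<inter> C') \<in> J}. card (C \<inter> C') = j}. p ^ (s choose 2) * p ^ ((s choose 2) - (card (C \<inter> C') choose 2)))
         = real (card {C' \<in> ksets V s. card (C \<inter> C') = j}) * (p ^ (s choose 2) * p ^ ((s choose 2) - (j choose 2)))" by simp
    qed
    also have "\<dots> \<le> (\<Sum>j\<in>J. real ((s choose j) * card V ^ (s - j)) * (p ^ (s choose 2) * p ^ ((s choose 2) - (j choose 2))))"
      using p by (intro sum_mono mult_right_mono of_nat_mono card_ksets_meeting[OF finV C]) auto
    also have "\<dots> = p ^ (s choose 2) * (\<Sum>j\<in>J. real (s choose j) * (real (card V) ^ (s - j) * p ^ ((s choose 2) - (j choose 2))))"
      by (simp add: sum_distrib_left mult_ac)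
    finally show ?thesis .
  qed
  then have "pair_weight V s J p \<le> (\<Sum>C\<in>ksets V s. p ^ (s choose 2) * (\<Sum>j\<in>J. real (s choose j) * (real (card V) ^ (s - j) * p ^ ((s choose 2) - (j choose 2)))))"
    unfolding pair_weight_def by (rule sum_mono)
  then show ?thesis using finV by (simp add: \<mu>_def card_ksets mult.assoc)
qed

text \<open>The weight of a second clique that shares \<open>j\<close> vertices with the first. At \<open>p =
  n^(-2/R)\<close> its exponent is \<open>(s - j) (1 - (s + j - 1) / R)\<close>, which is not positive
  for \<open>s + j > R\<close>.\<close>

lemma overlap_weight_le:
  assumes n: "1 \<le> n" and p: "0 \<le> p" and R: "1 \<le> R" "R + 1 \<le> s + j" "j \<le> s"
  shows "real n ^ (s - j) * p ^ ((s choose 2) - (j choose 2)) \<le> (p * real n powr (2 / real R)) ^ ((s choose 2) - (j choose 2))"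
proof -
  define D where "D = (s choose 2) - (j choose 2)"
  have c2: "real (s choose 2) = real s * (real s - 1) / 2" for s
    by (cases s) (simp_all add: choose_two real_of_nat_div algebra_simps)
  have "j choose 2 \<le> s choose 2" using R by (intro binomial_right_mono)
  then have "real D = real s * (real s - 1) / 2 - real j * (real j - 1) / 2"
    by (simp only: D_def of_nat_diff c2)
  then have D: "2 * real D = real (s - j) * (real s + real j - 1)"
    using R by (simp add: of_nat_diff field_simps)
  have "real (s - j) * real R \<le> real (s - j) * (real s + real j - 1)"
    using R by (intro mult_left_mono) auto
  then have e: "real (s - j) \<le> real D * (2 / real R)" using D R by (simp add: field_simps)
  have "real n ^ (s - j) = real n powr real (s - j)" using n by (simp add: powr_realpow)
  also have "\<dots> \<le> real n powr (real D * (2 / real R))" using n e by (intro powr_mono) auto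
  also have "\<dots> = (real n powr (2 / real R)) ^ D" using n by (simp only: powr_power)
  finally have "real n ^ (s - j) * p ^ D \<le> (real n powr (2 / real R)) ^ D * p ^ D"
    using p by (intro mult_right_mono) auto
  then show ?thesis by (simp only: D_def power_mult_distrib mult.commute)
qed

lemma strict_overlap_weight_le:
  assumes "1 \<le> n" "0 \<le> p" "2 \<le> s" "j \<in> {1..<s}" and y: "p * real n powr (2 / real s) \<le> 1"
  shows "real n ^ (s - j) * p ^ ((s choose 2) - (j choose 2)) \<le> p * real n powr (2 / real s)"
proof -
  have "(s - 1) choose 2 < s choose 2" using assms by (cases s) (auto simp: numeral_2_eq_2)
  moreover have "j choose 2 \<le> (s - 1) choose 2" using assms by (intro binomial_right_mono) auto
  (* at least one factor of the small quantity remains *)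
  ultimately have D: "1 \<le> (s choose 2) - (j choose 2)" by linarith
  have "real n ^ (s - j) * p ^ ((s choose 2) - (j choose 2)) \<le> (p * real n powr (2 / real s)) ^ ((s choose 2) - (j choose 2))"
    using assms by (intro overlap_weight_le) auto
  also have "\<dots> \<le> (p * real n powr (2 / real s)) ^ 1" using D y assms by (intro power_decreasing) auto
  finally show ?thesis by simp
qed

lemma \<mu>_nonneg: "0 \<le> p \<Longrightarrow> 0 \<le> \<mu> s n p" by (simp add: \<mu>_def)

lemma strict_pair_weight_le:
  assumes finV: "finite V" and "1 \<le> card V" "0 \<le> p" "2 \<le> s" and y: "p * real (card V) powr (2 / real s) \<le> 1"
  shows "pair_weight V s {1..<s} p \<le> \<mu> s (card V) p * (2 ^ s * (p * real (card V) powr (2 / real s)))"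
proof -
  let ?y = "p * real (card V) powr (2 / real s)"
  have "(\<Sum>j\<in>{1..<s}. real (s choose j) * (real (card V) ^ (s - j) * p ^ ((s choose 2) - (j choose 2)))) \<le> (\<Sum>j\<in>{1..<s}. real (s choose j) * ?y)"
    using assms by (intro sum_mono mult_left_mono strict_overlap_weight_le) auto
  also have "\<dots> \<le> (\<Sum>j\<le>s. real (s choose j) * ?y)" using assms by (intro sum_mono2) auto
  also have "\<dots> = 2 ^ s * ?y" unfolding sum_distrib_right[symmetric] of_nat_sum[symmetric] choose_row_sum by simp
  finally show ?thesis
    using order_trans[OF pair_weight_le[OF finV assms(3), of "{1..<s}" s] mult_left_mono[OF _ \<mu>_nonneg[OF assms(3)]]] by simp
qed

lemma pair_weight_bounded:
  assumes finV: "finite V" and "1 \<le> card V" "0 \<le> p" "1 \<le> R" and y: "p * real (card V) powr (2 / real R) \<le> 1"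
  shows "pair_weight V (R + 1) {..R + 1} p \<le> 2 ^ (R + 1)"
proof -
  let ?s = "R + 1" and ?n = "card V"
  have one: "real ?n ^ (?s - j) * p ^ ((?s choose 2) - (j choose 2)) \<le> 1" if "j \<le> ?s" for j
  proof -
    have "real ?n ^ (?s - j) * p ^ ((?s choose 2) - (j choose 2)) \<le> (p * real ?n powr (2 / real R)) ^ ((?s choose 2) - (j choose 2))"
      using assms that by (intro overlap_weight_le) auto
    also have "\<dots> \<le> 1" using y assms by (intro power_le_one) auto
    finally show ?thesis .
  qed
  have "\<mu> ?s ?n p \<le> 1"
  proof -
    have "?n choose ?s \<le> ?n ^ ?s" by (rule choose_le_power)
    then have "real (?n choose ?s) \<le> real ?n ^ ?s" by (metis of_nat_le_iff of_nat_power)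
    then have "\<mu> ?s ?n p \<le> real ?n ^ ?s * p ^ (?s choose 2)" unfolding \<mu>_def using assms by (intro mult_right_mono) auto
    also have "\<dots> \<le> 1" using one[of 0] by (simp add: numeral_2_eq_2)
    finally show ?thesis .
  qed
  moreover have "(\<Sum>j\<in>{..?s}. real (?s choose j) * (real ?n ^ (?s - j) * p ^ ((?s choose 2) - (j choose 2)))) \<le> 2 ^ ?s"
  proof -
    have "(\<Sum>j\<in>{..?s}. real (?s choose j) * (real ?n ^ (?s - j) * p ^ ((?s choose 2) - (j choose 2)))) \<le> (\<Sum>j\<in>{..?s}. real (?s choose j) * 1)"
      using one by (intro sum_mono mult_left_mono) auto
    also have "\<dots> = 2 ^ ?s" unfolding mult_1_right of_nat_sum[symmetric] choose_row_sum by simp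
    finally show ?thesis .
  qed
  ultimately have "\<mu> ?s ?n p * (\<Sum>j\<in>{..?s}. real (?s choose j) * (real ?n ^ (?s - j) * p ^ ((?s choose 2) - (j choose 2)))) \<le> 1 * 2 ^ ?s"
    using assms(3) by (intro mult_mono sum_nonneg mult_nonneg_nonneg) auto
  then show ?thesis using pair_weight_le[OF finV assms(3) finite_atMost, of ?s ?s] by linarith
qed

section \<open>Moments of the clique count\<close>

lemma card_cliques_sum: "finite V \<Longrightarrow> real (card (cliques V s g)) = (\<Sum>C\<in>ksets V s. of_bool (all_edges C \<subseteq> g))"
  by (simp add: cliques_def sum_of_bool_eq Int_def)

lemma iexp_lipschitz: "cmod (iexp a - iexp b) \<le> \<bar>a - b\<bar>"
proof -
  have "iexp a = iexp b * iexp (a - b)" by (simp add: exp_add[symmetric] algebra_simps)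
  then have "iexp a - iexp b = iexp b * (iexp (a - b) - 1)" by (simp only: right_diff_distrib mult_1_right)
  then have "cmod (iexp a - iexp b) = cmod (iexp (a - b) - 1)" by (simp add: norm_mult)
  also have "\<dots> \<le> \<bar>a - b\<bar>" using iexp_approx1[of "a - b" 0] by simp
  finally show ?thesis .
qed

context
  fixes V :: "'a set" and p :: real and s :: nat
  assumes finV: "finite V" and p: "0 \<le> p" "p \<le> 1" and s: "2 \<le> s"
begin

abbreviation (input) "rgraph \<equiv> rsub (all_edges V) p"

lemma expct_contains: "U \<subseteq> all_edges V \<Longrightarrow> expct rgraph (\<lambda>g. of_bool (U \<subseteq> g)) = p ^ card U"
  using finV p by (intro rsub_contains) auto

lemma edges_sub: "C \<in> ksets V s \<Longrightarrow> all_edges C \<subseteq> all_edges V"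
  by (intro all_edges_mono) (auto simp: ksets_def)

lemma card_edges: "C \<in> ksets V s \<Longrightarrow> card (all_edges C) = s choose 2"
  using card_all_edges[OF ksets_finite[OF finV]] by (simp add: ksets_def)

lemma expct_cliques: "expct rgraph (\<lambda>g. real (card (cliques V s g))) = \<mu> s (card V) p"
proof -
  have "expct rgraph (\<lambda>g. real (card (cliques V s g))) = (\<Sum>C\<in>ksets V s. expct rgraph (\<lambda>g. of_bool (all_edges C \<subseteq> g)))"
    unfolding card_cliques_sum[OF finV] using finV by (intro expct_sum) simp
  also have "\<dots> = (\<Sum>C\<in>ksets V s. p ^ (s choose 2))"
    using expct_contains[OF edges_sub] card_edges by (intro sum.cong) auto
  finally show ?thesis using finV by (simp add: \<mu>_def card_ksets)
qed

lemma expct_cliques_square: "expct rgraph (\<lambda>g. real (card (cliques V s g)) ^ 2) = (\<Sum>C\<in>ksets V s. \<Sum>C'\<in>ksets V s. p ^ card (all_edges C \<union> all_edges C'))"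
proof -
  have "expct rgraph (\<lambda>g. real (card (cliques V s g)) ^ 2) 
      = (\<Sum>C\<in>ksets V s. \<Sum>C'\<in>ksets V s. expct rgraph (\<lambda>g. of_bool (all_edges C \<union> all_edges C' \<subseteq> g)))"
    unfolding card_cliques_sum[OF finV] power2_eq_square sum_product Un_subset_iff of_bool_conj
    using finV by (simp only: expct_sum finite_rsub finite_all_edges)
  also have "\<dots> = (\<Sum>C\<in>ksets V s. \<Sum>C'\<in>ksets V s. p ^ card (all_edges C \<union> all_edges C'))"
    using edges_sub by (intro sum.cong refl expct_contains) auto
  finally show ?thesis .
qed

lemma expct_cliques_square_pairs: "expct rgraph (\<lambda>g. real (card (cliques V s g)) ^ 2) = pair_weight V s {..s} p"
proof -
  have "{C' \<in> ksets V s. card (C \<inter> C') \<in> {..s}} = ksets V s" if "C \<in> ksets V s" for C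
  proof -
    have "card (C \<inter> C') \<le> s" for C' using that ksets_finite[OF finV that] card_mono[of C "C \<inter> C'"] by (auto simp: ksets_def)
    then show ?thesis by simp
  qed
  then show ?thesis unfolding expct_cliques_square pair_weight_def by (simp cong: sum.cong)
qed

lemma pair_cases:
  assumes C: "C \<in> ksets V s" and C': "C' \<in> ksets V s"
  shows "card (C \<inter> C') = 0 \<and> C \<noteq> C' \<and> all_edges C \<inter> all_edges C' = {} \<or> card (C \<inter> C') \<in> {1..<s} \<and> C \<noteq> C' \<or> C = C'"
proof -
  have fin: "finite C" "finite C'" "card C = s" "card C' = s" using C C' ksets_finite[OF finV C] ksets_finite[OF finV C'] by (simp_all add: ksets_def)
  show ?thesis
  proof (cases "C = C'")
    case False
    have "card (C \<inter> C') < s"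
    proof (rule ccontr)
      assume "\<not> card (C \<inter> C') < s"
      then have "C \<inter> C' = C" "C \<inter> C' = C'" using fin by (intro card_seteq; simp)+
      then show False using False by simp
    qed
    moreover have "all_edges C \<inter> all_edges C' = {}" if "card (C \<inter> C') = 0"
      unfolding all_edges_Int by (rule all_edges_small) (use fin that in auto)
    ultimately show ?thesis using False by (cases "card (C \<inter> C') = 0") auto
  qed simp
qed

lemma vari_cliques:
  "\<mu> s (card V) p * (1 - p ^ (s choose 2)) \<le> vari rgraph (\<lambda>g. real (card (cliques V s g)))"
  "vari rgraph (\<lambda>g. real (card (cliques V s g))) \<le> \<mu> s (card V) p + pair_weight V s {1..<s} p"
proof -
  let ?c = "s choose 2" and ?K = "ksets V s"
  let ?U = "\<lambda>C C'. p ^ card (all_edges C \<union> all_edges C')"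
  have m: "\<mu> s (card V) p = (\<Sum>C\<in>?K. p ^ ?c)" using finV by (simp add: \<mu>_def card_ksets)
  have v: "vari rgraph (\<lambda>g. real (card (cliques V s g))) = (\<Sum>C\<in>?K. \<Sum>C'\<in>?K. ?U C C' - p ^ ?c * p ^ ?c)"
    unfolding vari_def expct_cliques expct_cliques_square m power2_eq_square[of "sum _ _"] sum_product by (simp add: sum_subtractf)
  have two: "of_bool (C' = C) * (p ^ ?c - p ^ ?c * p ^ ?c) \<le> ?U C C' - p ^ ?c * p ^ ?c \<and>
     ?U C C' - p ^ ?c * p ^ ?c \<le> of_bool (C' = C) * p ^ ?c + of_bool (card (C \<inter> C') \<in> {1..<s}) * ?U C C'"
    if C: "C \<in> ?K" "C' \<in> ?K" for C C'
  proof -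
    have fin: "finite (all_edges C)" "finite (all_edges C')" using ksets_finite[OF finV C(1)] ksets_finite[OF finV C(2)] by simp_all
    have c: "card (all_edges C) = ?c" "card (all_edges C') = ?c" by (rule card_edges[OF C(1)], rule card_edges[OF C(2)])
    have le: "card (all_edges C \<union> all_edges C') \<le> ?c + ?c" using card_Un_le[of "all_edges C" "all_edges C'"] c by simp
    have lo: "p ^ ?c * p ^ ?c \<le> ?U C C'" unfolding power_add[symmetric] using le p by (intro power_decreasing) auto
    have p0: "0 \<le> p ^ ?c" "0 \<le> ?U C C'" "0 \<le> p ^ ?c * p ^ ?c" using p by auto
    consider "C = C'" | "C \<noteq> C'" "card (C \<inter> C') \<in> {1..<s}" | "C \<noteq> C'" "all_edges C \<inter> all_edges C' = {}"
      using pair_cases[OF C] by blast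
    then show ?thesis
    proof cases
      case 1 
      then have "?U C C' = p ^ ?c" using c by simp
      moreover have "0 \<le> of_bool (card (C \<inter> C') \<in> {1..<s}) * ?U C C'" using p0 by simp
      ultimately show ?thesis unfolding \<open>C = C'\<close>[symmetric] using p0 by (simp only: of_bool_eq mult_1_left simp_thms) linarith
    next
      case 2 then show ?thesis using lo p0 by auto
    next
      case 3
      then have "card (all_edges C \<union> all_edges C') = ?c + ?c" using card_Un_disjoint[OF fin] c by simp
      then have "?U C C' = p ^ ?c * p ^ ?c" by (simp add: power_add)
      then show ?thesis using 3 p0 by auto
    qed
  qed
  have delta: "(\<Sum>C\<in>?K. \<Sum>C'\<in>?K. of_bool (C' = C) * z) = (\<Sum>C\<in>?K. z)" for z :: real
  proof (intro sum.cong refl)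
    fix C assume "C \<in> ?K"
    moreover have "of_bool (C' = C) * z = (if C' = C then z else 0)" for C' by simp
    ultimately show "(\<Sum>C'\<in>?K. of_bool (C' = C) * z) = z" using finV by (simp only: sum.delta finite_ksets if_True)
  qed
  have "\<mu> s (card V) p * (1 - p ^ ?c) = (\<Sum>C\<in>?K. \<Sum>C'\<in>?K. of_bool (C' = C) * (p ^ ?c - p ^ ?c * p ^ ?c))"
    unfolding delta using finV by (simp add: \<mu>_def card_ksets algebra_simps)
  also have "\<dots> \<le> vari rgraph (\<lambda>g. real (card (cliques V s g)))" unfolding v using two by (intro sum_mono) blast
  finally show "\<mu> s (card V) p * (1 - p ^ ?c) \<le> vari rgraph (\<lambda>g. real (card (cliques V s g)))" .
  have "vari rgraph (\<lambda>g. real (card (cliques V s g))) \<le> (\<Sum>C\<in>?K. \<Sum>C'\<in>?K. of_bool (C' = C) * p ^ ?c + of_bool (card (C \<inter> C') \<in> {1..<s}) * ?U C C')"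
    unfolding v using two by (intro sum_mono) blast
  also have "\<dots> = \<mu> s (card V) p + pair_weight V s {1..<s} p"
  proof -
    have "(\<Sum>C'\<in>?K. of_bool (card (C \<inter> C') \<in> {1..<s}) * ?U C C') = (\<Sum>C'\<in>{C' \<in> ?K. card (C \<inter> C') \<in> {1..<s}}. ?U C C')" for C
      using finV by (subst sum.inter_filter) (auto intro: sum.cong simp del: sum_of_bool_mult_eq)
    then show ?thesis by (simp only: sum.distrib delta m pair_weight_def)
  qed
  finally show "vari rgraph (\<lambda>g. real (card (cliques V s g))) \<le> \<mu> s (card V) p + pair_weight V s {1..<s} p" .
qed

text \<open>Planting a clique raises the clique count by one, unless the clique was already present or another
  clique is completed along with it; the latter has to share an edge with the planted one.\<close>

lemma expct_new_cliques:
  assumes C: "C \<in> ksets V s"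
  shows "p ^ (s choose 2) * expct rgraph (\<lambda>g. \<bar>real (card (cliques V s (g \<union> all_edges C))) - real (card (cliques V s g)) - 1\<bar>)
    \<le> p ^ (s choose 2) * p ^ (s choose 2) + (\<Sum>C'\<in>{C' \<in> ksets V s. card (C \<inter> C') \<in> {1..<s}}. p ^ card (all_edges C \<union> all_edges C'))"
proof -
  let ?c = "s choose 2" and ?K = "ksets V s" and ?M = "{C' \<in> ksets V s. card (C \<inter> C') \<in> {1..<s}}"
  let ?b = "\<lambda>C' g. of_bool (all_edges C' - all_edges C \<subseteq> g) :: real"
  have finM: "finite ?M" using finV by simp
  have pt: "\<bar>real (card (cliques V s (g \<union> all_edges C))) - real (card (cliques V s g)) - 1\<bar> \<le> of_bool (all_edges C \<subseteq> g) + (\<Sum>C'\<in>?M. ?b C' g)" for g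
  proof -
    let ?N = "cliques V s (g \<union> all_edges C) - cliques V s g"
    have sub: "cliques V s g \<subseteq> cliques V s (g \<union> all_edges C)" by (auto simp: cliques_def)
    have fin: "finite (cliques V s h)" for h using finV by (simp add: cliques_def)
    have d: "real (card (cliques V s (g \<union> all_edges C))) - real (card (cliques V s g)) = real (card ?N)"
      using card_Diff_subset[OF fin sub] card_mono[OF fin sub] by (simp add: of_nat_diff)
    have CN: "C \<in> ?N \<longleftrightarrow> \<not> all_edges C \<subseteq> g" using C by (auto simp: cliques_def)
    have "card (?N - {C}) \<le> card {C' \<in> ?M. all_edges C' - all_edges C \<subseteq> g}"
    proof (rule card_mono)
      show "?N - {C} \<subseteq> {C' \<in> ?M. all_edges C' - all_edges C \<subseteq> g}"
      proof
        fix C' assume C': "C' \<in> ?N - {C}"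
        then have "C' \<in> ?K" "C' \<noteq> C" "all_edges C' \<subseteq> g \<union> all_edges C" "\<not> all_edges C' \<subseteq> g" by (auto simp: cliques_def)
        then show "C' \<in> {C' \<in> ?M. all_edges C' - all_edges C \<subseteq> g}" using pair_cases[OF C, of C'] by blast
      qed
    qed (use finV in simp)
    then have N: "real (card (?N - {C})) \<le> (\<Sum>C'\<in>?M. ?b C' g)"
      using finM by (simp add: sum_of_bool_eq Int_def)
    show ?thesis
    proof (cases "C \<in> ?N")
      case True
      then have "card ?N = Suc (card (?N - {C}))" using fin by (metis card.remove finite_Diff)
      then show ?thesis using N True CN unfolding d by simp
    next
      case False
      then have "?N - {C} = ?N" "all_edges C \<subseteq> g" using CN by blast+
      then show ?thesis using N unfolding d by simp
    qed
  qed
  have "expct rgraph (\<lambda>g. \<bar>real (card (cliques V s (g \<union> all_edges C))) - real (card (cliques V s g)) - 1\<bar>) \<le> expct rgraph (\<lambda>g. of_bool (all_edges C \<subseteq> g) + (\<Sum>C'\<in>?M. ?b C' g))"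
    using finV pt by (intro expct_mono) auto
  also have "\<dots> = p ^ ?c + (\<Sum>C'\<in>?M. p ^ card (all_edges C' - all_edges C))"
  proof -
    have "expct rgraph (?b C') = p ^ card (all_edges C' - all_edges C)" if "C' \<in> ?M" for C'
      using that edges_sub[of C'] by (intro expct_contains) auto
    then have "expct rgraph (\<lambda>g. \<Sum>C'\<in>?M. ?b C' g) = (\<Sum>C'\<in>?M. p ^ card (all_edges C' - all_edges C))"
      using finV by (subst expct_sum) (auto intro: sum.cong simp only: finite_rsub finite_all_edges)
    moreover have "expct rgraph (\<lambda>g. of_bool (all_edges C \<subseteq> g)) = p ^ ?c"
      using expct_contains[OF edges_sub[OF C]] card_edges[OF C] by simp
    ultimately show ?thesis using finV by (subst expct_add) simp_all
  qed
  finally have "p ^ ?c * expct rgraph (\<lambda>g. \<bar>real (card (cliques V s (g \<union> all_edges C))) - real (card (cliques V s g)) - 1\<bar>)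
     \<le> p ^ ?c * (p ^ ?c + (\<Sum>C'\<in>?M. p ^ card (all_edges C' - all_edges C)))"
    using p by (intro mult_left_mono) auto
  also have "\<dots> = p ^ ?c * p ^ ?c + (\<Sum>C'\<in>?M. p ^ card (all_edges C \<union> all_edges C'))"
  proof -
    have "p ^ ?c * p ^ card (all_edges C' - all_edges C) = p ^ card (all_edges C \<union> all_edges C')" if "C' \<in> ?M" for C'
    proof -
      have "card (all_edges C \<union> all_edges C') = card (all_edges C) + card (all_edges C' - all_edges C)"
        using ksets_finite[OF finV C] ksets_finite[OF finV, of C' s] that card_Un_disjoint[of "all_edges C" "all_edges C' - all_edges C"] by simp
      then show ?thesis using card_edges[OF C] by (simp add: power_add)
    qed
    then show ?thesis by (simp add: distrib_left sum_distrib_left)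
  qed
  finally show ?thesis .
qed

text \<open>The mean of \<open>X e^(i \<theta> X)\<close> is a sum over cliques of averages conditioned on one
  clique.  Under this conditioning \<open>X\<close> is close to \<open>X + 1\<close>, which
  characterises Poisson variables.\<close>

lemma size_biased_char:
  "cmod (expct rgraph (\<lambda>g. of_real (real (card (cliques V s g))) * iexp (\<theta> * real (card (cliques V s g))))
      - of_real (\<mu> s (card V) p) * iexp \<theta> * expct rgraph (\<lambda>g. iexp (\<theta> * real (card (cliques V s g)))))
    \<le> \<bar>\<theta>\<bar> * (\<mu> s (card V) p * p ^ (s choose 2) + pair_weight V s {1..<s} p)"
proof -
  let ?c = "s choose 2" and ?K = "ksets V s"
  define X where "X = (\<lambda>g. real (card (cliques V s g)))"
  have "expct rgraph (\<lambda>g. of_real (X g) * iexp (\<theta> * X g)) = (\<Sum>C\<in>?K. expct rgraph (\<lambda>g. of_bool (all_edges C \<subseteq> g) *\<^sub>R iexp (\<theta> * X g)))"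
  proof -
    have "of_real (X g) * iexp (\<theta> * X g) = (\<Sum>C\<in>?K. of_bool (all_edges C \<subseteq> g) *\<^sub>R iexp (\<theta> * X g))" for g
    proof -
      have "complex_of_real (X g) = (\<Sum>C\<in>?K. of_real (of_bool (all_edges C \<subseteq> g)))"
        unfolding X_def card_cliques_sum[OF finV] by (rule of_real_sum)
      then show ?thesis unfolding scaleR_conv_of_real by (simp only: sum_distrib_right)
    qed
    then show ?thesis using finV by (simp only: expct_sum finite_rsub finite_all_edges)
  qed
  also have "\<dots> = (\<Sum>C\<in>?K. p ^ ?c *\<^sub>R expct rgraph (\<lambda>g. iexp (\<theta> * X (g \<union> all_edges C))))"
  proof (intro sum.cong refl)
    fix C assume C: "C \<in> ?K"
    show "expct rgraph (\<lambda>g. of_bool (all_edges C \<subseteq> g) *\<^sub>R iexp (\<theta> * X g)) = p ^ ?c *\<^sub>R expct rgraph (\<lambda>g. iexp (\<theta> * X (g \<union> all_edges C)))"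
      using rsub_plant[OF _ edges_sub[OF C] p, of "\<lambda>g. iexp (\<theta> * X g)"] finV card_edges[OF C] by simp
  qed
  finally have 1: "expct rgraph (\<lambda>g. of_real (X g) * iexp (\<theta> * X g)) = (\<Sum>C\<in>?K. p ^ ?c *\<^sub>R expct rgraph (\<lambda>g. iexp (\<theta> * X (g \<union> all_edges C))))" .
  have 2: "of_real (\<mu> s (card V) p) * iexp \<theta> * expct rgraph (\<lambda>g. iexp (\<theta> * X g)) = (\<Sum>C\<in>?K. p ^ ?c *\<^sub>R expct rgraph (\<lambda>g. iexp (\<theta> * (X g + 1))))"
  proof -
    have "expct rgraph (\<lambda>g. iexp (\<theta> * (X g + 1))) = iexp \<theta> * expct rgraph (\<lambda>g. iexp (\<theta> * X g))"
      by (subst integral_mult_right_zero[symmetric]) (simp add: distrib_left exp_add mult.commute)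
    then show ?thesis using finV by (simp add: \<mu>_def card_ksets scaleR_conv_of_real mult.assoc)
  qed
  have "cmod (expct rgraph (\<lambda>g. of_real (X g) * iexp (\<theta> * X g)) - of_real (\<mu> s (card V) p) * iexp \<theta> * expct rgraph (\<lambda>g. iexp (\<theta> * X g)))
     = cmod (\<Sum>C\<in>?K. p ^ ?c *\<^sub>R (expct rgraph (\<lambda>g. iexp (\<theta> * X (g \<union> all_edges C)) - iexp (\<theta> * (X g + 1)))))"
    unfolding 1 2 sum_subtractf[symmetric] scaleR_diff_right[symmetric] using finV by (simp add: expct_diff)
  also have "\<dots> \<le> (\<Sum>C\<in>?K. \<bar>\<theta>\<bar> * (p ^ ?c * expct rgraph (\<lambda>g. \<bar>X (g \<union> all_edges C) - X g - 1\<bar>)))"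
  proof (rule order_trans[OF norm_sum], intro sum_mono)
    fix C assume C: "C \<in> ?K"
    have "cmod (expct rgraph (\<lambda>g. iexp (\<theta> * X (g \<union> all_edges C)) - iexp (\<theta> * (X g + 1)))) \<le> expct rgraph (\<lambda>g. cmod (iexp (\<theta> * X (g \<union> all_edges C)) - iexp (\<theta> * (X g + 1))))"
      using finV by (intro expct_norm_le) auto
    also have "\<dots> \<le> expct rgraph (\<lambda>g. \<bar>\<theta>\<bar> * \<bar>X (g \<union> all_edges C) - X g - 1\<bar>)"
    proof (intro expct_mono)
      fix g
      have "\<theta> * X (g \<union> all_edges C) - \<theta> * (X g + 1) = \<theta> * (X (g \<union> all_edges C) - X g - 1)" by (simp add: algebra_simps)
      then show "cmod (iexp (\<theta> * X (g \<union> all_edges C)) - iexp (\<theta> * (X g + 1))) \<le> \<bar>\<theta>\<bar> * \<bar>X (g \<union> all_edges C) - X g - 1\<bar>"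
        using iexp_lipschitz[of "\<theta> * X (g \<union> all_edges C)" "\<theta> * (X g + 1)"] by (simp only: abs_mult)
    qed (use finV in simp)
    also have "\<dots> = \<bar>\<theta>\<bar> * expct rgraph (\<lambda>g. \<bar>X (g \<union> all_edges C) - X g - 1\<bar>)" by simp
    finally have "p ^ ?c * cmod (expct rgraph (\<lambda>g. iexp (\<theta> * X (g \<union> all_edges C)) - iexp (\<theta> * (X g + 1)))) \<le> p ^ ?c * (\<bar>\<theta>\<bar> * expct rgraph (\<lambda>g. \<bar>X (g \<union> all_edges C) - X g - 1\<bar>))"
      using p by (intro mult_left_mono) auto
    then show "cmod (p ^ ?c *\<^sub>R expct rgraph (\<lambda>g. iexp (\<theta> * X (g \<union> all_edges C)) - iexp (\<theta> * (X g + 1)))) \<le> \<bar>\<theta>\<bar> * (p ^ ?c * expct rgraph (\<lambda>g. \<bar>X (g \<union> all_edges C) - X g - 1\<bar>))"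
      using p by (simp add: mult.left_commute)
  qed
  also have "\<dots> \<le> (\<Sum>C\<in>?K. \<bar>\<theta>\<bar> * (p ^ ?c * p ^ ?c + (\<Sum>C'\<in>{C' \<in> ?K. card (C \<inter> C') \<in> {1..<s}}. p ^ card (all_edges C \<union> all_edges C'))))"
    unfolding X_def by (intro sum_mono mult_left_mono expct_new_cliques) auto
  also have "\<dots> = \<bar>\<theta>\<bar> * (\<mu> s (card V) p * p ^ ?c + pair_weight V s {1..<s} p)"
    using finV by (simp add: sum_distrib_left[symmetric] sum.distrib pair_weight_def \<mu>_def card_ksets)
  finally show ?thesis unfolding X_def .
qed

end

section \<open>The clique count minus the packing number\<close>

lemma packing_number_mono:
  assumes "finite Z" "Y \<subseteq> Z"
  shows "packing_number Y \<le> packing_number Z"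
proof -
  have finY: "finite Y" using assms finite_subset by auto
  have "is_packing Z (max_packing Y)" using max_packing(1)[OF finY] assms by (auto simp: is_packing_def)
  then show ?thesis using packing_number_ge[OF assms(1)] max_packing(2)[OF finY] by metis
qed

lemma packing_number_intersecting:
  assumes "finite Z" and N: "\<And>C C'. C \<in> N \<Longrightarrow> C' \<in> N \<Longrightarrow> C \<inter> C' \<noteq> {}"
  shows "packing_number Z \<le> packing_number (Z - N) + 1"
proof -
  let ?P = "max_packing Z"
  have P: "?P \<subseteq> Z" "disjoint ?P" using max_packing(1)[OF assms(1)] by (auto simp: is_packing_def)
  have finP: "finite ?P" using P(1) assms(1) finite_subset by auto
  have "is_packing (Z - N) (?P - N)" using P by (auto simp: is_packing_def disjoint_def)
  then have "card (?P - N) \<le> packing_number (Z - N)" using assms(1) by (intro packing_number_ge) auto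
  moreover have "card (?P \<inter> N) \<le> 1"
  proof -
    have "C = C'" if "C \<in> ?P \<inter> N" "C' \<in> ?P \<inter> N" for C C'
      using that N[of C C'] disjointD[OF P(2), of C C'] by blast
    then show ?thesis unfolding One_nat_def using finP by (subst card_le_Suc0_iff_eq) auto
  qed
  moreover have "card ?P = card (?P - N) + card (?P \<inter> N)"
    using card_Diff_subset_Int[of ?P N] finP card_mono[OF finP, of "?P \<inter> N"] by simp
  ultimately show ?thesis using max_packing(2)[OF assms(1)] by linarith
qed

lemma packing_number_insert:
  assumes "finite Z" "C \<in> Z" "C \<notin> Y" "Y \<subseteq> Z" "\<And>C'. C' \<in> Y \<Longrightarrow> C \<inter> C' = {}"
  shows "packing_number Y + 1 \<le> packing_number Z"
proof -
  have finY: "finite Y" by (rule finite_subset[OF assms(4,1)])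
  let ?P = "max_packing Y"
  have P: "?P \<subseteq> Y" "disjoint ?P" using max_packing(1)[OF finY] by (auto simp: is_packing_def)
  have "b \<inter> C = {}" "C \<inter> b = {}" if "b \<in> ?P" for b
    using assms(5)[of b] that P(1) by (auto simp only: Int_commute[of b C])
  then have "disjoint (insert C ?P)" using P(2) unfolding disjoint_def by simp
  then have "is_packing Z (insert C ?P)" using P assms by (auto simp: is_packing_def)
  moreover have "C \<notin> ?P" using P(1) assms(3) by blast
  ultimately show ?thesis
    using packing_number_ge[OF assms(1)] finite_subset[OF P(1) finY] max_packing(2)[OF finY] by fastforce
qed

text \<open>\<open>N\<close> consists of the sets that contain a given edge. If it has one member, then
  \<open>card Z\<close> and the packing number both grow by one, unless that member meets another set.
  If it has more, the increment is at most \<open>|N|\<close>, and the members meet each other in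
  \<open>|N| (|N| - 1)\<close> ordered pairs.\<close>

lemma packing_excess_increment:
  fixes Z N :: "'a set set"
  assumes finZ: "finite Z" and NZ: "N \<subseteq> Z" and N: "\<And>C C'. C \<in> N \<Longrightarrow> C' \<in> N \<Longrightarrow> C \<inter> C' \<noteq> {}"
  defines "H \<equiv> \<lambda>Z. real (card Z) - real (packing_number Z)"
  shows "(H Z - H (Z - N)) ^ 2 \<le> 2 * (\<Sum>C\<in>N. real (card {C' \<in> Z. C' \<noteq> C \<and> C \<inter> C' \<noteq> {}}))"
proof -
  let ?s = "\<Sum>C\<in>N. real (card {C' \<in> Z. C' \<noteq> C \<and> C \<inter> C' \<noteq> {}})"
  have finN: "finite N" using NZ finZ finite_subset by auto
  define a where "a = card N"
  define d where "d = real (packing_number Z) - real (packing_number (Z - N))"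
  have d: "0 \<le> d" "d \<le> 1"
    using packing_number_intersecting[of Z N, OF finZ N] packing_number_mono[OF finZ, of "Z - N"] by (simp_all add: d_def)
  have "card Z = card (Z - N) + a" using card_Diff_subset[OF finN NZ] card_mono[OF finZ NZ] by (simp add: a_def)
  then have H: "H Z - H (Z - N) = real a - d" by (simp add: H_def d_def)
  have each: "real a - 1 \<le> real (card {C' \<in> Z. C' \<noteq> C \<and> C \<inter> C' \<noteq> {}})" if C: "C \<in> N" for C
  proof -
    have "N - {C} \<subseteq> {C' \<in> Z. C' \<noteq> C \<and> C \<inter> C' \<noteq> {}}" using C N NZ by auto
    then have "card (N - {C}) \<le> card {C' \<in> Z. C' \<noteq> C \<and> C \<inter> C' \<noteq> {}}" using finZ by (intro card_mono) auto
    moreover have "card N = Suc (card (N - {C}))" using C finN by (metis card.remove)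
    ultimately show ?thesis by (simp add: a_def)
  qed
  have s: "real a * (real a - 1) \<le> ?s"
    using sum_bounded_below[of N "real a - 1" "\<lambda>C. real (card {C' \<in> Z. C' \<noteq> C \<and> C \<inter> C' \<noteq> {}})"] each by (simp add: a_def)
  have s0: "0 \<le> ?s" by (intro sum_nonneg) auto
  consider "a = 0" | "a = 1" "?s = 0" | "a = 1" "1 \<le> ?s" | "2 \<le> a"
  proof -
    have "?s = 0 \<or> 1 \<le> ?s" unfolding of_nat_sum[symmetric] by (cases "(\<Sum>C\<in>N. card {C' \<in> Z. C' \<noteq> C \<and> C \<inter> C' \<noteq> {}})") auto
    moreover have "a = 0 \<or> a = 1 \<or> 2 \<le> a" by linarith
    ultimately show thesis using that by blast
  qed
  then show ?thesis
  proof cases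
    case 1
    then have "N = {}" using finN by (simp add: a_def)
    then show ?thesis by simp
  next
    case 2
    then obtain C where C: "N = {C}" by (auto simp: a_def card_1_singleton_iff)
    then have "card {C' \<in> Z. C' \<noteq> C \<and> C \<inter> C' \<noteq> {}} = 0" using 2 by simp
    then have "{C' \<in> Z. C' \<noteq> C \<and> C \<inter> C' \<noteq> {}} = {}" using finZ by (subst (asm) card_0_eq) auto
    then have "packing_number (Z - N) + 1 \<le> packing_number Z"
      using C NZ by (intro packing_number_insert[OF finZ, of C]) auto
    then have "d = 1" using d by (simp add: d_def)
    then show ?thesis using H 2 by simp
  next
    case 3
    have "(real a - d) ^ 2 \<le> 1 ^ 2" using 3 d by (intro power_mono) auto
    then show ?thesis unfolding H using 3 by simp
  next
    case 4
    have "(real a - d) ^ 2 \<le> real a ^ 2" using 4 d by (intro power_mono) auto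
    also have "\<dots> \<le> 2 * (real a * (real a - 1))" using 4 by (simp add: power2_eq_square algebra_simps)
    finally show ?thesis unfolding H using s by linarith
  qed
qed

text \<open>In the Efron-Stein sum the factor \<open>p\<close> turns the forced edge \<open>e\<close> back into
  a random one. Each pair of cliques is counted once for every edge of its first member.\<close>

lemma vari_packing_excess:
  fixes V :: "'a set"
  assumes finV: "finite V" and p: "0 \<le> p" "p \<le> 1" and s: "2 \<le> s"
  shows "vari (rsub (all_edges V) p) (\<lambda>g. real (card (cliques V s g)) - real (packing_number (cliques V s g)))
     \<le> 2 * real (s choose 2) * pair_weight V s {1..<s} p"
proof -
  let ?K = "ksets V s" and ?E = "all_edges V"
  define H where "H = (\<lambda>g. real (card (cliques V s g)) - real (packing_number (cliques V s g)))"
  define M where "M = (\<lambda>C. {C' \<in> ?K. card (C \<inter> C') \<in> {1..<s}})"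
  have finE: "finite ?E" using finV by simp
  have "p * expct (rsub ?E p) (\<lambda>g. (H (insert e g) - H (g - {e})) ^ 2)
     \<le> (\<Sum>C\<in>{C \<in> ?K. e \<in> all_edges C}. \<Sum>C'\<in>M C. 2 * p ^ card (all_edges C \<union> all_edges C'))" if e: "e \<in> ?E" for e
  proof -
    let ?Ke = "{C \<in> ?K. e \<in> all_edges C}"
    let ?b = "\<lambda>C C' g. of_bool ((all_edges C \<union> all_edges C') - {e} \<subseteq> g) :: real"
    have "(H (insert e g) - H (g - {e})) ^ 2 \<le> (\<Sum>C\<in>?Ke. \<Sum>C'\<in>M C. 2 * ?b C C' g)" for g
    proof -
      let ?Z = "cliques V s (insert e g)"
      let ?N = "{C \<in> ?Z. e \<in> all_edges C}"
      have finZ: "finite ?Z" using finV by (simp add: cliques_def)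
      have rest: "cliques V s (g - {e}) = ?Z - ?N" by (auto simp: cliques_def)
      have e2: "card e = 2" using e by (simp add: all_edges_def)
      have "(H (insert e g) - H (g - {e})) ^ 2 \<le> 2 * (\<Sum>C\<in>?N. real (card {C' \<in> ?Z. C' \<noteq> C \<and> C \<inter> C' \<noteq> {}}))"
        unfolding H_def rest
      proof (rule packing_excess_increment[OF finZ])
        fix C C' assume "C \<in> ?N" "C' \<in> ?N"
        then have "e \<subseteq> C \<inter> C'" by (auto simp: all_edges_def)
        then have "e = {}" if "C \<inter> C' = {}" using that by simp
        then show "C \<inter> C' \<noteq> {}" using e2 by force
      qed auto
      also have "(\<Sum>C\<in>?N. real (card {C' \<in> ?Z. C' \<noteq> C \<and> C \<inter> C' \<noteq> {}})) \<le> (\<Sum>C\<in>?N. \<Sum>C'\<in>M C. ?b C C' g)"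
      proof (intro sum_mono)
        fix C assume C: "C \<in> ?N"
        then have CK: "C \<in> ?K" "all_edges C \<subseteq> insert e g" by (auto simp: cliques_def)
        have "{C' \<in> ?Z. C' \<noteq> C \<and> C \<inter> C' \<noteq> {}} \<subseteq> {C' \<in> M C. (all_edges C \<union> all_edges C') - {e} \<subseteq> g}"
        proof
          fix C' assume C': "C' \<in> {C' \<in> ?Z. C' \<noteq> C \<and> C \<inter> C' \<noteq> {}}"
          then have C'K: "C' \<in> ?K" "all_edges C' \<subseteq> insert e g" by (auto simp: cliques_def)
          have "card (C \<inter> C') \<noteq> 0" using C' ksets_finite[OF finV CK(1)] by simp
          then have "C' \<in> M C" using pair_cases[OF finV p s CK(1) C'K(1)] C' C'K by (auto simp: M_def)
          then show "C' \<in> {C' \<in> M C. (all_edges C \<union> all_edges C') - {e} \<subseteq> g}" using CK C'K by blast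
        qed
        then have "card {C' \<in> ?Z. C' \<noteq> C \<and> C \<inter> C' \<noteq> {}} \<le> card {C' \<in> M C. (all_edges C \<union> all_edges C') - {e} \<subseteq> g}"
          using finV by (intro card_mono) (auto simp: M_def)
        then show "real (card {C' \<in> ?Z. C' \<noteq> C \<and> C \<inter> C' \<noteq> {}}) \<le> (\<Sum>C'\<in>M C. ?b C C' g)"
          using finV by (subst sum_of_bool_eq) (auto simp: M_def Int_def conj_assoc)
      qed
      also have "\<dots> \<le> (\<Sum>C\<in>?Ke. \<Sum>C'\<in>M C. ?b C C' g)"
        using finV by (intro sum_mono2) (auto simp: cliques_def intro!: sum_nonneg)
      finally show ?thesis by (simp only: sum_distrib_left)
    qed
    then have "expct (rsub ?E p) (\<lambda>g. (H (insert e g) - H (g - {e})) ^ 2) \<le> expct (rsub ?E p) (\<lambda>g. \<Sum>C\<in>?Ke. \<Sum>C'\<in>M C. 2 * ?b C C' g)"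
      using finE by (intro expct_mono) auto
    also have "\<dots> = (\<Sum>C\<in>?Ke. \<Sum>C'\<in>M C. 2 * expct (rsub ?E p) (?b C C'))"
      using finE by (simp only: expct_sum finite_rsub integral_mult_right_zero)
    finally have "p * expct (rsub ?E p) (\<lambda>g. (H (insert e g) - H (g - {e})) ^ 2) \<le> p * (\<Sum>C\<in>?Ke. \<Sum>C'\<in>M C. 2 * expct (rsub ?E p) (?b C C'))"
      using p by (intro mult_left_mono) auto
    also have "\<dots> = (\<Sum>C\<in>?Ke. \<Sum>C'\<in>M C. 2 * p ^ card (all_edges C \<union> all_edges C'))"
      unfolding sum_distrib_left
    proof (intro sum.cong refl)
      fix C C' assume C: "C \<in> ?Ke" "C' \<in> M C"
      let ?U = "all_edges C \<union> all_edges C'"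
      have CK: "C \<in> ?K" "C' \<in> ?K" using C by (auto simp: M_def)
      have sub: "?U \<subseteq> ?E" using edges_sub[OF finV p s CK(1)] edges_sub[OF finV p s CK(2)] by simp
      have "card ?U = Suc (card (?U - {e}))" using C finite_subset[OF sub finE] by (intro card.remove) auto
      moreover have "expct (rsub ?E p) (?b C C') = p ^ card (?U - {e})"
        using sub by (intro expct_contains[OF finV p s]) auto
      ultimately show "p * (2 * expct (rsub ?E p) (?b C C')) = 2 * p ^ card ?U" by simp
    qed
    finally show ?thesis .
  qed
  then have "vari (rsub ?E p) H \<le> (\<Sum>e\<in>?E. \<Sum>C\<in>{C \<in> ?K. e \<in> all_edges C}. \<Sum>C'\<in>M C. 2 * p ^ card (all_edges C \<union> all_edges C'))"
    by (intro order_trans[OF efron_stein[OF finE p]] sum_mono)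
  also have "\<dots> = (\<Sum>C\<in>?K. \<Sum>e\<in>{e \<in> ?E. e \<in> all_edges C}. \<Sum>C'\<in>M C. 2 * p ^ card (all_edges C \<union> all_edges C'))"
    using finV by (intro sum.swap_restrict) auto
  also have "\<dots> = (\<Sum>C\<in>?K. 2 * real (s choose 2) * (\<Sum>C'\<in>M C. p ^ card (all_edges C \<union> all_edges C')))"
  proof (intro sum.cong refl)
    fix C assume C: "C \<in> ?K"
    have "{e \<in> ?E. e \<in> all_edges C} = all_edges C" using edges_sub[OF finV p s C] by auto
    then have "card {e \<in> ?E. e \<in> all_edges C} = s choose 2" using card_edges[OF finV p s C] by simp
    then show "(\<Sum>e\<in>{e \<in> ?E. e \<in> all_edges C}. \<Sum>C'\<in>M C. 2 * p ^ card (all_edges C \<union> all_edges C')) = 2 * real (s choose 2) * (\<Sum>C'\<in>M C. p ^ card (all_edges C \<union> all_edges C'))"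
      by (simp only: sum_constant sum_distrib_left[symmetric] mult_ac)
  qed
  also have "\<dots> = 2 * real (s choose 2) * pair_weight V s {1..<s} p"
    by (simp only: pair_weight_def M_def sum_distrib_left[symmetric])
  finally show ?thesis unfolding H_def .
qed

section \<open>Gaussian limits from size biasing\<close>

lemma iexp_has_derivative:
  "((\<lambda>u. iexp (u * c)) has_vector_derivative (\<i> * of_real c * iexp (u * c))) (at u within S)"
proof -
  have "((\<lambda>z. exp (\<i> * (z * of_real c))) has_field_derivative (\<i> * of_real c * exp (\<i> * (of_real u * of_real c)))) (at (of_real u))"
    by (auto intro!: derivative_eq_intros)
  from has_vector_derivative_real_field[OF this] show ?thesis by simp
qed

lemma expct_finite_sum:
  fixes f :: "'a \<Rightarrow> 'b::{banach,second_countable_topology}"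
  shows "finite (set_pmf M) \<Longrightarrow> expct M f = (\<Sum>x\<in>set_pmf M. pmf M x *\<^sub>R f x)"
  by (rule integral_measure_pmf) auto

text \<open>The hypothesis says that \<open>X\<close> nearly satisfies the equation for Poisson variables of
  mean \<open>m\<close>. For the standardised variable this becomes \<open>f' = - u f\<close> up to an
  error \<open>|u| \<eta> + u^2 / (2 \<surd>m)\<close>, so \<open>f e^(u^2/2)\<close> has a small
  derivative and stays close to its value 1 at 0.\<close>

lemma gaussian_estimate:
  fixes X :: "'a \<Rightarrow> real" and m \<eta> t :: real
  assumes fin: "finite (set_pmf M)" and m: "0 < m" and \<eta>: "0 \<le> \<eta>"
    and bias: "\<And>\<theta>. cmod (expct M (\<lambda>x. of_real (X x) * iexp (\<theta> * X x)) - of_real m * iexp \<theta> * expct M (\<lambda>x. iexp (\<theta> * X x))) \<le> \<bar>\<theta>\<bar> * (m * \<eta>)"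
  shows "cmod (expct M (\<lambda>x. iexp (t * ((X x - m) / sqrt m))) - of_real (exp (- (t ^ 2 / 2)))) \<le> \<bar>t\<bar> * (\<bar>t\<bar> * \<eta> + t ^ 2 / (2 * sqrt m))"
proof -
  define \<sigma> where "\<sigma> = sqrt m"
  have \<sigma>: "0 < \<sigma>" "\<sigma> * \<sigma> = m" using m by (auto simp: \<sigma>_def)
  define Z where "Z = (\<lambda>x. (X x - m) / \<sigma>)"
  define f where "f = (\<lambda>u. expct M (\<lambda>x. iexp (u * Z x)))"
  define f' where "f' = (\<lambda>u. expct M (\<lambda>x. \<i> * of_real (Z x) * iexp (u * Z x)))"
  have df: "(f has_vector_derivative f' u) (at u within S)" for u S
    unfolding f_def f'_def expct_finite_sum[OF fin]
    by (intro has_vector_derivative_sum bounded_linear.has_vector_derivative[OF bounded_linear_scaleR_right] iexp_has_derivative)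
  have f1: "cmod (f u) \<le> 1" for u
  proof -
    have "cmod (f u) \<le> expct M (\<lambda>x. cmod (iexp (u * Z x)))" unfolding f_def by (rule expct_norm_le[OF fin])
    then show ?thesis by simp
  qed
  have stein: "cmod (f' u + of_real u * f u) \<le> \<bar>u\<bar> * \<eta> + u ^ 2 / (2 * \<sigma>)" for u
  proof -
    define \<theta> where "\<theta> = u / \<sigma>"
    have u: "u = \<theta> * \<sigma>" using \<sigma> by (simp add: \<theta>_def)
    have e: "iexp (u * Z x) = iexp (- (\<theta> * m)) * iexp (\<theta> * X x)" for x
    proof -
      have "u * Z x = \<theta> * (X x - m)" using \<sigma>(1) by (simp add: u Z_def)
      also have "\<dots> = - (\<theta> * m) + \<theta> * X x" by (simp add: right_diff_distrib)
      finally have "u * Z x = - (\<theta> * m) + \<theta> * X x" .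
      then show ?thesis by (simp only: of_real_add exp_add distrib_left)
    qed
    let ?A = "expct M (\<lambda>x. of_real (X x) * iexp (\<theta> * X x))" and ?B = "expct M (\<lambda>x. iexp (\<theta> * X x))"
    let ?w = "iexp (- (\<theta> * m))"
    have fB: "f u = ?w * ?B" unfolding f_def e by simp
    have "f' u = \<i> / of_real \<sigma> * ?w * (?A - of_real m * ?B)"
    proof -
      have "f' u = expct M (\<lambda>x. \<i> / of_real \<sigma> * ?w * (of_real (X x) * iexp (\<theta> * X x) - of_real m * iexp (\<theta> * X x)))"
        unfolding f'_def e by (intro arg_cong[where f = "expct M"] ext) (simp add: Z_def algebra_simps diff_divide_distrib)
      also have "\<dots> = \<i> / of_real \<sigma> * ?w * expct M (\<lambda>x. of_real (X x) * iexp (\<theta> * X x) - of_real m * iexp (\<theta> * X x))"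
        by (rule integral_mult_right_zero)
      also have "expct M (\<lambda>x. of_real (X x) * iexp (\<theta> * X x) - of_real m * iexp (\<theta> * X x)) = ?A - of_real m * ?B"
        by (subst expct_diff[OF fin]) simp
      finally show ?thesis .
    qed
    then have eq: "f' u + of_real u * f u = \<i> / of_real \<sigma> * ?w * (?A - of_real m * iexp \<theta> * ?B)
       + \<i> * of_real \<sigma> * (iexp \<theta> - 1 - \<i> * of_real \<theta>) * f u"
    proof -
      assume h: "f' u = \<i> / of_real \<sigma> * ?w * (?A - of_real m * ?B)"
      have ms: "complex_of_real m / of_real \<sigma> = of_real \<sigma>" using \<sigma> by (simp add: \<sigma>(2)[symmetric])
      have "\<i> / of_real \<sigma> * ?w * (?A - of_real m * ?B) = \<i> / of_real \<sigma> * ?w * (?A - of_real m * iexp \<theta> * ?B) + \<i> * (of_real m / of_real \<sigma>) * (iexp \<theta> - 1) * (?w * ?B)"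
        using \<sigma>(1) by (simp add: field_simps)
      also have "\<dots> = \<i> / of_real \<sigma> * ?w * (?A - of_real m * iexp \<theta> * ?B) + \<i> * of_real \<sigma> * (iexp \<theta> - 1) * f u"
        unfolding ms fB ..
      finally show ?thesis unfolding h by (simp add: u algebra_simps)
    qed
    have "cmod (f' u + of_real u * f u) \<le> cmod (\<i> / of_real \<sigma> * ?w * (?A - of_real m * iexp \<theta> * ?B))
       + cmod (\<i> * of_real \<sigma> * (iexp \<theta> - 1 - \<i> * of_real \<theta>) * f u)"
      unfolding eq by (rule norm_triangle_ineq)
    also have "cmod (\<i> / of_real \<sigma> * ?w * (?A - of_real m * iexp \<theta> * ?B)) \<le> 1 / \<sigma> * (\<bar>\<theta>\<bar> * (m * \<eta>))"
      using \<sigma> bias[of \<theta>] by (simp add: norm_mult norm_divide divide_right_mono)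
    also have "1 / \<sigma> * (\<bar>\<theta>\<bar> * (m * \<eta>)) = \<bar>u\<bar> * \<eta>"
      using \<sigma>(1) by (simp add: u abs_mult \<sigma>(2)[symmetric])
    (* the linear term of \<open>iexp \<theta>\<close> cancels \<open>u f u\<close> exactly because \<open>\<sigma>^2 = m\<close> *)
    also have "cmod (\<i> * of_real \<sigma> * (iexp \<theta> - 1 - \<i> * of_real \<theta>) * f u) \<le> \<sigma> * (\<theta> ^ 2 / 2) * 1"
    proof -
      have "cmod (iexp \<theta> - 1 - \<i> * of_real \<theta>) \<le> \<theta> ^ 2 / 2"
        using iexp_approx1[of \<theta> 1] by (simp add: diff_diff_eq power2_eq_square)
      then have "cmod (\<i> * of_real \<sigma>) * cmod (iexp \<theta> - 1 - \<i> * of_real \<theta>) * cmod (f u) \<le> \<sigma> * (\<theta> ^ 2 / 2) * 1"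
        using \<sigma> f1 by (intro mult_mono) (auto simp: norm_mult)
      then show ?thesis by (simp only: norm_mult)
    qed
    also have "\<sigma> * (\<theta> ^ 2 / 2) * 1 = u ^ 2 / (2 * \<sigma>)" using \<sigma>(1) by (simp add: u field_simps power2_eq_square)
    finally show ?thesis by simp
  qed
  define F where "F = (\<lambda>u. of_real (exp (u ^ 2 / 2)) * f u)"
  define F' where "F' = (\<lambda>u. of_real (exp (u ^ 2 / 2)) * (f' u + of_real u * f u))"
  have dF: "(F has_vector_derivative F' u) (at u within S)" for u S
  proof -
    have "((\<lambda>u. exp (u ^ 2 / 2)) has_real_derivative (u * exp (u ^ 2 / 2))) (at u within S)"
      by (auto intro!: derivative_eq_intros)
    then have "((\<lambda>u. complex_of_real (exp (u ^ 2 / 2))) has_vector_derivative of_real (u * exp (u ^ 2 / 2))) (at u within S)"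
      by (intro has_vector_derivative_of_real) (simp add: has_real_derivative_iff_has_vector_derivative)
    from has_vector_derivative_mult[OF this df] show ?thesis
      unfolding F_def F'_def by (simp add: algebra_simps)
  qed
  let ?B = "exp (t ^ 2 / 2) * (\<bar>t\<bar> * \<eta> + t ^ 2 / (2 * \<sigma>))"
  have "norm (F t - F 0) \<le> ?B * norm (t - 0)"
  proof (rule differentiable_bound[of "{- \<bar>t\<bar>..\<bar>t\<bar>}" F "\<lambda>u h. h *\<^sub>R F' u"])
    show "(F has_derivative (\<lambda>h. h *\<^sub>R F' u)) (at u within {- \<bar>t\<bar>..\<bar>t\<bar>})" for u
      using dF[of u] by (simp add: has_vector_derivative_def)
    show "onorm (\<lambda>h. h *\<^sub>R F' u) \<le> ?B" if u: "u \<in> {- \<bar>t\<bar>..\<bar>t\<bar>}" for u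
    proof (rule onorm_bound)
      have ut: "\<bar>u\<bar> \<le> \<bar>t\<bar>" using u by auto
      then have u2: "u ^ 2 \<le> t ^ 2" by (rule abs_le_square_iff[THEN iffD1])
      have "norm (F' u) = exp (u ^ 2 / 2) * norm (f' u + of_real u * f u)" by (simp add: F'_def norm_mult)
      also have "\<dots> \<le> exp (t ^ 2 / 2) * (\<bar>t\<bar> * \<eta> + t ^ 2 / (2 * \<sigma>))"
      proof (intro mult_mono)
        have "\<bar>u\<bar> * \<eta> + u ^ 2 / (2 * \<sigma>) \<le> \<bar>t\<bar> * \<eta> + t ^ 2 / (2 * \<sigma>)"
          using ut u2 \<eta> \<sigma> by (intro add_mono mult_right_mono divide_right_mono) auto
        then show "cmod (f' u + of_real u * f u) \<le> \<bar>t\<bar> * \<eta> + t ^ 2 / (2 * \<sigma>)" using stein[of u] by linarith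
      qed (use u2 in auto)
      finally have "norm (F' u) \<le> ?B" .
      then show "norm (h *\<^sub>R F' u) \<le> ?B * norm h" for h :: real
        by (simp add: mult.commute mult_left_mono)
    qed (use \<eta> \<sigma> in auto)
  qed auto
  moreover have "F 0 = 1" by (simp add: F_def f_def)
  ultimately have main: "cmod (F t - 1) \<le> ?B * \<bar>t\<bar>" by simp
  have "f t - of_real (exp (- (t ^ 2 / 2))) = of_real (exp (- (t ^ 2 / 2))) * (F t - 1)"
  proof -
    have "complex_of_real (exp (- (t ^ 2 / 2))) * of_real (exp (t ^ 2 / 2)) = 1"
      unfolding of_real_mult[symmetric] exp_add[symmetric] by simp
    then show ?thesis by (simp only: F_def right_diff_distrib mult.assoc[symmetric] mult_1_left mult_1_right)
  qed
  then have "cmod (f t - of_real (exp (- (t ^ 2 / 2)))) = exp (- (t ^ 2 / 2)) * cmod (F t - 1)" by (simp add: norm_mult)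
  also have "\<dots> \<le> exp (- (t ^ 2 / 2)) * (?B * \<bar>t\<bar>)" using main by (intro mult_left_mono) auto
  also have "\<dots> = (exp (- (t ^ 2 / 2)) * exp (t ^ 2 / 2)) * (\<bar>t\<bar> * (\<bar>t\<bar> * \<eta> + t ^ 2 / (2 * \<sigma>)))" by (simp only: mult_ac)
  also have "exp (- (t ^ 2 / 2)) * exp (t ^ 2 / 2) = 1" unfolding exp_add[symmetric] by simp
  finally show ?thesis by (simp add: f_def Z_def \<sigma>_def)
qed

section \<open>The chromatic number of the complement\<close>

abbreviation complement :: "'a set \<Rightarrow> 'a set set \<Rightarrow> 'a graph" where
  "complement V g \<equiv> (V, all_edges V - g)"

lemma binomial_random_graph_complement:
  assumes "0 \<le> p" "p \<le> 1"
  shows "binomial_random_graph n (1 - p) = map_pmf (complement {1..n}) (rsub (all_edges {1..n}) p)"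
proof -
  let ?E = "all_edges {1..n}"
  have flip: "bernoulli_pmf (1 - p) = map_pmf Not (bernoulli_pmf p)"
  proof (rule pmf_eqI)
    fix b
    have "pmf (map_pmf Not (bernoulli_pmf p)) (Not (Not b)) = pmf (bernoulli_pmf p) (Not b)"
      by (rule pmf_map_inj') (simp add: inj_def)
    then show "pmf (bernoulli_pmf (1 - p)) b = pmf (map_pmf Not (bernoulli_pmf p)) b"
      using assms by (cases b) simp_all
  qed
  have fin: "finite ?E" by simp
  have "Pi_pmf ?E False (\<lambda>_. bernoulli_pmf (1 - p)) = map_pmf (\<lambda>h. Not \<circ> h) (Pi_pmf ?E True (\<lambda>_. bernoulli_pmf p))"
    unfolding flip by (rule Pi_pmf_map[OF fin]) simp
  also have "Pi_pmf ?E True (\<lambda>_. bernoulli_pmf p) = map_pmf (\<lambda>f x. if x \<in> ?E then f x else True) (Pi_pmf ?E False (\<lambda>_. bernoulli_pmf p))"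
    by (rule Pi_pmf_default_swap[OF fin, symmetric])
  finally show ?thesis
    unfolding binomial_random_graph_def rsub_def pmf.map_comp
    by (simp add: pmf.map_comp) (intro map_pmf_cong refl, auto)
qed

text \<open>The cliques may overlap: each vertex is coloured by one clique that contains it.\<close>

lemma chromatic_le_cover:
  assumes "V \<subseteq> \<Union>P" "finite P" "\<And>A. A \<in> P \<Longrightarrow> all_edges A \<subseteq> g"
  shows "\<exists>c. proper_colouring (complement V g) (card P) c"
proof -
  obtain i where i: "inj_on i P" "i ` P = {..<card P}"
    using ex_bij_betw_finite_nat[OF assms(2)] by (auto simp: bij_betw_def atLeast0LessThan)
  define part where "part = (\<lambda>v. SOME A. A \<in> P \<and> v \<in> A)"
  have part: "part v \<in> P \<and> v \<in> part v" if "v \<in> V" for v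
    unfolding part_def by (rule someI_ex) (use assms(1) that in blast)
  have "proper_colouring (complement V g) (card P) (\<lambda>v. i (part v))"
    unfolding proper_colouring_def
  proof (intro conjI ballI impI)
    fix v assume "v \<in> fst (complement V g)"
    then show "i (part v) < card P" using part[of v] i(2) by auto
  next
    fix u v assume uv: "u \<in> fst (complement V g)" "v \<in> fst (complement V g)" "{u, v} \<in> snd (complement V g)"
    show "i (part u) \<noteq> i (part v)"
    proof
      assume "i (part u) = i (part v)"
      then have "part u = part v" using i(1) part uv by (auto simp: inj_on_def)
      then have "{u, v} \<subseteq> part u" using part uv by auto
      then have "{u, v} \<in> all_edges (part u)" using uv(3) by (auto simp: all_edges_def)
      then show False using assms(3) part[of u] uv by auto
    qed
  qed
  then show ?thesis by blast
qed

lemma chromatic_number_le: "proper_colouring G k c \<Longrightarrow> chromatic_number G \<le> k"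
  unfolding chromatic_number_def by (rule Least_le) blast

lemma chromatic_number_attained:
  assumes "finite V"
  shows "\<exists>c. proper_colouring (complement V g) (chromatic_number (complement V g)) c"
proof -
  have "all_edges A \<subseteq> g" if "A \<in> (\<lambda>v. {v}) ` V" for A
    using that all_edges_small[of A] by auto
  then have "\<exists>c. proper_colouring (complement V g) (card ((\<lambda>v. {v}) ` V)) c"
    using assms by (intro chromatic_le_cover) auto
  then show ?thesis unfolding chromatic_number_def by (rule LeastI)
qed

text \<open>Cover the vertices by the maximum packing, by the blocks of an optimal partition of the core that
  are cliques, and by single vertices for the \<open>r b\<close> vertices of the other blocks and the
  fewer than \<open>r\<close> vertices left out of the core.\<close>

lemma chromatic_upper:
  assumes finV: "finite V" and r: "0 < r"
  shows "r * chromatic_number (complement V g) + packing_number (cliques V (r + 1) g) \<le> card V + r ^ 2 * (deficiency V r g + 1)"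
proof -
  let ?Z = "cliques V (r + 1) g" and ?b = "deficiency V r g" and ?res = "residual V r g" and ?core = "core V r g"
  have finZ: "finite ?Z" using finV by (simp add: cliques_def)
  define MP where "MP = max_packing ?Z"
  have MP: "MP \<subseteq> ?Z" "disjoint MP" "card MP = packing_number ?Z"
    using max_packing[OF finZ] by (auto simp: MP_def is_packing_def)
  have finMP: "finite MP" using MP(1) finZ finite_subset by auto
  obtain Q where Q: "pm r ?core Q" "card (Q - cliques V r g) \<le> ?b" using deficiency[OF finV r] by blast
  have finc: "finite ?core" by (rule finite_subset[OF core_sub finV])
  have finQ: "finite Q" by (rule finite_pm[OF Q(1) finc])
  define S where "S = \<Union>(Q - cliques V r g) \<union> (?res - ?core)"
  define P where "P = MP \<union> (Q \<inter> cliques V r g) \<union> (\<lambda>v. {v}) ` S"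
  have resV: "?res \<subseteq> V" by (auto simp: residual_def)
  have finres: "finite ?res" by (rule finite_subset[OF resV finV])
  have Qcore: "\<Union>Q = ?core" using Q(1) by (simp add: pm_def partition_on_def)
  have finS: "finite S" unfolding S_def using Qcore finc finres finite_subset[of "\<Union>(Q - cliques V r g)" ?core] by auto
  have "V \<subseteq> \<Union>P"
  proof
    fix v assume v: "v \<in> V"
    show "v \<in> \<Union>P"
    proof (cases "v \<in> \<Union>MP")
      case True then show ?thesis by (auto simp: P_def)
    next
      case False
      then have vr: "v \<in> ?res" using v by (simp add: residual_def MP_def)
      show ?thesis
      proof (cases "v \<in> ?core")
        case True
        then obtain A where "A \<in> Q" "v \<in> A" using Qcore by auto
        then show ?thesis by (cases "A \<in> cliques V r g") (auto simp: P_def S_def)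
      next
        case False then show ?thesis using vr by (auto simp: P_def S_def)
      qed
    qed
  qed
  moreover have "finite P" using finMP finQ finS by (simp add: P_def)
  moreover have "all_edges A \<subseteq> g" if "A \<in> P" for A
    using that MP(1) all_edges_small[of A] by (auto simp: P_def cliques_def)
  ultimately have "chromatic_number (complement V g) \<le> card P"
    using chromatic_le_cover chromatic_number_le by blast
  also have "card P \<le> card MP + card (Q \<inter> cliques V r g) + card S"
    unfolding P_def using card_Un_le[of "MP \<union> (Q \<inter> cliques V r g)" "(\<lambda>v. {v}) ` S"] card_Un_le[of MP "Q \<inter> cliques V r g"] card_image_le[OF finS, of "\<lambda>v. {v}"]
    by linarith
  also have "card S \<le> r * ?b + r"
  proof -
    have "card (\<Union>(Q - cliques V r g)) \<le> (\<Sum>A\<in>Q - cliques V r g. card A)"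
      using card_UN_le[of "Q - cliques V r g" id] finQ by simp
    also have "\<dots> = card (Q - cliques V r g) * r" using Q(1) by (simp add: pm_def)
    also have "\<dots> \<le> r * ?b" using Q(2) by (simp add: mult.commute)
    finally have "card (\<Union>(Q - cliques V r g)) \<le> r * ?b" .
    moreover have "card (?res - ?core) \<le> r"
    proof -
      have "card (?res - ?core) = card ?res - card ?core" using core(1) finc by (rule card_Diff_subset[rotated])
      also have "\<dots> = card ?res mod r" unfolding core(2) by (rule minus_mult_div_eq_mod)
      finally show ?thesis using r mod_less_divisor[of r "card ?res"] by linarith
    qed
    ultimately show ?thesis unfolding S_def using card_Un_le[of "\<Union>(Q - cliques V r g)" "?res - ?core"] by linarith
  qed
  finally have "chromatic_number (complement V g) \<le> packing_number ?Z + card Q + (r * ?b + r)"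
    using MP(3) card_mono[OF finQ, of "Q \<inter> cliques V r g"] by simp
  then have "r * chromatic_number (complement V g) \<le> r * (packing_number ?Z + card Q + (r * ?b + r))" by (rule mult_le_mono2)
  also have "\<dots> = r * packing_number ?Z + r * card Q + r ^ 2 * (?b + 1)" by (simp add: algebra_simps power2_eq_square)
  also have "r * card Q = card ?core" using pm_card[OF Q(1) finc] by simp
  also have "card ?core \<le> card ?res" by (rule card_mono[OF finres core(1)])
  finally have 1: "r * chromatic_number (complement V g) \<le> r * packing_number ?Z + card ?res + r ^ 2 * (?b + 1)" by simp
  have "card ?res + (r + 1) * packing_number ?Z = card V"
  proof -
    have UV: "\<Union>MP \<subseteq> V" using MP(1) by (auto simp: cliques_def ksets_def)
    have "card (\<Union>MP) = (\<Sum>C\<in>MP. card C)"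
      using MP(1) finV finite_subset[of _ V] disjointD[OF MP(2)]
      by (intro card_Union_disjoint) (auto simp: pairwise_def disjnt_def cliques_def ksets_def)
    also have "\<dots> = (\<Sum>C\<in>MP. r + 1)" using MP(1) by (intro sum.cong) (auto simp: cliques_def ksets_def)
    also have "\<dots> = (r + 1) * packing_number ?Z" using MP(3) by (simp only: sum_constant of_nat_id mult.commute)
    finally show ?thesis using card_Diff_subset[OF finite_subset[OF UV finV] UV] card_mono[OF finV UV] by (simp add: residual_def MP_def)
  qed
  then show ?thesis using 1 by simp
qed

lemma choose_ge_excess: "1 \<le> s \<Longrightarrow> m + 1 \<le> s + (m choose s)"
proof (induction m)
  case (Suc m)
  show ?case
  proof (cases "m + 1 < s")
    case False
    obtain t where t: "s = Suc t" using Suc.prems by (cases s) auto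
    have "1 \<le> m choose t" using False t by (simp add: Suc_leI)
    moreover have "m + 1 \<le> Suc t + (m choose Suc t)" using Suc t by simp
    ultimately show ?thesis unfolding t binomial_Suc_Suc by linarith
  qed simp
qed simp

text \<open>A colour class of \<open>s > r\<close> vertices saves \<open>s - r\<close> over classes of size
  \<open>r\<close>. It contains an \<open>(r+1)\<close>-clique, and these form a packing; any saving
  beyond one is paid for by the \<open>(r+2)\<close>-cliques inside the class.\<close>

lemma chromatic_lower:
  fixes V :: "'a set"
  assumes finV: "finite V"
  shows "card V \<le> r * chromatic_number (complement V g) + packing_number (cliques V (r + 1) g) + card (cliques V (r + 2) g)"
proof -
  let ?Z = "cliques V (r + 1) g"
  define k where "k = chromatic_number (complement V g)"
  obtain c where c: "proper_colouring (complement V g) k c" using chromatic_number_attained[OF finV] by (auto simp: k_def)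
  define cl where "cl = (\<lambda>i. {v \<in> V. c v = i})"
  have clV: "cl i \<subseteq> V" "finite (cl i)" for i using finV by (auto simp: cl_def)
  have disj: "cl i \<inter> cl j = {}" if "i \<noteq> j" for i j :: nat using that by (auto simp: cl_def)
  have edges: "all_edges A \<subseteq> g" if A: "A \<subseteq> cl i" for A i
  proof
    fix e assume e: "e \<in> all_edges A"
    then obtain u v where uv: "e = {u, v}" "u \<noteq> v" by (auto simp: all_edges_def card_2_iff)
    then have "u \<in> V" "v \<in> V" "c u = c v" using e A by (auto simp: all_edges_def cl_def)
    then have "{u, v} \<notin> all_edges V - g" using c by (auto simp: proper_colouring_def)
    moreover have "{u, v} \<in> all_edges V" using e uv A clV(1)[of i] by (auto simp: all_edges_def)
    ultimately show "e \<in> g" using uv by simp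
  qed
  define I where "I = {i. i < k \<and> r + 1 \<le> card (cl i)}"
  have finI: "finite I" by (simp add: I_def)
  have "\<exists>T. T \<subseteq> cl i \<and> card T = r + 1" if "i \<in> I" for i
    using that obtain_subset_with_card_n[of "r + 1" "cl i"] by (auto simp: I_def)
  then obtain T where T: "\<And>i. i \<in> I \<Longrightarrow> T i \<subseteq> cl i \<and> card (T i) = r + 1" by metis
  have Tdisj: "T i \<inter> T j = {}" if "i \<in> I" "j \<in> I" "i \<noteq> j" for i j
    using T[OF that(1)] T[OF that(2)] disj[OF that(3)] by blast
  have "card I \<le> packing_number ?Z"
  proof -
    have "inj_on T I"
    proof (rule inj_onI, rule ccontr)
      fix i j assume ij: "i \<in> I" "j \<in> I" "T i = T j" "i \<noteq> j"
      then have "T i = {}" using Tdisj[of i j] by simp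
      then show False using T[OF ij(1)] by simp
    qed
    then have "card I = card (T ` I)" by (simp add: card_image)
    also have "\<dots> \<le> packing_number ?Z"
    proof (rule packing_number_ge)
      have "T ` I \<subseteq> ?Z"
      proof
        fix C assume "C \<in> T ` I"
        then obtain i where i: "i \<in> I" "C = T i" by auto
        then show "C \<in> ?Z" using T[OF i(1)] edges[of "T i" i] clV(1)[of i] by (auto simp: cliques_def ksets_def)
      qed
      moreover have "disjoint (T ` I)" using Tdisj by (fastforce simp: disjoint_def)
      ultimately show "is_packing ?Z (T ` I)" by (simp add: is_packing_def)
    qed (use finV in \<open>simp add: cliques_def\<close>)
    finally show ?thesis .
  qed
  moreover have "(\<Sum>i<k. card (cl i) choose (r + 2)) \<le> card (cliques V (r + 2) g)"
  proof -
    have "(\<Sum>i<k. card (cl i) choose (r + 2)) = (\<Sum>i<k. card (ksets (cl i) (r + 2)))"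
      using clV(2) by (intro sum.cong refl) (simp only: card_ksets)
    also have "\<dots> = card (\<Union>i\<in>{..<k}. ksets (cl i) (r + 2))"
    proof (rule card_UN_disjoint[symmetric])
      show "\<forall>i\<in>{..<k}. \<forall>j\<in>{..<k}. i \<noteq> j \<longrightarrow> ksets (cl i) (r + 2) \<inter> ksets (cl j) (r + 2) = {}"
      proof (intro ballI impI)
        fix i j :: nat assume "i \<noteq> j"
        then have "card C \<noteq> r + 2" if "C \<subseteq> cl i" "C \<subseteq> cl j" for C using disj[of i j] that by (cases "C = {}") auto
        then have "\<not> (C \<in> ksets (cl i) (r + 2) \<and> C \<in> ksets (cl j) (r + 2))" for C
          by (auto simp: ksets_def)
        then show "ksets (cl i) (r + 2) \<inter> ksets (cl j) (r + 2) = {}" by blast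
      qed
    qed (use clV in auto)
    also have "\<dots> \<le> card (cliques V (r + 2) g)"
    proof (rule card_mono)
      show "(\<Union>i\<in>{..<k}. ksets (cl i) (r + 2)) \<subseteq> cliques V (r + 2) g"
      proof
        fix C assume "C \<in> (\<Union>i\<in>{..<k}. ksets (cl i) (r + 2))"
        then obtain i where i: "C \<subseteq> cl i" "card C = r + 2" by (auto simp: ksets_def)
        then show "C \<in> cliques V (r + 2) g" using edges[OF i(1)] clV(1)[of i] by (simp add: cliques_def ksets_def)
      qed
    qed (use finV in \<open>simp add: cliques_def\<close>)
    finally show ?thesis .
  qed
  moreover have "card V \<le> r * k + card I + (\<Sum>i<k. card (cl i) choose (r + 2))"
  proof -
    have "V = (\<Union>i\<in>{..<k}. cl i)" using c by (auto simp: cl_def proper_colouring_def)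
    then have "card V = (\<Sum>i<k. card (cl i))"
      using card_UN_disjoint[of "{..<k}" cl] clV(2) disj by simp
    also have "\<dots> \<le> (\<Sum>i<k. r + of_bool (i \<in> I) + (card (cl i) choose (r + 2)))"
    proof (intro sum_mono)
      fix i assume "i \<in> {..<k}"
      then show "card (cl i) \<le> r + of_bool (i \<in> I) + (card (cl i) choose (r + 2))"
        using choose_ge_excess[of "r + 2" "card (cl i)"] by (cases "i \<in> I") (auto simp: I_def)
    qed
    also have "\<dots> = r * k + (\<Sum>i<k. of_bool (i \<in> I)) + (\<Sum>i<k. card (cl i) choose (r + 2))"
      by (simp only: sum.distrib sum_constant card_lessThan mult.commute of_nat_id)
    also have "(\<Sum>i<k. of_bool (i \<in> I)) = card I"
    proof -
      have "{..<k} \<inter> {i. i \<in> I} = I" by (auto simp: I_def)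
      then show ?thesis by (simp add: sum_of_bool_eq)
    qed
    finally show ?thesis .
  qed
  ultimately show ?thesis unfolding k_def by linarith
qed

section \<open>Standard deviations\<close>

definition sd :: "'a pmf \<Rightarrow> ('a \<Rightarrow> real) \<Rightarrow> real" where
  "sd M f = sqrt (expct M (\<lambda>x. (f x - expct M f) ^ 2))"

lemma vari_centred:
  assumes fin: "finite (set_pmf M)"
  shows "expct M (\<lambda>x. (f x - expct M f) ^ 2) = vari M f"
proof -
  have "(f x - expct M f) ^ 2 = f x ^ 2 - 2 * expct M f * f x + expct M f ^ 2" for x
    by (simp add: power2_eq_square algebra_simps)
  then have "expct M (\<lambda>x. (f x - expct M f) ^ 2) = expct M (\<lambda>x. f x ^ 2) - 2 * expct M f * expct M f + expct M f ^ 2"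
    using fin by (simp add: expct_add expct_diff)
  then show ?thesis by (simp add: vari_def power2_eq_square)
qed

lemma vari_nonneg: "finite (set_pmf M) \<Longrightarrow> 0 \<le> vari M f"
  unfolding vari_centred[symmetric] by (rule expct_nonneg) simp

lemma vari_le_square: "vari M f \<le> expct M (\<lambda>x. f x ^ 2)"
  by (simp add: vari_def)

lemma sd_eq: "finite (set_pmf M) \<Longrightarrow> sd M f = sqrt (vari M f)"
  by (simp add: sd_def vari_centred)

lemma sd_triangle:
  assumes fin: "finite (set_pmf M)"
  shows "sd M (\<lambda>x. f x + g x) \<le> sd M f + sd M g"
proof -
  have sd: "sd M f = L2_set (\<lambda>x. sqrt (pmf M x) * (f x - expct M f)) (set_pmf M)" for f
    unfolding sd_def L2_set_def expct_finite_sum[OF fin, of "\<lambda>x. (f x - expct M f) ^ 2"]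
    by (simp add: power_mult_distrib)
  have "sqrt (pmf M x) * (f x + g x - expct M (\<lambda>x. f x + g x)) = sqrt (pmf M x) * (f x - expct M f) + sqrt (pmf M x) * (g x - expct M g)" for x
    by (simp add: expct_add[OF fin] algebra_simps)
  then show ?thesis unfolding sd by (simp only: L2_set_triangle_ineq)
qed

lemma sd_cmult: "sd M (\<lambda>x. c * f x) = \<bar>c\<bar> * sd M f"
proof -
  have "(c * f x - expct M (\<lambda>x. c * f x)) ^ 2 = c ^ 2 * (f x - expct M f) ^ 2" for x
    by (simp add: power_mult_distrib[symmetric] right_diff_distrib)
  then show ?thesis by (simp add: sd_def real_sqrt_mult)
qed

lemma sd_const [simp]: "sd M (\<lambda>x. c) = 0" by (simp add: sd_def)

lemma expct_abs_le_sd: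
  assumes fin: "finite (set_pmf M)"
  shows "expct M (\<lambda>x. \<bar>f x - expct M f\<bar>) \<le> sd M f"
proof -
  have "0 \<le> vari M (\<lambda>x. \<bar>f x - expct M f\<bar>)" by (rule vari_nonneg[OF fin])
  then have "expct M (\<lambda>x. \<bar>f x - expct M f\<bar>) ^ 2 \<le> expct M (\<lambda>x. (f x - expct M f) ^ 2)" by (simp add: vari_def)
  then show ?thesis unfolding sd_def by (rule real_le_rsqrt)
qed

lemma sd_le_root_square: "finite (set_pmf M) \<Longrightarrow> sd M f \<le> sqrt (expct M (\<lambda>x. f x ^ 2))"
  by (simp add: sd_eq vari_le_square)

lemma expct_iexp_diff:
  assumes fin: "finite (set_pmf M)"
  shows "cmod (expct M (\<lambda>x. iexp (t * f x)) - expct M (\<lambda>x. iexp (t * g x))) \<le> \<bar>t\<bar> * expct M (\<lambda>x. \<bar>f x - g x\<bar>)"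
proof -
  have "cmod (expct M (\<lambda>x. iexp (t * f x)) - expct M (\<lambda>x. iexp (t * g x))) = cmod (expct M (\<lambda>x. iexp (t * f x) - iexp (t * g x)))"
    by (subst expct_diff[OF fin]) simp
  also have "\<dots> \<le> expct M (\<lambda>x. cmod (iexp (t * f x) - iexp (t * g x)))" by (rule expct_norm_le[OF fin])
  also have "\<dots> \<le> expct M (\<lambda>x. \<bar>t\<bar> * \<bar>f x - g x\<bar>)"
  proof (rule expct_mono[OF fin])
    fix x
    have "\<bar>t * f x - t * g x\<bar> = \<bar>t\<bar> * \<bar>f x - g x\<bar>" by (simp add: abs_mult[symmetric] right_diff_distrib)
    then show "cmod (iexp (t * f x) - iexp (t * g x)) \<le> \<bar>t\<bar> * \<bar>f x - g x\<bar>" using iexp_lipschitz[of "t * f x" "t * g x"] by simp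
  qed
  finally show ?thesis by simp
qed

section \<open>The chromatic number in the window\<close>

context clique_window
begin

text \<open>The parameter \<open>y\<close> measures how far \<open>p\<close> is below the upper end of the
  window. All relative errors below tend to 0 with \<open>y\<close> and \<open>1 / m\<close>.\<close>

definition "gr n = rsub (all_edges {1..n}) (p n)"
definition "X n g = real (card (cliques {1..n} (r + 1) g))"
definition "chi n g = real (chromatic_number (complement {1..n} g))"
definition "m n = \<mu> (r + 1) n (p n)"
definition "y n = p n * real n powr (2 / real (r + 1))"

lemma finite_gr [simp]: "finite (set_pmf (gr n))" by (simp add: gr_def)

lemma y_nonneg: "0 \<le> y n" using p01 by (simp add: y_def)

lemma y_tendsto: "y \<longlonglongrightarrow> 0"
proof (rule tendstoI)
  fix e :: real assume e: "0 < e"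
  show "\<forall>\<^sub>F n in sequentially. dist (y n) 0 < e"
    using eventually_sparse[OF half_gt_zero[OF e]] unfolding y_def[symmetric]
  proof eventually_elim
    case (elim n)
    then show ?case using y_nonneg[of n] e by (simp add: dist_real_def)
  qed
qed

lemma y_small: "\<forall>\<^sub>F n in sequentially. y n \<le> 1"
  using eventually_sparse[of 1] by (simp add: y_def)

text \<open>Up to a constant the mean is \<open>n^(r+1) p^(r+1 choose 2) = (n^(r-1) p^(r choose 2)) (n^2
  p^r)\<close>; the lower end of the window makes the first factor a large multiple of \<open>ln
  n\<close> and the second at least 1.\<close>

lemma m_at_top: "filterlim m at_top sequentially"
  unfolding filterlim_at_top
proof
  fix A :: real
  define R where "R = r + 1"
  define T where "T = max 1 (A * real R ^ R)"
  have R0: "0 < real R ^ R" by (simp add: R_def)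
  have "\<forall>\<^sub>F n in sequentially. norm (real n powr (- 2 / real r) * ln (real n) powr (1 / real (r choose 2))) \<le> 1 * norm (p n)"
    by (rule landau_o.smallD[OF lower]) simp
  moreover have "\<forall>\<^sub>F n in sequentially. 0 < p n \<and> T * ln (real n) \<le> real n ^ (r - 1) * p n ^ (r choose 2)"
    by (rule eventually_dense) (simp add: T_def)
  ultimately show "\<forall>\<^sub>F n in sequentially. A \<le> m n"
    using eventually_ge_at_top[of "max 3 R"]
  proof eventually_elim
    case (elim n)
    have n3: "3 \<le> n" "R \<le> n" using elim(3) by auto
    have l1: "1 \<le> ln (real n)" by (rule ln_ge1[OF n3(1)])
    have "1 \<le> ln (real n) powr (1 / real (r choose 2))" using l1 by (intro ge_one_powr_ge_zero) auto
    then have "real n powr (- 2 / real r) * 1 \<le> real n powr (- 2 / real r) * ln (real n) powr (1 / real (r choose 2))"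
      by (intro mult_left_mono) auto
    also have "\<dots> \<le> p n" using elim(1) p01[of n] by simp
    finally have "(real n powr (- 2 / real r)) ^ r \<le> p n ^ r" by (intro power_mono) auto
    also have "(real n powr (- 2 / real r)) ^ r = real n powr (- 2)" using n3 r2 by (subst powr_power) auto
    also have "\<dots> = 1 / real n ^ 2" using n3 by (simp add: powr_minus powr_numeral field_simps)
    finally have pr: "1 \<le> real n ^ 2 * p n ^ r" using n3 by (simp add: field_simps)
    have "T * 1 \<le> T * ln (real n)" using l1 by (intro mult_left_mono) (auto simp: T_def)
    also have "\<dots> \<le> real n ^ (r - 1) * p n ^ (r choose 2)" using elim(2) by blast
    finally have "T * 1 \<le> (real n ^ (r - 1) * p n ^ (r choose 2)) * (real n ^ 2 * p n ^ r)"
      using pr p01[of n] by (intro mult_mono) auto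
    also have "\<dots> = real n ^ R * p n ^ (R choose 2)"
    proof -
      have "r - 1 + 2 = R" "(r choose 2) + r = (R choose 2)" using r2 by (simp_all add: R_def numeral_2_eq_2)
      then show ?thesis by (metis mult.assoc mult.left_commute power_add)
    qed
    also have "\<dots> = real R ^ R * ((real n / real R) ^ R * p n ^ (R choose 2))"
      using R0 by (simp add: power_divide)
    also have "\<dots> \<le> real R ^ R * m n"
      unfolding m_def R_def[symmetric] \<mu>_def using n3 p01[of n]
      by (intro mult_left_mono mult_right_mono binomial_ge_n_over_k_pow_k) auto
    finally have "A * real R ^ R \<le> m n * real R ^ R" by (simp add: T_def mult.commute)
    then show "A \<le> m n" using R0 by simp
  qed
qed

lemma expct_X: "expct (gr n) (X n) = m n"
  unfolding gr_def X_def m_def using expct_cliques[of "{1..n}" "p n" "r + 1"] p01 r2 by simp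

lemma power_le_y:
  assumes "1 \<le> n"
  shows "p n ^ (r + 1 choose 2) \<le> y n"
proof -
  have c0: "0 < (r + 1) choose 2" by (rule zero_less_binomial) (use r2 in simp)
  have "p n ^ (r + 1 choose 2) \<le> p n ^ 1" by (rule power_decreasing) (use c0 p01[of n] in linarith)+
  also have "p n ^ 1 = p n * 1" by simp
  also have "p n * 1 \<le> p n * real n powr (2 / real (r + 1))"
    using assms p01[of n] by (intro mult_left_mono ge_one_powr_ge_zero) auto
  finally show ?thesis by (simp add: y_def)
qed

lemma pairs_le:
  assumes "1 \<le> n" "y n \<le> 1"
  shows "pair_weight {1..n} (r + 1) {1..<r + 1} (p n) \<le> m n * (2 ^ (r + 1) * y n)"
  using strict_pair_weight_le[of "{1..n}" "p n" "r + 1"] assms p01[of n] r2 by (simp add: y_def m_def)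

lemma m_nonneg: "0 \<le> m n" using p01 by (simp add: m_def \<mu>_def)

lemma sd_X_tendsto: "(\<lambda>n. sd (gr n) (X n) / sqrt (m n)) \<longlonglongrightarrow> 1"
proof -
  have v: "\<forall>\<^sub>F n in sequentially. 1 - y n \<le> vari (gr n) (X n) / m n \<and> vari (gr n) (X n) / m n \<le> 1 + 2 ^ (r + 1) * y n"
    using y_small filterlim_at_top_dense[THEN iffD1, OF m_at_top, rule_format, of 0] eventually_ge_at_top[of 1]
  proof eventually_elim
    case (elim n)
    have "m n * (1 - y n) \<le> m n * (1 - p n ^ (r + 1 choose 2))"
      using power_le_y[OF elim(3)] elim(2) by (intro mult_left_mono) auto
    also have "\<dots> \<le> vari (gr n) (X n)"
      unfolding gr_def X_def m_def using vari_cliques(1)[of "{1..n}" "p n" "r + 1"] p01 r2 by simp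
    finally have 1: "m n * (1 - y n) \<le> vari (gr n) (X n)" .
    have "vari (gr n) (X n) \<le> m n + pair_weight {1..n} (r + 1) {1..<r + 1} (p n)"
      unfolding gr_def X_def m_def using vari_cliques(2)[of "{1..n}" "p n" "r + 1"] p01 r2 by simp
    also have "\<dots> \<le> m n + m n * (2 ^ (r + 1) * y n)" using pairs_le[OF elim(3,1)] by (rule add_left_mono)
    finally show ?case using 1 elim(2) by (simp add: field_simps)
  qed
  have "(\<lambda>n. vari (gr n) (X n) / m n) \<longlonglongrightarrow> 1"
  proof (rule tendsto_sandwich)
    show "(\<lambda>n. 1 - y n) \<longlonglongrightarrow> 1" using tendsto_diff[OF tendsto_const y_tendsto, of 1] by simp
    show "(\<lambda>n. 1 + 2 ^ (r + 1) * y n) \<longlonglongrightarrow> 1"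
      using tendsto_add[OF tendsto_const tendsto_mult[OF tendsto_const y_tendsto], of 1 "2 ^ (r + 1)"] by simp
  qed (use v in \<open>auto elim: eventually_mono\<close>)
  then have "(\<lambda>n. sqrt (vari (gr n) (X n) / m n)) \<longlonglongrightarrow> sqrt 1" by (rule tendsto_real_sqrt)
  then show ?thesis by (simp add: sd_eq real_sqrt_divide)
qed

text \<open>Up to the constant \<open>n\<close> this is the sum of \<open>X - \<nu>\<close> and of the error in
  the deterministic bounds.\<close>

definition "excess n g = real r * chi n g + X n g"

lemma sd_excess_le:
  "\<forall>\<^sub>F n in sequentially. sd (gr n) (excess n) \<le> sqrt (2 * real (r + 1 choose 2) * (m n * (2 ^ (r + 1) * y n))) + sqrt (2 * 2 ^ (r + 2) + 32 * real r ^ 4)"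
proof -
  show ?thesis
    using y_small deficiency_second_moment eventually_ge_at_top[of 1]
  proof eventually_elim
    case (elim n)
    let ?V = "{1..n}"
    let ?nu = "\<lambda>g. real (packing_number (cliques ?V (r + 1) g))"
    let ?K = "\<lambda>g. real (card (cliques ?V (r + 2) g))" and ?b = "\<lambda>g. real (deficiency ?V r g)"
    define H where "H = (\<lambda>g. X n g - ?nu g)"
    define err where "err = (\<lambda>g. real r * chi n g + ?nu g - real n)"
    have split: "excess n = (\<lambda>g. (H g + err g) + real n)" by (simp add: fun_eq_iff excess_def H_def err_def)
    have "sd (gr n) (excess n) \<le> sd (gr n) H + sd (gr n) err"
      unfolding split using sd_triangle[of "gr n" "\<lambda>g. H g + err g" "\<lambda>g. real n"] sd_triangle[of "gr n" H err] by simp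
    moreover have "sd (gr n) H \<le> sqrt (2 * real (r + 1 choose 2) * (m n * (2 ^ (r + 1) * y n)))"
    proof -
      have "vari (gr n) H \<le> 2 * real (r + 1 choose 2) * pair_weight ?V (r + 1) {1..<r + 1} (p n)"
        unfolding gr_def H_def X_def using p01 r2 by (intro vari_packing_excess) auto
      also have "\<dots> \<le> 2 * real (r + 1 choose 2) * (m n * (2 ^ (r + 1) * y n))"
        using pairs_le[OF elim(3,1)] by (intro mult_left_mono) auto
      finally show ?thesis by (simp add: sd_eq)
    qed
    moreover have "sd (gr n) err \<le> sqrt (2 * 2 ^ (r + 2) + 32 * real r ^ 4)"
    proof -
      have pt: "err g ^ 2 \<le> 2 * ?K g ^ 2 + (4 * real r ^ 4 * ?b g ^ 2 + 4 * real r ^ 4)" for g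
      proof -
        have fV: "finite ?V" by simp
        have "real (r * chromatic_number (complement ?V g) + packing_number (cliques ?V (r + 1) g)) \<le> real (card ?V + r ^ 2 * (deficiency ?V r g + 1))"
          by (rule of_nat_mono, rule chromatic_upper[OF fV]) (use r2 in simp)
        then have up: "err g \<le> real r ^ 2 * (?b g + 1)" by (simp add: err_def chi_def distrib_left)
        have "real (card ?V) \<le> real (r * chromatic_number (complement ?V g) + packing_number (cliques ?V (r + 1) g) + card (cliques ?V (r + 2) g))"
          by (rule of_nat_mono, rule chromatic_lower[OF fV])
        then have lo: "- ?K g \<le> err g" by (simp add: err_def chi_def)
        let ?u = "real r ^ 2 * (?b g + 1)"
        have "\<bar>err g\<bar> \<le> ?K g + ?u" proof -
          have "0 \<le> ?u" "0 \<le> ?K g" by simp_all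
          then show ?thesis using up lo by linarith
        qed
        then have "err g ^ 2 \<le> (?K g + ?u) ^ 2" by (metis power2_abs power_mono abs_ge_zero)
        also have "\<dots> \<le> 2 * ?K g ^ 2 + 2 * ?u ^ 2" using sum_squares_bound[of "?K g" ?u] by (simp add: power2_sum)
        also have "?u ^ 2 = real r ^ 4 * (?b g + 1) ^ 2" by (simp add: power_mult_distrib power_mult[symmetric])
        also have "\<dots> \<le> real r ^ 4 * (2 * ?b g ^ 2 + 2)"
          using sum_squares_bound[of "?b g" 1] by (intro mult_left_mono) (auto simp: power2_sum)
        finally show ?thesis by (simp add: algebra_simps)
      qed
      have "expct (gr n) (\<lambda>g. err g ^ 2) \<le> expct (gr n) (\<lambda>g. 2 * ?K g ^ 2 + (4 * real r ^ 4 * ?b g ^ 2 + 4 * real r ^ 4))"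
        using pt by (intro expct_mono) auto
      also have "\<dots> = 2 * expct (gr n) (\<lambda>g. ?K g ^ 2) + (4 * real r ^ 4 * expct (gr n) (\<lambda>g. ?b g ^ 2) + 4 * real r ^ 4)"
        by (simp add: expct_add)
      also have "\<dots> \<le> 2 * 2 ^ (r + 2) + (4 * real r ^ 4 * 7 + 4 * real r ^ 4)"
      proof (intro add_mono mult_left_mono order_refl)
        have "expct (gr n) (\<lambda>g. ?K g ^ 2) = pair_weight ?V (r + 2) {..r + 2} (p n)"
          unfolding gr_def using p01 by (intro expct_cliques_square_pairs) auto
        also have "\<dots> \<le> 2 ^ (r + 2)"
          using pair_weight_bounded[of ?V "p n" "r + 1"] elim p01[of n] by (simp add: y_def)
        finally show "expct (gr n) (\<lambda>g. ?K g ^ 2) \<le> 2 ^ (r + 2)" .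
        show "expct (gr n) (\<lambda>g. ?b g ^ 2) \<le> 7" unfolding gr_def by (rule elim(2))
      qed auto
      finally have "expct (gr n) (\<lambda>g. err g ^ 2) \<le> 2 * 2 ^ (r + 2) + 32 * real r ^ 4" by simp
      then show ?thesis by (rule order_trans[OF sd_le_root_square[OF finite_gr] real_sqrt_le_mono])
    qed
    ultimately show ?case by linarith
  qed
qed

lemma root_m_at_top: "filterlim (\<lambda>n. sqrt (m n)) at_top sequentially"
  by (rule filterlim_compose[OF sqrt_at_top m_at_top])

lemma sd_excess_tendsto: "(\<lambda>n. sd (gr n) (excess n) / sqrt (m n)) \<longlonglongrightarrow> 0"
proof (rule tendsto_sandwich)
  let ?c = "2 * real (r + 1 choose 2) * 2 ^ (r + 1)" and ?d = "sqrt (2 * 2 ^ (r + 2) + 32 * real r ^ 4)"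
  show "\<forall>\<^sub>F n in sequentially. 0 \<le> sd (gr n) (excess n) / sqrt (m n)"
    by (simp add: sd_def expct_nonneg m_nonneg)
  show "\<forall>\<^sub>F n in sequentially. sd (gr n) (excess n) / sqrt (m n) \<le> sqrt (?c * y n) + ?d / sqrt (m n)"
    using sd_excess_le filterlim_at_top_dense[THEN iffD1, OF m_at_top, rule_format, of 0]
  proof eventually_elim
    case (elim n)
    have "2 * real (r + 1 choose 2) * (m n * (2 ^ (r + 1) * y n)) = m n * (?c * y n)" by (simp only: mult_ac)
    then have "sqrt (2 * real (r + 1 choose 2) * (m n * (2 ^ (r + 1) * y n))) = sqrt (m n) * sqrt (?c * y n)"
      by (simp only: real_sqrt_mult)
    then have "sd (gr n) (excess n) \<le> sqrt (m n) * sqrt (?c * y n) + ?d" using elim(1) by linarith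
    then have "sd (gr n) (excess n) / sqrt (m n) \<le> (sqrt (m n) * sqrt (?c * y n) + ?d) / sqrt (m n)"
      by (rule divide_right_mono) (simp add: m_nonneg)
    then show ?case using elim(2) by (simp only: add_divide_distrib) simp
  qed
  have "(\<lambda>n. sqrt (?c * y n)) \<longlonglongrightarrow> sqrt (?c * 0)"
    by (intro tendsto_real_sqrt tendsto_mult tendsto_const y_tendsto)
  moreover have "(\<lambda>n. ?d / sqrt (m n)) \<longlonglongrightarrow> 0"
    by (rule real_tendsto_divide_at_top[OF tendsto_const root_m_at_top])
  ultimately show "(\<lambda>n. sqrt (?c * y n) + ?d / sqrt (m n)) \<longlonglongrightarrow> 0"
    using tendsto_add[of "\<lambda>n. sqrt (?c * y n)" 0 sequentially "\<lambda>n. ?d / sqrt (m n)" 0] by simp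
qed simp

lemma sd_chi_tendsto: "(\<lambda>n. real r * sd (gr n) (chi n) / sqrt (m n)) \<longlonglongrightarrow> 1"
proof (rule tendsto_sandwich)
  have sandwich: "sd (gr n) (X n) - sd (gr n) (excess n) \<le> real r * sd (gr n) (chi n)"
    "real r * sd (gr n) (chi n) \<le> sd (gr n) (X n) + sd (gr n) (excess n)" for n
  proof -
    have 1: "sd (gr n) (\<lambda>g. real r * chi n g) = real r * sd (gr n) (chi n)" "sd (gr n) (\<lambda>g. - 1 * X n g) = sd (gr n) (X n)"
      "sd (gr n) (\<lambda>g. - 1 * (real r * chi n g)) = real r * sd (gr n) (chi n)"
      by (simp_all only: sd_cmult abs_of_nat abs_neg_one mult_1_left)
    have 2: "(\<lambda>g. excess n g + - 1 * X n g) = (\<lambda>g. real r * chi n g)" "(\<lambda>g. excess n g + - 1 * (real r * chi n g)) = X n"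
      by (auto simp: excess_def)
    show "sd (gr n) (X n) - sd (gr n) (excess n) \<le> real r * sd (gr n) (chi n)"
      using sd_triangle[OF finite_gr, of n "excess n" "\<lambda>g. - 1 * (real r * chi n g)"] unfolding 1 2 by simp
    show "real r * sd (gr n) (chi n) \<le> sd (gr n) (X n) + sd (gr n) (excess n)"
      using sd_triangle[OF finite_gr, of n "excess n" "\<lambda>g. - 1 * X n g"] unfolding 1 2 by simp
  qed
  show "\<forall>\<^sub>F n in sequentially. sd (gr n) (X n) / sqrt (m n) - sd (gr n) (excess n) / sqrt (m n) \<le> real r * sd (gr n) (chi n) / sqrt (m n)"
    unfolding diff_divide_distrib[symmetric] using sandwich(1) by (intro always_eventually allI divide_right_mono) (auto simp: m_nonneg)
  show "\<forall>\<^sub>F n in sequentially. real r * sd (gr n) (chi n) / sqrt (m n) \<le> sd (gr n) (X n) / sqrt (m n) + sd (gr n) (excess n) / sqrt (m n)"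
    unfolding add_divide_distrib[symmetric] using sandwich(2) by (intro always_eventually allI divide_right_mono) (auto simp: m_nonneg)
  show "(\<lambda>n. sd (gr n) (X n) / sqrt (m n) - sd (gr n) (excess n) / sqrt (m n)) \<longlonglongrightarrow> 1"
    using tendsto_diff[OF sd_X_tendsto sd_excess_tendsto] by simp
  show "(\<lambda>n. sd (gr n) (X n) / sqrt (m n) + sd (gr n) (excess n) / sqrt (m n)) \<longlonglongrightarrow> 1"
    using tendsto_add[OF sd_X_tendsto sd_excess_tendsto] by simp
qed

lemma variance_asymptotics: "(\<lambda>n. expct (gr n) (\<lambda>g. (chi n g - expct (gr n) (chi n)) ^ 2)) \<sim>[sequentially] (\<lambda>n. m n / real r ^ 2)"
proof (rule asymp_equivI')
  have "(\<lambda>n. (real r * sd (gr n) (chi n) / sqrt (m n)) ^ 2) \<longlonglongrightarrow> 1 ^ 2"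
    by (intro tendsto_power sd_chi_tendsto)
  moreover have "(real r * sd (gr n) (chi n) / sqrt (m n)) ^ 2 = expct (gr n) (\<lambda>g. (chi n g - expct (gr n) (chi n)) ^ 2) / (m n / real r ^ 2)" for n
    by (simp add: sd_def power_divide power_mult_distrib m_nonneg expct_nonneg mult.commute)
  ultimately show "(\<lambda>n. expct (gr n) (\<lambda>g. (chi n g - expct (gr n) (chi n)) ^ 2) / (m n / real r ^ 2)) \<longlonglongrightarrow> 1" by simp
qed

lemma char_X:
  assumes "1 \<le> n" "y n \<le> 1" "0 < m n"
  shows "cmod (expct (gr n) (\<lambda>g. iexp (t * ((X n g - m n) / sqrt (m n)))) - of_real (exp (- (t ^ 2 / 2))))
    \<le> \<bar>t\<bar> * (\<bar>t\<bar> * ((1 + 2 ^ (r + 1)) * y n) + t ^ 2 / (2 * sqrt (m n)))"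
proof (rule gaussian_estimate[OF finite_gr assms(3)])
  fix \<theta>
  have "cmod (expct (gr n) (\<lambda>g. of_real (X n g) * iexp (\<theta> * X n g)) - of_real (m n) * iexp \<theta> * expct (gr n) (\<lambda>g. iexp (\<theta> * X n g)))
     \<le> \<bar>\<theta>\<bar> * (m n * p n ^ (r + 1 choose 2) + pair_weight {1..n} (r + 1) {1..<r + 1} (p n))"
    unfolding gr_def X_def m_def using size_biased_char[of "{1..n}" "p n" "r + 1" \<theta>] p01 r2 by simp
  also have "\<dots> \<le> \<bar>\<theta>\<bar> * (m n * y n + m n * (2 ^ (r + 1) * y n))"
    using power_le_y[OF assms(1)] pairs_le[OF assms(1,2)] m_nonneg by (intro mult_left_mono add_mono) auto
  also have "\<dots> = \<bar>\<theta>\<bar> * (m n * ((1 + 2 ^ (r + 1)) * y n))" by (simp add: algebra_simps)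
  finally show "cmod (expct (gr n) (\<lambda>g. of_real (X n g) * iexp (\<theta> * X n g)) - of_real (m n) * iexp \<theta> * expct (gr n) (\<lambda>g. iexp (\<theta> * X n g)))
     \<le> \<bar>\<theta>\<bar> * (m n * ((1 + 2 ^ (r + 1)) * y n))" .
qed (simp add: y_nonneg)

text \<open>Up to the excess, the standardised chromatic number is minus the standardised clique count, and the
  Gaussian is symmetric.\<close>

lemma char_chi:
  "(\<lambda>n. expct (gr n) (\<lambda>g. iexp (t * ((chi n g - expct (gr n) (chi n)) / (sqrt (m n) / real r))))) \<longlonglongrightarrow> of_real (exp (- (t ^ 2 / 2)))"
proof (rule LIM_zero_cancel, rule Lim_null_comparison)
  let ?Z = "\<lambda>n g. (chi n g - expct (gr n) (chi n)) / (sqrt (m n) / real r)"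
  let ?W = "\<lambda>n g. - ((X n g - m n) / sqrt (m n))"
  show "\<forall>\<^sub>F n in sequentially. cmod (expct (gr n) (\<lambda>g. iexp (t * ?Z n g)) - of_real (exp (- (t ^ 2 / 2))))
     \<le> \<bar>t\<bar> * (sd (gr n) (excess n) / sqrt (m n)) + \<bar>t\<bar> * (\<bar>t\<bar> * ((1 + 2 ^ (r + 1)) * y n) + t ^ 2 / 2 / sqrt (m n))"
    using y_small filterlim_at_top_dense[THEN iffD1, OF m_at_top, rule_format, of 0] eventually_ge_at_top[of 1]
  proof eventually_elim
    case (elim n)
    have s: "0 < sqrt (m n)" using elim by simp
    have "expct (gr n) (excess n) = real r * expct (gr n) (chi n) + m n"
      unfolding excess_def using expct_X[of n] by (simp add: expct_add)
    then have d: "?Z n g - ?W n g = (excess n g - expct (gr n) (excess n)) / sqrt (m n)" for g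
      using r2 s by (simp add: excess_def field_simps)
    have "cmod (expct (gr n) (\<lambda>g. iexp (t * ?Z n g)) - expct (gr n) (\<lambda>g. iexp (t * ?W n g))) \<le> \<bar>t\<bar> * expct (gr n) (\<lambda>g. \<bar>?Z n g - ?W n g\<bar>)"
      by (rule expct_iexp_diff[OF finite_gr])
    also have "expct (gr n) (\<lambda>g. \<bar>?Z n g - ?W n g\<bar>) = expct (gr n) (\<lambda>g. \<bar>excess n g - expct (gr n) (excess n)\<bar>) / sqrt (m n)"
      unfolding d using s by (simp add: abs_divide)
    also have "\<dots> \<le> sd (gr n) (excess n) / sqrt (m n)"
      using s by (intro divide_right_mono expct_abs_le_sd) auto
    finally have 1: "cmod (expct (gr n) (\<lambda>g. iexp (t * ?Z n g)) - expct (gr n) (\<lambda>g. iexp (t * ?W n g))) \<le> \<bar>t\<bar> * (sd (gr n) (excess n) / sqrt (m n))"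
      by (simp add: mult_left_mono)
    have 2: "cmod (expct (gr n) (\<lambda>g. iexp (t * ?W n g)) - of_real (exp (- (t ^ 2 / 2)))) \<le> \<bar>t\<bar> * (\<bar>t\<bar> * ((1 + 2 ^ (r + 1)) * y n) + t ^ 2 / 2 / sqrt (m n))"
      using char_X[OF elim(3,1,2), of "- t"] by simp
    show ?case using norm_triangle_ineq[of "expct (gr n) (\<lambda>g. iexp (t * ?Z n g)) - expct (gr n) (\<lambda>g. iexp (t * ?W n g))"
          "expct (gr n) (\<lambda>g. iexp (t * ?W n g)) - of_real (exp (- (t ^ 2 / 2)))"] 1 2 by simp
  qed
  have "(\<lambda>n. t ^ 2 / 2 / sqrt (m n)) \<longlonglongrightarrow> 0"
    by (rule real_tendsto_divide_at_top[OF tendsto_const root_m_at_top])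
  then have "(\<lambda>n. \<bar>t\<bar> * (sd (gr n) (excess n) / sqrt (m n)) + \<bar>t\<bar> * (\<bar>t\<bar> * ((1 + 2 ^ (r + 1)) * y n) + t ^ 2 / 2 / sqrt (m n)))
     \<longlonglongrightarrow> \<bar>t\<bar> * 0 + \<bar>t\<bar> * (\<bar>t\<bar> * ((1 + 2 ^ (r + 1)) * 0) + 0)"
    by (intro tendsto_intros sd_excess_tendsto y_tendsto)
  then show "(\<lambda>n. \<bar>t\<bar> * (sd (gr n) (excess n) / sqrt (m n)) + \<bar>t\<bar> * (\<bar>t\<bar> * ((1 + 2 ^ (r + 1)) * y n) + t ^ 2 / 2 / sqrt (m n))) \<longlonglongrightarrow> 0"
    by simp
qed

lemma brg: "binomial_random_graph n (1 - p n) = map_pmf (complement {1..n}) (gr n)"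
  unfolding gr_def by (rule binomial_random_graph_complement) (use p01 in auto)

lemma expct_brg: "expct (binomial_random_graph n (1 - p n)) f = expct (gr n) (\<lambda>g. f (complement {1..n} g))"
  unfolding brg by (rule integral_map_pmf)

lemma clt:
  "weak_conv_m
     (\<lambda>n. distr (measure_pmf (binomial_random_graph n (1 - p n))) borel
        (\<lambda>G. (real (chromatic_number G) - expct (binomial_random_graph n (1 - p n)) (\<lambda>H. real (chromatic_number H)))
             / (sqrt (\<mu> (r + 1) n (p n)) / real r)))
     std_normal_distribution"
proof (rule levy_continuity)
  let ?f = "\<lambda>n G. (real (chromatic_number G) - expct (binomial_random_graph n (1 - p n)) (\<lambda>H. real (chromatic_number H)))
             / (sqrt (\<mu> (r + 1) n (p n)) / real r)"
  show "real_distribution (distr (measure_pmf (binomial_random_graph n (1 - p n))) borel (?f n))" for n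
    by (intro prob_space.real_distribution_distr measure_pmf.prob_space_axioms) simp
  show "real_distribution std_normal_distribution" by (rule real_dist_normal_dist)
  fix t
  have "char (distr (measure_pmf (binomial_random_graph n (1 - p n))) borel (?f n)) t
     = expct (gr n) (\<lambda>g. iexp (t * ((chi n g - expct (gr n) (chi n)) / (sqrt (m n) / real r))))" for n
    unfolding char_def by (subst integral_distr) (simp_all add: expct_brg chi_def[abs_def] m_def)
  then show "(\<lambda>n. char (distr (measure_pmf (binomial_random_graph n (1 - p n))) borel (?f n)) t) \<longlonglongrightarrow> char std_normal_distribution t"
    using char_chi[of t] by (simp add: char_std_normal_distribution)
qed

lemma variance_chromatic:
  "(\<lambda>n. measure_pmf.variance (binomial_random_graph n (1 - p n)) (\<lambda>G. real (chromatic_number G))) \<sim>[sequentially] (\<lambda>n. \<mu> (r + 1) n (p n) / (real r)\<^sup>2)"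
  using variance_asymptotics unfolding expct_brg chi_def m_def .

end

theorem theorem1p5:
  fixes r :: nat and p :: "nat \<Rightarrow> real"
  assumes "r \<ge> 2"
    and "\<And>n. 0 \<le> p n \<and> p n \<le> 1"
    and "(\<lambda>n. real n powr (- 2 / real r) * ln (real n) powr (1 / real (r choose 2))) \<in> o(p)"
    and "p \<in> o(\<lambda>n. real n powr (- 2 / real (r + 1)))"
  shows "weak_conv_m
           (\<lambda>n. distr (measure_pmf (binomial_random_graph n (1 - p n))) borel
              (\<lambda>G. (real (chromatic_number G)
                     - measure_pmf.expectation (binomial_random_graph n (1 - p n))
                         (\<lambda>H. real (chromatic_number H)))
                   / (sqrt (\<mu> (r + 1) n (p n)) / real r)))
           std_normal_distribution
       \<and> (\<lambda>n. measure_pmf.variance (binomial_random_graph n (1 - p n))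
                 (\<lambda>G. real (chromatic_number G)))
           \<sim>[sequentially] (\<lambda>n. \<mu> (r + 1) n (p n) / (real r)\<^sup>2)"
proof -
  interpret clique_window r p by unfold_locales (rule assms)+
  show ?thesis using clt variance_chromatic by simp
qed

end
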